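(* Let $\Omega\subset\mathbb{R}^3$ be a bounded, simply connected domain with connected boundary of class $C^{1,\alpha}$ for some $\alpha\in(0,1)$, and let $q=\frac{3}{1-\alpha}$. Let $L\subset\mathbb{R}^3\setminus\overline{\Omega}$ be an oriented simple closed curve. Let $\lambda\in(0,1)$, $\Lambda>1$, $\sigma\in\Sigma(\lambda,\Lambda)$, and suppose there exist a constant $c>0$ and a subdomain $\Omega'$ of $\Omega$ such that $|C_L|\ge c$ in $\Omega'$. Then there exists a constant $C_1$ depending only on $\lambda,\Lambda,\alpha$ and $\Omega$ such that if $$\|\nabla\cdot(\sigma C_L)\|_{L^q(\Omega)}+\|C_L\cdot\nu\|_{C^{0,\alpha}(\partial\Omega)}\le\frac{c}{2C_1},$$ then $J_L=\sigma(C_L-\nabla w_L)$ satisfies $$|J_L|\ge\frac{\lambda c}{2}\quad\text{in }\Omega'.$$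
   Context: $\nu$ is the unit outer normal on $\partial\Omega$. $\Sigma(\lambda,\Lambda)=\{\sigma\in W^{1,\infty}(\Omega):\ \lambda\le\sigma\le\lambda^{-1}\text{ in }\Omega,\ \|\sigma\|_{W^{1,\infty}(\Omega)}\le\Lambda\}$, where $\|u\|_{W^{1,\infty}(\Omega)}=\sum_{|\beta|\le1}\|\partial^\beta u\|_{L^\infty(\Omega)}$. Coil field: $\mu>0$ is a fixed constant (vacuum permeability). $D\subset\mathbb{R}^3\setminus\overline{\Omega}$ is a compact oriented surface with $\partial D=L$ (orientations compatible by the right-hand rule) and unit normal $n$, and $$C_L(x)=-\frac{\mu}{4\pi}\int_D\frac{(y-x)\times n(y)}{|y-x|^3}\,dS_y,$$ which is smooth on $\overline\Omega$. Adjoint problem: $w_L\in H^1(\Omega)$ is the weak solution, unique up to an additive constant, of $\nabla\cdot(\sigma\nabla w_L)=\nabla\cdot(\sigma C_L)$ in $\Omega$, $\sigma\partial_\nu w_L=\sigma C_L\cdot\nu$ on $\partial\Omega$, i.e. $\int_\Omega\sigma\nabla w_L\cdot\nabla\phi\,dx=\int_\Omega\sigma C_L\cdot\nabla\phi\,dx$ for all $\phi\in H^1(\Omega)$. *)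

theory Defs
  imports "HOL-Analysis.Analysis" "HOL-Probability.Essential_Supremum"
begin

definition partial_deriv :: "3 \<Rightarrow> (real^3 \<Rightarrow> real) \<Rightarrow> real^3 \<Rightarrow> real" where
  "partial_deriv i f x = frechet_derivative f (at x) (axis i 1)"

definition grad :: "(real^3 \<Rightarrow> real) \<Rightarrow> real^3 \<Rightarrow> real^3" where
  "grad f x = (\<chi> i. partial_deriv i f x)"

text \<open>Smoothness: every iterated partial derivative (the list gives the multi-index) is
  differentiable everywhere.\<close>

definition test_function :: "(real^3) set \<Rightarrow> (real^3 \<Rightarrow> real) \<Rightarrow> bool" where
  "test_function \<Omega> \<phi> \<longleftrightarrow>
     (\<forall>is x. foldr partial_deriv is \<phi> differentiable (at x)) \<and>
     compact (closure {x. \<phi> x \<noteq> 0}) \<and> closure {x. \<phi> x \<noteq> 0} \<subseteq> \<Omega>"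

definition locally_integrable ::
    "(real^3) set \<Rightarrow> (real^3 \<Rightarrow> 'b::{banach, second_countable_topology}) \<Rightarrow> bool" where
  "locally_integrable \<Omega> f \<longleftrightarrow> (\<forall>K. compact K \<and> K \<subseteq> \<Omega> \<longrightarrow> set_integrable lebesgue K f)"

definition has_weak_grad :: "(real^3) set \<Rightarrow> (real^3 \<Rightarrow> real) \<Rightarrow> (real^3 \<Rightarrow> real^3) \<Rightarrow> bool" where
  "has_weak_grad \<Omega> u G \<longleftrightarrow> locally_integrable \<Omega> u \<and> locally_integrable \<Omega> G \<and>
     (\<forall>\<phi>. test_function \<Omega> \<phi> \<longrightarrow>
        (LINT x|lebesgue_on \<Omega>. u x *\<^sub>R grad \<phi> x) = - (LINT x|lebesgue_on \<Omega>. \<phi> x *\<^sub>R G x))"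

definition has_weak_div :: "(real^3) set \<Rightarrow> (real^3 \<Rightarrow> real^3) \<Rightarrow> (real^3 \<Rightarrow> real) \<Rightarrow> bool" where
  "has_weak_div \<Omega> F f \<longleftrightarrow> locally_integrable \<Omega> F \<and> locally_integrable \<Omega> f \<and>
     (\<forall>\<phi>. test_function \<Omega> \<phi> \<longrightarrow>
        (LINT x|lebesgue_on \<Omega>. F x \<bullet> grad \<phi> x) = - (LINT x|lebesgue_on \<Omega>. f x * \<phi> x))"

text \<open>All norms take values in the extended nonnegative reals, so that they are infinite on
  functions outside the corresponding space.\<close>

definition Linf_norm :: "(real^3) set \<Rightarrow> (real^3 \<Rightarrow> real) \<Rightarrow> ennreal" where
  "Linf_norm \<Omega> f = esssup (lebesgue_on \<Omega>) (\<lambda>x. ennreal \<bar>f x\<bar>)"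

definition Lp_norm :: "(real^3) set \<Rightarrow> real \<Rightarrow> (real^3 \<Rightarrow> real) \<Rightarrow> ennreal" where
  "Lp_norm \<Omega> p f =
     (if f \<in> borel_measurable (lebesgue_on \<Omega>)
         \<and> (\<integral>\<^sup>+x. ennreal (\<bar>f x\<bar> powr p) \<partial>lebesgue_on \<Omega>) < \<infinity>
      then ennreal (enn2real (\<integral>\<^sup>+x. ennreal (\<bar>f x\<bar> powr p) \<partial>lebesgue_on \<Omega>) powr (1 / p))
      else \<infinity>)"

definition holder_norm :: "(real^3) set \<Rightarrow> real \<Rightarrow> (real^3 \<Rightarrow> real) \<Rightarrow> ennreal" where
  "holder_norm S \<alpha> g =
     (SUP x\<in>S. ennreal \<bar>g x\<bar>) +
     (SUP (x, y)\<in>{(x, y). x \<in> S \<and> y \<in> S \<and> x \<noteq> y}. ennreal (\<bar>g x - g y\<bar> / dist x y powr \<alpha>))"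

definition square_integrable_on ::
    "(real^3) set \<Rightarrow> (real^3 \<Rightarrow> 'b::{banach, second_countable_topology}) \<Rightarrow> bool" where
  "square_integrable_on \<Omega> f \<longleftrightarrow> f \<in> borel_measurable (lebesgue_on \<Omega>) \<and>
     integrable (lebesgue_on \<Omega>) (\<lambda>x. (norm (f x))\<^sup>2)"

definition H1_with_grad :: "(real^3) set \<Rightarrow> (real^3 \<Rightarrow> real) \<Rightarrow> (real^3 \<Rightarrow> real^3) \<Rightarrow> bool" where
  "H1_with_grad \<Omega> u G \<longleftrightarrow>
     has_weak_grad \<Omega> u G \<and> square_integrable_on \<Omega> u \<and> square_integrable_on \<Omega> G"

definition Sigma_class :: "(real^3) set \<Rightarrow> real \<Rightarrow> real \<Rightarrow> (real^3 \<Rightarrow> real) set" where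
  "Sigma_class \<Omega> lam Lam =
     {\<sigma>. (AE x in lebesgue_on \<Omega>. lam \<le> \<sigma> x \<and> \<sigma> x \<le> inverse lam) \<and>
         (\<exists>G. has_weak_grad \<Omega> \<sigma> G \<and>
              Linf_norm \<Omega> \<sigma> + (\<Sum>i\<in>UNIV. Linf_norm \<Omega> (\<lambda>x. G x $ i)) \<le> ennreal Lam)}"

definition drop3 :: "real^3 \<Rightarrow> real^2" where
  "drop3 y = vector [y$1, y$2]"

text \<open>After the rigid motion \<open>y \<mapsto> p + T y\<close>, the set \<open>\<Omega>\<close> is near \<open>p\<close> the region strictly above the
  graph of \<open>\<psi>\<close>, where \<open>\<psi>\<close> is continuously differentiable with gradient \<open>g\<close>.\<close>

definition boundary_chart ::
    "(real^3) set \<Rightarrow> real^3 \<Rightarrow> real \<Rightarrow> (real^3 \<Rightarrow> real^3) \<Rightarrow> (real^2 \<Rightarrow> real) \<Rightarrow> (real^2 \<Rightarrow> real^2) \<Rightarrow> bool"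
  where
  "boundary_chart \<Omega> p r T \<psi> g \<longleftrightarrow>
     r > 0 \<and> orthogonal_transformation T \<and> \<psi> 0 = 0 \<and>
     (\<forall>u\<in>ball 0 r. (\<psi> has_derivative (\<lambda>h. g u \<bullet> h)) (at u)) \<and>
     continuous_on (ball 0 r) g \<and>
     \<Omega> \<inter> ball p r = (\<lambda>y. p + T y) ` {y \<in> ball 0 r. \<psi> (drop3 y) < y $ 3}"

definition C1_holder_boundary :: "(real^3) set \<Rightarrow> real \<Rightarrow> bool" where
  "C1_holder_boundary \<Omega> \<alpha> \<longleftrightarrow>
     (\<forall>p\<in>frontier \<Omega>. \<exists>r T \<psi> g. boundary_chart \<Omega> p r T \<psi> g \<and>
        (\<exists>K. \<forall>u\<in>ball 0 r. \<forall>v\<in>ball 0 r. dist (g u) (g v) \<le> K * dist u v powr \<alpha>))"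

text \<open>The vector \<open>(g 0, -1)\<close> is orthogonal to the graph and points out of the region above it; for
  a \<open>C\<close>-\<open>1\<close> boundary the resulting unit vector does not depend on the chart.\<close>

definition outer_normal :: "(real^3) set \<Rightarrow> real^3 \<Rightarrow> real^3" where
  "outer_normal \<Omega> p =
     (THE v. \<exists>r T \<psi> g. boundary_chart \<Omega> p r T \<psi> g \<and> v = T (sgn (vector [g 0 $ 1, g 0 $ 2, -1])))"

text \<open>Two-dimensional Hausdorff measure; the factor \<open>\<pi> / 4\<close> normalises it to surface area.\<close>

definition hausdorff2 :: "(real^3) set \<Rightarrow> ennreal" where
  "hausdorff2 A =
     (SUP \<delta>\<in>{0::real<..}.
        INF U\<in>{U :: nat \<Rightarrow> (real^3) set. A \<subseteq> (\<Union>i. U i) \<and> (\<forall>i. bounded (U i) \<and> diameter (U i) \<le> \<delta>)}.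
          \<Sum>i. ennreal (pi / 4 * (diameter (U i))\<^sup>2))"

definition surface_measure :: "(real^3) measure" where
  "surface_measure = measure_of UNIV (sets borel) hausdorff2"

text \<open>
  A positively oriented chart of the surface \<open>D\<close> with boundary curve \<open>\<gamma>\<close> and unit normal \<open>n\<close>: a
  bi-Lipschitz parametrisation \<open>\<Phi>\<close> of a relatively open part of \<open>D\<close> by a relatively open part \<open>U\<close>
  of the closed upper half plane, such that \<open>n\<close> has the direction of \<open>\<partial>\<^sub>1\<Phi> \<times> \<partial>\<^sub>2\<Phi>\<close>, the
  boundary curve corresponds to the line \<open>u$2 = 0\<close>, and \<open>\<gamma>\<close> runs along it in the direction of
  increasing \<open>u$1\<close>. The last condition is the right-hand rule: \<open>n\<close>, the tangent \<open>\<partial>\<^sub>1\<Phi>\<close> of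
  the curve and the inward direction \<open>\<partial>\<^sub>2\<Phi>\<close> satisfy \<open>(n \<times> \<partial>\<^sub>1\<Phi>) \<bullet> \<partial>\<^sub>2\<Phi> > 0\<close>.
  The bi-Lipschitz class contains the \<open>C\<close>-\<open>1\<close> surfaces with boundary and also allows edges and corners
  (for instance, polygonal curves), where the normal is only determined almost everywhere.
\<close>

definition surface_chart ::
    "(real^3) set \<Rightarrow> (real \<Rightarrow> real^3) \<Rightarrow> (real^3 \<Rightarrow> real^3) \<Rightarrow> (real^2) set \<Rightarrow> (real^2 \<Rightarrow> real^3) \<Rightarrow> bool"
  where
  "surface_chart D \<gamma> n U \<Phi> \<longleftrightarrow>
     openin (top_of_set {u. 0 \<le> u $ 2}) U \<and>
     openin (top_of_set D) (\<Phi> ` U) \<and>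
     (\<exists>a>0. \<exists>b. \<forall>u\<in>U. \<forall>v\<in>U. a * dist u v \<le> dist (\<Phi> u) (\<Phi> v) \<and> dist (\<Phi> u) (\<Phi> v) \<le> b * dist u v) \<and>
     (AE u in lebesgue_on U. \<exists>\<Phi>'. (\<Phi> has_derivative \<Phi>') (at u) \<and>
        n (\<Phi> u) = sgn (cross3 (\<Phi>' (axis 1 1)) (\<Phi>' (axis 2 1)))) \<and>
     (\<forall>u\<in>U. \<Phi> u \<in> path_image \<gamma> \<longleftrightarrow> u $ 2 = 0) \<and>
     (\<forall>s t. \<forall>u\<in>U. \<forall>v\<in>U. 0 \<le> s \<and> s < t \<and> t \<le> 1 \<and> \<gamma> s = \<Phi> u \<and> \<gamma> t = \<Phi> v \<and> \<gamma> ` {s..t} \<subseteq> \<Phi> ` U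
        \<longrightarrow> u $ 1 < v $ 1)"

definition compact_oriented_surface ::
    "(real^3) set \<Rightarrow> (real \<Rightarrow> real^3) \<Rightarrow> (real^3 \<Rightarrow> real^3) \<Rightarrow> bool" where
  "compact_oriented_surface D \<gamma> n \<longleftrightarrow>
     compact D \<and> path_image \<gamma> \<subseteq> D \<and>
     n \<in> borel_measurable (restrict_space borel D) \<and> (\<forall>y\<in>D. norm (n y) = 1) \<and>
     (\<forall>p\<in>D. \<exists>U \<Phi>. surface_chart D \<gamma> n U \<Phi> \<and> p \<in> \<Phi> ` U)"

definition coil_field :: "real \<Rightarrow> (real^3) set \<Rightarrow> (real^3 \<Rightarrow> real^3) \<Rightarrow> real^3 \<Rightarrow> real^3" where
  "coil_field \<mu> D n x =
     - (\<mu> / (4 * pi)) *\<^sub>R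
       (LINT y:D|surface_measure. (1 / norm (y - x) ^ 3) *\<^sub>R cross3 (y - x) (n y))"

definition adjoint_solution ::
    "(real^3) set \<Rightarrow> (real^3 \<Rightarrow> real) \<Rightarrow> (real^3 \<Rightarrow> real^3) \<Rightarrow> (real^3 \<Rightarrow> real) \<Rightarrow> (real^3 \<Rightarrow> real^3) \<Rightarrow> bool"
  where
  "adjoint_solution \<Omega> \<sigma> C w Gw \<longleftrightarrow> H1_with_grad \<Omega> w Gw \<and>
     (\<forall>\<phi> G\<phi>. H1_with_grad \<Omega> \<phi> G\<phi> \<longrightarrow>
        (LINT x|lebesgue_on \<Omega>. \<sigma> x * (Gw x \<bullet> G\<phi> x)) = (LINT x|lebesgue_on \<Omega>. \<sigma> x * (C x \<bullet> G\<phi> x)))"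

end

theory Submission
 imports Defs
begin

text \<open>
  Let \<open>G\<close> be the gradient of the adjoint solution and \<open>M\<close> a bound for the data. It suffices that \<open>|G| \<le> C M\<close>
  almost everywhere: with \<open>M = c / (2 C)\<close> this gives \<open>|C_L - G| \<ge> c / 2\<close>. Freeze \<open>\<sigma>\<close> near a point; near a boundary
  point, flatten the boundary and reflect. As the scale derivative of the averaging kernel is a Laplacian, the
  equation shows that averages of \<open>G\<close> at the scales \<open>t\<close> and \<open>t / 2\<close> differ by \<open>O(t\<^sup>\<alpha>)\<close> times \<open>M\<close> plus the average of
  \<open>|G|\<close>. Summing over dyadic scales and absorbing yields \<open>|G| \<le> C (M + \<parallel>G\<parallel>\<^sub>1)\<close>. Finally, testing the equation with
  the solution itself, whose oscillation is controlled by \<open>sup |G|\<close> along chains of balls, bounds \<open>\<parallel>G\<parallel>\<^sub>1\<close> by \<open>C M\<close>.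
\<close>

text \<open>The averaging kernel is a truncated power of \<open>t^2 - |x - y|^2\<close>, so that the
  test functions are the explicit functions \<open>kW\<close>, first derivatives of
  \<open>zq y t 4\<close>. That \<open>G\<close> is a gradient permits an exchange of indices: the
  Laplacian of that power against one component of \<open>G\<close> becomes \<open>G\<close> against
  the gradient of such a test function. The obstacle at the boundary is the inhomogeneous flux,
  since even reflection suits only zero flux. Subtracting the constant field
  \<open>(F p . n) n\<close> from both \<open>G\<close> and the coil field leaves a flux that
  vanishes at \<open>p\<close> and is of order \<open>t powr al\<close> nearby. Boundary values of
  weak functions are replaced by cut-offs in the height over the boundary. The exponent
  \<open>q\<close> enters only through the bound of order \<open>t powr (2 + al)\<close> for the
  integral of \<open>|f|\<close> over a ball of radius \<open>t\<close>. The error at scale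
  \<open>t\<close> contains the integral of \<open>|G|\<close> over a ball, and \<open>G\<close> is
  not known to be bounded. The absorption therefore works with averages over balls of radius at
  least \<open>s\<close>, which are finite for each \<open>s\<close>, and yields a bound independent
  of \<open>s\<close>.\<close>

notation scaleR (infixr "*r" 75) and inner (infix "*i" 70)

abbreviation "lint \<equiv> integrable lborel"

abbreviation "Bm \<equiv> borel_measurable borel"

abbreviation nnint :: "('a::euclidean_space => ennreal) => ennreal" (binder "NINT " 10) where
 "nnint f \<equiv> nn_integral lborel f"

lemmas int_add = Bochner_Integration.integrable_add and int_diff = Bochner_Integration.integrable_diff
 and int_bound = Bochner_Integration.integrable_bound and integral_plus = Bochner_Integration.integral_add
 and integral_minus2 = Bochner_Integration.integral_diff and integral_ge0 = Bochner_Integration.integral_nonneg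
 and dist_nm = dist_norm norm_minus_commute and Bm_int = borel_measurable_integrable
 and integral_cong2 = Bochner_Integration.integral_cong

section \<open>Weak gradients\<close>

definition C1 :: "(real^3 => real) => (real^3 => real^3) => bool" where
 "C1 ph D \<longleftrightarrow> (\<forall>x. (ph has_derivative (%h. D x *i h)) (at x)) & continuous_on UNIV D"

text \<open>Test functions are only C1, which makes the class stable under multiplication by C1
  cut-offs and under composition with the shears and reflections used at the boundary. Identities
  known for smooth test functions reach this class through \<open>C1c_approx_test\<close>.\<close>

definition C1c :: "(real^3) set => (real^3 => real) => (real^3 => real^3) => bool" where
 "C1c U ph D \<longleftrightarrow> C1 ph D & (\<exists>K. compact K & K \<subseteq> U & (\<forall>x. x \<notin> K --> ph x = 0))"

lemma C1_deriv: "C1 ph D ==> (ph has_derivative (%h. D x *i h)) (at x)" by (simp add: C1_def)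

lemma C1_continuous: "C1 ph D ==> continuous_on S ph" by (meson C1_def continuous_at_imp_continuous_on has_derivative_continuous)

lemma C1_continuous_grad: "C1 ph D ==> continuous_on S D" by (meson C1_def continuous_on_subset subset_UNIV)

lemma C1_borel: "C1 ph D ==> ph \<in> Bm" by (simp add: C1_continuous borel_measurable_continuous_onI)

lemma C1_borel_grad: "C1 ph D ==> D \<in> Bm" by (simp add: C1_continuous_grad borel_measurable_continuous_onI)

lemma C1_const: "C1 (%x. c) (%x. 0)" by (simp add: C1_def)

lemma C1_inner: "C1 (%x. b *i x) (%x. b)" unfolding C1_def by (auto intro!: derivative_eq_intros)

lemma C1_add: "C1 f F ==> C1 g G ==> C1 (%x. f x + g x) (%x. F x + G x)"
 unfolding C1_def by (auto intro!: derivative_eq_intros continuous_intros simp: inner_add_left)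

lemma C1_diff: "C1 f F ==> C1 g G ==> C1 (%x. f x - g x) (%x. F x - G x)"
 unfolding C1_def by (auto intro!: derivative_eq_intros continuous_intros simp: inner_diff_left)

lemma C1_mult:
 assumes "C1 f F" "C1 g G" shows "C1 (%x. f x * g x) (%x. g x *r F x + f x *r G x)"
proof -
 have "continuous_on UNIV f" "continuous_on UNIV g" using assms C1_continuous by auto
 thus ?thesis using assms unfolding C1_def by (auto intro!: derivative_eq_intros continuous_intros simp: inner_add_left algebra_simps)
qed

lemma C1_cmult: "C1 g G ==> C1 (%x. c * g x) (%x. c *r G x)" using C1_mult[OF C1_const, of g G c] by simp

lemma C1_compose_real:
 assumes "C1 f F" "!!s. (z has_real_derivative z' s) (at s)" "continuous_on UNIV z'" shows "C1 (%x. z (f x)) (%x. z' (f x) *r F x)" unfolding C1_def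
proof (intro conjI allI)
 fix x
 have "(z has_derivative (%h. h * z' (f x))) (at (f x))" using assms(2) has_field_derivative_def by (metis has_derivative_eq_rhs mult_commute_abs)
 from has_derivative_compose[OF C1_deriv[OF assms(1)] this]
 show "((%x. z (f x)) has_derivative (*i) (z' (f x) *r F x)) (at x)" by (rule has_derivative_eq_rhs) (auto simp: mult.commute)
 show "continuous_on UNIV (%x. z' (f x) *r F x)" using assms(1) by (intro continuous_intros continuous_on_compose2[OF assms(3)])
   (auto simp: C1_continuous C1_continuous_grad)
qed

lemma C1c_C1: "C1c U ph D ==> C1 ph D" by (simp add: C1c_def)

lemma C1c_mono: "C1c U ph D ==> U \<subseteq> V ==> C1c V ph D" unfolding C1c_def by blast

lemma C1_zero_grad:
 assumes "C1 ph D" "closed K" "!!x. x \<notin> K ==> ph x = 0" "x \<notin> K" shows "D x = 0"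
proof -
 have "(ph has_derivative (%h. 0)) (at x)" by (rule has_derivative_transform_within_open[where f="%_. 0" and s="-K"]) (use assms in auto)
 hence "(%h. D x *i h) = (%h. 0)" using C1_deriv[OF assms(1)] has_derivative_unique by blast
 thus ?thesis by (metis inner_eq_zero_iff)
qed

lemma C1cE:
 assumes "C1c U ph D"
 obtains K where "compact K" "K \<subseteq> U" "!!x. x \<notin> K ==> ph x = 0" "!!x. x \<notin> K ==> D x = 0"
proof -
 obtain K where K: "compact K" "K \<subseteq> U" "!!x. x \<notin> K ==> ph x = 0" using assms unfolding C1c_def by auto
 moreover have "D x = 0" if "x \<notin> K" for x
  by (rule C1_zero_grad[of ph D K]) (use K that assms in \<open>auto simp: C1c_def compact_imp_closed\<close>)
 ultimately show ?thesis using that by blast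
qed

lemma C1c_zero:
 assumes "C1c U ph D" "x \<notin> U" shows "ph x = 0" "D x = 0"
proof -
 obtain K where "compact K" "K \<subseteq> U" "!!x. x \<notin> K ==> ph x = 0" "!!x. x \<notin> K ==> D x = 0" by (rule C1cE[OF assms(1)]) (rule that)
 thus "ph x = 0" "D x = 0" using assms(2) by blast+
qed

lemma C1c_mult:
 assumes "C1 f F" "C1c U g G" shows "C1c U (%x. f x * g x) (%x. g x *r F x + f x *r G x)"
proof -
 obtain K where "compact K" "K \<subseteq> U" "!!x. x \<notin> K ==> g x = 0" by (rule C1cE[OF assms(2)]) (rule that)
 moreover have "C1 (%x. f x * g x) (%x. g x *r F x + f x *r G x)" by (rule C1_mult[OF assms(1) C1c_C1[OF assms(2)]])
 ultimately show ?thesis unfolding C1c_def by (intro conjI exI[of _ K]) simp_all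
qed

lemma C1c_add:
 assumes "C1c U f F" "C1c U g G" shows "C1c U (%x. f x + g x) (%x. F x + G x)"
proof -
 obtain K where "compact K" "K \<subseteq> U" "!!x. x \<notin> K ==> f x = 0" by (rule C1cE[OF assms(1)]) (rule that)
 moreover obtain L where "compact L" "L \<subseteq> U" "!!x. x \<notin> L ==> g x = 0" by (rule C1cE[OF assms(2)]) (rule that)
 ultimately have "compact (K \<union> L) & K \<union> L \<subseteq> U & (\<forall>x. x \<notin> K \<union> L --> f x + g x = 0)" by auto
 moreover have "C1 (%x. f x + g x) (%x. F x + G x)" by (rule C1_add[OF C1c_C1[OF assms(1)] C1c_C1[OF assms(2)]])
 ultimately show ?thesis unfolding C1c_def by (intro conjI exI[of _ "K \<union> L"]) simp_all
qed

lemma C1c_cmult: "C1c U g G ==> C1c U (%x. c * g x) (%x. c *r G x)" using C1c_mult[OF C1_const, of U g G c] by simp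

section \<open>Continuous functions with compact support\<close>

lemma bounded_range_compact_support:
 fixes f :: "'a::t2_space => 'b::real_normed_vector"
 assumes "continuous_on UNIV f" "compact K" "!!x. x \<notin> K ==> f x = 0"
 obtains B where "B > 0" "!!x. norm (f x) <= B"
proof -
 have "bounded (f ` K)" by (intro compact_imp_bounded compact_continuous_image continuous_on_subset[OF assms(1)] assms(2)) auto
 then obtain B where "B > 0" "!!x. x \<in> K ==> norm (f x) <= B" unfolding bounded_pos by auto
 hence "norm (f x) <= B" for x using assms(3)[of x] by (cases "x \<in> K") auto
 thus ?thesis using that \<open>B > 0\<close> by blast
qed

lemma compact_neighbourhood:
 fixes K :: "'a::real_normed_vector set"
 assumes "compact K" "compact (cball (0::'a) r)"
 obtains L where "compact L" "!!x y. x \<in> K ==> norm y <= r ==> x + y \<in> L"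
proof (rule that)
 show "compact {x + y | x y. x \<in> K & y \<in> cball 0 r}" by (rule compact_sums[OF assms])
 fix x y :: 'a assume "x \<in> K" "norm y <= r"
 hence "x \<in> K & y \<in> cball 0 r" by simp
 thus "x + y \<in> {x + y | x y. x \<in> K & y \<in> cball 0 r}" by blast
qed

lemma uniformly_continuous_compact_support:
 fixes f :: "'a::euclidean_space => 'b::real_normed_vector"
 assumes "continuous_on UNIV f" "compact K" "!!x. x \<notin> K ==> f x = 0" shows "uniformly_continuous_on UNIV f"
proof -
 obtain L where L: "compact L" "!!x y. x \<in> K ==> norm y <= 1 ==> x + y \<in> L" using compact_neighbourhood[OF assms(2) compact_cball] by blast
 have uc: "uniformly_continuous_on L f" by (rule compact_uniformly_continuous[OF continuous_on_subset[OF assms(1)] L(1)]) simp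
 show ?thesis unfolding uniformly_continuous_on_def
 proof (intro allI impI)
  fix e :: real assume "e > 0"
  then obtain d where d: "d > 0" "!!x x'. x \<in> L ==> x' \<in> L ==> dist x' x < d ==> dist (f x') (f x) < e"
   using uc unfolding uniformly_continuous_on_def by metis
  have "dist (f x') (f x) < e" if "dist x' x < min d 1" for x x'
  proof (cases "x \<in> K \<or> x' \<in> K")
   case True
   have n: "norm (x - x') <= 1" "norm (x' - x) <= 1" using that by (auto simp: dist_nm)
   have "x \<in> L & x' \<in> L" using True L(2)[of x "0"] L(2)[of x' "0"] L(2)[of x "x' - x"] L(2)[of x' "x - x'"] n by auto
   thus ?thesis using d that by auto
  qed (use assms \<open>e > 0\<close> in auto)
  thus "\<exists>d>0. \<forall>x\<in>UNIV. \<forall>x'\<in>UNIV. dist x' x < d --> dist (f x') (f x) < e"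
   using d(1) by (intro exI[of _ "min d 1"]) auto
 qed
qed

lemma C1c_bounded:
 assumes "C1c U ph D"
 obtains B where "B > 0" "!!x. \<bar>ph x\<bar> <= B" "!!x. norm (D x) <= B"
proof -
 obtain K where K: "compact K" "K \<subseteq> U" "!!x. x \<notin> K ==> ph x = 0" "!!x. x \<notin> K ==> D x = 0" by (rule C1cE[OF assms]) (rule that)
 obtain B1 where B1: "B1 > 0" "!!x. norm (ph x) <= B1"
  by (rule bounded_range_compact_support[where f=ph and K=K]) (use K C1_continuous[OF C1c_C1[OF assms]] that in \<open>auto\<close>)
 obtain B2 where B2: "B2 > 0" "!!x. norm (D x) <= B2"
  by (rule bounded_range_compact_support[where f=D and K=K]) (use K C1_continuous_grad[OF C1c_C1[OF assms]] that in \<open>auto\<close>)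
 show ?thesis by (rule that[of "B1 + B2"]) (use B1 B2 in \<open>auto intro: add_increasing add_increasing2 less_imp_le\<close>)
qed

lemma abs_inner_le:
 fixes x :: "'a::real_inner" shows "norm x <= B ==> \<bar>x *i h\<bar> <= B * norm h"
 by (rule order_trans[OF Cauchy_Schwarz_ineq2]) (simp add: mult_right_mono)

lemma integrable_indicator_compact:
 "compact (K::'a::euclidean_space set) ==> lint (indicator K :: 'a => real)" by (rule integrable_real_indicator)
  (use emeasure_bounded_finite[OF compact_imp_bounded] in \<open>auto intro: borel_compact\<close>)

lemma integrable_compact_support:
 fixes f :: "'a::euclidean_space => 'b::{banach,second_countable_topology}"
 assumes "continuous_on UNIV f" "compact K" "!!x. x \<notin> K ==> f x = 0" shows "lint f"
proof -
 obtain B where B: "B > 0" "!!x. norm (f x) <= B" by (rule bounded_range_compact_support[where f=f and K=K]) (use assms that in auto)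
 have "f \<in> Bm" using assms(1) by (simp add: borel_measurable_continuous_onI)
 moreover have "lint (%x. B * indicator K x :: real)" by (intro integrable_mult_right integrable_indicator_compact assms(2))
 ultimately show ?thesis by (rule_tac int_bound[where f="%x. B * indicator K x :: real"]) (use B assms(3) in \<open>auto simp: indicator_def\<close>)
qed

lemma C1c_integrable:
 assumes "C1c U ph D" shows "lint ph" "lint D"
proof -
 obtain K where K: "compact K" "K \<subseteq> U" "!!x. x \<notin> K ==> ph x = 0" "!!x. x \<notin> K ==> D x = 0" by (rule C1cE[OF assms]) (rule that)
 show "lint ph" by (rule integrable_compact_support[OF C1_continuous[OF C1c_C1[OF assms]] K(1,3)])
 show "lint D" by (rule integrable_compact_support[OF C1_continuous_grad[OF C1c_C1[OF assms]] K(1,4)])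
qed

lemma int_scaleR_bounded:
 fixes u :: "'a => real" and f :: "'a => 'b::{banach,second_countable_topology}"
 assumes "integrable M u" "f \<in> borel_measurable M" "!!x. norm (f x) <= B" shows "integrable M (%x. u x *r f x)"
proof (rule int_bound[where f="%x. B * u x"])
 have "norm (u x *r f x) <= norm (B * u x)" for x
  using assms(3)[of x] mult_right_mono[of "norm (f x)" "\<bar>B\<bar>" "\<bar>u x\<bar>"] by (simp add: abs_mult mult.commute)
 thus "AE x in M. norm (u x *r f x) <= norm (B * u x)" by simp
qed (use assms in auto)

lemma int_bounded_scaleR:
 fixes u :: "'a => real" and f :: "'a => 'b::{banach,second_countable_topology}"
 assumes "integrable M f" "u \<in> borel_measurable M" "!!x. \<bar>u x\<bar> <= B" shows "integrable M (%x. u x *r f x)"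
proof (rule int_bound[where f="%x. B *r f x"])
 have "norm (u x *r f x) <= norm (B *r f x)" for x using assms(3)[of x] mult_right_mono[of "\<bar>u x\<bar>" "\<bar>B\<bar>" "norm (f x)"] by simp
 thus "AE x in M. norm (u x *r f x) <= norm (B *r f x)" by simp
qed (use assms in auto)

text \<open>Uniform continuity of the gradient and the mean value inequality for
  \<open>ph y - D x . y\<close> give a first-order remainder that is uniform in \<open>x\<close>.
  The uniformity allows difference quotients to be integrated.\<close>

lemma C1c_uniform:
 assumes "C1c U ph D" "e > 0" shows "\<exists>d>0. \<forall>x h. norm h < d --> \<bar>ph (x + h) - ph x - D x *i h\<bar> <= e * norm h"
proof -
 obtain K where K: "compact K" "K \<subseteq> U" "!!x. x \<notin> K ==> ph x = 0" "!!x. x \<notin> K ==> D x = 0"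
  by (rule C1cE[OF assms(1)]) (rule that)
 have "uniformly_continuous_on UNIV D" by (rule uniformly_continuous_compact_support[OF C1_continuous_grad[OF C1c_C1[OF assms(1)]] K(1,4)])
 then obtain d where d: "d > 0" "!!x y. dist y x < d ==> dist (D y) (D x) < e" using assms(2) unfolding uniformly_continuous_on_def by (metis UNIV_I)
 have "\<bar>ph (x + h) - ph x - D x *i h\<bar> <= e * norm h" if "norm h < d" for x h
 proof -
  let ?f = "%y. ph y - D x *i y"
  have "norm (?f (x + h) - ?f x) <= e * norm ((x + h) - x)"
  proof (rule differentiable_bound[where S="ball x d"])
   show "(?f has_derivative (%k. (D y - D x) *i k)) (at y within ball x d)" for y by (rule has_derivative_at_withinI)
     (auto intro!: derivative_eq_intros C1_deriv[OF C1c_C1[OF assms(1)]] simp: inner_diff_left)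
   show "onorm (%k. (D y - D x) *i k) <= e" if "y \<in> ball x d" for y
   proof (rule onorm_le)
    fix k
    have "norm (D y - D x) <= e" using d(2)[of y x] that by (simp add: dist_nm)
    thus "norm ((D y - D x) *i k) <= e * norm k"
     using Cauchy_Schwarz_ineq2[of "D y - D x" k] mult_right_mono[of "norm (D y - D x)" e "norm k"] by simp
   qed
  qed (use that d(1) in \<open>auto simp: dist_norm\<close>)
  moreover have "?f (x + h) - ?f x = ph (x + h) - ph x - D x *i h" by (simp add: inner_add_right)
  ultimately show ?thesis by simp
 qed
 thus ?thesis using d(1) by (intro exI[of _ d]) simp
qed

section \<open>Volume-preserving changes of variables and integration by parts\<close>

definition mpres :: "('a::euclidean_space => 'a) => bool" where
 "mpres T \<longleftrightarrow> T \<in> Bm & distr lborel borel T = lborel"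

lemma mpres_integral:
 fixes f :: "'a::euclidean_space => 'b::{banach,second_countable_topology}"
 assumes "mpres T" "f \<in> Bm" shows "(LBINT x. f (T x)) = (LBINT x. f x)"
 using integral_distr[of T lborel borel f] assms unfolding mpres_def by simp

lemma mpres_integrable:
 fixes f :: "'a::euclidean_space => 'b::{banach,second_countable_topology}"
 assumes "mpres T" "f \<in> Bm" shows "lint (%x. f (T x)) = lint f" using integrable_distr_eq[of T lborel borel f] assms unfolding mpres_def by simp

lemma mpres_nn_integral:
 assumes "mpres T" "f \<in> Bm" shows "(NINT x. f (T x)) = (NINT x. f x)"
 using nn_integral_distr[of T lborel borel f] assms unfolding mpres_def by simp

lemma mpres_borel: "mpres T ==> T \<in> Bm" by (simp add: mpres_def)

lemma mpres_AE:
 assumes "mpres T" "AE x in lborel. P x" shows "AE x in lborel. P (T x)"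
proof -
 obtain N where N: "N \<in> sets lborel" "emeasure lborel N = 0" "{x. \<not> P x} \<subseteq> N"
  using assms(2) by (auto elim!: AE_E simp: space_lborel)
 have "emeasure lborel (T -` N) = emeasure lborel N" using assms(1) N(1) emeasure_distr[of T lborel borel N] unfolding mpres_def by simp
 moreover have "T -` N \<in> sets lborel" using measurable_sets[OF mpres_borel[OF assms(1)], of N] N(1) by simp
 ultimately show ?thesis using N by (intro AE_I'[of "T -` N"]) (auto simp: null_sets_def)
qed

lemma mpres_comp:
 assumes "mpres S" "mpres T" shows "mpres (%x. S (T x))"
proof -
 have [measurable]: "S \<in> Bm" "T \<in> Bm" using assms mpres_borel by auto
 have "distr lborel borel (%x. S (T x)) = distr (distr lborel borel T) borel S" by (subst distr_distr) (auto simp: comp_def)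
 also have "... = lborel" using assms by (simp add: mpres_def)
 finally show ?thesis by (simp add: mpres_def)
qed

lemma mpres_plus: "mpres (%x. x + a)" unfolding mpres_def using lborel_distr_plus[of a] by (simp add: add.commute[of _ a])

lemma mpres_reflect: "mpres (%x. a - x)"
proof -
 have "mpres (%x::'a. - x)" unfolding mpres_def using lborel_affine_euclidean[of "%_. -1" "0::'a"]
  by (simp add: sum_negf euclidean_representation density_1)
 from mpres_comp[OF mpres_plus[of a] this] show ?thesis by simp
qed

text \<open>Only translation invariance is used: \<open>ph\<close> and its translate by
  \<open>h\<close> have equal integrals, so the integral of \<open>D x . h\<close> equals minus that
  of the first-order remainder, which is at most \<open>e * norm h\<close> times the volume of a
  fixed compact set.\<close>

lemma C1c_integral_grad:
 assumes "C1c U ph D" shows "(LBINT x. D x) = 0"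
proof -
 obtain K where K: "compact K" "K \<subseteq> U" "!!x. x \<notin> K ==> ph x = 0" "!!x. x \<notin> K ==> D x = 0"
  by (rule C1cE[OF assms(1)]) (rule that)
 obtain L where L: "compact L" "!!x y. x \<in> K ==> norm y <= 1 ==> x + y \<in> L" using compact_neighbourhood[OF K(1) compact_cball] by blast
 note i = C1c_integrable[OF assms]
 define v where "v = (LBINT x. D x)"
 have *: "norm v <= e * measure lborel L" if e: "e > 0" for e
 proof (cases "v = 0")
  case False
  obtain d where d: "d > 0" "!!x h. norm h < d ==> \<bar>ph (x + h) - ph x - D x *i h\<bar> <= e * norm h" using C1c_uniform[OF assms e] by blast
  \<comment> \<open>The shift points along the vector to be shown zero, so that
    \<open>v . h = norm v * norm h\<close>; its length is small enough for the uniform remainder and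
    for staying inside \<open>L\<close>.\<close>
  define h where "h = (min d 1 / (2 * norm v)) *r v"
  have h: "norm h < d" "norm h <= 1" "norm h > 0" "v *i h = norm v * norm h"
   using d(1) False by (auto simp: h_def power2_norm_eq_inner[symmetric] power2_eq_square)
  have ih: "lint (%x. ph (x + h))" "(LBINT x. ph (x + h)) = (LBINT x. ph x)"
   using i(1) by (simp_all add: mpres_integrable[OF mpres_plus] mpres_integral[OF mpres_plus])
  have "norm v * norm h = - (LBINT x. ph (x + h) - ph x - D x *i h)" using i ih h(4) by (simp add: v_def)
  also have "... <= (LBINT x. (e * norm h) * indicator L x)"
  proof (subst integral_minus[symmetric], intro integral_mono)
   fix x
   have "x \<notin> L ==> x \<notin> K & x + h \<notin> K" using L(2)[of x 0] L(2)[of "x + h" "- h"] h(2) by auto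
   thus "- (ph (x + h) - ph x - D x *i h) <= (e * norm h) * indicator L x" using d(2)[OF h(1), of x] K(3,4) by (cases "x \<in> L") auto
  qed (use i ih integrable_indicator_compact[OF L(1)] in auto)
  finally show ?thesis using h(3) by (simp add: mult_ac mult_le_cancel_left_pos)
 qed (use e in simp)
 have "norm v <= 0"
 proof (rule field_le_epsilon)
  fix e :: real assume e: "e > 0"
  have "norm v <= e / (measure lborel L + 1) * measure lborel L" using e by (intro *) (auto simp: add_nonneg_pos)
  also have "... <= e" using e by (simp add: divide_simps add_nonneg_pos)
  finally show "norm v <= 0 + e" by simp
 qed
 thus ?thesis by (simp add: v_def)
qed

lemma C1_ibp:
 assumes "C1 u Du" "C1c U ph D" shows "(LBINT x. u x *r D x + ph x *r Du x) = 0"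
 using C1c_integral_grad[OF C1c_mult[OF assms]] by (simp add: add.commute)

text \<open>\<open>u\<close> and \<open>G\<close> are integrable on the whole space; only their restrictions to \<open>U\<close> matter.\<close>

definition wgrad :: "(real^3) set => (real^3 => real) => (real^3 => real^3) => bool" where
 "wgrad U u G \<longleftrightarrow> lint u & lint G &
  (\<forall>ph D. C1c U ph D --> (LBINT x. u x *r D x + ph x *r G x) = 0)"

lemma wgrad_eq0:
 assumes "wgrad U u G" "C1c U ph D" shows "(LBINT x. u x *r D x + ph x *r G x) = 0"
proof -
 have "\<forall>ph D. C1c U ph D --> (LBINT x. u x *r D x + ph x *r G x) = 0" using assms(1) unfolding wgrad_def by (elim conjE)
 from this[rule_format, OF assms(2)] show ?thesis .
qed

lemma wgradI:
 assumes "lint u" "lint G"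
  "!!ph D. C1c U ph D ==> (LBINT x. u x *r D x + ph x *r G x) = 0" shows "wgrad U u G" unfolding wgrad_def by (intro conjI allI impI assms)

lemma wgrad_integrable:
 assumes "wgrad U u G" shows "lint u" "lint G"
proof -
 show "lint u" using assms unfolding wgrad_def by (elim conjE)
 show "lint G" using assms unfolding wgrad_def by (elim conjE)
qed

lemma C1c_int_scaleR:
 assumes "C1c U ph D" shows "lint (u::real^3 => real) ==> lint (%x. u x *r D x)"
  "lint (G::real^3 => 'b::{banach,second_countable_topology}) ==> lint (%x. ph x *r G x)"
proof -
 obtain B where B: "B > 0" "!!x. \<bar>ph x\<bar> <= B" "!!x. norm (D x) <= B" by (rule C1c_bounded[OF assms]) (rule that)
 note C = C1c_C1[OF assms]
 note m = C1_borel[OF C] C1_borel_grad[OF C]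
 show "lint u ==> lint (%x. u x *r D x)" by (rule int_scaleR_bounded[OF _ _ B(3)]) (use m in simp_all)
 show "lint G ==> lint (%x. ph x *r G x)" by (rule int_bounded_scaleR[OF _ _ B(2)]) (use m in simp_all)
qed

lemma wgradD:
 assumes "wgrad U u G" "C1c U ph D" shows "(LBINT x. u x *r D x) = - (LBINT x. ph x *r G x)"
proof -
 have "(LBINT x. u x *r D x) + (LBINT x. ph x *r G x) = (LBINT x. u x *r D x + ph x *r G x)"
  by (intro integral_plus[symmetric] C1c_int_scaleR[OF assms(2)] wgrad_integrable[OF assms(1)])
 also have "... = 0" by (rule wgrad_eq0[OF assms])
 finally show ?thesis by (simp add: eq_neg_iff_add_eq_0)
qed

lemma wgrad_mono:
 assumes "wgrad U u G" "V \<subseteq> U" shows "wgrad V u G"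
 by (intro wgradI wgrad_integrable[OF assms(1)] wgrad_eq0[OF assms(1)] C1c_mono[OF _ assms(2)])

lemma wgrad_cong:
 assumes "wgrad U u G" "!!x. x \<in> U ==> u x = v x" "!!x. x \<in> U ==> G x = H x"
  "lint v" "lint H" shows "wgrad U v H"
proof (rule wgradI)
 fix ph D assume a: "C1c U ph D"
 have "v x *r D x + ph x *r H x = u x *r D x + ph x *r G x" for x using C1c_zero[OF a, of x] assms(2,3)[of x] by (cases "x \<in> U") auto
 thus "(LBINT x. v x *r D x + ph x *r H x) = 0" using wgrad_eq0[OF assms(1) a] by simp
qed (use assms in auto)

lemma wgrad_add:
 assumes "wgrad U u G" "wgrad U v H" shows "wgrad U (%x. u x + v x) (%x. G x + H x)"
proof (rule wgradI)
 fix ph D assume a: "C1c U ph D"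
 have "(LBINT x. (u x + v x) *r D x + ph x *r (G x + H x))
   = (LBINT x. (u x *r D x + ph x *r G x) + (v x *r D x + ph x *r H x))" by (simp add: algebra_simps)
 also have "... = 0 + 0" using wgrad_eq0[OF assms(1) a] wgrad_eq0[OF assms(2) a] by (subst integral_plus)
   (auto intro!: C1c_int_scaleR[OF a] wgrad_integrable[OF assms(1)] wgrad_integrable[OF assms(2)])
 finally show "(LBINT x. (u x + v x) *r D x + ph x *r (G x + H x)) = 0" by simp
qed (auto intro!: wgrad_integrable[OF assms(1)] wgrad_integrable[OF assms(2)])

lemma C1_mult_indicator_integrable:
 fixes u :: "real^3 => 'b::{banach,second_countable_topology}"
 assumes "continuous_on UNIV u" "bounded U" "U \<in> sets borel" shows "lint (%x. indicator U x *r u x)"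
proof -
 have "compact (closure U)" using assms by simp
 moreover have "continuous_on (closure U) u" using assms(1) continuous_on_subset by blast
 ultimately have "set_integrable lborel (closure U) u" unfolding set_integrable_def by (rule borel_integrable_compact)
 hence "set_integrable lborel U u" by (rule set_integrable_subset) (use assms(3) closure_subset in auto)
 thus ?thesis by (simp add: set_integrable_def)
qed

lemma C1_wgrad:
 assumes "C1 u Du" "bounded U" "U \<in> sets borel" shows "wgrad U (%x. indicator U x *r u x) (%x. indicator U x *r Du x)"
proof (rule wgradI)
 show "lint (%x. indicator U x *r u x)" "lint (%x. indicator U x *r Du x)"
  by (intro C1_mult_indicator_integrable C1_continuous[OF assms(1)] C1_continuous_grad[OF assms(1)] assms)+
 fix ph D assume a: "C1c U ph D"
 have "(indicator U x *r u x) *r D x + ph x *r indicator U x *r Du x = u x *r D x + ph x *r Du x" for x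
  using C1c_zero[OF a, of x] by (cases "x \<in> U") auto
 thus "(LBINT x. (indicator U x *r u x) *r D x + ph x *r indicator U x *r Du x) = 0" using C1_ibp[OF assms(1) a] by simp
qed

lemma wgrad_mult:
 assumes "wgrad U u G" "C1 z Dz" "!!x. \<bar>z x\<bar> <= B" "!!x. norm (Dz x) <= B" shows "wgrad U (%x. z x * u x) (%x. u x *r Dz x + z x *r G x)"
proof (rule wgradI)
 note [measurable] = C1_borel[OF assms(2)] C1_borel_grad[OF assms(2)]
 show 1: "lint (%x. z x * u x)" using int_bounded_scaleR[of lborel u z B] assms(3) wgrad_integrable[OF assms(1)] by simp
 show 2: "lint (%x. u x *r Dz x + z x *r G x)"
  using int_bounded_scaleR[of lborel G z B] int_scaleR_bounded[of lborel u Dz B] assms(3,4) wgrad_integrable[OF assms(1)] by simp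
 fix ph D assume a: "C1c U ph D"
 have "(LBINT x. u x *r (ph x *r Dz x + z x *r D x) + (z x * ph x) *r G x) = 0" by (rule wgrad_eq0[OF assms(1) C1c_mult[OF assms(2) a]])
 thus "(LBINT x. (z x * u x) *r D x + ph x *r (u x *r Dz x + z x *r G x)) = 0" by (simp add: algebra_simps)
qed

section \<open>Mollification\<close>

lemma translation_L1_approx:
 fixes f :: "'a::euclidean_space => 'b::{banach,second_countable_topology}"
 assumes f: "lint f" and e: "e > (0::real)" and g: "lint g" "(LBINT x. norm (g x - f x)) <= e / 3"
   "\<exists>d>0. \<forall>h. norm h < d --> (LBINT x. norm (g (x + h) - g x)) <= e / 3"
 shows "\<exists>d>0. \<forall>h. norm h < d --> (LBINT x. norm (f (x + h) - f x)) <= e"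
proof -
 have i: "lint (%x. k (x + h))" if "lint k" for k :: "'a => 'b" and h using that by (subst mpres_integrable[OF mpres_plus]) auto
 note [simp] = i[OF f] i[OF g(1)]
 have "(LBINT x. norm (f (x + h) - f x)) <= e / 3 + (LBINT x. norm (g (x + h) - g x)) + e / 3" for h
 proof -
  have "(LBINT x. norm (f (x + h) - f x))
   <= (LBINT x. norm (g (x + h) - f (x + h)) + norm (g (x + h) - g x) + norm (g x - f x))"
  proof (intro integral_mono)
   fix x show "norm (f (x + h) - f x) <= norm (g (x + h) - f (x + h)) + norm (g (x + h) - g x) + norm (g x - f x)"
    using norm_triangle_ineq4[of "g (x + h) - g x" "g (x + h) - f (x + h)"]
     norm_triangle_ineq[of "f (x + h) - g x" "g x - f x"] by (simp add: algebra_simps)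
  qed (use f g in auto)
  also have "... = (LBINT x. norm (g (x + h) - f (x + h))) + (LBINT x. norm (g (x + h) - g x)) + (LBINT x. norm (g x - f x))" using f g by simp
  also have "(LBINT x. norm (g (x + h) - f (x + h))) = (LBINT x. norm (g x - f x))"
   using mpres_integral[OF mpres_plus, of "%x. norm (g x - f x)"] f g by simp
  finally show ?thesis using g(2) by simp
 qed
 note * = this
 obtain d where "d > 0" "!!h. norm h < d ==> (LBINT x. norm (g (x + h) - g x)) <= e / 3" using g(3) by blast
 moreover have "a <= e" if "a <= e / 3 + b + e / 3" "b <= e / 3" for a b using that by linarith
 ultimately show ?thesis using * by blast
qed

text \<open>The absolute difference of the two indicators is twice the part of \<open>U\<close> lost
  by the shift plus a signed difference whose integral is zero by translation invariance. The lost
  part tends to zero by dominated convergence, because every point of an open set survives small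
  shifts.\<close>

lemma translation_L1_open:
 fixes U :: "'a::euclidean_space set" and c :: "'b::{banach,second_countable_topology}"
 assumes U: "open U" "emeasure lborel U < \<infinity>" and e: "e > (0::real)"
 shows "\<exists>d>0. \<forall>h. norm h < d --> (LBINT x. norm (indicator U (x + h) *r c - indicator U x *r c)) <= e"
proof -
 note [measurable] = borel_open[OF U(1)]
 let ?g = "%h x. indicator U x * (1 - indicator U (x + h)) :: real"
 have iU[simp]: "lint (indicator U :: 'a => real)" using U by (intro integrable_real_indicator) auto
 have iUh[simp]: "lint (%x. indicator U (x + h) :: real)" for h using iU by (subst mpres_integrable[OF mpres_plus]) auto
 have ig[simp]: "lint (?g h)" for h by (rule int_bound[OF iU]) (auto simp: indicator_def)
 have "((%h. (LBINT x. ?g h x)) \<longlongrightarrow> (\<integral>x. 0 \<partial>(lborel :: 'a measure))) (at 0)"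
 proof (unfold tendsto_at_iff_sequentially comp_def, intro allI impI integral_dominated_convergence[where w="indicator U"] AE_I2)
  fix X :: "nat => 'a" and x :: 'a
  assume X: "X \<longlonglongrightarrow> 0"
  have "x \<in> U ==> \<forall>\<^sub>F n in sequentially. x + X n \<in> U"
   using U(1) by (intro topological_tendstoD[OF tendsto_add[OF tendsto_const X]]) auto
  thus "(%n. ?g (X n) x) \<longlonglongrightarrow> 0" by (cases "x \<in> U") (auto intro!: tendsto_eventually elim!: eventually_mono)
 qed (auto simp: indicator_def)
 hence "\<forall>\<^sub>F h in at 0. (LBINT x. ?g h x) * (2 * norm c) < e" by (intro order_tendstoD(2)[OF tendsto_mult_left_zero]) (use e in auto)
 then obtain d where d: "d > 0" "!!h. h ~= 0 ==> norm h < d ==> (LBINT x. ?g h x) * (2 * norm c) < e"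
  unfolding eventually_at by (auto simp: dist_norm)
 have "(LBINT x. norm (indicator U (x + h) *r c - indicator U x *r c)) = (LBINT x. ?g h x) * (2 * norm c)" for h
 proof -
  have "(LBINT x. norm (indicator U (x + h) *r c - indicator U x *r c))
   = (LBINT x. (2 * ?g h x + (indicator U (x + h) - indicator U x)) * norm c)" by (intro integral_cong2) (auto simp: indicator_def)
  also have "... = (2 * (LBINT x. ?g h x) + ((LBINT x. indicator U (x + h)) - (LBINT x. indicator U x))) * norm c" using iU iUh ig by simp
  also have "(LBINT x. indicator U (x + h)) = (LBINT x. (indicator U x :: real))" by (rule mpres_integral[OF mpres_plus]) auto
  finally show ?thesis by simp
 qed
 note eq = this
 have z: "(%x. indicator U x * (1 - indicator U x)) = (%_. 0 :: real)" by (auto simp: indicator_def)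
 show ?thesis
 proof (intro exI[of _ d] conjI allI impI d(1))
  fix h :: 'a assume "norm h < d"
  thus "(LBINT x. norm (indicator U (x + h) *r c - indicator U x *r c)) <= e"
   using d(2)[of h] e unfolding eq by (cases "h = 0") (auto simp: less_imp_le z)
 qed
qed

text \<open>Induction over integrable functions: an indicator is replaced by that of an open
  superset with little excess measure, and limits are handled by approximation in L1.\<close>

lemma translation_L1:
 fixes f :: "'a::euclidean_space => 'b::{banach,second_countable_topology}"
 assumes "lint f" and "e > (0::real)" shows "\<exists>d>0. \<forall>h. norm h < d --> (LBINT x. norm (f (x + h) - f x)) <= e" using assms
proof (induction arbitrary: e rule: integrable_induct)
 case (base A c)
 have Am[measurable]: "A \<in> sets borel" using base by simp
 define e' where "e' = e / (3 * (norm c + 1))"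
 have c1: "norm c + 1 > 0" by (simp add: add_nonneg_pos)
 have e': "e' > 0" using base(3) c1 unfolding e'_def by simp
 obtain U where U: "open U" "A \<subseteq> U" "emeasure lborel (U - A) < e'" using outer_regular_lborel[OF Am e'] by blast
 note [measurable] = borel_open[OF U(1)]
 have "emeasure lborel U = emeasure lborel A + emeasure lborel (U - A)"
  using U(2) by (subst plus_emeasure) (auto intro: arg_cong[where f="emeasure lborel"])
 hence fin: "emeasure lborel U < \<infinity>" using base(2) U(3) by (auto simp: less_top[symmetric])
 have le: "measure lborel (U - A) <= e'" using U(3) e' by (simp add: measure_def enn2real_leI less_imp_le)
 have "(LBINT x. norm (indicator U x *r c - indicator A x *r c)) = (LBINT x. indicator (U - A) x * norm c)"
  using U(2) by (intro integral_cong2) (auto simp: indicator_def)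
 also have "... <= e' * norm c" using le by (simp add: mult_right_mono)
 also have "... <= e / 3" using base(3) c1 unfolding e'_def by (simp add: divide_simps)
 finally show ?case using fin base by (intro translation_L1_approx[OF _ _ _ _ translation_L1_open[OF U(1) fin]]) auto
next
 case (add f g)
 have i[simp]: "lint (%x. f (x + h))" "lint (%x. g (x + h))" for h using add.hyps by (simp_all add: mpres_integrable[OF mpres_plus])
 have "(LBINT x. norm (f (x + h) + g (x + h) - (f x + g x)))
   <= (LBINT x. norm (f (x + h) - f x) + norm (g (x + h) - g x))" for h
  by (intro integral_mono) (use add.hyps in \<open>auto simp: add_diff_add intro: norm_triangle_ineq\<close>)
 hence le: "(LBINT x. norm (f (x + h) + g (x + h) - (f x + g x)))
   <= (LBINT x. norm (f (x + h) - f x)) + (LBINT x. norm (g (x + h) - g x))" for h using add.hyps by simp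
 obtain d1 where d1: "d1 > 0" "!!h. norm h < d1 ==> (LBINT x. norm (f (x + h) - f x)) <= e / 2" using add.IH(1)[of "e / 2"] add.prems by auto
 obtain d2 where d2: "d2 > 0" "!!h. norm h < d2 ==> (LBINT x. norm (g (x + h) - g x)) <= e / 2" using add.IH(2)[of "e / 2"] add.prems by auto
 show ?case
 proof (intro exI[of _ "min d1 d2"] conjI allI impI)
  fix h :: 'a assume "norm h < min d1 d2"
  thus "(LBINT x. norm (f (x + h) + g (x + h) - (f x + g x))) <= e" using le[of h] d1(2)[of h] d2(2)[of h] by simp
 qed (use d1 d2 in simp)
next
 case (lim f s)
 note [measurable] = Bm_int[OF lim.hyps(4)] Bm_int[OF lim.hyps(1)]
 have "(%i. (LBINT x. norm (s i x - f x))) \<longlonglongrightarrow> (\<integral>x. 0 \<partial>(lborel :: 'a measure))"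
 proof (intro integral_dominated_convergence[where w="%x. 3 * norm (f x)"] AE_I2)
  fix x :: 'a and i
  show "norm (norm (s i x - f x)) <= 3 * norm (f x)" using lim.hyps(3)[of x i] norm_triangle_ineq4[of "s i x" "f x"] by simp
  show "(%i. norm (s i x - f x)) \<longlonglongrightarrow> 0" using lim.hyps(2)[of x] by (simp add: tendsto_norm_zero LIM_zero)
 qed (use lim.hyps(4) in auto)
 hence "\<forall>\<^sub>F i in sequentially. (LBINT x. norm (s i x - f x)) < e / 3" by (rule order_tendstoD(2)) (use lim.prems in auto)
 then obtain i where "(LBINT x. norm (s i x - f x)) < e / 3" by (auto simp: eventually_sequentially)
 thus ?case using lim.hyps lim.prems by (intro translation_L1_approx[OF _ _ _ _ lim.IH[of "e / 3" i]]) auto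
qed

section \<open>Convolution with C1 kernels\<close>

definition cv :: "(real^3 => real) => (real^3 => 'c::{banach,second_countable_topology}) => real^3 => 'c" where
 "cv et u x = (LBINT z. et (x - z) *r u z)"

lemma integral_norm_diff_le:
 fixes f g :: "'a::euclidean_space => 'b::{banach,second_countable_topology}"
 assumes "integrable M f" "integrable M g" "integrable M b" "!!x. norm (f x - g x) <= b x"
 shows "norm ((\<integral>x. f x \<partial>M) - (\<integral>x. g x \<partial>M)) <= (\<integral>x. b x \<partial>M)"
 using Bochner_Integration.integral_norm_bound_integral[of M "%x. f x - g x" b] assms by simp

lemma cv_integrable_integrand:
 fixes u :: "real^3 => 'c::{banach,second_countable_topology}"
 assumes "C1c U et D" "lint u" shows "lint (%z. et (x - z) *r u z)"
proof -
 obtain B where "B > 0" "!!x. \<bar>et x\<bar> <= B" "!!x. norm (D x) <= B" by (rule C1c_bounded[OF assms(1)]) (rule that)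
 moreover have [measurable]: "et \<in> Bm" by (rule C1_borel[OF C1c_C1[OF assms(1)]])
 ultimately show ?thesis by (intro int_bounded_scaleR[OF assms(2)]) auto
qed

lemma cv_borel:
 assumes "et \<in> Bm" "u \<in> Bm" shows "cv et u \<in> Bm"
proof -
 note [measurable] = assms
 have "(%x. (LBINT z. et (x - z) *r u z)) \<in> Bm" by measurable
 thus ?thesis by (simp add: cv_def[abs_def])
qed

text \<open>The derivative falls on the kernel. Its first-order remainder is uniform in the point,
  hence can be integrated against \<open>|u|\<close> for any integrable \<open>u\<close>.\<close>

lemma C1_cv:
 fixes u :: "real^3 => real"
 assumes "C1c U et D" "lint u" shows "C1 (cv et u) (%x. (LBINT z. u z *r D (x - z)))"
proof -
 let ?D = "%x. (LBINT z. u z *r D (x - z))" and ?N = "LBINT z. \<bar>u z\<bar>"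
 note C = C1c_C1[OF assms(1)]
 note [measurable] = C1_borel[OF C] C1_borel_grad[OF C]
 obtain B where B: "B > 0" "!!x. \<bar>et x\<bar> <= B" "!!x. norm (D x) <= B" by (rule C1c_bounded[OF assms(1)]) (rule that)
 have iD: "lint (%z. u z *r D (x - z))" for x by (rule int_scaleR_bounded[OF assms(2), where B=B]) (use B in auto)
 note i = cv_integrable_integrand[OF assms] integrable_inner_left[OF iD]
 have "(cv et u has_derivative (%h. ?D x *i h)) (at x)" for x unfolding has_derivative_at_alt
 proof (intro conjI allI impI bounded_linear_inner_right)
  fix e :: real assume e: "e > 0"
  have N: "?N >= 0" by simp
  obtain d where d: "d > 0" "!!y h. norm h < d ==> \<bar>et (y + h) - et y - D y *i h\<bar> <= e / (?N + 1) * norm h"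
   using C1c_uniform[OF assms(1), of "e / (?N + 1)"] e N by (auto simp: add_nonneg_pos)
  show "\<exists>d>0. \<forall>y. norm (y - x) < d --> norm (cv et u y - cv et u x - ?D x *i (y - x)) <= e * norm (y - x)"
  proof (intro exI[of _ d] conjI allI impI d(1))
   fix y assume y: "norm (y - x) < d"
   have "norm ((LBINT z. et (y - z) *r u z) - (LBINT z. et (x - z) *r u z + (u z *r D (x - z)) *i (y - x)))
    <= (LBINT z. (e / (?N + 1) * norm (y - x)) * \<bar>u z\<bar>)"
   proof (rule integral_norm_diff_le)
    fix z
    have "et (y - z) *r u z - (et (x - z) *r u z + (u z *r D (x - z)) *i (y - x)) = (et (y - z) - et (x - z) - D (x - z) *i (y - x)) * u z"
     by (simp add: algebra_simps)
    thus "norm (et (y - z) *r u z - (et (x - z) *r u z + (u z *r D (x - z)) *i (y - x))) <= (e / (?N + 1) * norm (y - x)) * \<bar>u z\<bar>"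
     using mult_right_mono[OF d(2)[OF y, of "x - z"], of "\<bar>u z\<bar>"] by (simp add: abs_mult)
   qed (use i assms(2) in auto)
   also have "... = (e * norm (y - x)) * (?N / (?N + 1))" by simp
   also have "... <= (e * norm (y - x)) * 1" using e N by (intro mult_left_mono) (auto simp: divide_le_eq add_nonneg_pos)
   finally show "norm (cv et u y - cv et u x - ?D x *i (y - x)) <= e * norm (y - x)"
    using i integral_inner_left[OF iD, of x "y - x"] by (simp add: cv_def diff_diff_add)
  qed
 qed
 moreover have "continuous_on UNIV ?D"
 proof (rule continuous_at_imp_continuous_on, intro ballI, unfold continuous_at_sequentially comp_def, intro allI impI)
  fix x X assume X: "X \<longlonglongrightarrow> (x::real^3)"
  show "(%n. ?D (X n)) \<longlonglongrightarrow> ?D x"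
  proof (intro integral_dominated_convergence[where w="%z. \<bar>u z\<bar> * B"] AE_I2)
   show "(%n. u z *r D (X n - z)) \<longlonglongrightarrow> u z *r D (x - z)" for z
    by (intro tendsto_intros continuous_on_tendsto_compose[OF C1_continuous_grad[OF C, of UNIV]] X) auto
  qed (use assms(2) B(3) in \<open>auto intro: mult_left_mono\<close>)
 qed
 ultimately show ?thesis unfolding C1_def by simp
qed

lemma cv_support:
 assumes "!!z. z \<notin> K ==> u z = 0" "!!x. norm x > d ==> et x = 0" "!!z. z \<in> K ==> norm (x - z) > d" shows "cv et u x = 0"
proof -
 have eq: "et (x - z) *r u z = 0" for z using assms by (cases "z \<in> K") auto
 show ?thesis by (simp only: cv_def eq Bochner_Integration.integral_zero)
qed

lemma C1c_reflect:
 assumes "C1c UNIV et D" "!!y. norm y > d ==> et y = 0" "cball x d \<subseteq> U" shows "C1c U (%z. et (x - z)) (%z. - D (x - z))" unfolding C1c_def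
proof
 note C = C1c_C1[OF assms(1)]
 show "C1 (%z. et (x - z)) (%z. - D (x - z))" unfolding C1_def
 proof (intro conjI allI)
  fix z
  have "((%z. x - z) has_derivative (%h. - h)) (at z)" by (auto intro!: derivative_eq_intros)
  from has_derivative_compose[OF this C1_deriv[OF C]]
  show "((%z. et (x - z)) has_derivative (*i) (- D (x - z))) (at z)" by (rule has_derivative_eq_rhs) auto
  show "continuous_on UNIV (%z. - D (x - z))" by (intro continuous_intros continuous_on_compose2[OF C1_continuous_grad[OF C, of UNIV]]) auto
 qed
 show "\<exists>K. compact K & K \<subseteq> U & (\<forall>z. z \<notin> K --> et (x - z) = 0)"
  by (intro exI[of _ "cball x d"]) (use assms in \<open>auto simp: dist_norm\<close>)
qed

text \<open>The kernel reflected about \<open>x\<close> is itself a test function once its support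
  ball lies in \<open>U\<close>; the two minus signs, from the reflection and from the weak
  derivative, cancel.\<close>

lemma wgrad_cv:
 assumes "wgrad U u G" "C1c UNIV et D" "!!y. norm y > d ==> et y = 0" "cball x d \<subseteq> U" shows "(LBINT z. u z *r D (x - z)) = cv et G x"
 using wgradD[OF assms(1) C1c_reflect[OF assms(2-4)]] by (simp add: cv_def)

text \<open>\<open>D\<close> is the gradient of the kernel \<open>et\<close>.\<close>

definition mollifier :: "real => (real^3 => real) => (real^3 => real^3) => bool" where
 "mollifier d et D \<longleftrightarrow> C1c UNIV et D & (\<forall>y. norm y > d --> et y = 0) & (\<forall>y. 0 <= et y) & (LBINT y. et y) = 1"

lemma mollifierD:
 assumes "mollifier d et D" shows "C1c UNIV et D" "norm y > d ==> et y = 0" "0 <= et y" "(LBINT y. et y) = 1"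
  "lint et" "et \<in> Bm" using assms C1c_integrable(1)[of UNIV et D] Bm_int[of lborel et] unfolding mollifier_def by auto

lemma cv_commute:
 assumes "et \<in> Bm" "u \<in> Bm" shows "cv et u x = (LBINT y. et y *r u (x - y))"
 using mpres_integral[OF mpres_reflect[of x], of "%z. et (x - z) *r u z"] assms by (simp add: cv_def)

lemma cv_diff_bound:
 assumes m: "mollifier d et D" and u: "u \<in> Bm" "lint (%y. et y *r u (x - y))" and b: "!!y. norm y <= d ==> norm (u (x - y) - c) <= B"
 shows "norm (cv et u x - c) <= B"
proof -
 note M = mollifierD[OF m]
 have ic: "lint (%y. et y *r c)" using M(5) by simp
 have i: "lint (%y. et y *r (u (x - y) - c))" using u(2) ic by (simp add: scaleR_diff_right)
 have "(LBINT y. et y *r (u (x - y) - c)) = (LBINT y. et y *r u (x - y)) - (LBINT y. et y *r c)" using u(2) ic by (simp add: scaleR_diff_right)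
 also have "... = cv et u x - c" using M(4) by (simp add: cv_commute[OF M(6) u(1)] integral_scaleR_left[OF M(5)])
 finally have "norm (cv et u x - c) <= (LBINT y. norm (et y *r (u (x - y) - c)))" using integral_norm_bound by metis
 also have "... <= (LBINT y. et y * B)"
 proof (rule integral_mono)
  show "norm (et y *r (u (x - y) - c)) <= et y * B" for y using b[of y] M(2)[of y] M(3)[of y] by (cases "norm y <= d") (auto intro: mult_left_mono)
  show "lint (%y. norm (et y *r (u (x - y) - c)))" by (rule integrable_norm[OF i])
 qed (use M(5) in auto)
 also have "... = B" using M(4,5) by simp
 finally show ?thesis .
qed

text \<open>The error is an average of translation errors, and Fubini moves the L1 norm inside this
  average.\<close>

lemma cv_L1_diff:
 assumes m: "mollifier d et D" and u: "lint u" and b: "!!h. norm h <= d ==> (LBINT x. norm (u (x + h) - u x)) <= e"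
 shows "(NINT x. ennreal (norm (cv et u x - u x))) <= ennreal e"
proof -
 note M = mollifierD[OF m]
 note [measurable] = M(6) Bm_int[OF u]
 have um: "u \<in> Bm" by measurable
 have pw: "ennreal (norm (cv et u x - u x)) <= (NINT y. ennreal (et y * norm (u (x - y) - u x)))" for x
 proof -
  have i1: "lint (%y. et y *r u (x - y))"
   using mpres_integrable[OF mpres_reflect[of x], of "%z. et (x - z) *r u z"] cv_integrable_integrand[OF M(1) u, of x] by simp
  have ic: "lint (%y. et y *r u x)" using M(5) by simp
  have i: "lint (%y. et y *r (u (x - y) - u x))" using i1 ic by (simp add: scaleR_diff_right)
  have "(LBINT y. et y *r (u (x - y) - u x)) = (LBINT y. et y *r u (x - y)) - (LBINT y. et y *r u x)" using i1 ic by (simp add: scaleR_diff_right)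
  also have "... = cv et u x - u x" using M(4) by (simp add: cv_commute[OF M(6) um] integral_scaleR_left[OF M(5)])
  finally have "ennreal (norm (cv et u x - u x)) <= (NINT y. ennreal (norm (et y *r (u (x - y) - u x))))"
   using integral_norm_bound_ennreal[OF i] by metis
  thus ?thesis using M(3) by simp
 qed
 have "(NINT x. ennreal (norm (cv et u x - u x)))
   <= (NINT x. (NINT y. ennreal (et y * norm (u (x - y) - u x))))" by (rule nn_integral_mono) (rule pw)
 also have "... = (NINT y. (NINT x. ennreal (et y * norm (u (x - y) - u x))))" by (rule lborel_pair.Fubini') measurable
 also have "... <= (NINT y. ennreal (et y) * ennreal e)"
 proof (rule nn_integral_mono)
  fix y
  have "(NINT x. ennreal (et y * norm (u (x - y) - u x))) = ennreal (et y) * (NINT x. ennreal (norm (u (x - y) - u x)))"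
   using M(3) by (simp add: ennreal_mult nn_integral_cmult)
  also have "... <= ennreal (et y) * ennreal e" using b[of "- y"] M(2)[of y] u mpres_integrable[OF mpres_plus, of u "- y"]
   by (cases "norm y <= d") (auto intro!: mult_left_mono ennreal_leI simp: nn_integral_eq_integral)
  finally show "(NINT x. ennreal (et y * norm (u (x - y) - u x))) <= ennreal (et y) * ennreal e" .
 qed
 also have "... = (NINT y. ennreal (et y)) * ennreal e" by (rule nn_integral_multc) measurable
 also have "(NINT y. ennreal (et y)) = 1" using nn_integral_eq_integral[OF M(5)] M(3,4) by simp
 finally show ?thesis by simp
qed

lemma cv_L1_tendsto:
 assumes m: "!!n. mollifier (d n) (et n) (D n)" and d: "d \<longlonglongrightarrow> 0" and u: "lint u"
 shows "(%n. (NINT x. ennreal (norm (cv (et n) u x - u x)))) \<longlonglongrightarrow> 0"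
proof (rule order_tendstoI)
 fix a :: ennreal assume a: "0 < a"
 then obtain e where e: "e > (0::real)" "ennreal e < a"
  by (metis ennreal_less_zero_iff dense ennreal_cases less_top_ennreal order_less_imp_not_less top.not_eq_extremum)
 obtain d0 where d0: "d0 > 0" "!!h. norm h < d0 ==> (LBINT x. norm (u (x + h) - u x)) <= e" using translation_L1[OF u e(1)] by blast
 have "eventually (%n. d n < d0) sequentially" using order_tendstoD(2)[OF d d0(1)] .
 thus "eventually (%n. (NINT x. ennreal (norm (cv (et n) u x - u x))) < a) sequentially"
 proof eventually_elim
  case (elim n)
  have "(NINT x. ennreal (norm (cv (et n) u x - u x))) <= ennreal e" by (rule cv_L1_diff[OF m u]) (use d0(2) elim in auto)
  thus ?case using e(2) by (rule order_le_less_trans)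
 qed
qed auto


lemma cv_integrable:
 assumes m: "mollifier d et D" and u: "lint u" shows "lint (cv et u)"
proof -
 note M = mollifierD[OF m]
 note [measurable] = M(6) Bm_int[OF u]
 have [measurable]: "cv et u \<in> Bm" by (rule cv_borel) measurable
 have "(NINT x. ennreal (norm (cv et u x))) <= (NINT x. (NINT z. ennreal (norm (et (x - z) *r u z))))"
  unfolding cv_def by (intro nn_integral_mono integral_norm_bound_ennreal cv_integrable_integrand[OF M(1) u])
 also have "... = (NINT z. (NINT x. ennreal (norm (et (x - z) *r u z))))" by (rule lborel_pair.Fubini') measurable
 also have "... = (NINT z. ennreal (norm (u z)))"
 proof (rule nn_integral_cong)
  fix z
  have "(NINT x. ennreal (norm (et (x - z) *r u z))) = (NINT x. ennreal (et (x + - z)) * ennreal (norm (u z)))" using M(3) by (simp add: ennreal_mult)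
  also have "... = (NINT x. ennreal (et (x + - z))) * ennreal (norm (u z))" by (rule nn_integral_multc) measurable
  also have "(NINT x. ennreal (et (x + - z))) = (NINT x. ennreal (et x))"
   by (rule mpres_nn_integral[OF mpres_plus, of "%x. ennreal (et x)"]) measurable
  also have "... = 1" using nn_integral_eq_integral[OF M(5)] M(3,4) by simp
  finally show "(NINT x. ennreal (norm (et (x - z) *r u z))) = ennreal (norm (u z))" by simp
 qed
 also have "... < \<infinity>" using u unfolding integrable_iff_bounded by simp
 finally show ?thesis unfolding integrable_iff_bounded by simp
qed

lemma cv_AE_subseq:
 assumes m: "!!n. mollifier (d n) (et n) (D n)" and d: "d \<longlonglongrightarrow> 0" and u: "lint u"
 shows "\<exists>r::nat=>nat. strict_mono r & (AE x in lborel. (%n. cv (et (r n)) u x) \<longlonglongrightarrow> u x)"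
proof -
 have i: "lint (%x. cv (et n) u x - u x)" for n using cv_integrable[OF m u] u by simp
 have "(%n. ennreal (LBINT x. norm (cv (et n) u x - u x))) \<longlonglongrightarrow> ennreal 0"
  using cv_L1_tendsto[OF m d u] nn_integral_eq_integral[OF integrable_norm[OF i]] by simp
 hence "(%n. (LBINT x. norm (cv (et n) u x - u x))) \<longlonglongrightarrow> 0" by (subst (asm) tendsto_ennreal_iff) auto
 from tendsto_L1_AE_subseq[OF i this] obtain r where r: "strict_mono (r::nat=>nat)"
  "AE x in lborel. (%n. cv (et (r n)) u x - u x) \<longlonglongrightarrow> 0" by blast
 have "AE x in lborel. (%n. cv (et (r n)) u x) \<longlonglongrightarrow> u x" using r(2) by eventually_elim (rule LIM_zero_cancel)
 thus ?thesis using r(1) by blast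
qed

text \<open>The functions \<open>s \<mapsto> s\<^sup>-\<^sup>k exp (-1/s)\<close> on \<open>s > 0\<close>, extended by zero, are closed under differentiation.\<close>

definition flat :: "nat => real => real" where
 "flat k s = (if s > 0 then exp (- 1 / s) / s ^ k else 0)"

text \<open>A single term of the exponential series of \<open>1 / s\<close> is at most
  \<open>exp (1 / s)\<close>. The free exponent \<open>n\<close> lets \<open>flat k\<close> vanish
  at zero to any desired order.\<close>

lemma flat_bound:
 assumes "s > 0" shows "flat k s <= fact (k + n) * s ^ n"
proof -
 have "(1 / s) ^ (k + n) / fact (k + n) <= exp (1 / s)" using exp_ge_zero assms sum_le_suminf[OF summable_exp[of "1 / s"], of "{k + n}"]
  by (simp add: exp_def divide_inverse mult.commute)
 hence "1 <= exp (1 / s) * (fact (k + n) * s ^ (k + n))" using assms by (simp add: field_simps power_divide)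
 hence "exp (- 1 / s) <= fact (k + n) * s ^ (k + n)" by (simp add: exp_minus field_simps)
 thus ?thesis using assms by (simp add: flat_def field_simps power_add)
qed

lemma flat_deriv: "(flat k has_real_derivative (flat (k + 2) s - real k * flat (k + 1) s)) (at s)"
proof -
 consider "s > 0" | "s < 0" | "s = 0" by linarith
 thus ?thesis
 proof cases
  case 1
  have "((%s. exp (- 1 / s) / s ^ k) has_real_derivative (flat (k + 2) s - real k * flat (k + 1) s)) (at s)"
  proof -
   have "((%s. exp (- 1 / s) / s ^ k) has_real_derivative
    ((exp (- 1 / s) * (1 / s^2)) * s ^ k - exp (- 1 / s) * (real k * s ^ (k - 1))) / (s ^ k * s ^ k)) (at s)"
    using 1 by (auto intro!: derivative_eq_intros simp: power2_eq_square)
   also have "((exp (- 1 / s) * (1 / s^2)) * s ^ k - exp (- 1 / s) * (real k * s ^ (k - 1))) / (s ^ k * s ^ k)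
    = exp (- 1 / s) / s ^ (k + 2) - real k * (exp (- 1 / s) / s ^ (k + 1))" using 1 by (cases k) (simp_all add: diff_divide_distrib power2_eq_square)
   finally show ?thesis using 1 by (simp add: flat_def)
  qed
  thus ?thesis by (rule has_field_derivative_transform_within_open[where S="{0<..}"]) (use 1 in \<open>auto simp: flat_def\<close>)
 next
  case 2
  have "((%s. 0) has_real_derivative (flat (k + 2) s - real k * flat (k + 1) s)) (at s)" using 2 by (auto simp: flat_def)
  thus ?thesis by (rule has_field_derivative_transform_within_open[where S="{..<0}"]) (use 2 in \<open>auto simp: flat_def\<close>)
 next
  case 3
  have "(%h. (flat k (0 + h) - flat k 0) / h) \<midarrow>0\<rightarrow> 0"
  proof (rule Lim_null_comparison)
   show "\<forall>\<^sub>F h in at 0. norm ((flat k (0 + h) - flat k 0) / h) <= fact (k + 2) * \<bar>h\<bar>"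
   proof (rule always_eventually, rule allI)
    fix h :: real
    show "norm ((flat k (0 + h) - flat k 0) / h) <= fact (k + 2) * \<bar>h\<bar>"
    proof (cases "h > 0")
     case True
     have "flat k h >= 0" using True by (simp add: flat_def)
     thus ?thesis using True flat_bound[OF True, of k 2] by (simp add: flat_def[of _ 0] divide_le_eq power2_eq_square mult.assoc)
    next
     case False
     hence "flat k (0 + h) = 0" "flat k 0 = 0" by (auto simp: flat_def)
     thus ?thesis by (simp del: fact_Suc)
    qed
   qed
   show "((%h. fact (k + 2) * \<bar>h\<bar>) \<longlongrightarrow> 0) (at (0::real))" by (auto intro!: tendsto_eq_intros)
  qed
  thus ?thesis using 3 by (simp add: DERIV_def flat_def)
 qed
qed

text \<open>A class of functions closed under every partial derivative. Smoothness of a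
  mollification then needs no formula for higher derivatives: each derivative of the convolution is
  the convolution with another member of the class.\<close>

inductive bump :: "real => (real^3 => real) => bool" for r where
 bump_base: "bump r (%x. flat k (r^2 - x *i x))"
| bump_coord: "bump r f ==> bump r (%x. x $ i * f x)"
| bump_add: "bump r f ==> bump r g ==> bump r (%x. f x + g x)"
| bump_cmult: "bump r f ==> bump r (%x. c * f x)"

lemma bump_support: "bump r f ==> 0 < r ==> norm x > r ==> f x = 0"
proof (induction rule: bump.induct)
 case (bump_base k)
 have "r^2 < (norm x)^2" using bump_base by (intro power_strict_mono) auto
 thus ?case by (simp add: flat_def power2_norm_eq_inner)
qed auto

lemma bump_deriv:
 "bump r f ==> \<exists>D. (\<forall>x. (f has_derivative (%h. D x *i h)) (at x)) & (\<forall>i. bump r (%x. D x $ i))"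
proof (induction rule: bump.induct)
 case (bump_base k)
 let ?d = "%s. flat (k + 2) s - real k * flat (k + 1) s"
 let ?D = "%x. (- 2 * ?d (r^2 - x *i x)) *r x"
 have "((%x. flat k (r^2 - x *i x)) has_derivative (%h. ?D x *i h)) (at x)" for x
 proof -
  have 1: "((%x. r^2 - x *i x) has_derivative (%h. - 2 * (x *i h))) (at x)" by (auto intro!: derivative_eq_intros simp: inner_commute)
  have "(flat k has_derivative (%h. ?d (r^2 - x *i x) * h)) (at (r^2 - x *i x))"
   using flat_deriv[of k "r^2 - x *i x"] by (simp add: has_field_derivative_def)
  from has_derivative_compose[OF 1 this] show ?thesis by (rule has_derivative_eq_rhs) (auto simp: algebra_simps)
 qed
 moreover have "bump r (%x. ?D x $ i)" for i
 proof -
  have "bump r (%x. (-2) * (x $ i * (flat (k + 2) (r^2 - x *i x) + (- real k) * flat (k + 1) (r^2 - x *i x))))" by (intro bump.intros)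
  thus ?thesis by (simp add: algebra_simps)
 qed
 ultimately show ?case by (intro exI[of _ ?D]) blast
next
 case (bump_coord f i)
 then obtain D where D: "!!x. (f has_derivative (%h. D x *i h)) (at x)" "!!i. bump r (%x. D x $ i)" by blast
 let ?D = "%x. f x *r axis i 1 + x $ i *r D x"
 have "((%x. x $ i * f x) has_derivative (%h. ?D x *i h)) (at x)" for x
 proof -
  have "((%x::real^3. x $ i) has_derivative (%h. h $ i)) (at x)" by (intro bounded_linear_imp_has_derivative bounded_linear_vec_nth)
  from has_derivative_mult[OF this D(1)] show ?thesis by (rule has_derivative_eq_rhs) (auto simp: inner_add_left inner_axis' algebra_simps)
 qed
 moreover have "bump r (%x. ?D x $ j)" for j
 proof -
  have "bump r (%x. (if i = j then 1 else 0) * f x + x $ i * D x $ j)" by (intro bump.intros D bump_coord)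
  thus ?thesis by (simp add: axis_def mult.commute eq_commute)
 qed
 ultimately show ?case by (intro exI[of _ ?D]) blast
next
 case (bump_add f g)
 then obtain D E where D: "!!x. (f has_derivative (%h. D x *i h)) (at x)" "!!i. bump r (%x. D x $ i)"
  and E: "!!x. (g has_derivative (%h. E x *i h)) (at x)" "!!i. bump r (%x. E x $ i)" by blast
 have "((%x. f x + g x) has_derivative (%h. (D x + E x) *i h)) (at x)" for x using has_derivative_add[OF D(1) E(1)] by (simp add: inner_add_left)
 moreover have "bump r (%x. (D x + E x) $ j)" for j using bump.bump_add[OF D(2) E(2)] by simp
 ultimately show ?case by (intro exI[of _ "%x. D x + E x"]) blast
next
 case (bump_cmult f c)
 then obtain D where D: "!!x. (f has_derivative (%h. D x *i h)) (at x)" "!!i. bump r (%x. D x $ i)" by blast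
 have "((%x. c * f x) has_derivative (%h. (c *r D x) *i h)) (at x)" for x using has_derivative_mult_right[OF D(1)] by simp
 moreover have "bump r (%x. (c *r D x) $ j)" for j using bump.bump_cmult[OF D(2)] by simp
 ultimately show ?case by (intro exI[of _ "%x. c *r D x"]) blast
qed

lemma bump_C1c:
 assumes "bump r f" "0 < r"
 obtains D where "C1c UNIV f D" "!!i. bump r (%x. D x $ i)"
proof -
 obtain D where D: "!!x. (f has_derivative (%h. D x *i h)) (at x)" "!!i. bump r (%x. D x $ i)" using bump_deriv[OF assms(1)] by blast
 have "continuous_on UNIV (%x. D x $ i)" for i using bump_deriv[OF D(2)[of i]] has_derivative_continuous by (metis continuous_at_imp_continuous_on)
 hence "continuous_on UNIV (%x. \<chi> i. D x $ i)" by (rule continuous_on_vec_lambda)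
 hence "C1 f D" using D(1) by (simp add: C1_def vec_nth_inverse)
 moreover have "f x = 0" if "x \<notin> cball 0 r" for x using bump_support[OF assms, of x] that by simp
 ultimately have "C1c UNIV f D" unfolding C1c_def by (intro conjI exI[of _ "cball 0 r"]) auto
 thus ?thesis using D(2) by (rule that)
qed

lemma C1_partial_deriv: "C1 ph D ==> partial_deriv i ph = (%x. D x $ i)" using frechet_derivative_at[OF C1_deriv, symmetric]
 by (auto simp: partial_deriv_def fun_eq_iff inner_axis)

lemma C1_grad: "C1 ph D ==> grad ph = D" by (auto simp: grad_def C1_partial_deriv fun_eq_iff vec_eq_iff)

lemma bump_cv_partial:
 fixes u :: "real^3 => real"
 assumes "lint u" "0 < r" "bump r f" shows "\<exists>g. bump r g & foldr partial_deriv is (cv f u) = cv g u" using assms(3)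
proof (induction "is")
 case Nil thus ?case by auto
next
 case (Cons i "is")
 then obtain g where g: "bump r g" "foldr partial_deriv is (cv f u) = cv g u" by blast
 obtain D where D: "C1c UNIV g D" "!!i. bump r (%x. D x $ i)" by (rule bump_C1c[OF g(1) assms(2)]) (rule that)
 obtain B where B: "B > 0" "!!x. \<bar>g x\<bar> <= B" "!!x. norm (D x) <= B" by (rule C1c_bounded[OF D(1)]) (rule that)
 note [measurable] = C1_borel_grad[OF C1c_C1[OF D(1)]]
 have iD: "lint (%z. u z *r D (x - z))" for x by (rule int_scaleR_bounded[OF assms(1), where B=B]) (use B in auto)
 have "partial_deriv i (cv g u) x = cv (%x. D x $ i) u x" for x
 proof -
  have "partial_deriv i (cv g u) x = (LBINT z. u z *r D (x - z)) $ i" using C1_partial_deriv[OF C1_cv[OF D(1) assms(1)]] by simp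
  also have "... = (LBINT z. (u z *r D (x - z)) $ i)" by (rule integral_bounded_linear[OF bounded_linear_vec_nth iD, symmetric])
  finally show ?thesis by (simp add: cv_def mult.commute)
 qed
 hence "partial_deriv i (cv g u) = cv (%x. D x $ i) u" by blast
 thus ?case using D(2)[of i] g(2) by auto
qed

lemma bump_mollifier:
 assumes "0 < (r::real)"
 obtains et D where "mollifier r et D" "bump r et"
proof -
 let ?f = "%x::real^3. flat 0 (r^2 - x *i x)"
 have b: "bump r ?f" by (rule bump_base)
 obtain D where D: "C1c UNIV ?f D" by (rule bump_C1c[OF b assms])
 have pos: "?f x >= 0" for x by (simp add: flat_def)
 have "?f 0 ~= 0" using assms by (simp add: flat_def)
 have int: "lint ?f" by (rule C1c_integrable[OF D])
 have "(LBINT x. ?f x) > 0"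
 proof (rule ccontr)
  assume "\<not> ?thesis"
  moreover have "(LBINT x. ?f x) >= 0" using pos by (intro integral_ge0) auto
  ultimately have "(LBINT x. ?f x) = 0" by simp
  hence "AE x in lborel. ?f x = 0" using integral_nonneg_eq_0_iff_AE[OF int] pos by simp
  hence "AE x in lborel. x \<notin> ball (0::real^3) r"
  proof eventually_elim
   case (elim x)
   have "norm x < r ==> x *i x < r^2" by (metis norm_ge_zero power2_norm_eq_inner power_strict_mono zero_less_numeral)
   thus ?case using elim by (auto simp: flat_def split: if_splits)
  qed
  hence "emeasure lborel (ball (0::real^3) r) = 0" by (subst (asm) AE_iff_measurable[OF _ refl]) (auto simp: space_lborel ball_def)
  thus False using assms content_ball_pos[of r "0::real^3"] by (simp add: measure_def)
 qed
 hence c: "(LBINT x. ?f x) > 0" .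
 let ?c = "1 / (LBINT x. ?f x)"
 have "mollifier r (%x. ?c * ?f x) (%x. ?c *r D x)" unfolding mollifier_def
  using C1c_cmult[OF D, of ?c] bump_support[OF b assms] pos c by (auto intro!: divide_nonneg_pos)
 thus ?thesis by (rule that) (rule bump_cmult[OF b])
qed

text \<open>Mollification with a kernel of the \<open>bump\<close> class gives smooth functions,
  uniformly close together with the gradients; the radius is chosen so that the support stays inside
  \<open>U\<close>. This connects the smooth test functions of the weak formulations with the class
  \<open>C1c\<close>.\<close>

lemma C1c_approx_test:
 assumes "open U" "C1c U ph D" "e > 0"
 shows "\<exists>psi. test_function U psi & (\<forall>x. \<bar>psi x - ph x\<bar> <= e) & (\<forall>x. norm (grad psi x - D x) <= e)
  & continuous_on UNIV psi & continuous_on UNIV (grad psi)"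
proof -
 obtain K where K: "compact K" "K \<subseteq> U" "!!x. x \<notin> K ==> ph x = 0" "!!x. x \<notin> K ==> D x = 0"
  by (rule C1cE[OF assms(2)]) (rule that)
 note C = C1c_C1[OF assms(2)]
 obtain r0 where r0: "r0 > 0" "!!x y. x \<in> K ==> dist x y <= r0 ==> y \<in> U"
 proof -
  obtain r0 where "r0 > 0" "(\<Union>x\<in>K. cball x r0) \<subseteq> U"
   using compact_subset_open_imp_cball_epsilon_subset[OF K(1) assms(1) K(2)] by metis
  thus ?thesis by (intro that[of r0]) (auto dest!: subsetD[of _ U])
 qed
 have "uniformly_continuous_on UNIV D" by (rule uniformly_continuous_compact_support[OF C1_continuous_grad[OF C] K(1,4)])
 moreover have "uniformly_continuous_on UNIV ph" by (rule uniformly_continuous_compact_support[OF C1_continuous[OF C] K(1,3)])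
 ultimately obtain d1 d2 where d1: "d1 > 0" "!!x y. dist y x < d1 ==> dist (D y) (D x) < e"
  and d2: "d2 > 0" "!!x y. dist y x < d2 ==> dist (ph y) (ph x) < e" using assms(3) unfolding uniformly_continuous_on_def by (metis UNIV_I)
 define r where "r = min r0 (min (d1 / 2) (d2 / 2))"
 have r: "r > 0" "r <= r0" "r < d1" "r < d2" using r0 d1(1) d2(1) by (auto simp: r_def)
 obtain et E where m: "mollifier r et E" "bump r et" by (rule bump_mollifier[OF r(1)])
 note M = mollifierD[OF m(1)]
 have iphi: "lint ph" "lint D" using C1c_integrable[OF assms(2)] by auto
 let ?psi = "cv et ph"
 have C1: "C1 ?psi (%x. (LBINT z. ph z *r E (x - z)))" by (rule C1_cv[OF M(1) iphi(1)])
 have wg: "wgrad UNIV ph D" by (rule wgradI[OF iphi C1_ibp[OF C]])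
 have eq: "(LBINT z. ph z *r E (x - z)) = cv et D x" for x by (rule wgrad_cv[OF wg M(1,2)]) auto
 have gr: "grad ?psi = cv et D" using C1_grad[OF C1] eq by auto
 note bm = C1_borel[OF C] C1_borel_grad[OF C]
 have int2: "lint (%y. et y *r ph (x - y))" "lint (%y. et y *r D (x - y))" for x
  using mpres_integrable[OF mpres_reflect[of x], of "%z. et (x - z) *r ph z"] cv_integrable_integrand[OF M(1) iphi(1), of x]
   mpres_integrable[OF mpres_reflect[of x], of "%z. et (x - z) *r D z"] cv_integrable_integrand[OF M(1) iphi(2), of x] bm M(6) by simp_all
 have 1: "\<bar>?psi x - ph x\<bar> <= e" for x using cv_diff_bound[OF m(1) bm(1) int2(1), of x "ph x" e] d2(2)[of "x - y" x for y] r(4)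
  by (fastforce simp: dist_norm intro: less_imp_le)
 have 2: "norm (grad ?psi x - D x) <= e" for x unfolding gr using cv_diff_bound[OF m(1) bm(2) int2(2), of x "D x" e] d1(2)[of "x - y" x for y] r(3)
  by (fastforce simp: dist_norm intro: less_imp_le)
 obtain L where L: "compact L" "!!x y. x \<in> K ==> norm y <= r ==> x + y \<in> L" and LU: "L \<subseteq> U"
 proof -
  have "compact {x + y | x y. x \<in> K & y \<in> cball 0 r}" by (intro compact_sums K(1) compact_cball)
  moreover have "{x + y | x y. x \<in> K & y \<in> cball 0 r} \<subseteq> U" using r0(2) r(2) by (auto simp: dist_norm)
  ultimately show ?thesis using that[of "{x + y | x y. x \<in> K & y \<in> cball 0 r}"] by auto
 qed
 have "?psi x = 0" if "x \<notin> L" for x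
 proof (rule cv_support[OF K(3) M(2)])
  fix z assume "z \<in> K"
  thus "r < norm (x - z)" using L(2)[of z "x - z"] that by (auto simp: not_le[symmetric])
 qed
 hence "{x. ?psi x ~= 0} \<subseteq> L" by blast
 hence cl: "closure {x. ?psi x ~= 0} \<subseteq> L" using L(1) by (simp add: closure_minimal compact_imp_closed)
 have "compact (closure {x. ?psi x ~= 0})" using compact_Int_closed[OF L(1) closed_closure, of "{x. ?psi x ~= 0}"] cl by (simp add: Int_absorb1)
 moreover have "foldr partial_deriv is ?psi differentiable (at x)" for "is" x
 proof -
  obtain g where g: "bump r g" "foldr partial_deriv is ?psi = cv g ph" using bump_cv_partial[OF iphi(1) r(1) m(2)] by blast
  obtain D' where "C1c UNIV g D'" by (rule bump_C1c[OF g(1) r(1)])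
  from C1_deriv[OF C1_cv[OF this iphi(1)]] show ?thesis unfolding g(2) differentiable_def by blast
 qed
 ultimately have "test_function U ?psi" unfolding test_function_def using cl LU by blast
 moreover have "continuous_on UNIV (grad ?psi)" using C1 C1_grad[OF C1] by (simp add: C1_def)
 ultimately show ?thesis using 1 2 C1_continuous[OF C1] by blast
qed

section \<open>Weak divergences, and passage from smooth to C1 test functions\<close>

definition wdiv :: "(real^3) set => (real^3 => real^3) => (real^3 => real) => bool" where
 "wdiv U F f \<longleftrightarrow> lint F & lint f &
  (\<forall>ph D. C1c U ph D --> (LBINT x. F x *i D x) = - (LBINT x. f x * ph x))"

lemma wdivD:
 assumes "wdiv U F f" "C1c U ph D" shows "(LBINT x. F x *i D x) = - (LBINT x. f x * ph x)"
proof -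
 have "\<forall>ph D. C1c U ph D --> (LBINT x. F x *i D x) = - (LBINT x. f x * ph x)" using assms(1) unfolding wdiv_def by (elim conjE)
 from this[rule_format, OF assms(2)] show ?thesis .
qed

lemma wdiv_integrable:
 assumes "wdiv U F f" shows "lint F" "lint f"
proof -
 show "lint F" using assms unfolding wdiv_def by (elim conjE)
 show "lint f" using assms unfolding wdiv_def by (elim conjE)
qed

lemma int_inner_bounded:
 fixes F :: "'a => 'b::euclidean_space"
 assumes "integrable M F" "D \<in> borel_measurable M" "!!x. norm (D x) <= B" shows "integrable M (%x. F x *i D x)"
proof (rule int_bound[where f="%x. B * norm (F x)"])
 show "AE x in M. norm (F x *i D x) <= norm (B * norm (F x))"
 proof (rule AE_I2)
  fix x
  have "norm (F x *i D x) <= norm (F x) * norm (D x)" using Cauchy_Schwarz_ineq2[of "F x" "D x"] by simp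
  also have "... <= norm (F x) * \<bar>B\<bar>" using assms(3)[of x] by (intro mult_left_mono) auto
  finally show "norm (F x *i D x) <= norm (B * norm (F x))" by (simp add: abs_mult mult.commute)
 qed
qed (use assms(1,2) Bm_int[OF assms(1)] in auto)

lemma le_all_eps:
 fixes a c :: real
 assumes "!!e. e > 0 ==> a <= e * c" shows "a <= 0"
proof (rule ccontr)
 assume "\<not> a <= 0"
 have "a <= (a / (2 * (\<bar>c\<bar> + 1))) * c" using \<open>\<not> a <= 0\<close> by (intro assms) auto
 also have "... <= (a / (2 * (\<bar>c\<bar> + 1))) * (\<bar>c\<bar> + 1)" using \<open>\<not> a <= 0\<close> by (intro mult_left_mono) auto
 also have "... = a / 2" by (simp add: divide_simps)
 finally show False using \<open>\<not> a <= 0\<close> by simp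
qed

lemma test_function_C1c:
 assumes "test_function Om psi" shows "C1c Om psi (grad psi)"
proof -
 have d: "psi differentiable (at x)" "partial_deriv i psi differentiable (at x)" for x i
  using assms[unfolded test_function_def] spec[of "%is. \<forall>x. foldr partial_deriv is psi differentiable (at x)" "[]"]
   spec[of "%is. \<forall>x. foldr partial_deriv is psi differentiable (at x)" "[i]"] by simp_all
 have "(psi has_derivative (%h. grad psi x *i h)) (at x)" for x
 proof -
  let ?f = "frechet_derivative psi (at x)"
  have f: "(psi has_derivative ?f) (at x)" using d(1) by (simp add: frechet_derivative_works)
  have "?f h = grad psi x *i h" for h
  proof -
   have "h = (\<Sum>i\<in>UNIV. h $ i *r axis i 1)" by (simp add: basis_expansion[symmetric] scalar_mult_eq_scaleR[symmetric])
   hence "?f h = ?f (\<Sum>i\<in>UNIV. h $ i *r axis i 1)" by simp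
   also have "... = (\<Sum>i\<in>UNIV. h $ i * ?f (axis i 1))" using has_derivative_linear[OF f] by (simp add: linear_sum linear_scale)
   also have "... = grad psi x *i h" by (simp add: grad_def partial_deriv_def inner_vec_def mult.commute)
   finally show ?thesis .
  qed
  hence "?f = (%h. grad psi x *i h)" by (rule ext)
  thus ?thesis using f by simp
 qed
 moreover have "continuous_on UNIV (grad psi)" unfolding grad_def[abs_def]
  by (intro continuous_on_vec_lambda continuous_at_imp_continuous_on ballI differentiable_imp_continuous_within d(2))
 moreover have "compact (closure {x. psi x ~= 0})" "closure {x. psi x ~= 0} \<subseteq> Om" using assms unfolding test_function_def by blast+
 moreover have "x \<notin> closure {x. psi x ~= 0} ==> psi x = 0" for x using closure_subset[of "{x. psi x ~= 0}"] by blast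
 ultimately show ?thesis unfolding C1c_def C1_def by blast
qed

lemma integral_nth:
 fixes f :: "'a => real^3"
 assumes "integrable M f" shows "(\<integral>x. f x \<partial>M) $ i = (\<integral>x. f x $ i \<partial>M)" "integrable M (%x. f x $ i)"
 using integral_bounded_linear[OF bounded_linear_vec_nth assms, of i] integrable_bounded_linear[OF bounded_linear_vec_nth assms, of i] by simp_all

lemma wdiv_of_test:
 assumes U: "open U" and i: "lint F" "lint f" and t: "!!psi. test_function U psi ==> (LBINT x. F x *i grad psi x) = - (LBINT x. f x * psi x)"
 shows "wdiv U F f" unfolding wdiv_def
proof (intro conjI allI impI i)
 have iC: "lint (%x. F x *i E x)" "lint (%x. f x * psi x)" if a: "C1c U psi E" for psi E
 proof -
  obtain B where B: "B > 0" "!!x. \<bar>psi x\<bar> <= B" "!!x. norm (E x) <= B" by (rule C1c_bounded[OF a]) (rule that)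
  show "lint (%x. F x *i E x)" "lint (%x. f x * psi x)"
   using int_inner_bounded[OF i(1) _ B(3)] C1_borel_grad[OF C1c_C1[OF a]] C1c_int_scaleR(2)[OF a i(2)] by (auto simp: mult.commute)
 qed
 fix ph D assume a: "C1c U ph D"
 have "norm (LBINT x. F x *i D x + f x * ph x) <= e * (LBINT x. norm (F x) + \<bar>f x\<bar>)" if e: "e > 0" for e
 proof -
  obtain psi where p: "test_function U psi" "!!x. \<bar>psi x - ph x\<bar> <= e" "!!x. norm (grad psi x - D x) <= e"
   using C1c_approx_test[OF U a e] by auto
  note iC' = iC[OF test_function_C1c[OF p(1)]] iC[OF a]
  have "norm ((LBINT x. F x *i D x + f x * ph x) - (LBINT x. F x *i grad psi x + f x * psi x)) <= (LBINT x. e * (norm (F x) + \<bar>f x\<bar>))"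
  proof (rule integral_norm_diff_le)
   fix x
   have "F x *i D x + f x * ph x - (F x *i grad psi x + f x * psi x) = F x *i (D x - grad psi x) + f x * (ph x - psi x)" by (simp add: algebra_simps)
   also have "norm ... <= norm (F x) * norm (D x - grad psi x) + \<bar>f x\<bar> * \<bar>ph x - psi x\<bar>"
    using Cauchy_Schwarz_ineq2[of "F x" "D x - grad psi x"] by (intro norm_triangle_le) (simp add: abs_mult)
   also have "... <= norm (F x) * e + \<bar>f x\<bar> * e"
    using p(2,3)[of x] by (intro add_mono mult_mono) (auto simp: norm_minus_commute abs_minus_commute)
   finally show "norm (F x *i D x + f x * ph x - (F x *i grad psi x + f x * psi x)) <= e * (norm (F x) + \<bar>f x\<bar>)"
    by (simp add: algebra_simps)
  qed (use i iC' in auto)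
  thus ?thesis using t[OF p(1)] iC' by simp
 qed
 from le_all_eps[OF this] show "(LBINT x. F x *i D x) = - (LBINT x. f x * ph x)" using iC[OF a] by simp
qed

text \<open>The weak \<open>j\<close>-th derivative of \<open>u\<close> is the weak divergence of
  \<open>u\<close> times the \<open>j\<close>-th coordinate vector, which reduces the claim to
  \<open>wdiv_of_test\<close>.\<close>

lemma wgrad_of_test:
 assumes U: "open U" and i: "lint u" "lint G" and t: "!!psi. test_function U psi ==> (LBINT x. u x *r grad psi x) = - (LBINT x. psi x *r G x)"
 shows "wgrad U u G"
proof (rule wgradI[OF i], subst vec_eq_iff, rule allI)
 fix ph D j assume a: "C1c U ph D"
 note iC = C1c_int_scaleR(1)[OF _ i(1)] C1c_int_scaleR(2)[OF _ i(2)]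
 have "wdiv U (%x. u x *r axis j 1) (%x. G x $ j)"
 proof (rule wdiv_of_test[OF U])
  fix psi assume p: "test_function U psi"
  have "(LBINT x. u x *r grad psi x) $ j = - (LBINT x. psi x *r G x) $ j" unfolding t[OF p] by simp
  thus "(LBINT x. (u x *r axis j 1) *i grad psi x) = - (LBINT x. G x $ j * psi x)"
   using iC[OF test_function_C1c[OF p]] by (simp add: integral_nth(1) inner_axis' mult.commute)
 qed (use i in \<open>auto intro: integral_nth\<close>)
 note d = wdivD[OF this a]
 have "(LBINT x. u x *r D x + ph x *r G x) $ j = (LBINT x. u x * D x $ j) + (LBINT x. ph x * G x $ j)" using iC[OF a] by (simp add: integral_nth(1))
 thus "(LBINT x. u x *r D x + ph x *r G x) $ j = 0 $ j" using d by (simp add: inner_axis' mult.commute)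
qed

section \<open>Cut-offs and Jacobians\<close>

lemma pos_part_power_deriv:
 "((%s::real. (max 0 s) ^ Suc (Suc n)) has_real_derivative (real (Suc (Suc n)) * (max 0 s) ^ Suc n)) (at s)"
proof -
 consider "s > 0" | "s < 0" | "s = 0" by linarith
 thus ?thesis
 proof cases
  case 1
  have "((%s::real. s ^ Suc (Suc n)) has_real_derivative (real (Suc (Suc n)) * (max 0 s) ^ Suc n)) (at s)"
   using DERIV_pow[of "Suc (Suc n)" s] 1 by (simp del: power_Suc of_nat_Suc)
  thus ?thesis by (rule has_field_derivative_transform_within_open[where S="{0<..}"]) (use 1 in auto)
 next
  case 2
  have "((%s::real. 0) has_real_derivative (real (Suc (Suc n)) * (max 0 s) ^ Suc n)) (at s)" using 2 by auto
  thus ?thesis by (rule has_field_derivative_transform_within_open[where S="{..<0}"]) (use 2 in auto)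
 next
  case 3
  have "(%h::real. ((max 0 (0 + h)) ^ Suc (Suc n) - (max 0 0) ^ Suc (Suc n)) / h) \<midarrow>0\<rightarrow> 0"
  proof (rule Lim_null_comparison)
   show "\<forall>\<^sub>F h in at (0::real). norm (((max 0 (0 + h)) ^ Suc (Suc n) - (max 0 0) ^ Suc (Suc n)) / h) <= \<bar>h\<bar> ^ Suc n"
    by (rule always_eventually) (auto simp: max_def abs_mult intro!: mult_nonpos_nonneg)
   show "((%h::real. \<bar>h\<bar> ^ Suc n) \<longlongrightarrow> 0) (at 0)" by (auto intro!: tendsto_eq_intros)
  qed
  thus ?thesis using 3 by (simp add: DERIV_def)
 qed
qed

lemma pos_part_square_deriv: "((%s::real. (max 0 s)^2) has_real_derivative 2 * max 0 s) (at s)"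
 unfolding power2_eq_square using pos_part_power_deriv[of 0 s] by simp

text \<open>With \<open>a\<close> and \<open>b\<close> the positive parts of \<open>s - 1\<close>
  and \<open>2 - s\<close>, the quotient of \<open>a^2\<close> by \<open>a^2 + b^2\<close> is C1
  because the denominator never vanishes. The numerator of its derivative is
  \<open>2 * a * b * (a + b)\<close>, so the cut-off is increasing; this sign is used where the
  derivative serves as a weight near the boundary.\<close>

lemma cutoff_exists:
 obtains X X' :: "real => real" and B where
  "!!s. (X has_real_derivative X' s) (at s)" "continuous_on UNIV X'"
  "!!s. 0 <= X s" "!!s. X s <= 1" "!!s. s <= 1 ==> X s = 0" "!!s. s >= 2 ==> X s = 1"
  "!!s. s <= 1 \<or> s >= 2 ==> X' s = 0" "!!s. \<bar>X' s\<bar> <= B" "B > 0" "!!s. 0 <= X' s"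
proof -
 define a where "a = (%s::real. max 0 (s - 1))"
 define b where "b = (%s::real. max 0 (2 - s))"
 define X where "X = (%s. (a s)^2 / ((a s)^2 + (b s)^2))"
 define X' where "X' = (%s. (2 * a s * ((a s)^2 + (b s)^2) - (a s)^2 * (2 * a s - 2 * b s)) / ((a s)^2 + (b s)^2)^2)"
 have pos: "(a s)^2 + (b s)^2 > 0" for s by (cases "s > 1") (auto simp: a_def b_def intro: add_pos_nonneg add_nonneg_pos)
 have da: "((%s. (a s)^2) has_real_derivative 2 * a s) (at s)" for s
 proof -
  have g: "((%s. s - 1) has_real_derivative 1) (at s)" by (auto intro!: derivative_eq_intros)
  have "((%s. (max 0 (s - 1))^2) has_real_derivative 2 * max 0 (s - 1) * 1) (at s)"
   by (rule DERIV_chain2[where f="%s. (max 0 s)^2" and g="%s. s - 1", OF pos_part_square_deriv g])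
  thus ?thesis by (simp add: a_def)
 qed
 have db: "((%s. (b s)^2) has_real_derivative - 2 * b s) (at s)" for s
 proof -
  have g: "((%s. 2 - s) has_real_derivative - 1) (at s)" by (auto intro!: derivative_eq_intros)
  have "((%s. (max 0 (2 - s))^2) has_real_derivative 2 * max 0 (2 - s) * (- 1)) (at s)"
   by (rule DERIV_chain2[where f="%s. (max 0 s)^2" and g="%s. 2 - s", OF pos_part_square_deriv g])
  thus ?thesis by (simp add: b_def)
 qed
 have der: "(X has_real_derivative X' s) (at s)" for s unfolding X_def by (rule DERIV_cong[OF DERIV_divide[OF da DERIV_add[OF da db]]])
   (use pos[of s] in \<open>auto simp: X'_def power2_eq_square[of "(a s)^2 + (b s)^2"]\<close>)
 have cab: "continuous_on UNIV a" "continuous_on UNIV b" unfolding a_def b_def by (intro continuous_intros)+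
 have cX': "continuous_on UNIV X'" unfolding X'_def by (intro continuous_intros cab ballI) (rule power_not_zero, rule less_imp_neq[OF pos, symmetric])
 have X0: "X s = 0" if "s <= 1" for s using that by (simp add: X_def a_def)
 have X1: "X s = 1" if "s >= 2" for s using that pos[of s] by (simp add: X_def b_def)
 have X'0: "X' s = 0" if "s <= 1 \<or> s >= 2" for s using that by (auto simp: X'_def a_def b_def power2_eq_square)
 obtain B where B: "B > 0" "!!s. norm (X' s) <= B"
 proof (rule bounded_range_compact_support[OF cX', of "{1..2}"])
  show "X' s = 0" if "s \<notin> {1..2}" for s using X'0[of s] that by auto
 qed (auto intro: that)
 show ?thesis
 proof (rule that[of X X' B])
  show "0 <= X s" for s using pos[of s] by (simp add: X_def)
  show "X s <= 1" for s using pos[of s] by (simp add: X_def divide_le_eq)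
  have "2 * a s * ((a s)^2 + (b s)^2) - (a s)^2 * (2 * a s - 2 * b s) = 2 * (a s * b s * (a s + b s))" for s
   by (simp add: power2_eq_square algebra_simps)
  moreover have "0 <= a s" "0 <= b s" for s by (simp_all add: a_def b_def)
  ultimately show "0 <= X' s" for s by (simp add: X'_def)
 qed (use der cX' X0 X1 X'0 B in auto)
qed

text \<open>It is enough to measure boxes. The preimage of a box under \<open>T\<close> is its image
  under the inverse \<open>S\<close>, and the change of variables formula applies with Jacobian of
  modulus one.\<close>

lemma mpres_of_det:
 fixes T S :: "real^3 => real^3"
 assumes "continuous_on UNIV T" "!!x. S (T x) = x" "!!x. T (S x) = x"
  "!!x. (S has_derivative S' x) (at x)" "!!x. \<bar>det (matrix (S' x))\<bar> = 1" shows "mpres T"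
proof -
 have T[measurable]: "T \<in> Bm" using assms(1) by (rule borel_measurable_continuous_onI)
 have "lborel = distr lborel borel T"
 proof (rule lborel_eqI)
  fix l u :: "real^3" assume lu: "!!b. b \<in> Basis ==> l *i b <= u *i b"
  have eq: "T -` box l u = S ` box l u" using assms(2,3) by (auto simp: image_iff) metis
  have "((%x. 1) has_integral measure lborel (box l u)) (box l u)"
   using has_integral_measure_lborel[of "box l u"] emeasure_lborel_box_finite[of l u] by simp
  hence "((%x. \<bar>det (matrix (S' x))\<bar>) has_integral measure lborel (box l u)) (box l u)" using assms(5) by simp
  moreover have "inj_on S (box l u)" using assms(3) by (metis inj_onI)
  ultimately have "S ` box l u \<in> lmeasurable & measure lebesgue (S ` box l u) = measure lborel (box l u)"
   using has_measure_differentiable_image[of "box l u" S S' "measure lborel (box l u)"] assms(4) by (auto intro: has_derivative_at_withinI)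
  hence "emeasure lebesgue (T -` box l u) = ennreal (measure lborel (box l u))"
   unfolding eq by (metis emeasure_eq_measure2 fmeasurable_def mem_Collect_eq emeasure_eq_ennreal_measure less_top order_less_irrefl)
  moreover have Tb: "T -` box l u \<in> sets borel" using measurable_sets[OF T, of "box l u"] by simp
  ultimately show "emeasure (distr lborel borel T) (box l u) = (\<Prod>b\<in>Basis. (u - l) *i b)"
   using lu by (simp add: emeasure_distr emeasure_lborel_box_eq measure_lborel_box_eq prod_ennreal[symmetric] inner_diff_left)
 qed simp
 thus ?thesis using T by (simp add: mpres_def)
qed

lemma det_rank1:
 fixes g e :: "real^3" shows "det (matrix (%h. h + (g *i h) *r e)) = 1 + g *i e"
 by (simp add: det_3 matrix_def inner_axis axis_def inner_vec_def sum_3) algebra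

section \<open>Reflections\<close>

text \<open>\<open>A x\<close> is the adjoint of the derivative \<open>T' x\<close>.\<close>

definition cmap :: "(real^3 => real^3) => (real^3 => real^3 => real^3) => (real^3 => real^3 => real^3) => real => bool" where
 "cmap T T' A L \<longleftrightarrow> mpres T & (\<forall>x. (T has_derivative T' x) (at x)) & (\<forall>x h k. T' x h *i k = h *i A x k) &
  continuous_on UNIV (%p. A (fst p) (snd p)) & (\<forall>x k. norm (A x k) <= L * norm k) & 0 <= L"

lemma cmap_linear:
 assumes "cmap T T' A L" shows "A x (k + l) = A x k + A x l" "A x (c *r k) = c *r A x k" "A x (k - l) = A x k - A x l"
proof -
 have b: "A x k *i h = T' x h *i k" for h k using assms by (simp add: cmap_def inner_commute)
 show "A x (k + l) = A x k + A x l" "A x (c *r k) = c *r A x k" "A x (k - l) = A x k - A x l"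
  by (subst vector_eq_rdot[symmetric], simp add: b inner_add_left inner_add_right inner_diff_left inner_diff_right)+
qed

lemma cmap_continuous: "cmap T T' A L ==> continuous_on S T" by (meson cmap_def continuous_at_imp_continuous_on has_derivative_continuous)

lemma cmap_borel:
 assumes "cmap T T' A L" "G \<in> Bm" shows "(%x. A x (G x)) \<in> Bm"
proof -
 note [measurable] = assms(2)
 have "(%p. A (fst p) (snd p)) \<in> Bm" using assms(1) by (auto simp: cmap_def intro: borel_measurable_continuous_onI)
 hence m1: "(%p. A (fst p) (snd p)) \<in> borel_measurable (borel \<Otimes>\<^sub>M borel)" by (simp add: borel_prod)
 have m2: "(%x. (x, G x)) \<in> borel \<rightarrow>\<^sub>M (borel \<Otimes>\<^sub>M borel)" by measurable
 from measurable_compose[OF m2 m1] show ?thesis by simp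
qed

lemma cmap_C1:
 assumes "cmap T T' A L" "C1 ph D" shows "C1 (%x. ph (T x)) (%x. A x (D (T x)))" unfolding C1_def
proof (intro conjI allI)
 fix x
 have "(T has_derivative T' x) (at x)" and a: "!!h k. T' x h *i k = h *i A x k" using assms(1) by (auto simp: cmap_def)
 from has_derivative_compose[OF this(1) C1_deriv[OF assms(2)]]
 show "((%x. ph (T x)) has_derivative (*i) (A x (D (T x)))) (at x)" by (rule has_derivative_eq_rhs) (auto simp: a[symmetric] inner_commute)
 have c: "continuous_on UNIV (%p. A (fst p) (snd p))" using assms(1) by (simp add: cmap_def)
 have "continuous_on UNIV (%x. D (T x))"
  by (rule continuous_on_compose2[OF C1_continuous_grad[OF assms(2), of UNIV] cmap_continuous[OF assms(1)]]) auto
 hence "continuous_on UNIV (%x. (x, D (T x)))" by (intro continuous_intros)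
 from continuous_on_compose2[OF c this] show "continuous_on UNIV (%x. A x (D (T x)))" by simp
qed

lemma cmap_C1c:
 assumes "cmap T T' A L" "C1c U ph D" "continuous_on UNIV S" "!!x. S (T x) = x" "S ` U \<subseteq> V" shows "C1c V (%x. ph (T x)) (%x. A x (D (T x)))"
proof -
 obtain K where K: "compact K" "K \<subseteq> U" "!!x. x \<notin> K ==> ph x = 0" "!!x. x \<notin> K ==> D x = 0"
  by (rule C1cE[OF assms(2)]) (rule that)
 have "compact (S ` K)" using K(1) assms(3) by (meson compact_continuous_image continuous_on_subset subset_UNIV)
 moreover have "S ` K \<subseteq> V" using K(2) assms(5) by blast
 moreover have "ph (T x) = 0" if "x \<notin> S ` K" for x using that K(3)[of "T x"] assms(4)[of x] by (metis image_eqI)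
 ultimately show ?thesis unfolding C1c_def by (intro conjI cmap_C1[OF assms(1) C1c_C1[OF assms(2)]] exI[of _ "S ` K"]) auto
qed

lemma cmap_integrable:
 assumes "cmap T T' A L" "lint G" shows "lint (%x. A x (G (T x)))"
proof (rule int_bound[where f="%x. L * norm (G (T x))"])
 have mp: "mpres T" using assms(1) by (simp add: cmap_def)
 note [measurable] = Bm_int[OF assms(2)] mpres_borel[OF mp]
 show "lint (%x. L * norm (G (T x)))" using assms(2) mpres_integrable[OF mp, of G] by (intro integrable_mult_right integrable_norm) simp
 show "(%x. A x (G (T x))) \<in> borel_measurable lborel" using cmap_borel[OF assms(1), of "%x. G (T x)"] by simp
 have "norm (A x (G (T x))) <= norm (L * norm (G (T x)))" for x using assms(1) by (auto simp: cmap_def abs_mult)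
 thus "AE x in lborel. norm (A x (G (T x))) <= norm (L * norm (G (T x)))" by simp
qed

lemma mollifier_sequence:
 obtains et :: "nat => real^3 => real" and D where "!!n. mollifier (1 / real (Suc n)) (et n) (D n)"
proof -
 have "\<exists>et D. mollifier (1 / real (Suc n)) et D" for n
 proof -
  have "0 < 1 / real (Suc n)" by simp
  then obtain et D where "mollifier (1 / real (Suc n)) et D" by (rule bump_mollifier)
  thus ?thesis by blast
 qed
 then obtain et where "\<forall>n. \<exists>D. mollifier (1 / real (Suc n)) (et n) D" by metis
 then obtain D where "\<forall>n. mollifier (1 / real (Suc n)) (et n) (D n)" by metis
 thus ?thesis using that by blast
qed

lemma cv_L1_tendsto_real:
 assumes m: "!!n. mollifier (d n) (et n) (D n)" and d: "d \<longlonglongrightarrow> 0" and u: "lint u"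
 shows "(%n. (LBINT x. norm (cv (et n) u x - u x))) \<longlonglongrightarrow> 0"
proof -
 have i: "lint (%x. cv (et n) u x - u x)" for n using cv_integrable[OF m u] u by simp
 have "(%n. ennreal (LBINT x. norm (cv (et n) u x - u x))) \<longlonglongrightarrow> ennreal 0"
  using cv_L1_tendsto[OF m d u] nn_integral_eq_integral[OF integrable_norm[OF i]] by simp
 thus ?thesis by (subst (asm) tendsto_ennreal_iff) auto
qed

text \<open>The chain rule holds for the mollifications of \<open>u\<close>. The errors pass to the
  limit in L1, because composition with a measure-preserving map keeps L1 norms and the adjoint
  derivatives are bounded by \<open>L\<close>.\<close>

lemma wgrad_chain:
 assumes w: "wgrad U u G" and U: "open U" and T: "cmap T T' A L" and S: "continuous_on UNIV S" "!!x. S (T x) = x" "!!x. T (S x) = x"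
 shows "wgrad (T -` U) (%x. u (T x)) (%x. A x (G (T x)))"
proof (rule wgradI)
 have mp: "mpres T" and L: "!!x k. norm (A x k) <= L * norm k" "0 <= L" using T by (auto simp: cmap_def)
 note i = wgrad_integrable[OF w]
 note [measurable] = Bm_int[OF i(1)] Bm_int[OF i(2)] mpres_borel[OF mp]
 show 1: "lint (%x. u (T x))" using i(1) by (subst mpres_integrable[OF mp]) auto
 show 2: "lint (%x. A x (G (T x)))" by (rule cmap_integrable[OF T i(2)])
 fix ph D assume a: "C1c (T -` U) ph D"
 obtain K where K: "compact K" "K \<subseteq> T -` U" "!!x. x \<notin> K ==> ph x = 0" "!!x. x \<notin> K ==> D x = 0"
  by (rule C1cE[OF a]) (rule that)
 obtain B where B: "B > 0" "!!x. \<bar>ph x\<bar> <= B" "!!x. norm (D x) <= B" by (rule C1c_bounded[OF a]) (rule that)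
 have TK: "compact (T ` K)" "T ` K \<subseteq> U" using K(1,2) by (auto intro!: compact_continuous_image cmap_continuous[OF T])
 obtain d0 where d0: "d0 > 0" "!!x. x \<in> K ==> cball (T x) d0 \<subseteq> U"
 proof -
  obtain r0 where "r0 > 0" "(\<Union>x\<in>T ` K. cball x r0) \<subseteq> U"
   using compact_subset_open_imp_cball_epsilon_subset[OF TK(1) U TK(2)] by metis
  thus ?thesis by (intro that[of r0]) blast+
 qed
 obtain et E where m: "!!n. mollifier (1 / real (Suc n)) (et n) (E n)" by (rule mollifier_sequence) (rule that)
 have d: "(%n. 1 / real (Suc n)) \<longlonglongrightarrow> 0" by (rule LIMSEQ_Suc[OF lim_1_over_n])
 let ?I = "LBINT x. u (T x) *r D x + ph x *r A x (G (T x))"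
 let ?a = "%n. (LBINT x. norm (cv (et n) u x - u x))"
 let ?b = "%n. (LBINT x. norm (cv (et n) G x - G x))"
 have "norm ?I <= B * ?a n + (B * L) * ?b n" if n: "1 / real (Suc n) <= d0" for n
 proof -
  note M = mollifierD[OF m[of n]]
  let ?Du = "%x. (LBINT z. u z *r E n (x - z))"
  have C1u: "C1 (cv (et n) u) ?Du" by (rule C1_cv[OF M(1) i(1)])
  have z: "(LBINT x. cv (et n) u (T x) *r D x + ph x *r A x (?Du (T x))) = 0" by (rule C1_ibp[OF cmap_C1[OF T C1u] a])
  \<comment> \<open>On the support of \<open>ph\<close> the mollifier's ball around
    \<open>T x\<close> lies in \<open>U\<close>, so the gradient of the mollification is the
    mollification of \<open>G\<close>; elsewhere the factor \<open>ph x\<close> is zero.\<close>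
  have eq: "ph x *r A x (?Du (T x)) = ph x *r A x (cv (et n) G (T x))" for x
  proof (cases "x \<in> K")
   case True
   have "cball (T x) (1 / real (Suc n)) \<subseteq> U" using d0(2)[OF True] n by force
   thus ?thesis using wgrad_cv[OF w M(1,2)] by simp
  qed (use K(3) in simp)
  note ci = cv_integrable[OF m i(1), of n] cv_integrable[OF m i(2), of n]
  note [measurable] = Bm_int[OF ci(1)] Bm_int[OF ci(2)]
  have ciT: "lint (%x. cv (et n) u (T x))" using ci(1) by (subst mpres_integrable[OF mp]) auto
  have di: "lint (%x. norm (cv (et n) u x - u x))" "lint (%x. norm (cv (et n) G x - G x))" using ci i by (auto intro: integrable_norm)
  have diT: "lint (%x. norm (cv (et n) u (T x) - u (T x)))" "lint (%x. norm (cv (et n) G (T x) - G (T x)))"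
   using di mpres_integrable[OF mp, of "%x. norm (cv (et n) u x - u x)"] mpres_integrable[OF mp, of "%x. norm (cv (et n) G x - G x)"] by auto
  have "norm ?I = norm (?I - (LBINT x. cv (et n) u (T x) *r D x + ph x *r A x (cv (et n) G (T x))))" using z by (simp only: eq diff_zero)
  also have "... <= (LBINT x. B * norm (cv (et n) u (T x) - u (T x)) + (B * L) * norm (cv (et n) G (T x) - G (T x)))"
  proof (rule integral_norm_diff_le)
   show "lint (%x. u (T x) *r D x + ph x *r A x (G (T x)))" by (intro int_add C1c_int_scaleR[OF a] 1 2)
   show "lint (%x. cv (et n) u (T x) *r D x + ph x *r A x (cv (et n) G (T x)))"
    by (intro int_add C1c_int_scaleR[OF a] ciT cmap_integrable[OF T ci(2)])
   show "lint (%x. B * norm (cv (et n) u (T x) - u (T x)) + (B * L) * norm (cv (et n) G (T x) - G (T x)))" using diT by simp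
   fix x
   have "u (T x) *r D x + ph x *r A x (G (T x)) - (cv (et n) u (T x) *r D x + ph x *r A x (cv (et n) G (T x)))
    = (u (T x) - cv (et n) u (T x)) *r D x + ph x *r A x (G (T x) - cv (et n) G (T x))" by (simp add: cmap_linear[OF T] algebra_simps)
   also have "norm ... <= \<bar>u (T x) - cv (et n) u (T x)\<bar> * norm (D x) + \<bar>ph x\<bar> * norm (A x (G (T x) - cv (et n) G (T x)))"
    by (rule norm_triangle_le) simp
   also have "... <= \<bar>u (T x) - cv (et n) u (T x)\<bar> * B + B * (L * norm (G (T x) - cv (et n) G (T x)))"
    using B L by (intro add_mono mult_mono) auto
   finally show "norm (u (T x) *r D x + ph x *r A x (G (T x)) - (cv (et n) u (T x) *r D x + ph x *r A x (cv (et n) G (T x))))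
    <= B * norm (cv (et n) u (T x) - u (T x)) + (B * L) * norm (cv (et n) G (T x) - G (T x))"
    by (simp add: norm_minus_commute abs_minus_commute mult_ac)
  qed
  also have "... = B * (LBINT x. norm (cv (et n) u (T x) - u (T x))) + (B * L) * (LBINT x. norm (cv (et n) G (T x) - G (T x)))" using diT by simp
  also have "(LBINT x. norm (cv (et n) u (T x) - u (T x))) = ?a n" by (rule mpres_integral[OF mp, of "%x. norm (cv (et n) u x - u x)"]) measurable
  also have "(LBINT x. norm (cv (et n) G (T x) - G (T x))) = ?b n" by (rule mpres_integral[OF mp, of "%x. norm (cv (et n) G x - G x)"]) measurable
  finally show ?thesis .
 qed
 moreover have "eventually (%n. 1 / real (Suc n) <= d0) sequentially" using order_tendstoD(2)[OF d d0(1)] by eventually_elim simp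
 ultimately have ev: "eventually (%n. norm ?I <= B * ?a n + (B * L) * ?b n) sequentially" by (auto elim: eventually_mono)
 have "(%n. B * ?a n + (B * L) * ?b n) \<longlonglongrightarrow> B * 0 + (B * L) * 0" by (intro tendsto_intros cv_L1_tendsto_real[OF m d] i)
 from tendsto_lowerbound[OF this ev] show "?I = 0" by simp
qed

text \<open>Mollifications have gradient at most \<open>K\<close> on each smaller concentric ball,
  so the mean value inequality holds for them and survives along an almost everywhere convergent
  subsequence. The null set is that of the convergence, hence does not depend on the pair of
  points.\<close>

lemma wgrad_oscillation:
 assumes w: "wgrad (ball a r) u G" and b: "AE x in lborel. x \<in> ball a r --> norm (G x) <= K" and K: "K >= 0"
 shows "\<exists>N\<in>null_sets lborel. \<forall>x\<in>ball a r - N. \<forall>y\<in>ball a r - N. \<bar>u x - u y\<bar> <= K * dist x y"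
proof -
 note i = wgrad_integrable[OF w]
 obtain et E where m: "!!n. mollifier (1 / real (Suc n)) (et n) (E n)" by (rule mollifier_sequence) (rule that)
 have d: "(%n. 1 / real (Suc n)) \<longlonglongrightarrow> 0" by (rule LIMSEQ_Suc[OF lim_1_over_n])
 obtain s :: "nat => nat" where s: "strict_mono s" and AE: "AE x in lborel. (%n. cv (et (s n)) u x) \<longlonglongrightarrow> u x"
  using cv_AE_subseq[OF m d i(1)] by blast
 obtain N where N: "N \<in> null_sets lborel" "{x. \<not> (%n. cv (et (s n)) u x) \<longlonglongrightarrow> u x} \<subseteq> N"
  using AE by (auto elim!: AE_E simp: space_lborel null_sets_def)
 have "\<bar>u x - u y\<bar> <= K * dist x y" if x: "x \<in> ball a r - N" and y: "y \<in> ball a r - N" for x y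
 proof -
  define r' where "r' = max (dist a x) (dist a y)"
  have r': "r' < r" "x \<in> cball a r'" "y \<in> cball a r'" using x y by (auto simp: r'_def)
  have lim: "(%n. \<bar>cv (et (s n)) u x - cv (et (s n)) u y\<bar>) \<longlonglongrightarrow> \<bar>u x - u y\<bar>"
   using N(2) x y by (intro tendsto_intros) auto
  have step: "\<bar>cv (et n) u x - cv (et n) u y\<bar> <= K * dist x y" if n: "1 / real (Suc n) < r - r'" for n
  proof -
   note M = mollifierD[OF m[of n]]
   note [measurable] = M(6) Bm_int[OF i(2)]
   let ?Du = "%x. (LBINT z. u z *r E n (x - z))"
   have C1u: "C1 (cv (et n) u) ?Du" by (rule C1_cv[OF M(1) i(1)])
   have bd: "norm (?Du z) <= K" if z: "z \<in> cball a r'" for z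
   proof -
    have sub: "cball z (1 / real (Suc n)) \<subseteq> ball a r"
    proof
     fix t assume "t \<in> cball z (1 / real (Suc n))"
     hence "dist a t <= r' + 1 / real (Suc n)" using z dist_triangle[of a t z] by simp
     thus "t \<in> ball a r" using n by simp
    qed
    have eq: "?Du z = cv (et n) G z" by (rule wgrad_cv[OF w M(1,2) sub])
    have ii: "lint (%t. et n (z - t) *r G t)" by (rule cv_integrable_integrand[OF M(1) i(2)])
    have i3: "lint (%t. et n (z - t))" using M(5) by (subst mpres_integrable[OF mpres_reflect]) auto
    have "norm (cv (et n) G z) <= (LBINT t. norm (et n (z - t) *r G t))" unfolding cv_def by (rule integral_norm_bound)
    also have "... <= (LBINT t. et n (z - t) * K)"
    proof (rule integral_mono_AE[OF integrable_norm[OF ii]])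
     show "lint (%t. et n (z - t) * K)" using i3 by simp
     show "AE t in lborel. norm (et n (z - t) *r G t) <= et n (z - t) * K" using b
     proof eventually_elim
      case (elim t)
      show ?case
      proof (cases "t \<in> cball z (1 / real (Suc n))")
       case True
       thus ?thesis using elim sub M(3)[of "z - t"] by (auto intro!: mult_left_mono)
      next
       case False
       thus ?thesis using M(2)[of "z - t"] by (simp add: dist_norm)
      qed
     qed
    qed
    also have "... = K * (LBINT t. et n (z - t))" by simp
    also have "(LBINT t. et n (z - t)) = 1" using mpres_integral[OF mpres_reflect[of z], of "et n"] M(4) by simp
    finally show ?thesis using eq by simp
   qed
   have "norm (cv (et n) u x - cv (et n) u y) <= K * norm (x - y)"
   proof (rule differentiable_bound[where S="cball a r'" and f'="%z h. ?Du z *i h"])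
    show "(cv (et n) u has_derivative (*i) (?Du z)) (at z within cball a r')" for z by (rule has_derivative_at_withinI[OF C1_deriv[OF C1u]])
    show "onorm ((*i) (?Du z)) <= K" if "z \<in> cball a r'" for z by (rule onorm_le) (use abs_inner_le[OF bd[OF that]] in simp)
   qed (use r' in auto)
   thus ?thesis by (simp add: dist_norm)
  qed
  have "eventually (%n. \<bar>cv (et (s n)) u x - cv (et (s n)) u y\<bar> <= K * dist x y) sequentially"
  proof -
   have "(%n. 1 / real (Suc (s n))) \<longlonglongrightarrow> 0" using LIMSEQ_subseq_LIMSEQ[OF d s] by (simp add: comp_def)
   hence "eventually (%n. 1 / real (Suc (s n)) < r - r') sequentially" using r'(1) by (intro order_tendstoD(2)) auto
   thus ?thesis by eventually_elim (rule step)
  qed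
  from tendsto_upperbound[OF lim this] show ?thesis by simp
 qed
 thus ?thesis using N(1) by blast
qed

text \<open>Moving points only along a fixed \<open>e\<close> changes the identity by a rank one
  map, so the Jacobian is \<open>1\<close> plus an inner product with \<open>e\<close>. The
  condition is put on the inverse map because \<open>mpres_of_det\<close> evaluates the Jacobian
  there. Both shears and hyperplane reflections have this form.\<close>

lemma cmap_rank1:
 assumes s: "C1 s gs" and s': "C1 s' gs'" and B: "!!x. norm (gs x) <= B" and det: "!!y. \<bar>1 + gs' y *i e\<bar> = 1"
  and inv: "!!x. x + s x *r e + s' (x + s x *r e) *r e = x" "!!x. x + s' x *r e + s (x + s' x *r e) *r e = x"
 shows "cmap (%x. x + s x *r e) (%x h. h + (gs x *i h) *r e) (%x k. k + (e *i k) *r gs x) (1 + norm e * B)" unfolding cmap_def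
proof (intro conjI allI)
 have der: "((%x. x + s x *r e) has_derivative (%h. h + (gs x *i h) *r e)) (at x)" for x by (auto intro!: derivative_eq_intros C1_deriv[OF s])
 have der': "((%x. x + s' x *r e) has_derivative (%h. h + (gs' x *i h) *r e)) (at x)" for x by (auto intro!: derivative_eq_intros C1_deriv[OF s'])
 show "mpres (%x. x + s x *r e)"
 proof (rule mpres_of_det[where S="%x. x + s' x *r e"])
  show "continuous_on UNIV (%x. x + s x *r e)" by (intro continuous_intros C1_continuous[OF s])
 qed (use inv der' det det_rank1 in auto)
 show "((%x. x + s x *r e) has_derivative (%h. h + (gs x *i h) *r e)) (at x)" for x by (rule der)
 show "(h + (gs x *i h) *r e) *i k = h *i (k + (e *i k) *r gs x)" for x h k by (simp add: inner_add_left inner_add_right inner_commute)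
 have "continuous_on UNIV (%p::(real^3)\<times>(real^3). gs (fst p))"
  by (rule continuous_on_compose2[OF C1_continuous_grad[OF s, of UNIV]]) (auto intro: continuous_intros)
 thus "continuous_on UNIV (%p. snd p + (e *i snd p) *r gs (fst p))" by (intro continuous_intros)
 have B0: "B >= 0" using B[of 0] norm_ge_zero order_trans by blast
 thus "0 <= 1 + norm e * B" by simp
 fix x k
 have "norm (k + (e *i k) *r gs x) <= norm k + \<bar>e *i k\<bar> * norm (gs x)" by (rule norm_triangle_le) simp
 also have "... <= norm k + (norm e * norm k) * B" using B[of x] B0 Cauchy_Schwarz_ineq2[of e k] by (intro add_mono mult_mono) auto
 finally show "norm (k + (e *i k) *r gs x) <= (1 + norm e * B) * norm k" by (simp add: algebra_simps)
qed

lemma cmap_mono: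
 assumes "cmap T T' A L" "L <= M" shows "cmap T T' A M"
proof -
 have "norm (A x k) <= M * norm k" for x k
 proof -
  have "norm (A x k) <= L * norm k" using assms(1) by (simp add: cmap_def)
  also have "... <= M * norm k" by (rule mult_right_mono[OF assms(2) norm_ge_zero])
  finally show ?thesis .
 qed
 thus ?thesis using assms by (auto simp: cmap_def)
qed

lemma cmap_comp:
 assumes T: "cmap T T' A L" and S: "cmap S S' B M" shows "cmap (%x. T (S x)) (%x h. T' (S x) (S' x h)) (%x k. B x (A (S x) k)) (M * L)"
 unfolding cmap_def
proof (intro conjI allI)
 have cA: "continuous_on UNIV (%p. A (fst p) (snd p))" and cB: "continuous_on UNIV (%p. B (fst p) (snd p))" using assms by (auto simp: cmap_def)
 show "mpres (%x. T (S x))" using assms by (auto simp: cmap_def intro: mpres_comp)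
 show "((%x. T (S x)) has_derivative (%h. T' (S x) (S' x h))) (at x)" for x
  using assms has_derivative_compose[of S "S' x" x UNIV T "T' (S x)"] by (auto simp: cmap_def)
 show "T' (S x) (S' x h) *i k = h *i B x (A (S x) k)" for x h k using assms by (auto simp: cmap_def)
 have "continuous_on UNIV (%p::(real^3)\<times>(real^3). S (fst p))"
  by (rule continuous_on_compose2[OF cmap_continuous[OF S, of UNIV]]) (auto intro: continuous_intros)
 hence "continuous_on UNIV (%p::(real^3)\<times>(real^3). (S (fst p), snd p))" by (intro continuous_intros)
 from continuous_on_compose2[OF cA this] have "continuous_on UNIV (%p::(real^3)\<times>(real^3). A (S (fst p)) (snd p))" by simp
 hence "continuous_on UNIV (%p::(real^3)\<times>(real^3). (fst p, A (S (fst p)) (snd p)))" by (intro continuous_intros)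
 from continuous_on_compose2[OF cB this] show "continuous_on UNIV (%p. B (fst p) (A (S (fst p)) (snd p)))" by simp
 have LM: "0 <= L" "0 <= M" "!!x k. norm (A x k) <= L * norm k" "!!x k. norm (B x k) <= M * norm k" using assms by (auto simp: cmap_def)
 thus "0 <= M * L" by simp
 show "norm (B x (A (S x) k)) <= M * L * norm k" for x k using LM(4)[of x "A (S x) k"] mult_left_mono[OF LM(3)[of "S x" k] LM(2)] by simp
qed

definition rfl :: "real^3 => real^3 => real^3 => real^3" where
 "rfl p n x = x + (- 2 * ((x - p) *i n)) *r n"

definition rfl0 :: "real^3 => real^3 => real^3" where
 "rfl0 n k = k + (n *i k) *r (- 2 *r n)"

lemma unit_inner: "norm (n::real^3) = 1 ==> n *i n = 1" by (simp add: power2_norm_eq_inner[symmetric])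

lemma rfl_props:
 assumes "norm n = 1" shows "rfl p n (rfl p n x) = x" "(rfl p n x - p) *i n = - ((x - p) *i n)" "rfl0 n (rfl0 n k) = k" "n *i rfl0 n k = - (n *i k)"
  "norm (rfl0 n k) = norm k" "norm (rfl p n x - p) = norm (x - p)" "rfl0 n n = - n"
proof -
 note u = unit_inner[OF assms]
 show "(rfl p n x - p) *i n = - ((x - p) *i n)" "n *i rfl0 n k = - (n *i k)" using u by (auto simp: rfl_def rfl0_def algebra_simps inner_commute)
 show "rfl0 n n = - n" by (simp add: rfl0_def u scaleR_2)
 have n2: "n *i rfl0 n k = - (n *i k)" "((x + c *r n) - p) *i n = (x - p) *i n + c" for c using u by (auto simp: rfl0_def algebra_simps inner_commute)
 have "rfl0 n (rfl0 n k) = rfl0 n k + (n *i rfl0 n k) *r (- 2 *r n)" by (simp only: rfl0_def[of n "rfl0 n k"])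
 also have "... = k" unfolding n2 by (simp add: rfl0_def)
 finally show "rfl0 n (rfl0 n k) = k" .
 have "rfl p n (rfl p n x) = x + (- 2 * ((x - p) *i n)) *r n + (- 2 * ((x - p) *i n + (- 2 * ((x - p) *i n)))) *r n" unfolding rfl_def n2 ..
 also have "... = x" by (simp add: algebra_simps)
 finally show "rfl p n (rfl p n x) = x" .
 have r: "rfl0 n k *i rfl0 n k = k *i k" for k using u by (simp add: rfl0_def algebra_simps inner_commute)
 thus "norm (rfl0 n k) = norm k" by (simp add: norm_eq_sqrt_inner)
 have "rfl p n x - p = rfl0 n (x - p)" by (simp add: rfl_def rfl0_def inner_commute algebra_simps)
 thus "norm (rfl p n x - p) = norm (x - p)" using r by (simp add: norm_eq_sqrt_inner)
qed

lemma cmap_rfl: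
 assumes "norm n = 1" shows "cmap (rfl p n) (%x. rfl0 n) (%x. rfl0 n) 3"
proof -
 note u = unit_inner[OF assms]
 have C: "C1 (%x. - 2 * ((x - p) *i n)) (%x. - 2 *r n)" unfolding C1_def by (auto intro!: derivative_eq_intros simp: inner_commute)
 have 1: "x + (- 2 * ((x - p) *i n)) *r n + (- 2 * ((x + (- 2 * ((x - p) *i n)) *r n - p) *i n)) *r n = x" for x
  using rfl_props(1)[OF assms, of p x] unfolding rfl_def .
 have "cmap (%x. x + (- 2 * ((x - p) *i n)) *r n) (%x h. h + ((- 2 *r n) *i h) *r n) (%x k. k + (n *i k) *r (- 2 *r n)) (1 + norm n * 2)"
 proof (rule cmap_rank1[OF C C])
  show "norm (- 2 *r n) <= 2" using assms by simp
  show "\<bar>1 + (- 2 *r n) *i n\<bar> = 1" using u by simp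
 qed (rule 1)+
 moreover have "(%x h. h + ((- 2 *r n) *i h) *r n) = (%x::real^3. rfl0 n)" by (auto simp: rfl0_def fun_eq_iff algebra_simps)
 ultimately show ?thesis using assms by (simp add: rfl_def[abs_def] rfl0_def[abs_def])
qed

lemma AE_not_hyperplane:
 fixes n p :: "'a::euclidean_space"
 assumes "n ~= 0" shows "AE x in lborel. (x - p) *i n ~= 0"
proof -
 have "(x - p) *i n = 0 \<longleftrightarrow> n *i x = n *i p" for x
  by (simp only: inner_diff_left inner_commute[of x n] inner_commute[of p n] right_minus_eq)
 hence eq: "{x. (x - p) *i n = 0} = {x. n *i x = n *i p}" by blast
 have "negligible {x. (x - p) *i n = 0}" unfolding eq using assms by (intro negligible_hyperplane) auto
 moreover have c: "closed {x. (x - p) *i n = 0}" unfolding eq by (rule closed_hyperplane)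
 ultimately have "{x. (x - p) *i n = 0} \<in> null_sets lborel" using negligible_iff_null_sets[of "{x. (x - p) *i n = 0}"] borel_closed[OF c]
  by (simp add: null_sets_completion_iff)
 thus ?thesis by (rule AE_I') auto
qed

text \<open>The hyperplane is a null set and the reflection exchanges the two open half spaces while
  preserving volume, so an integral over the whole space folds onto one side.\<close>

lemma abs_half_space_integral:
 fixes f :: "real^3 => 'b::{banach,second_countable_topology}"
 assumes "norm n = 1" "lint f"
 shows "(LBINT x. (if (x - p) *i n > 0 then f x else 0)) + (LBINT x. (if (x - p) *i n > 0 then f (rfl p n x) else 0)) = (LBINT x. f x)"
  "lint (%x. if (x - p) *i n > 0 then f x else 0)"
  "lint (%x. if (x - p) *i n > 0 then f (rfl p n x) else 0)"
proof -
 have mp: "mpres (rfl p n)" using cmap_rfl[OF assms(1)] by (simp add: cmap_def)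
 have n0: "n ~= 0" using assms(1) by auto
 note [measurable] = Bm_int[OF assms(2)] mpres_borel[OF mp]
 show i1: "lint (%x. if (x - p) *i n > 0 then f x else 0)" by (rule int_bound[OF assms(2)]) auto
 have fr: "lint (%x. f (rfl p n x))" using assms(2) by (subst mpres_integrable[OF mp]) auto
 show i2: "lint (%x. if (x - p) *i n > 0 then f (rfl p n x) else 0)" by (rule int_bound[OF fr]) auto
 let ?h = "%x. if (x - p) *i n < 0 then f x else 0"
 have i3: "lint ?h" by (rule int_bound[OF assms(2)]) auto
 have "(LBINT x. ?h (rfl p n x)) = (LBINT x. ?h x)" by (rule mpres_integral[OF mp]) measurable
 hence "(LBINT x. (if (x - p) *i n > 0 then f (rfl p n x) else 0)) = (LBINT x. ?h x)" by (simp add: rfl_props(2)[OF assms(1)])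
 hence "(LBINT x. (if (x - p) *i n > 0 then f x else 0)) + (LBINT x. (if (x - p) *i n > 0 then f (rfl p n x) else 0))
  = (LBINT x. (if (x - p) *i n > 0 then f x else 0) + ?h x)" using i1 i3 by simp
 also have "... = (LBINT x. f x)"
 proof (rule integral_cong_AE)
  show "AE x in lborel. (if (x - p) *i n > 0 then f x else 0) + ?h x = f x" using AE_not_hyperplane[OF n0, of p] by eventually_elim auto
 qed measurable
 finally show "(LBINT x. (if (x - p) *i n > 0 then f x else 0)) + (LBINT x. (if (x - p) *i n > 0 then f (rfl p n x) else 0)) = (LBINT x. f x)" .
qed

lemma C1c_cutoff:
 assumes a: "C1c V ph D" and ze: "C1 ze Dze" "closed S" "!!x. x \<notin> S ==> ze x = 0" and sub: "V \<inter> S \<subseteq> U"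
 shows "C1c U (%x. ze x * ph x) (%x. ph x *r Dze x + ze x *r D x)"
proof -
 obtain K where K: "compact K" "K \<subseteq> V" "!!x. x \<notin> K ==> ph x = 0" "!!x. x \<notin> K ==> D x = 0" by (rule C1cE[OF a]) (rule that)
 have "compact (K \<inter> S)" using K(1) ze(2) by (rule compact_Int_closed)
 moreover have "K \<inter> S \<subseteq> U" using K(2) sub by blast
 moreover have "ze x * ph x = 0" if "x \<notin> K \<inter> S" for x using that K(3)[of x] ze(3)[of x] by auto
 ultimately show ?thesis unfolding C1c_def by (intro conjI C1_mult[OF ze(1) C1c_C1[OF a]] exI[of _ "K \<inter> S"]) auto
qed

lemma eventually_real_mult_ge:
 assumes "0 < (s::real)" shows "\<forall>\<^sub>F k in sequentially. c <= real k * s"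
proof -
 obtain k0 where "c / s < real k0" using reals_Archimedean2 by blast
 hence "c <= real k0 * s" using assms by (simp add: divide_less_eq)
 moreover have "real k0 * s <= real k * s" if "k0 <= k" for k using that assms by simp
 ultimately show ?thesis by (intro eventually_sequentiallyI[of k0]) (rule order_trans)
qed

lemma integrable_If:
 fixes f g :: "'a::euclidean_space => 'b::{banach,second_countable_topology}"
 assumes "lint f" "lint g" "{x. P x} \<in> sets lborel" shows "lint (%x. if P x then f x else g x)"
proof -
 have "lint (%x. indicator {x. P x} x *r f x + indicator (- {x. P x}) x *r g x)"
  by (intro int_add integrable_mult_indicator assms) (use assms(3) in simp)
 thus ?thesis by (rule Bochner_Integration.integrable_cong[THEN iffD1, rotated -1]) auto
qed

text \<open>The weak equation is known only on one side of the hyperplane, so test functions are cut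
  off at distance \<open>1 / k\<close> from it. Testing with both \<open>ph\<close> and its mirror
  image leaves, in the term with the derivative of the cut-off, only the difference of the two; this
  difference vanishes on the hyperplane and offsets the factor \<open>k\<close>. Thus no boundary
  values of \<open>u\<close> appear.\<close>

lemma wgrad_reflect:
 assumes n: "norm n = 1" and w: "wgrad (V \<inter> {x. (x - p) *i n > 0}) u G" and V: "!!x. x \<in> V ==> rfl p n x \<in> V"
 shows "wgrad V (%x. if (x - p) *i n > 0 then u x else u (rfl p n x))
  (%x. if (x - p) *i n > 0 then G x else rfl0 n (G (rfl p n x)))" (is "wgrad V ?u ?G")
proof (rule wgradI)
 let ?R = "rfl p n"
 let ?l = "%x. (x - p) *i n"
 note cm = cmap_rfl[OF n, of p]
 have mp: "mpres ?R" using cm by (simp add: cmap_def)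
 note i = wgrad_integrable[OF w]
 note u = unit_inner[OF n]
 note [measurable] = Bm_int[OF i(1)] Bm_int[OF i(2)] mpres_borel[OF mp]
 have bl: "bounded_linear (rfl0 n)"
  by (rule bounded_linear_intro[where K=3]) (use cm in \<open>auto simp: cmap_linear[OF cm] cmap_def mult.commute\<close>)
 have iuR: "lint (%x. u (?R x))" using i(1) by (subst mpres_integrable[OF mp]) auto
 have iG0: "lint (%x. rfl0 n (G x))" by (rule integrable_bounded_linear[OF bl i(2)])
 have iGR: "lint (%x. rfl0 n (G (?R x)))" by (rule cmap_integrable[OF cm i(2)])
 have [measurable]: "{x. ?l x > 0} \<in> sets lborel" by simp
 show iu: "lint ?u" and iG: "lint ?G" by (rule integrable_If; use i iuR iGR in simp)+
 fix ph D assume a: "C1c V ph D"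
 let ?phR = "%x. ph (?R x)"
 let ?DR = "%x. rfl0 n (D (?R x))"
 have cR: "continuous_on UNIV ?R" by (rule cmap_continuous[OF cm])
 have aR: "C1c V ?phR ?DR" by (rule cmap_C1c[OF cm a cR]) (use V rfl_props(1)[OF n] in auto)
 obtain B where B: "B > 0" "!!x. \<bar>ph x\<bar> <= B" "!!x. norm (D x) <= B" by (rule C1c_bounded[OF a]) (rule that)
 note C = C1c_C1[OF a]
 note [measurable] = C1_borel[OF C] C1_borel_grad[OF C] C1_borel_grad[OF C1c_C1[OF aR]]
 obtain X X' B' where X: "!!s::real. (X has_real_derivative X' s) (at s)" "continuous_on UNIV X'"
  "!!s. 0 <= X s" "!!s. X s <= 1" "!!s. s <= 1 ==> X s = 0" "!!s. s >= 2 ==> X s = 1"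
  "!!s. s <= 1 \<or> s >= 2 ==> X' s = 0" "!!s. \<bar>X' s\<bar> <= B'" "B' > 0" by (rule cutoff_exists) (rule that)
 define g where "g x = u x *r (D x + D (?R x)) + (ph x *r G x + ?phR x *r rfl0 n (G x))" for x
 have "lint (%x. u x *r (D x + D (?R x)))" by (rule int_scaleR_bounded[OF i(1) _ norm_triangle_le[OF add_mono[OF B(3) B(3)]]]) measurable
 moreover have "lint (%x. ph x *r G x + ?phR x *r rfl0 n (G x))"
  by (intro int_add C1c_int_scaleR(2)[OF a i(2)] C1c_int_scaleR(2)[OF aR iG0])
 ultimately have g_int: "lint g" unfolding g_def[abs_def] by (rule int_add)
 \<comment> \<open>\<open>h k\<close> is the integrand of the weak equation tested with the cut-off
   \<open>ph\<close>, plus the reflected integrand tested with the cut-off mirror image. Since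
   \<open>rfl0 n n = - n\<close>, the terms with \<open>X'\<close> combine to the difference
   \<open>ph x - ?phR x\<close>.\<close>
 define h where "h k x = X (real k * ?l x) *r g x + (u x * (ph x - ?phR x)) *r ((X' (real k * ?l x) * real k) *r n)" for k x
 have h0: "(LBINT x. h k x) = 0" if k: "k > 0" for k
 proof -
  let ?ze = "%x. X (real k * ?l x)"
  let ?Dze = "%x. (X' (real k * ?l x) * real k) *r n"
  have "C1 (%x. real k * ?l x) (%x. real k *r n)" unfolding C1_def by (auto intro!: derivative_eq_intros simp: inner_commute)
  from C1_compose_real[OF this X(1,2)] have Cze: "C1 ?ze ?Dze" by simp
  have cl: "closed {x. ?l x >= 1 / real k}" by (intro closed_Collect_le continuous_intros)
  have sup: "?ze x = 0" if "x \<notin> {x. ?l x >= 1 / real k}" for x using that k X(5)[of "real k * ?l x"] by (simp add: field_simps)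
  have sub: "V \<inter> {x. ?l x >= 1 / real k} \<subseteq> V \<inter> {x. ?l x > 0}"
  proof
   fix x assume "x \<in> V \<inter> {x. ?l x >= 1 / real k}"
   moreover have "1 / real k > 0" using k by simp
   ultimately have "x \<in> V" "?l x > 0" by (blast, simp only: Int_iff mem_Collect_eq) (blast intro: less_le_trans)
   thus "x \<in> V \<inter> {x. ?l x > 0}" by simp
  qed
  note t1 = C1c_cutoff[OF a Cze cl sup sub]
  note t2 = C1c_cutoff[OF aR Cze cl sup sub]
  note e1 = wgrad_eq0[OF w t1] and e2 = wgrad_eq0[OF w t2]
  let ?t1 = "%x. u x *r (ph x *r ?Dze x + ?ze x *r D x) + (?ze x * ph x) *r G x"
  let ?t2 = "%x. u x *r (?phR x *r ?Dze x + ?ze x *r ?DR x) + (?ze x * ?phR x) *r G x"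
  have i1: "lint ?t1" by (intro int_add C1c_int_scaleR[OF t1] i)
  have i2: "lint ?t2" by (intro int_add C1c_int_scaleR[OF t2] i)
  have "rfl0 n 0 = 0" by (simp add: rfl0_def)
  hence e3: "(LBINT x. rfl0 n (?t2 x)) = 0" using trans[OF integral_bounded_linear[OF bl i2] arg_cong[OF e2, of "rfl0 n"]] by (rule trans[rotated])
  note i3 = integrable_bounded_linear[OF bl i2]
  have "h k x = ?t1 x + rfl0 n (?t2 x)" for x unfolding h_def g_def cmap_linear[OF cm] rfl_props(3,7)[OF n] by (simp add: algebra_simps)
  hence "(LBINT x. h k x) = (LBINT x. ?t1 x + rfl0 n (?t2 x))" by (simp only:)
  also have "... = 0 + 0" by (rule trans[OF integral_plus[OF i1 i3] arg_cong2[where f="(+)", OF e1 e3]])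
  finally show ?thesis by simp
 qed
 have [measurable]: "g \<in> borel_measurable lborel" using g_int by (rule Bm_int)
 have [measurable]: "X \<in> Bm" "X' \<in> Bm"
  using X(2) DERIV_isCont[OF X(1)] by (auto intro!: borel_measurable_continuous_onI continuous_at_imp_continuous_on)
 \<comment> \<open>This linear bound is what makes the dominating function independent of
   \<open>k\<close>: where \<open>X'\<close> is nonzero, \<open>k\<close> times the distance to the
   hyperplane is less than 2.\<close>
 have diff: "\<bar>ph x - ?phR x\<bar> <= B * (2 * \<bar>?l x\<bar>)" for x
 proof -
  have "norm (ph x - ph (?R x)) <= B * norm (x - ?R x)"
  proof (rule differentiable_bound[where S=UNIV and f'="%z h. D z *i h"])
   show "onorm ((*i) (D z)) <= B" for z by (rule onorm_le) (use abs_inner_le[OF B(3)[of z]] in simp)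
  qed (use C1_deriv[OF C] in \<open>auto intro: has_derivative_at_withinI\<close>)
  also have "norm (x - ?R x) = 2 * \<bar>?l x\<bar>" using n by (simp add: rfl_def)
  finally show ?thesis by simp
 qed
 have lim: "(%k. (LBINT x. h k x)) \<longlonglongrightarrow> (LBINT x. (if ?l x > 0 then g x else 0))"
 proof (rule integral_dominated_convergence[where w="%x. norm (g x) + \<bar>u x\<bar> * (4 * B * B')"])
  show "lint (%x. norm (g x) + \<bar>u x\<bar> * (4 * B * B'))"
   using g_int i(1) by (intro int_add integrable_norm integrable_mult_left integrable_abs) auto
  show "AE x in lborel. (%k. h k x) \<longlonglongrightarrow> (if ?l x > 0 then g x else 0)"
  proof (rule AE_I2)
   fix x
   show "(%k. h k x) \<longlonglongrightarrow> (if ?l x > 0 then g x else 0)"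
   proof (cases "?l x > 0")
    case True
    have "eventually (%k. h k x = g x) sequentially"
     using eventually_real_mult_ge[OF True, of 2] by eventually_elim (use X(6,7) in \<open>simp add: h_def\<close>)
    thus ?thesis using True by (simp add: tendsto_eventually)
   next
    case False
    have "h k x = 0" for k
    proof -
     have "real k * ?l x <= 1" using False mult_nonneg_nonpos[of "real k" "?l x"] by simp
     thus ?thesis using X(5,7)[of "real k * ?l x"] by (simp add: h_def)
    qed
    thus ?thesis using False by simp
   qed
  qed
  show "AE x in lborel. norm (h k x) <= norm (g x) + \<bar>u x\<bar> * (4 * B * B')" for k
  proof (rule AE_I2)
   fix x
   have 1: "norm (X (real k * ?l x) *r g x) <= norm (g x)" using X(3,4)[of "real k * ?l x"] by (simp add: mult_left_le_one_le)
   have 2: "\<bar>ph x - ?phR x\<bar> * (\<bar>X' (real k * ?l x)\<bar> * real k) <= 4 * B * B'"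
   proof (cases "real k * ?l x <= 1 \<or> real k * ?l x >= 2")
    case True
    thus ?thesis using X(7)[of "real k * ?l x"] B(1) X(9) by simp
   next
    case False
    hence "k > 0" by (cases k) auto
    hence l: "?l x > 0" using False mult_nonneg_nonpos[of "real k" "?l x"] by (cases "?l x > 0") auto
    have "\<bar>ph x - ?phR x\<bar> * (\<bar>X' (real k * ?l x)\<bar> * real k) <= (B * (2 * \<bar>?l x\<bar>)) * (B' * real k)"
     using diff[of x] X(8)[of "real k * ?l x"] B(1) X(9) by (intro mult_mono) auto
    also have "... = 2 * B * B' * (real k * ?l x)" using l by simp
    also have "... <= 2 * B * B' * 2" using False B(1) X(9) by (intro mult_left_mono) auto
    finally show ?thesis by simp
   qed
   have "norm (h k x) <= norm (X (real k * ?l x) *r g x) + \<bar>u x\<bar> * (\<bar>ph x - ?phR x\<bar> * (\<bar>X' (real k * ?l x)\<bar> * real k))"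
    unfolding h_def by (rule norm_triangle_le) (simp add: abs_mult n)
   thus "norm (h k x) <= norm (g x) + \<bar>u x\<bar> * (4 * B * B')" using 1 mult_left_mono[OF 2, of "\<bar>u x\<bar>"] by simp
  qed
 next
  have [measurable]: "(%x. ph (?R x)) \<in> borel_measurable lborel" using C1_borel[OF C1c_C1[OF aR]] by simp
  show "h k \<in> borel_measurable lborel" for k unfolding h_def[abs_def] by measurable
 qed measurable
 have "eventually (%k. (LBINT x. h k x) = 0) sequentially" using eventually_gt_at_top[of 0] by eventually_elim (rule h0)
 from LIMSEQ_unique[OF lim tendsto_eventually[OF this]]
 have gz: "(LBINT x. (if ?l x > 0 then g x else 0)) = 0" .
 have fi: "lint (%x. ?u x *r D x + ph x *r ?G x)" by (intro int_add C1c_int_scaleR[OF a] iu iG)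
 note H = abs_half_space_integral[OF n fi, of p]
 have eqf: "(if ?l x > 0 then ?u x *r D x + ph x *r ?G x else 0)
  + (if ?l x > 0 then ?u (?R x) *r D (?R x) + ph (?R x) *r ?G (?R x) else 0) = (if ?l x > 0 then g x else 0)" for x
  using rfl_props(1,2)[OF n, of p x] by (simp add: g_def algebra_simps)
 have "(LBINT x. ?u x *r D x + ph x *r ?G x) = (LBINT x. (if ?l x > 0 then ?u x *r D x + ph x *r ?G x else 0)
  + (if ?l x > 0 then ?u (?R x) *r D (?R x) + ph (?R x) *r ?G (?R x) else 0))" unfolding integral_plus[OF H(2,3)] by (rule H(1)[symmetric])
 also have "... = 0" unfolding eqf by (rule gz)
 finally show "(LBINT x. ?u x *r D x + ph x *r ?G x) = 0" .
qed


section \<open>Boundary frames\<close>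

text \<open>Near \<open>p\<close> the domain will be \<open>{x. hgt p n e s x > 0}\<close>; \<open>n\<close> is the inner normal at \<open>p\<close>, and the
  shear \<open>x \<mapsto> x - s x e\<close> flattens the boundary onto its tangent plane at \<open>p\<close>.\<close>

definition frame :: "real^3 => real^3 => real^3 => (real^3 => real) => (real^3 => real^3) => bool" where
 "frame p n e s gs \<longleftrightarrow> norm n = 1 & norm e = 1 & 0 < e *i n & C1 s gs & (\<forall>x ta. s (x + ta *r e) = s x) &
  s p = 0 & (\<forall>x. norm (gs x) <= 1 / 4)"

definition hgt :: "real^3 => real^3 => real^3 => (real^3 => real) => real^3 => real" where
 "hgt p n e s x = (x - s x *r e - p) *i n"

text \<open>The curved analogue of a mirror reflection: flatten by the shear, reflect in the tangent
  plane, shear back. It is a volume-preserving involution that changes the sign of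
  \<open>hgt\<close>.\<close>

definition rho :: "real^3 => real^3 => real^3 => (real^3 => real) => real^3 => real^3" where
 "rho p n e s x = (let y = rfl p n (x - s x *r e) in y + s y *r e)"

text \<open>The adjoint of the derivative of \<open>rho\<close> at \<open>x\<close>. The gradient of
  \<open>u\<close> composed with \<open>rho\<close> is therefore \<open>arho\<close> at
  \<open>x\<close> applied to the gradient of \<open>u\<close> at the reflected point, as used in
  \<open>extG\<close>.\<close>

definition arho :: "real^3 => real^3 => real^3 => (real^3 => real) => (real^3 => real^3) => real^3 => real^3 => real^3" where
 "arho p n e s gs x k = (let l = rfl0 n (k + (e *i k) *r gs (rho p n e s x)) in l - (e *i l) *r gs x)"

definition ext :: "real^3 => real^3 => real^3 => (real^3 => real) => (real^3 => real) => real^3 => real" where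
 "ext p n e s u x = (if hgt p n e s x > 0 then u x else u (rho p n e s x))"

definition extG :: "real^3 => real^3 => real^3 => (real^3 => real) => (real^3 => real^3) => (real^3 => real^3) => real^3 => real^3" where
 "extG p n e s gs G x = (if hgt p n e s x > 0 then G x else arho p n e s gs x (G (rho p n e s x)))"

context
 fixes p n e :: "real^3" and s gs
 assumes fr: "frame p n e s gs"
begin

lemma frameD:
 "norm n = 1" "norm e = 1" "0 < e *i n" "C1 s gs" "s (x + ta *r e) = s x" "s p = 0" "norm (gs x) <= 1 / 4" using fr by (auto simp: frame_def)

lemma frame_s_minus: "s (x - ta *r e) = s x" using frameD(5)[of x "- ta"] by simp

lemma frame_gs: "gs (x + ta *r e) = gs x" "gs (x - ta *r e) = gs x" "gs x *i e = 0" "e *i gs x = 0"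
proof -
 have g: "gs (x + ta *r e) = gs x" for ta
 proof -
  have sh: "((%x. x + ta *r e) has_derivative (%h. h)) (at x)" by (auto intro!: derivative_eq_intros)
  from has_derivative_compose[OF sh C1_deriv[OF frameD(4)]]
  have "(s has_derivative (%h. gs (x + ta *r e) *i h)) (at x)" by (simp add: frameD(5))
  from has_derivative_unique[OF this C1_deriv[OF frameD(4)]]
  have "gs (x + ta *r e) *i h = gs x *i h" for h by (rule fun_cong)
  thus ?thesis by (subst vector_eq_rdot[symmetric]) simp
 qed
 from g[of ta] g[of "- ta"] show "gs (x + ta *r e) = gs x" "gs (x - ta *r e) = gs x" by simp_all
 have l: "((%ta. x + ta *r e) has_derivative (%h. h *r e)) (at (0::real))" by (auto intro!: derivative_eq_intros)
 have "(s has_derivative (%h. gs x *i h)) (at (x + 0 *r e))" using C1_deriv[OF frameD(4)] by simp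
 from has_derivative_compose[OF l this]
 have "((%ta::real. s x) has_derivative (%h. gs x *i (h *r e))) (at 0)" by (simp add: frameD(5))
 from has_derivative_unique[OF this has_derivative_const] have "gs x *i (1 *r e) = 0" by (rule fun_cong)
 thus "gs x *i e = 0" "e *i gs x = 0" by (simp_all add: inner_commute)
qed

lemma frame_cmaps:
 "cmap (%x. x - s x *r e) (%x h. h - (gs x *i h) *r e) (%x k. k - (e *i k) *r gs x) (5 / 4)"
 "cmap (%x. x + s x *r e) (%x h. h + (gs x *i h) *r e) (%x k. k + (e *i k) *r gs x) (5 / 4)"
proof -
 have Cm: "C1 (%x. - s x) (%x. - gs x)" using C1_cmult[OF frameD(4), of "-1"] by simp
 have "cmap (%x. x + s x *r e) (%x h. h + (gs x *i h) *r e) (%x k. k + (e *i k) *r gs x) (1 + norm e * (1 / 4))"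
  by (rule cmap_rank1[OF frameD(4) Cm]) (use frameD(7) in \<open>auto simp: frame_gs frame_s_minus frameD(5)\<close>)
 thus "cmap (%x. x + s x *r e) (%x h. h + (gs x *i h) *r e) (%x k. k + (e *i k) *r gs x) (5 / 4)" by (simp add: frameD(2))
 have "cmap (%x. x + (- s x) *r e) (%x h. h + ((- gs x) *i h) *r e) (%x k. k + (e *i k) *r (- gs x)) (1 + norm e * (1 / 4))"
  by (rule cmap_rank1[OF Cm frameD(4)]) (use frameD(7) in \<open>auto simp: frame_gs frame_s_minus frameD(5)\<close>)
 thus "cmap (%x. x - s x *r e) (%x h. h - (gs x *i h) *r e) (%x k. k - (e *i k) *r gs x) (5 / 4)" by (simp add: frameD(2))
qed

lemma frame_s_bound: "\<bar>s x\<bar> <= norm (x - p) / 4"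
proof -
 have "norm (s x - s p) <= (1 / 4) * norm (x - p)"
 proof (rule differentiable_bound[where S=UNIV and f'="%z h. gs z *i h"])
  show "onorm ((*i) (gs z)) <= 1 / 4" for z by (rule onorm_le) (use abs_inner_le[OF frameD(7)[of z]] in simp)
 qed (use C1_deriv[OF frameD(4)] in \<open>auto intro: has_derivative_at_withinI\<close>)
 thus ?thesis by (simp add: frameD(6))
qed

lemma shear_norm: "norm (x - s x *r e - p) <= (5 / 4) * norm (x - p)" "norm (x + s x *r e - p) <= (5 / 4) * norm (x - p)"
 using norm_triangle_ineq4[of "x - p" "s x *r e"] norm_triangle_ineq[of "x - p" "s x *r e"] frame_s_bound[of x] frameD(2)
 by (simp_all add: algebra_simps)

lemma rho_rho: "rho p n e s (rho p n e s x) = x" by (simp add: rho_def Let_def frame_s_minus frameD(5) rfl_props(1)[OF frameD(1)])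

lemma hgt_rho: "hgt p n e s (rho p n e s x) = - hgt p n e s x"
 by (simp add: rho_def hgt_def Let_def frame_s_minus frameD(5) rfl_props(2)[OF frameD(1)])

lemma rho_norm: "norm (rho p n e s x - p) <= 2 * norm (x - p)"
proof -
 have "norm (rho p n e s x - p) <= (5 / 4) * norm (rfl p n (x - s x *r e) - p)" unfolding rho_def Let_def by (rule shear_norm(2))
 also have "... <= (5 / 4) * ((5 / 4) * norm (x - p))" unfolding rfl_props(6)[OF frameD(1)] using shear_norm(1)[of x] by simp
 also have "... <= 2 * norm (x - p)" by simp
 finally show ?thesis .
qed

lemma cmap_rho: "cmap (rho p n e s) (%x h. let l = rfl0 n (h - (gs x *i h) *r e) in l + (gs (rho p n e s x) *i l) *r e) (arho p n e s gs) 5"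
proof -
 have c: "cmap (%x. (%y. y + s y *r e) ((%x. rfl p n (x - s x *r e)) x))
  (%x h. (%l. l + (gs (rfl p n (x - s x *r e)) *i l) *r e) (rfl0 n (h - (gs x *i h) *r e)))
  (%x k. (%l. rfl0 n l - (e *i rfl0 n l) *r gs x) (k + (e *i k) *r gs (rfl p n (x - s x *r e)))) ((5 / 4 * 3) * (5 / 4))"
  by (rule cmap_comp[OF frame_cmaps(2) cmap_comp[OF cmap_rfl[OF frameD(1)] frame_cmaps(1)]])
 have g: "gs (rho p n e s x) = gs (rfl p n (x - s x *r e))" for x by (simp add: rho_def Let_def frame_gs)
 have "cmap (rho p n e s) (%x h. let l = rfl0 n (h - (gs x *i h) *r e) in l + (gs (rho p n e s x) *i l) *r e) (arho p n e s gs) ((5 / 4 * 3) * (5 / 4))"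
  using c unfolding g arho_def[abs_def] rho_def[abs_def] Let_def by (simp add: frame_gs)
 thus ?thesis by (rule cmap_mono) simp
qed

text \<open>With zero slope the shears would be trivial and \<open>arho\<close> would be the exact
  reflection \<open>rfl0\<close>. The deviation is linear in the slopes at the two points involved,
  and near \<open>p\<close> these are of order \<open>norm (x - p) powr al\<close>.\<close>

lemma arho_diff: "norm (arho p n e s gs x k - rfl0 n k) <= 2 * (norm (gs x) + norm (gs (rho p n e s x))) * norm k"
proof -
 let ?g = "gs (rho p n e s x)"
 note lin = cmap_linear[OF cmap_rfl[OF frameD(1)]]
 note N = rfl_props(5)[OF frameD(1)]
 let ?q = "(e *i k) *r ?g"
 let ?l = "rfl0 n (k + ?q)"
 have ek: "\<bar>e *i v\<bar> <= norm v" for v using Cauchy_Schwarz_ineq2[of e v] frameD(2) by simp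
 have q: "norm ?q <= norm k * norm ?g" using ek[of k] by (simp add: mult_right_mono)
 also have "... <= norm k * (1 / 4)" using frameD(7) by (intro mult_left_mono) auto
 finally have q2: "norm ?q <= norm k * (1 / 4)" .
 have l: "norm ?l <= 2 * norm k" unfolding N using norm_triangle_ineq[of k ?q] q2 norm_ge_zero[of k] by linarith
 have "arho p n e s gs x k - rfl0 n k = rfl0 n ?q - (e *i ?l) *r gs x" by (simp add: arho_def Let_def lin)
 also have "norm ... <= norm (rfl0 n ?q) + \<bar>e *i ?l\<bar> * norm (gs x)" using norm_triangle_ineq4 by (metis norm_scaleR)
 also have "... <= norm k * norm ?g + (2 * norm k) * norm (gs x)" unfolding N using q order_trans[OF ek l] by (intro add_mono mult_right_mono) auto
 also have "... <= 2 * (norm (gs x) + norm ?g) * norm k" by (simp add: algebra_simps)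
 finally show ?thesis .
qed

lemma hgt_C1: "C1 (hgt p n e s) (%x. n - (e *i n) *r gs x)"
proof -
 have "C1 (%x. n *i x + (- (p *i n)) - (e *i n) * s x) (%x. n + 0 - (e *i n) *r gs x)" by (intro C1_diff C1_add C1_inner C1_const C1_cmult frameD(4))
 moreover have "hgt p n e s = (%x. n *i x + (- (p *i n)) - (e *i n) * s x)" by (auto simp: hgt_def fun_eq_iff algebra_simps inner_commute)
 ultimately show ?thesis by simp
qed

lemma hgt_shift: "hgt p n e s (x + ta *r e) = hgt p n e s x + ta * (e *i n)" by (simp add: hgt_def frameD(5) algebra_simps)

text \<open>Chain rule for one shear, even reflection in the flat picture, chain rule for the other
  shear. Each shear enlarges distances from \<open>p\<close> by at most 5/4, so the radius drops
  from \<open>r\<close> to \<open>4 * r / 5\<close> and then safely to \<open>r / 2\<close>.\<close>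

lemma wgrad_ext:
 assumes w: "wgrad (ball p r \<inter> {x. hgt p n e s x > 0}) u G" shows "wgrad (ball p (r / 2)) (ext p n e s u) (extG p n e s gs G)"
proof -
 let ?P = "%x. x - s x *r e" and ?Q = "%x. x + s x *r e" and ?R = "rfl p n"
 let ?U = "ball p r \<inter> {x. hgt p n e s x > 0}"
 let ?V = "ball p (4 * r / 5)"
 note cP = frame_cmaps(1) and cQ = frame_cmaps(2)
 have PQ: "?P (?Q x) = x" "?Q (?P x) = x" for x by (simp_all add: frame_s_minus frameD(5))
 have U: "open ?U" by (intro open_Int open_ball open_Collect_less continuous_intros C1_continuous[OF hgt_C1])
 have w1: "wgrad (?Q -` ?U) (%x. u (?Q x)) (%x. G (?Q x) + (e *i G (?Q x)) *r gs x)" by (rule wgrad_chain[OF w U cQ cmap_continuous[OF cP] PQ])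
 have sub: "?V \<inter> {x. (x - p) *i n > 0} \<subseteq> ?Q -` ?U"
 proof
  fix x assume x: "x \<in> ?V \<inter> {x. (x - p) *i n > 0}"
  hence "norm (?Q x - p) < r" using shear_norm(2)[of x] by (simp add: dist_nm)
  moreover have "hgt p n e s (?Q x) > 0" using x by (simp add: hgt_def frameD(5))
  ultimately show "x \<in> ?Q -` ?U" by (simp add: dist_nm)
 qed
 have w2: "wgrad ?V (%x. if (x - p) *i n > 0 then u (?Q x) else u (?Q (?R x)))
  (%x. if (x - p) *i n > 0 then G (?Q x) + (e *i G (?Q x)) *r gs x else rfl0 n (G (?Q (?R x)) + (e *i G (?Q (?R x))) *r gs (?R x)))"
 proof (rule wgrad_reflect[OF frameD(1) wgrad_mono[OF w1 sub]])
  fix x assume "x \<in> ?V"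
  thus "?R x \<in> ?V" using rfl_props(6)[OF frameD(1), of p x] by (simp add: dist_nm)
 qed
 have w3: "wgrad (?P -` ?V) (%x. if (?P x - p) *i n > 0 then u (?Q (?P x)) else u (?Q (?R (?P x))))
  (%x. (%k. k - (e *i k) *r gs x) (if (?P x - p) *i n > 0 then G (?Q (?P x)) + (e *i G (?Q (?P x))) *r gs (?P x)
    else rfl0 n (G (?Q (?R (?P x))) + (e *i G (?Q (?R (?P x)))) *r gs (?R (?P x)))))"
  by (rule wgrad_chain[OF w2 open_ball cP cmap_continuous[OF cQ] PQ(2) PQ(1)])
 have e1: "(%x. if (?P x - p) *i n > 0 then u (?Q (?P x)) else u (?Q (?R (?P x)))) = ext p n e s u"
  unfolding PQ(2) by (auto simp: ext_def hgt_def rho_def Let_def fun_eq_iff)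
 have g: "gs (rho p n e s x) = gs (rfl p n (x - s x *r e))" for x by (simp add: rho_def Let_def frame_gs)
 have e2: "(%x. (%k. k - (e *i k) *r gs x) (if (?P x - p) *i n > 0 then G (?Q (?P x)) + (e *i G (?Q (?P x))) *r gs (?P x)
    else rfl0 n (G (?Q (?R (?P x))) + (e *i G (?Q (?R (?P x)))) *r gs (?R (?P x))))) = extG p n e s gs G"
 proof
  fix x
  have r: "?Q (?R (?P x)) = rho p n e s x" by (simp add: rho_def Let_def)
  show "(%k. k - (e *i k) *r gs x) (if (?P x - p) *i n > 0 then G (?Q (?P x)) + (e *i G (?Q (?P x))) *r gs (?P x)
    else rfl0 n (G (?Q (?R (?P x))) + (e *i G (?Q (?R (?P x)))) *r gs (?R (?P x)))) = extG p n e s gs G x"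
   unfolding PQ(2) r extG_def hgt_def arho_def g Let_def by (simp add: frame_gs inner_add_right)
 qed
 have "ball p (r / 2) \<subseteq> ?P -` ?V"
 proof
  fix x assume "x \<in> ball p (r / 2)"
  hence n: "norm (x - p) < r / 2" by (simp add: dist_nm)
  hence "norm (?P x - p) < 4 * r / 5" using shear_norm(1)[of x] norm_ge_zero[of "x - p"] by linarith
  thus "x \<in> ?P -` ?V" by (simp add: dist_nm)
 qed
 with w3[unfolded e1 e2] show ?thesis by (rule wgrad_mono)
qed

lemma extG_bound:
 assumes "AE x in lborel. norm (G x) <= K" shows "AE x in lborel. norm (extG p n e s gs G x) <= 5 * K"
proof -
 have "mpres (rho p n e s)" and b: "!!x k. norm (arho p n e s gs x k) <= 5 * norm k" using cmap_rho by (auto simp: cmap_def)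
 from mpres_AE[OF this(1) assms] assms show ?thesis
 proof eventually_elim
  case (elim x)
  have "0 <= K" using elim norm_ge_zero order_trans by blast
  thus ?case using elim b[of x "G (rho p n e s x)"] by (auto simp: extG_def)
 qed
qed

end

section \<open>Boundary charts, the outer normal and uniform frames\<close>

definition emb3 :: "real^2 => real => real^3" where
 "emb3 v c = vector [v $ 1, v $ 2, c]"

lemma drop3_nth [simp]: "drop3 y $ 1 = y $ 1" "drop3 y $ 2 = y $ 2" by (simp_all add: drop3_def)

lemma emb3_nth [simp]: "emb3 v c $ 1 = v $ 1" "emb3 v c $ 2 = v $ 2" "emb3 v c $ 3 = c" by (simp_all add: emb3_def)

lemma drop3_linear: "drop3 (x + y) = drop3 x + drop3 y" "drop3 (x - y) = drop3 x - drop3 y" "drop3 (c *r x) = c *r drop3 x"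
 "drop3 0 = 0" "drop3 (axis 3 1) = 0" "drop3 (emb3 v c) = v" by (simp_all add: vec_eq_iff forall_2 axis_def)

lemma emb3_inner: "emb3 v c *i y = v *i drop3 y + c * y $ 3" by (simp add: inner_vec_def sum_3 sum_2)

lemma emb3_norm: "(norm (emb3 v c))^2 = (norm v)^2 + c^2" unfolding power2_norm_eq_inner by (simp add: inner_vec_def sum_3 sum_2 power2_eq_square)

lemma emb3_linear: "emb3 v c - emb3 w d = emb3 (v - w) (c - d)" "a *r emb3 v c = emb3 (a *r v) (a * c)" "emb3 v c + emb3 w d = emb3 (v + w) (c + d)"
 "- emb3 v c = emb3 (- v) (- c)" by (simp_all add: vec_eq_iff forall_3)

lemma emb3_norm_ge: "c = 1 \<or> c = -1 ==> norm (emb3 v c) >= 1" "norm (emb3 v 0) = norm v" "norm (emb3 v 1) <= 1 + norm v"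
proof -
 show "norm (emb3 v c) >= 1" if "c = 1 \<or> c = -1"
 proof (rule power2_le_imp_le[OF _ norm_ge_zero])
  have "c^2 = 1" using that by auto
  thus "1^2 <= (norm (emb3 v c))^2" unfolding emb3_norm by simp
 qed
 have "(norm (emb3 v 0))^2 = (norm v)^2" unfolding emb3_norm by simp
 thus "norm (emb3 v 0) = norm v" by (rule power2_eq_imp_eq) simp_all
 show "norm (emb3 v 1) <= 1 + norm v"
 proof (rule power2_le_imp_le)
  show "(norm (emb3 v 1))^2 <= (1 + norm v)^2" unfolding emb3_norm by (simp add: power2_sum)
 qed simp
qed

lemma drop3_norm: "norm (drop3 y) <= norm y"
proof (rule power2_le_imp_le)
 show "(norm (drop3 y))^2 <= (norm y)^2" by (simp add: power2_norm_eq_inner inner_vec_def sum_3 sum_2)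
qed simp

lemma orth_inverse:
 assumes "orthogonal_transformation (T :: real^3 => real^3)"
 obtains S where "!!x. T (S x) = x" "!!x. S (T x) = x" "linear T" "linear S" "!!x y. T x *i T y = x *i y"
  "!!x y. T x *i y = x *i S y" "!!x. norm (T x) = norm x" "!!x. norm (S x) = norm x"
proof -
 have T: "linear T" "!!x y. T x *i T y = x *i y" "!!x. norm (T x) = norm x"
  using assms by (auto simp: orthogonal_transformation_def orthogonal_transformation_norm)
 have b: "bij T" by (rule orthogonal_transformation_bij[OF assms])
 let ?S = "inv T"
 have TS: "T (?S x) = x" "?S (T x) = x" for x using b by (auto simp: bij_def surj_f_inv_f inv_f_f)
 have "orthogonal_transformation ?S" by (rule orthogonal_transformation_inv[OF assms])
 hence S: "linear ?S" "!!x. norm (?S x) = norm x" by (auto simp: orthogonal_transformation_def orthogonal_transformation_norm)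
 have "T x *i y = x *i ?S y" for x y using T(2)[of x "?S y"] TS(1) by simp
 thus ?thesis using that[of ?S] T S TS by blast
qed

lemma chartD:
 assumes "boundary_chart Om p r T psi g"
 shows "r > 0" "orthogonal_transformation T" "psi 0 = 0" "u \<in> ball 0 r ==> (psi has_derivative (%h. g u *i h)) (at u)"
  "continuous_on (ball 0 r) g" "Om \<inter> ball p r = (%y. p + T y) ` {y \<in> ball 0 r. psi (drop3 y) < y $ 3}"
 using assms by (auto simp: boundary_chart_def)

lemma chart_mem:
 assumes c: "boundary_chart Om p r T psi g" and y: "norm y < r" shows "p + T y \<in> Om \<longleftrightarrow> psi (drop3 y) < y $ 3"
proof -
 obtain S where S: "!!x. S (T x) = x" "!!x. norm (T x) = norm x" by (rule orth_inverse[OF chartD(2)[OF c]]) (rule that)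
 have b: "p + T y \<in> ball p r" using y S(2) by (simp add: dist_norm)
 have "p + T y \<in> Om \<longleftrightarrow> p + T y \<in> (%y. p + T y) ` {y \<in> ball 0 r. psi (drop3 y) < y $ 3}"
  using b chartD(6)[OF c] by blast
 also have "... \<longleftrightarrow> psi (drop3 y) < y $ 3"
 proof
  assume "p + T y \<in> (%y. p + T y) ` {y \<in> ball 0 r. psi (drop3 y) < y $ 3}"
  then obtain z where "p + T y = p + T z" "psi (drop3 z) < z $ 3" by auto
  moreover from this have "y = z" using S(1) by (metis add_left_cancel)
  ultimately show "psi (drop3 y) < y $ 3" by simp
 qed (use y in auto)
 finally show ?thesis .
qed

text \<open>Along the ray from \<open>p\<close> in direction \<open>h\<close>, the chart compares
  the difference quotient of \<open>psi\<close> with the third coordinate of the direction. The sign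
  of \<open>h . v\<close> decides this comparison for all small \<open>t\<close>, which describes
  \<open>v\<close> by the set \<open>Om\<close> alone.\<close>

lemma chart_tangent:
 assumes c: "boundary_chart Om p r T psi g" and v: "v = T (sgn (emb3 (g 0) (-1)))"
 shows "h *i v < 0 ==> \<forall>\<^sub>F t in at_right 0. p + t *r h \<in> Om" "h *i v > 0 ==> \<forall>\<^sub>F t in at_right 0. p + t *r h \<notin> Om"
proof -
 obtain S where S: "!!x. T (S x) = x" "!!x. S (T x) = x" "linear T" "linear S" "!!x y. T x *i T y = x *i y"
  "!!x y. T x *i y = x *i S y" "!!x. norm (T x) = norm x" "!!x. norm (S x) = norm x" by (rule orth_inverse[OF chartD(2)[OF c]]) (rule that)
 define k where "k = S h"
 have r: "r > 0" by (rule chartD(1)[OF c])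
 let ?W = "norm (emb3 (g 0) (-1))"
 have W: "?W > 0" using emb3_norm_ge(1)[OF disjI2[OF refl], of "g 0"] by linarith
 have hv: "h *i v = (g 0 *i drop3 k - k $ 3) / ?W"
  unfolding v k_def inner_commute[of h] S(6) by (simp add: sgn_div_norm emb3_inner divide_inverse mult.commute)
 have line: "((%t. t *r drop3 k) has_derivative (%t. t *r drop3 k)) (at (0::real))" by (auto intro!: derivative_eq_intros)
 have "(psi has_derivative (%h. g 0 *i h)) (at (0 *r drop3 k))" using chartD(4)[OF c, of 0] r by simp
 from has_derivative_compose[OF line this]
 have "((%t. psi (t *r drop3 k)) has_real_derivative g 0 *i drop3 k) (at 0)" unfolding has_field_derivative_def by (rule has_derivative_eq_rhs) auto
 hence lim: "((%t. psi (t *r drop3 k) / t) \<longlongrightarrow> g 0 *i drop3 k) (at_right 0)"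
  using chartD(3)[OF c] by (auto simp: DERIV_def intro: tendsto_within_subset)
 have small: "\<forall>\<^sub>F t in at_right 0. norm (t *r k) < r"
 proof -
  have "((%t. norm (t *r k)) \<longlongrightarrow> norm (0 *r k)) (at_right 0)" by (intro tendsto_intros)
  thus ?thesis using r by (intro order_tendstoD(2)) auto
 qed
 have pos: "\<forall>\<^sub>F t in at_right (0::real). t > 0" by (rule eventually_at_right_less)
 have mem: "p + t *r h \<in> Om \<longleftrightarrow> psi (t *r drop3 k) / t < k $ 3" if "norm (t *r k) < r" "t > 0" for t
 proof -
  have "t *r h = T (t *r k)" using S(1) linear_scale[OF S(3)] by (simp add: k_def)
  thus ?thesis using chart_mem[OF c that(1)] that(2) by (simp add: drop3_linear divide_less_eq mult.commute)
 qed
 show "\<forall>\<^sub>F t in at_right 0. p + t *r h \<in> Om" if "h *i v < 0"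
 proof -
  have "g 0 *i drop3 k < k $ 3" using that W by (simp add: hv divide_less_0_iff)
  from order_tendstoD(2)[OF lim this] small pos show ?thesis by eventually_elim (simp add: mem)
 qed
 show "\<forall>\<^sub>F t in at_right 0. p + t *r h \<notin> Om" if "h *i v > 0"
 proof -
  have "g 0 *i drop3 k > k $ 3" using that W by (simp add: hv zero_less_divide_iff)
  from order_tendstoD(1)[OF lim this] small pos show ?thesis by eventually_elim (simp add: mem)
 qed
qed

text \<open>If two charts produced different unit vectors, the ray in the direction of their
  difference would enter the domain according to one chart and leave it according to the other. This
  makes the definite description in \<open>outer_normal\<close> meaningful.\<close>

lemma outer_normal_eq:
 assumes c: "boundary_chart Om p r T psi g" shows "outer_normal Om p = T (sgn (emb3 (g 0) (-1)))" unfolding outer_normal_def emb3_def[symmetric]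
proof (rule the_equality)
 show "\<exists>r T' psi g'. boundary_chart Om p r T' psi g' & T (sgn (emb3 (g 0) (-1))) = T' (sgn (emb3 (g' 0) (-1)))" using c by blast
 fix v' assume "\<exists>r T psi g. boundary_chart Om p r T psi g & v' = T (sgn (emb3 (g 0) (-1)))"
 then obtain r' T' psi' g' where c': "boundary_chart Om p r' T' psi' g'" and v': "v' = T' (sgn (emb3 (g' 0) (-1)))" by blast
 let ?v = "T (sgn (emb3 (g 0) (-1)))"
 have unit: "norm (T (sgn (emb3 (g 0) (-1)))) = 1" if cc: "boundary_chart Om p r T psi g" for r T psi g
 proof -
  obtain S :: "real^3 => real^3" where "!!x. norm (T x) = norm x" by (rule orth_inverse[OF chartD(2)[OF cc]]) (rule that)
  moreover have "emb3 (g 0) (-1) ~= 0" using emb3_norm_ge(1)[OF disjI2[OF refl], of "g 0"] by (metis norm_zero not_one_le_zero)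
  ultimately show ?thesis by (simp add: norm_sgn)
 qed
 show "v' = ?v"
 proof (rule ccontr)
  assume ne: "v' ~= ?v"
  have n: "norm v' = 1" "norm ?v = 1" using unit[OF c'] unit[OF c] v' by auto
  have "(norm (v' - ?v))^2 = 2 - 2 * (v' *i ?v)"
   using n by (simp add: power2_norm_eq_inner unit_inner[OF n(1)] unit_inner[OF n(2)] inner_diff_left inner_diff_right inner_commute)
  moreover have "(norm (v' - ?v))^2 > 0" using ne by simp
  ultimately have lt: "v' *i ?v < 1" by simp
  let ?h = "v' - ?v"
  have "?h *i ?v < 0" using lt unit_inner[OF n(2)] by (simp add: inner_diff_left)
  from chart_tangent(1)[OF c refl this] have 1: "\<forall>\<^sub>F t in at_right 0. p + t *r ?h \<in> Om" .
  have "?h *i v' > 0" using lt unit_inner[OF n(1)] by (simp add: inner_diff_left inner_commute[of ?v v'])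
  from chart_tangent(2)[OF c' v' this] have 2: "\<forall>\<^sub>F t in at_right 0. p + t *r ?h \<notin> Om" .
  from 1 2 have "\<forall>\<^sub>F t in at_right (0::real). False" by eventually_elim simp
  thus False by (simp add: eventually_False)
 qed
qed

text \<open>Recentring a chart at another point of its graph, with the same rotation, allows the
  outer normal there to be read off from \<open>g\<close> at that point.\<close>

lemma chart_shift:
 assumes c: "boundary_chart Om p r T psi g" and y: "norm y < r" "psi (drop3 y) = y $ 3"
 shows "boundary_chart Om (p + T y) (r - norm y) T (%v. psi (drop3 y + v) - psi (drop3 y)) (%v. g (drop3 y + v))" unfolding boundary_chart_def
proof (intro conjI ballI)
 obtain S where S: "!!x. T (S x) = x" "!!x. S (T x) = x" "linear T" "linear S" "!!x y. T x *i T y = x *i y"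
  "!!x y. T x *i y = x *i S y" "!!x. norm (T x) = norm x" "!!x. norm (S x) = norm x" by (rule orth_inverse[OF chartD(2)[OF c]]) (rule that)
 show "0 < r - norm y" using y by simp
 show "orthogonal_transformation T" by (rule chartD(2)[OF c])
 have bl: "drop3 y + v \<in> ball 0 r" if "v \<in> ball 0 (r - norm y)" for v using that norm_triangle_ineq[of "drop3 y" v] drop3_norm[of y] by simp
 show "((%v. psi (drop3 y + v) - psi (drop3 y)) has_derivative (*i) (g (drop3 y + v))) (at v)" if "v \<in> ball 0 (r - norm y)" for v
 proof -
  have "((%v. drop3 y + v) has_derivative (%h. h)) (at v)" by (auto intro!: derivative_eq_intros)
  from has_derivative_compose[OF this chartD(4)[OF c bl[OF that]]]
  show ?thesis by (auto intro!: derivative_eq_intros)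
 qed
 show "continuous_on (ball 0 (r - norm y)) (%v. g (drop3 y + v))"
 proof (rule continuous_on_compose2[OF chartD(5)[OF c]])
  show "(%v. drop3 y + v) ` ball 0 (r - norm y) \<subseteq> ball 0 r" using bl by blast
 qed (intro continuous_intros)
 show "Om \<inter> ball (p + T y) (r - norm y) = (%z. p + T y + T z) ` {z \<in> ball 0 (r - norm y). psi (drop3 y + drop3 z) - psi (drop3 y) < z $ 3}"
 proof (intro equalityI subsetI)
  fix x assume x: "x \<in> Om \<inter> ball (p + T y) (r - norm y)"
  let ?z = "S (x - (p + T y))"
  have xz: "x = p + T y + T ?z" by (simp add: S(1))
  have z: "norm ?z < r - norm y" using x by (simp add: S(8) dist_nm)
  have "norm (y + ?z) < r" using norm_triangle_ineq[of y ?z] z by simp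
  from chart_mem[OF c this] x have "psi (drop3 (y + ?z)) < (y + ?z) $ 3" using xz by (simp add: linear_add[OF S(3)] add.assoc)
  hence "psi (drop3 y + drop3 ?z) - psi (drop3 y) < ?z $ 3" using y(2) by (simp add: drop3_linear)
  thus "x \<in> (%z. p + T y + T z) ` {z \<in> ball 0 (r - norm y). psi (drop3 y + drop3 z) - psi (drop3 y) < z $ 3}"
   using xz z by (intro image_eqI[of _ _ ?z]) auto
 next
  fix x assume "x \<in> (%z. p + T y + T z) ` {z \<in> ball 0 (r - norm y). psi (drop3 y + drop3 z) - psi (drop3 y) < z $ 3}"
  then obtain z where z: "x = p + T y + T z" "norm z < r - norm y" "psi (drop3 y + drop3 z) - psi (drop3 y) < z $ 3" by auto
  have n: "norm (y + z) < r" using norm_triangle_ineq[of y z] z(2) by simp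
  have "p + T (y + z) \<in> Om" using chart_mem[OF c n] z(3) y(2) by (simp add: drop3_linear)
  thus "x \<in> Om \<inter> ball (p + T y) (r - norm y)" using z by (simp add: linear_add[OF S(3)] add.assoc dist_norm S(7))
 qed
qed simp

text \<open>The direction \<open>e\<close> is the vertical axis of a chart and in general not normal
  at \<open>p\<close>; the bound \<open>1 / K <= e . n\<close> keeps it uniformly transversal. The
  vector \<open>n - (e . n) gs x\<close> is the gradient of \<open>hgt\<close> (see
  \<open>hgt_C1\<close>), so the last clause says that the outer normal is minus the normalised
  gradient of the height.\<close>

definition gframe :: "(real^3) set => real => real => real => real^3 => real^3 => real^3 => (real^3 => real) => (real^3 => real^3) => bool" where
 "gframe Om al r K p n e s gs \<longleftrightarrow> frame p n e s gs & (\<forall>x. norm (gs x) <= K * norm (x - p) powr al) & 1 / K <= e *i n &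
  (\<forall>x\<in>ball p r. x \<in> Om \<longleftrightarrow> hgt p n e s x > 0) &
  (\<forall>x\<in>ball p r. hgt p n e s x = 0 --> x \<in> frontier Om & outer_normal Om x = - sgn (n - (e *i n) *r gs x))"

text \<open>The function \<open>psi\<close> minus its linearisation at \<open>w\<close>, cut off so that it is defined on the whole plane
  and its gradient is small everywhere.\<close>

lemma chart_remainder:
 fixes psi :: "real^2 => real" and g :: "real^2 => real^2"
 assumes der: "!!u. u \<in> ball 0 r ==> (psi has_derivative (%h. g u *i h)) (at u)" and cont: "continuous_on (ball 0 r) g"
  and H: "!!u v. u \<in> ball 0 r ==> v \<in> ball 0 r ==> dist (g u) (g v) <= K * dist u v powr al" and r: "r > 0" and al: "al > 0" and K: "K >= 0"
 shows "\<exists>de M. de > 0 & M > 0 & (\<forall>w. norm w < r / 4 --> (\<exists>q gq.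
  (\<forall>u. (q has_derivative (%h. gq u *i h)) (at u)) & continuous_on UNIV gq &
  (\<forall>u. norm (gq u) <= M * norm (u - w) powr al) & (\<forall>u. norm (gq u) <= 1 / 4) &
  (\<forall>u. norm (u - w) < de --> q u = psi u - psi w - g w *i (u - w) & gq u = g u - g w)))"
proof -
 obtain X X' B where X: "!!s::real. (X has_real_derivative X' s) (at s)" "continuous_on UNIV X'"
  "!!s. 0 <= X s" "!!s. X s <= 1" "!!s. s <= 1 ==> X s = 0" "!!s. s >= 2 ==> X s = 1"
  "!!s. s <= 1 \<or> s >= 2 ==> X' s = 0" "!!s. \<bar>X' s\<bar> <= B" "B > 0" by (rule cutoff_exists) (rule that)
 \<comment> \<open>The summand 1 covers the cut-off times \<open>g u - g w\<close>. The summand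
   \<open>4 * B\<close> covers the derivative of the cut-off, which lives where
   \<open>norm (u - w)^2 <= 2 * de^2\<close> and multiplies a remainder of order
   \<open>K * norm (u - w) powr (1 + al)\<close>.\<close>
 define M where "M = (K + 1) * (1 + 4 * B)"
 have M: "M > 0" using K X(9) by (simp add: M_def add_pos_pos)
 \<comment> \<open>The second entry makes \<open>M * t powr al\<close> at most 1/4 for
   \<open>t\<close> up to \<open>2 * de\<close>, which turns the Hoelder bound into the global slope
   bound 1/4; the first keeps the cut-off inside the chart.\<close>
 define de where "de = min (r / 8) ((1 / (4 * M)) powr (1 / al) / 2)"
 have de: "de > 0" "de <= r / 8" using r M by (auto simp: de_def)
 have small: "M * t powr al <= 1 / 4" if "0 <= t" "t <= 2 * de" for t
 proof -
  have "t <= (1 / (4 * M)) powr (1 / al)" using that(2) by (simp add: de_def)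
  hence "t powr al <= ((1 / (4 * M)) powr (1 / al)) powr al" using that(1) al by (intro powr_mono2) auto
  also have "... = 1 / (4 * M)" using M al by (simp add: powr_powr)
  finally show ?thesis using M by (simp add: field_simps)
 qed
 have main: "\<exists>q gq. (\<forall>u. (q has_derivative (%h. gq u *i h)) (at u)) & continuous_on UNIV gq &
  (\<forall>u. norm (gq u) <= M * norm (u - w) powr al) & (\<forall>u. norm (gq u) <= 1 / 4) &
  (\<forall>u. norm (u - w) < de --> q u = psi u - psi w - g w *i (u - w) & gq u = g u - g w)" if w: "norm w < r / 4" for w
 proof -
  let ?m = "%u. (norm (u - w))^2 / de^2"
  let ?z = "%u. psi u - psi w - g w *i (u - w)"
  define q where "q u = (1 - X (?m u)) * ?z u" for u
  define gq where "gq u = (1 - X (?m u)) *r (g u - g w) - (?z u * X' (?m u) * (2 / de^2)) *r (u - w)" for u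
  have inr: "u \<in> ball 0 r" if "norm (u - w) < r / 2" for u
  proof -
   have "norm u <= norm (u - w) + norm w" using norm_triangle_ineq[of "u - w" w] by simp
   thus ?thesis using that w r by simp
  qed
  have win: "w \<in> ball 0 r" using w r by simp
  have far: "X (?m u) = 1 & X' (?m u) = 0" if "norm (u - w) >= 2 * de" for u
  proof -
   have "(2 * de)^2 <= (norm (u - w))^2" using that de(1) by (intro power_mono) auto
   hence "4 * de^2 <= (norm (u - w))^2" by (simp add: power_mult_distrib)
   moreover have "0 <= de^2" by simp
   ultimately have "2 * de^2 <= (norm (u - w))^2" by linarith
   hence "?m u >= 2" using de(1) by (simp add: le_divide_eq)
   thus ?thesis using X(6,7) by blast
  qed
  have near: "X (?m u) = 0 & X' (?m u) = 0" if "norm (u - w) < de" for u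
  proof -
   have "(norm (u - w))^2 <= de^2" using that by (intro power_mono) auto
   hence "?m u <= 1" using de(1) by (simp add: field_simps)
   thus ?thesis using X(5,7) by blast
  qed
  have dm: "(?m has_derivative (%h. (2 / de^2) * ((u - w) *i h))) (at u)" for u
  proof -
   have eq: "?m = (%u. (1 / de^2) * ((u - w) *i (u - w)))" by (simp add: power2_norm_eq_inner)
   have "((%u. (u - w) *i (u - w)) has_derivative (%h. 2 * ((u - w) *i h))) (at u)" by (auto intro!: derivative_eq_intros simp: inner_commute)
   from has_derivative_mult_right[OF this, of "1 / de^2"] show ?thesis unfolding eq by (rule has_derivative_eq_rhs) auto
  qed
  have dX: "((%u. X (?m u)) has_derivative (%h. X' (?m u) * ((2 / de^2) * ((u - w) *i h)))) (at u)" for u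
   using has_derivative_compose[OF dm X(1)[of "?m u", unfolded has_field_derivative_def]] by simp
  have cm: "continuous_on UNIV ?m" by (intro continuous_intros) (use de in auto)
  have cX: "continuous_on UNIV X" using X(1) by (meson DERIV_isCont continuous_at_imp_continuous_on)
  have cc: "continuous_on S (%u. X (?m u))" "continuous_on S (%u. X' (?m u))" for S
   by (rule continuous_on_compose2[OF cX continuous_on_subset[OF cm]], auto,
     rule continuous_on_compose2[OF X(2) continuous_on_subset[OF cm]], auto)
  have d: "(q has_derivative (%h. gq u *i h)) (at u)" for u
  proof (cases "norm (u - w) < r / 2")
   case True
   have dz: "(?z has_derivative (%h. (g u - g w) *i h)) (at u)" by (auto intro!: derivative_eq_intros der[OF inr[OF True]] simp: inner_diff_left)
   have "((%u. 1 - X (?m u)) has_derivative (%h. - (X' (?m u) * ((2 / de^2) * ((u - w) *i h))))) (at u)"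
    by (rule has_derivative_eq_rhs[OF has_derivative_diff[OF has_derivative_const dX]]) simp
   from has_derivative_mult[OF this dz] show ?thesis unfolding q_def[abs_def]
   proof (rule has_derivative_eq_rhs, intro ext)
    fix h
    have "gq u *i h = (1 - X (?m u)) * ((g u - g w) *i h) - (?z u * X' (?m u) * (2 / de^2)) * ((u - w) *i h)"
     by (simp only: gq_def inner_diff_left[of "(1 - X (?m u)) *r (g u - g w)"] inner_scaleR_left)
    thus "(1 - X (?m u)) * ((g u - g w) *i h) + - (X' (?m u) * ((2 / de^2) * ((u - w) *i h))) * ?z u = gq u *i h" by (simp only:) (simp add: mult_ac)
   qed
  next
   case False
   hence u: "u \<in> - cball w (2 * de)" using de r by (auto simp: dist_nm)
   have z: "gq u = 0" using far[of u] u by (simp add: gq_def dist_nm)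
   have "(q has_derivative (%h. 0)) (at u)" by (rule has_derivative_transform_within_open[where f="%_. 0" and s="- cball w (2 * de)"])
     (use u far in \<open>auto simp: q_def dist_nm\<close>)
   thus ?thesis using z by simp
  qed
  have zc: "continuous_on (ball w (r / 2)) ?z"
  proof -
   have "continuous_on (ball w (r / 2)) psi"
   proof (rule continuous_at_imp_continuous_on, intro ballI)
    fix u assume "u \<in> ball w (r / 2)"
    hence "u \<in> ball 0 r" by (intro inr) (simp add: dist_nm)
    from has_derivative_continuous[OF der[OF this]] show "isCont psi u" .
   qed
   thus ?thesis by (intro continuous_intros)
  qed
  have gc: "continuous_on (ball w (r / 2)) g" by (rule continuous_on_subset[OF cont]) (use inr in \<open>auto simp: dist_nm\<close>)
  have c1: "continuous_on (ball w (r / 2)) gq" unfolding gq_def[abs_def] by (intro continuous_intros cc zc gc)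
  have c2: "continuous_on (- cball w (2 * de)) gq"
   by (rule continuous_on_eq[OF continuous_on_const[of _ 0]]) (use far in \<open>auto simp: gq_def dist_nm\<close>)
  have "continuous_on (ball w (r / 2) \<union> - cball w (2 * de)) gq" by (rule continuous_on_open_Un[OF open_ball _ c1 c2]) (simp add: open_Compl)
  moreover have "ball w (r / 2) \<union> - cball w (2 * de) = UNIV" using de r by auto
  ultimately have c: "continuous_on UNIV gq" by simp
  have hold: "norm (gq u) <= M * norm (u - w) powr al" for u
  proof (cases "norm (u - w) < 2 * de")
   case False
   hence "gq u = 0" using far[of u] by (simp add: gq_def)
   thus ?thesis using M by simp
  next
   case True
   let ?t = "norm (u - w)"
   have ub: "u \<in> ball 0 r" using True de r by (intro inr) simp
   have h1: "norm (g u - g w) <= K * ?t powr al" using H[OF ub win] by (simp add: dist_norm)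
   have h2: "\<bar>?z u\<bar> <= (K * ?t powr al) * ?t"
   proof -
    have "norm ((psi u - g w *i u) - (psi w - g w *i w)) <= (K * ?t powr al) * norm (u - w)"
    proof (rule differentiable_bound[where S="cball w ?t" and f="%x. psi x - g w *i x" and f'="%v h. (g v - g w) *i h"])
     fix v assume v: "v \<in> cball w ?t"
     hence vb: "v \<in> ball 0 r" using True de r by (intro inr) (simp add: dist_nm)
     show "((%x. psi x - g w *i x) has_derivative (%h. (g v - g w) *i h)) (at v within cball w ?t)"
      by (rule has_derivative_at_withinI) (auto intro!: derivative_eq_intros der[OF vb] simp: inner_diff_left)
     have "norm (g v - g w) <= K * norm (v - w) powr al" using H[OF vb win] by (simp add: dist_norm)
     also have "... <= K * ?t powr al" using v K al by (intro mult_left_mono powr_mono2) (auto simp: dist_nm)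
     finally show "onorm (%h. (g v - g w) *i h) <= K * ?t powr al" by (intro onorm_le) (use abs_inner_le in force)
    qed (auto simp: dist_nm)
    thus ?thesis by (simp add: inner_diff_right algebra_simps)
   qed
   have "norm (gq u) <= \<bar>1 - X (?m u)\<bar> * norm (g u - g w) + \<bar>?z u * X' (?m u) * (2 / de^2)\<bar> * ?t"
    unfolding gq_def using norm_triangle_ineq4 by (metis norm_scaleR)
   also have "... <= 1 * (K * ?t powr al) + (K * ?t powr al) * (4 * B)"
   proof (rule add_mono)
    show "\<bar>1 - X (?m u)\<bar> * norm (g u - g w) <= 1 * (K * ?t powr al)" using X(3,4)[of "?m u"] h1 by (intro mult_mono) auto
    show "\<bar>?z u * X' (?m u) * (2 / de^2)\<bar> * ?t <= (K * ?t powr al) * (4 * B)"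
    proof (cases "X' (?m u) = 0")
     case True
     thus ?thesis using K X(9) by simp
    next
     case False
     hence m2: "?m u <= 2" using X(7)[of "?m u"] by linarith
     have "\<bar>?z u * X' (?m u) * (2 / de^2)\<bar> * ?t = (\<bar>?z u\<bar> * \<bar>X' (?m u)\<bar>) * ((2 / de^2) * ?t)" by (simp add: abs_mult)
     also have "... <= (((K * ?t powr al) * ?t) * B) * ((2 / de^2) * ?t)" using h2 X(8)[of "?m u"] K by (intro mult_right_mono mult_mono) auto
     also have "... = (K * ?t powr al) * (B * (2 * ?m u))" by (simp add: power2_eq_square)
     also have "... <= (K * ?t powr al) * (B * (2 * 2))" using m2 K X(9) by (intro mult_left_mono) auto
     finally show ?thesis by (simp add: mult_ac)
    qed
   qed
   also have "... = (K * (1 + 4 * B)) * ?t powr al" by (simp add: algebra_simps)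
   also have "... <= M * ?t powr al" using X(9) by (intro mult_right_mono) (auto simp: M_def)
   finally show ?thesis .
  qed
  have quarter: "norm (gq u) <= 1 / 4" for u
  proof (cases "norm (u - w) < 2 * de")
   case True
   thus ?thesis using hold[of u] small[of "norm (u - w)"] by simp
  next
   case False
   hence "gq u = 0" using far[of u] by (simp add: gq_def)
   thus ?thesis by simp
  qed
  show ?thesis by (intro exI[of _ q] exI[of _ gq] conjI allI impI d c hold quarter) (use near in \<open>auto simp: q_def gq_def\<close>)
 qed
 show ?thesis using de(1) M main by blast
qed


lemma gframe_mono:
 assumes "gframe Om al r K p n e s gs" "r' <= r" "K <= K'" "0 < K" shows "gframe Om al r' K' p n e s gs" unfolding gframe_def
proof (intro conjI allI)
 show "frame p n e s gs" using assms(1) by (simp add: gframe_def)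
 show "norm (gs x) <= K' * norm (x - p) powr al" for x
 proof -
  have "norm (gs x) <= K * norm (x - p) powr al" using assms(1) by (simp add: gframe_def)
  also have "... <= K' * norm (x - p) powr al" using assms(3) by (intro mult_right_mono) auto
  finally show ?thesis .
 qed
 have "1 / K' <= 1 / K" using assms by (intro divide_left_mono) auto
 also have "... <= e *i n" using assms(1) by (simp add: gframe_def)
 finally show "1 / K' <= e *i n" .
 have sub: "x \<in> ball p r" if "x \<in> ball p r'" for x using that assms(2) by simp
 show "\<forall>x\<in>ball p r'. (x \<in> Om) = (0 < hgt p n e s x)" using assms(1) sub unfolding gframe_def by blast
 show "\<forall>x\<in>ball p r'. hgt p n e s x = 0 --> x \<in> frontier Om & outer_normal Om x = - sgn (n - (e *i n) *r gs x)"
  using assms(1) sub unfolding gframe_def by blast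
qed

text \<open>One chart at \<open>p0\<close> serves all frontier points near \<open>p0\<close>. For a
  point \<open>p\<close> with horizontal coordinate \<open>w\<close>, subtracting the linearisation
  of \<open>psi\<close> at \<open>w\<close> gives a function with zero value and slope at
  \<open>p\<close>, which becomes the shear over the tangent plane at \<open>p\<close>; the rotation
  and \<open>e\<close> stay the same. Hence \<open>r\<close> and \<open>K\<close> do not depend on
  \<open>p\<close>.\<close>

lemma chart_frames:
 assumes c: "boundary_chart Om p0 r0 T psi g" and H: "!!u v. u \<in> ball 0 r0 ==> v \<in> ball 0 r0 ==> dist (g u) (g v) <= K0 * dist u v powr al"
  and Om: "open Om" and al: "al > 0"
 shows "\<exists>r K. r > 0 & K > 0 & (\<forall>p\<in>frontier Om \<inter> ball p0 r. \<exists>n e s gs. gframe Om al r K p n e s gs)"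
proof -
 obtain S where S: "!!x. T (S x) = x" "!!x. S (T x) = x" "linear T" "linear S" "!!x y. T x *i T y = x *i y"
  "!!x y. T x *i y = x *i S y" "!!x. norm (T x) = norm x" "!!x. norm (S x) = norm x" by (rule orth_inverse[OF chartD(2)[OF c]]) (rule that)
 have r0: "r0 > 0" by (rule chartD(1)[OF c])
 have H': "dist (g u) (g v) <= \<bar>K0\<bar> * dist u v powr al" if "u \<in> ball 0 r0" "v \<in> ball 0 r0" for u v
 proof -
  have "dist (g u) (g v) <= K0 * dist u v powr al" by (rule H[OF that])
  also have "... <= \<bar>K0\<bar> * dist u v powr al" by (intro mult_right_mono) auto
  finally show ?thesis .
 qed
 obtain de M where de: "de > 0" and M: "M > 0" and Q: "!!w. norm w < r0 / 4 ==> \<exists>q gq.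
  (\<forall>u. (q has_derivative (%h. gq u *i h)) (at u)) & continuous_on UNIV gq &
  (\<forall>u. norm (gq u) <= M * norm (u - w) powr al) & (\<forall>u. norm (gq u) <= 1 / 4) &
  (\<forall>u. norm (u - w) < de --> q u = psi u - psi w - g w *i (u - w) & gq u = g u - g w)"
  using chart_remainder[OF chartD(4)[OF c] chartD(5)[OF c] H' r0 al] by auto
 define K1 where "K1 = 1 + norm (g 0) + \<bar>K0\<bar> * r0 powr al"
 have K1: "K1 >= 1" by (simp add: K1_def)
 have gb: "norm (g w) <= norm (g 0) + \<bar>K0\<bar> * r0 powr al" if "w \<in> ball 0 r0" for w
 proof -
  have "norm (g w) <= norm (g 0) + dist (g w) (g 0)" using norm_triangle_ineq[of "g 0" "g w - g 0"] by (simp add: dist_norm)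
  also have "dist (g w) (g 0) <= \<bar>K0\<bar> * dist w 0 powr al" using that r0 by (intro H') auto
  also have "... <= \<bar>K0\<bar> * r0 powr al" using that al by (intro mult_left_mono powr_mono2) auto
  finally show ?thesis by simp
 qed
 define r where "r = min (r0 / 8) de"
 have r: "r > 0" "r <= r0 / 8" "r <= de" using r0 de by (auto simp: r_def)
 have "\<exists>n e s gs. gframe Om al r (M + K1) p n e s gs" if p: "p \<in> frontier Om \<inter> ball p0 r" for p
 proof -
  let ?y = "S (p - p0)"
  let ?w = "drop3 ?y"
  have py: "p = p0 + T ?y" by (simp add: S(1))
  have yn: "norm ?y < r" using p by (simp add: S(8) dist_nm)
  hence wn: "norm ?w < r0 / 4" using drop3_norm[of ?y] r r0 by simp
  hence wb: "?w \<in> ball 0 r0" using r0 by simp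
  have yr0: "norm ?y < r0" using yn r r0 by simp
  \<comment> \<open>The chart describes only the points of \<open>Om\<close>. That a frontier point
    lies on the graph follows from both sides: it is not in the open set \<open>Om\<close>, and it
    is a limit of points of \<open>Om\<close>.\<close>
  have wy: "psi ?w = ?y $ 3"
  proof (rule antisym)
   have "p \<notin> Om" using p Om by (simp add: frontier_def interior_open)
   hence "p0 + T ?y \<notin> Om" using py by simp
   thus "?y $ 3 <= psi ?w" using chart_mem[OF c yr0] by simp
   have "p \<in> closure Om" using p by (simp add: frontier_def)
   then obtain X where X: "!!k. X k \<in> Om" "X \<longlonglongrightarrow> p" by (auto simp: closure_sequential)
   have bS: "bounded_linear S" using S(4) by (simp add: linear_conv_bounded_linear)
   have z: "(%k. S (X k - p0)) \<longlonglongrightarrow> ?y" by (intro bounded_linear.tendsto[OF bS] tendsto_intros X)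
   have "linear drop3" by (rule linearI) (auto simp: drop3_linear)
   hence bd: "bounded_linear drop3" by (simp add: linear_conv_bounded_linear)
   have "isCont psi ?w" by (rule has_derivative_continuous[OF chartD(4)[OF c wb]])
   from isCont_tendsto_compose[OF this bounded_linear.tendsto[OF bd z]]
   have l1: "(%k. psi (drop3 (S (X k - p0)))) \<longlonglongrightarrow> psi ?w" .
   have l2: "(%k. S (X k - p0) $ 3) \<longlonglongrightarrow> ?y $ 3" by (intro tendsto_vec_nth z)
   have "\<forall>\<^sub>F k in sequentially. norm (S (X k - p0)) < r0" by (rule order_tendstoD(2)[OF tendsto_norm[OF z] yr0])
   hence "\<forall>\<^sub>F k in sequentially. psi (drop3 (S (X k - p0))) <= S (X k - p0) $ 3"
   proof eventually_elim
    case (elim k)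
    have "p0 + T (S (X k - p0)) \<in> Om" using X(1)[of k] by (simp add: S(1))
    thus ?case using chart_mem[OF c elim] by simp
   qed
   from tendsto_le[OF _ l2 l1 this] show "psi ?w <= ?y $ 3" by simp
  qed
  obtain q gq where q: "!!u. (q has_derivative (%h. gq u *i h)) (at u)" "continuous_on UNIV gq"
  "!!u. norm (gq u) <= M * norm (u - ?w) powr al" "!!u. norm (gq u) <= 1 / 4"
  "!!u. norm (u - ?w) < de ==> q u = psi u - psi ?w - g ?w *i (u - ?w) & gq u = g u - g ?w" using Q[OF wn] by blast
  let ?\<pi> = "%x. drop3 (S (x - p0))"
  define e where "e = T (axis 3 1)"
  define N where "N = emb3 (- g ?w) 1"
  define n where "n = T (sgn N)"
  define s where "s = (%x. q (?\<pi> x))"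
  define gs where "gs = (%x. T (emb3 (gq (?\<pi> x)) 0))"
  let ?W = "norm N"
  have W1: "?W >= 1" unfolding N_def using emb3_norm_ge(1)[OF disjI1[OF refl]] .
  hence W0: "?W > 0" by linarith
  have W2: "?W <= K1" unfolding N_def K1_def using emb3_norm_ge(3)[of "- g ?w"] gb[OF wb] by simp
  have \<pi>p: "?\<pi> p = ?w" by simp
  have \<pi>d: "norm (?\<pi> x - ?w) <= norm (x - p)" for x
  proof -
   have "?\<pi> x - ?w = drop3 (S (x - p))" by (simp add: drop3_linear(2)[symmetric] linear_diff[OF S(4), symmetric])
   thus ?thesis using drop3_norm[of "S (x - p)"] S(8) by simp
  qed
  have \<pi>e: "?\<pi> (x + ta *r e) = ?\<pi> x" for x ta
  proof -
   have "S (x + ta *r e - p0) = S (x - p0) + ta *r axis 3 1"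
    using linear_add[OF S(4), of "x - p0" "ta *r e"] linear_scale[OF S(4)] S(2) by (simp add: e_def algebra_simps)
   thus ?thesis by (simp add: drop3_linear)
  qed
  have blS: "bounded_linear (%h. drop3 (S h))"
  proof -
   have "linear (%h. drop3 (S h))" by (rule linearI) (auto simp: drop3_linear linear_add[OF S(4)] linear_scale[OF S(4)])
   thus ?thesis by (simp add: linear_conv_bounded_linear)
  qed
  have \<pi>lin: "?\<pi> = (%x. drop3 (S x) - drop3 (S p0))" by (auto simp: fun_eq_iff linear_diff[OF S(4)] drop3_linear)
  have d\<pi>: "(?\<pi> has_derivative (%h. drop3 (S h))) (at x)" for x unfolding \<pi>lin
   by (rule has_derivative_eq_rhs[OF has_derivative_diff[OF bounded_linear_imp_has_derivative[OF blS] has_derivative_const]]) simp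
  have c\<pi>: "continuous_on UNIV ?\<pi>" using d\<pi> has_derivative_continuous continuous_at_imp_continuous_on by blast
  have C1s: "C1 s gs" unfolding C1_def
  proof (intro conjI allI)
   fix x
   from has_derivative_compose[OF d\<pi> q(1)]
   show "(s has_derivative (*i) (gs x)) (at x)" unfolding s_def gs_def by (rule has_derivative_eq_rhs) (auto simp: S(6) emb3_inner)
   have "linear (%v. T (emb3 v 0))" by (rule linearI) (simp_all add: linear_add[OF S(3), symmetric] linear_scale[OF S(3), symmetric] emb3_linear)
   hence "bounded_linear (%v. T (emb3 v 0))" by (simp add: linear_conv_bounded_linear)
   from bounded_linear.continuous_on[OF this, of UNIV "%x. gq (?\<pi> x)"]
   show "continuous_on UNIV gs" unfolding gs_def using continuous_on_compose2[OF q(2) c\<pi>] by simp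
  qed
  have gsn: "norm (gs x) = norm (gq (?\<pi> x))" for x by (simp add: gs_def S(7) emb3_norm_ge(2))
  have en: "e *i n = 1 / ?W" by (simp add: e_def n_def S(5) sgn_div_norm inner_axis' N_def divide_inverse)
  have nn: "norm n = 1" using W0 by (auto simp: n_def S(7) norm_sgn)
  have fr: "frame p n e s gs" unfolding frame_def
  proof (intro conjI allI)
   show "norm e = 1" by (simp add: e_def S(7) norm_axis_1)
   show "0 < e *i n" using W0 by (simp add: en)
   show "s (x + ta *r e) = s x" for x ta unfolding s_def by (simp only: \<pi>e)
   show "s p = 0" using q(5)[of ?w] de by (simp add: s_def)
   show "norm (gs x) <= 1 / 4" for x using q(4) by (simp add: gsn)
  qed (use nn C1s in auto)
  \<comment> \<open>The linear terms of \<open>hgt\<close> and of the remainder \<open>s\<close>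
    cancel, so \<open>hgt\<close> is the vertical distance to the graph divided by
    \<open>?W\<close>. Its sign therefore decides membership in \<open>Om\<close>.\<close>
  have hg: "hgt p n e s x = (S (x - p0) $ 3 - psi (?\<pi> x)) / ?W" and gse: "gs x = T (emb3 (g (?\<pi> x) - g ?w) 0)" if x: "x \<in> ball p r" for x
  proof -
   let ?z = "S (x - p0)"
   have dl: "norm (?\<pi> x - ?w) < de" using \<pi>d[of x] x r(3) by (simp add: dist_nm)
   note qq = q(5)[OF dl]
   show "gs x = T (emb3 (g (?\<pi> x) - g ?w) 0)" using qq by (simp add: gs_def)
   have "x - p = T (?z - ?y)" by (simp add: linear_diff[OF S(3)] S(1))
   hence "(x - p) *i n = (?z - ?y) *i sgn N" by (simp add: n_def S(5))
   also have "... = (N *i (?z - ?y)) / ?W" by (simp add: sgn_div_norm inner_commute divide_inverse mult.commute)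
   also have "N *i (?z - ?y) = - (g ?w *i (?\<pi> x - ?w)) + (?z $ 3 - ?y $ 3)" by (simp add: N_def emb3_inner drop3_linear)
   finally have "(x - p) *i n = (- (g ?w *i (?\<pi> x - ?w)) + (?z $ 3 - ?y $ 3)) / ?W" .
   moreover have "hgt p n e s x = (x - p) *i n - s x * (e *i n)" by (simp add: hgt_def inner_diff_left)
   moreover have "s x = psi (?\<pi> x) - ?y $ 3 - g ?w *i (?\<pi> x - ?w)" using qq wy by (simp add: s_def)
   ultimately show "hgt p n e s x = (?z $ 3 - psi (?\<pi> x)) / ?W"
    using W0 by (simp add: en diff_divide_distrib[symmetric] add_divide_distrib[symmetric])
  qed
  have mem: "x \<in> Om \<longleftrightarrow> psi (?\<pi> x) < S (x - p0) $ 3" and zr: "norm (S (x - p0)) < r0 / 2" if x: "x \<in> ball p r" for x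
  proof -
   have "norm (x - p0) <= norm (x - p) + norm (p - p0)" using norm_triangle_ineq[of "x - p" "p - p0"] by simp
   thus zr: "norm (S (x - p0)) < r0 / 2" using x p r r0 by (simp add: S(8) dist_nm)
   hence "norm (S (x - p0)) < r0" using r0 by simp
   from chart_mem[OF c this] show "x \<in> Om \<longleftrightarrow> psi (?\<pi> x) < S (x - p0) $ 3" by (simp add: S(1))
  qed
  have "gframe Om al r (M + K1) p n e s gs" unfolding gframe_def
  proof (intro conjI allI ballI fr)
   fix x
   have "norm (gs x) <= M * norm (?\<pi> x - ?w) powr al" using q(3) by (simp add: gsn)
   also have "... <= (M + K1) * norm (x - p) powr al" using \<pi>d[of x] M K1 al by (intro mult_mono powr_mono2) auto
   finally show "norm (gs x) <= (M + K1) * norm (x - p) powr al" .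
  next
   have "0 < (M + K1) * ?W" using W0 M K1 by (intro mult_pos_pos) auto
   hence "1 / (M + K1) <= 1 / ?W" using W2 M by (intro divide_left_mono) auto
   thus "1 / (M + K1) <= e *i n" by (simp add: en)
  next
   fix x assume x: "x \<in> ball p r"
   show "(x \<in> Om) = (0 < hgt p n e s x)" using mem[OF x] hg[OF x] W0 by (simp add: zero_less_divide_iff)
  next
   fix x assume x: "x \<in> ball p r"
   show "hgt p n e s x = 0 --> x \<in> frontier Om & outer_normal Om x = - sgn (n - (e *i n) *r gs x)"
   proof
    assume h0: "hgt p n e s x = 0"
    let ?z = "S (x - p0)"
    have z3: "psi (drop3 ?z) = ?z $ 3" using h0 hg[OF x] W0 by simp
    have "x \<notin> Om" using mem[OF x] z3 by simp
    moreover have "x \<in> closure Om" unfolding closure_approachable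
    proof (intro allI impI)
     fix ep :: real assume ep: "ep > 0"
     define t where "t = min (ep / 2) (r0 / 2)"
     have t: "t > 0" "t < ep" "t <= r0 / 2" using ep r0 by (auto simp: t_def)
     have "norm (?z + t *r axis 3 1) <= norm ?z + t" using norm_triangle_ineq[of ?z "t *r axis 3 1"] t by (simp add: norm_axis_1)
     hence n: "norm (?z + t *r axis 3 1) < r0" using zr[OF x] t by simp
     have "p0 + T (?z + t *r axis 3 1) \<in> Om" using chart_mem[OF c n] z3 t(1) by (simp add: drop3_linear)
     moreover have "p0 + T (?z + t *r axis 3 1) = x + t *r e" by (simp add: linear_add[OF S(3)] S(1) linear_scale[OF S(3)] e_def)
     moreover have "dist (x + t *r e) x < ep" using t by (simp add: dist_norm e_def S(7) norm_axis_1)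
     ultimately show "\<exists>y\<in>Om. dist y x < ep" by metis
    qed
    ultimately have fx: "x \<in> frontier Om" using Om by (simp add: frontier_def interior_open)
    have "norm ?z < r0" using zr[OF x] r0 by simp
    from outer_normal_eq[OF chart_shift[OF c this z3]]
    have o: "outer_normal Om x = T (sgn (emb3 (g (drop3 ?z)) (-1)))" by (simp add: S(1))
    have "n - (e *i n) *r gs x = (1 / ?W) *r T (emb3 (- g (drop3 ?z)) 1)"
    proof -
     have "n - (e *i n) *r gs x = (1 / ?W) *r (T N - gs x)"
     proof -
      have "n = (1 / ?W) *r T N" by (simp add: n_def sgn_div_norm linear_scale[OF S(3)] divide_inverse)
      thus ?thesis unfolding en by (simp only: scaleR_diff_right)
     qed
     also have "T N - gs x = T (emb3 (- g (drop3 ?z)) 1)" unfolding gse[OF x] N_def by (simp add: linear_diff[OF S(3), symmetric] emb3_linear)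
     finally show ?thesis .
    qed
    hence "sgn (n - (e *i n) *r gs x) = sgn (T (emb3 (- g (drop3 ?z)) 1))" using W0 by (simp add: sgn_scaleR)
    also have "... = T (sgn (emb3 (- g (drop3 ?z)) 1))" by (simp add: sgn_div_norm S(7) linear_scale[OF S(3)])
    also have "emb3 (- g (drop3 ?z)) 1 = - emb3 (g (drop3 ?z)) (-1)" by (simp add: emb3_linear)
    finally have "- sgn (n - (e *i n) *r gs x) = T (sgn (emb3 (g (drop3 ?z)) (-1)))" by (simp add: sgn_minus linear_neg[OF S(3)])
    thus "x \<in> frontier Om & outer_normal Om x = - sgn (n - (e *i n) *r gs x)" using fx o by simp
   qed
  qed
  thus ?thesis by blast
 qed
 moreover have "M + K1 > 0" using M K1 by simp
 ultimately show ?thesis using r(1) by blast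
qed

text \<open>The frontier is compact, so finitely many charts suffice and the least radius and
  largest constant work everywhere. This is where the dependence of the final constant on the shape
  of the domain enters.\<close>

lemma uniform_frames:
 assumes Om: "open Om" "bounded Om" and al: "al > 0" and C: "C1_holder_boundary Om al"
 shows "\<exists>r K. r > 0 & K >= 1 & (\<forall>p\<in>frontier Om. \<exists>n e s gs. gframe Om al r K p n e s gs)"
proof -
 have "\<exists>r K. r > 0 & K > 0 & (\<forall>p\<in>frontier Om \<inter> ball p0 r. \<exists>n e s gs. gframe Om al r K p n e s gs)" if p0: "p0 \<in> frontier Om" for p0
 proof -
  obtain r T psi g K where bc: "boundary_chart Om p0 r T psi g"
   and h: "\<forall>u\<in>ball 0 r. \<forall>v\<in>ball 0 r. dist (g u) (g v) <= K * dist u v powr al"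
   using C p0 unfolding C1_holder_boundary_def by blast
  show ?thesis by (rule chart_frames[where ?K0.0=K, OF bc _ Om(1) al]) (use h in blast)
 qed
 then obtain r K where rK: "!!p0. p0 \<in> frontier Om ==> r p0 > 0 & K p0 > 0 & (\<forall>p\<in>frontier Om \<inter> ball p0 (r p0). \<exists>n e s gs. gframe Om al (r p0) (K p0) p n e s gs)"
  by metis
 have "compact (frontier Om)" using Om(2) by (rule compact_frontier_bounded)
 moreover have "frontier Om \<subseteq> (\<Union>p\<in>frontier Om. ball p (r p))" using rK by force
 ultimately obtain P where P: "P \<subseteq> frontier Om" "finite P" "frontier Om \<subseteq> (\<Union>p\<in>P. ball p (r p))"
  using compactE_image[of "frontier Om" "frontier Om" "%p. ball p (r p)"] by (metis open_ball)
 define r' where "r' = Min (insert 1 (r ` P))"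
 define K' where "K' = Max (insert 1 (K ` P))"
 have r': "r' > 0" unfolding r'_def using P rK by (subst Min_gr_iff) auto
 have K': "K' >= 1" unfolding K'_def using P by (intro Max_ge) auto
 have "\<exists>n e s gs. gframe Om al r' K' p n e s gs" if p: "p \<in> frontier Om" for p
 proof -
  obtain p0 where p0: "p0 \<in> P" "p \<in> ball p0 (r p0)" using P(3) p by blast
  hence f: "p0 \<in> frontier Om" using P(1) by blast
  obtain n e s gs where g: "gframe Om al (r p0) (K p0) p n e s gs" using rK[OF f] p p0(2) by blast
  have "r' <= r p0" unfolding r'_def using P(2) p0(1) by (intro Min_le) auto
  moreover have "K p0 <= K'" unfolding K'_def using P(2) p0(1) by (intro Max_ge) auto
  ultimately have "gframe Om al r' K' p n e s gs" using gframe_mono[OF g] rK[OF f] by blast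
  thus ?thesis by blast
 qed
 thus ?thesis using r' K' by blast
qed

section \<open>Boundary flux\<close>

text \<open>The data of the boundary value problem, extended by zero outside \<open>Om\<close>; the bound on \<open>f\<close> is
  what remains of its \<open>L\<^sup>q\<close> norm after Hoelder's inequality with \<open>q = 3 / (1 - al)\<close>.\<close>

definition pdata where
 "pdata Om al lam Lam sg gsg F f M \<longleftrightarrow> wgrad Om sg gsg & (\<forall>x. x \<notin> Om --> sg x = 0) &
  (\<forall>x\<in>Om. lam <= sg x & sg x <= 1 / lam) & (\<forall>x. norm (gsg x) <= Lam) &
  continuous_on (closure Om) F & F \<in> Bm & wdiv Om (%x. sg x *r F x) f & (\<forall>x. x \<notin> Om --> f x = 0) &
  (\<forall>y t. 0 < t --> (LBINT x. indicator (cball y t) x * \<bar>f x\<bar>) <= 16 * M * t powr (2 + al)) &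
  (\<forall>x\<in>frontier Om. \<bar>F x *i outer_normal Om x\<bar> <= M) &
  (\<forall>x\<in>frontier Om. \<forall>y\<in>frontier Om. \<bar>F x *i outer_normal Om x - F y *i outer_normal Om y\<bar> <= M * dist x y powr al) & 0 < M"

lemma pdataD:
 assumes "pdata Om al lam Lam sg gsg F f M"
 shows "wgrad Om sg gsg" "x \<notin> Om ==> sg x = 0" "x \<in> Om ==> lam <= sg x" "x \<in> Om ==> sg x <= 1 / lam" "norm (gsg x) <= Lam"
  "continuous_on (closure Om) F" "F \<in> Bm" "wdiv Om (%x. sg x *r F x) f" "x \<notin> Om ==> f x = 0"
  "0 < t ==> (LBINT x. indicator (cball y t) x * \<bar>f x\<bar>) <= 16 * M * t powr (2 + al)"
  "x \<in> frontier Om ==> \<bar>F x *i outer_normal Om x\<bar> <= M"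
  "x \<in> frontier Om ==> y \<in> frontier Om ==> \<bar>F x *i outer_normal Om x - F y *i outer_normal Om y\<bar> <= M * dist x y powr al" "0 < M"
 using assms unfolding pdata_def by blast+

lemma frame_cutoff_C1:
 assumes fr: "frame p n e s gs" and X: "!!s::real. (X has_real_derivative X' s) (at s)" "continuous_on UNIV X'"
 shows "C1 (%x. X (k * hgt p n e s x)) (%x. (X' (k * hgt p n e s x) * k) *r (n - (e *i n) *r gs x))"
 using C1_compose_real[OF C1_cmult[OF hgt_C1[OF fr], of k] X] by simp

lemma smooth_abs_deriv:
 assumes "et > 0" shows "((%s. sqrt (s^2 + et^2) - et) has_real_derivative s / sqrt (s^2 + et^2)) (at s)"
proof -
 have "s^2 + et^2 > 0" using assms by (simp add: add_nonneg_pos)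
 thus ?thesis by (auto intro!: derivative_eq_intros simp: field_simps)
qed

text \<open>A substitute for the trace inequality: the weight \<open>X' * k\<close> concentrates on
  a thin strip above the boundary. Since \<open>gs\<close> is orthogonal to \<open>e\<close>, the
  derivative of \<open>X (k * hgt)\<close> along \<open>e\<close> is exactly \<open>e . n\<close>
  times this weight, and integration by parts along \<open>e\<close> moves the derivative onto
  \<open>|V|\<close>.\<close>

lemma strip_bound:
 assumes fr: "frame p n e s gs" and V: "C1c U V DV" and k: "k > 0" and X: "!!s::real. (X has_real_derivative X' s) (at s)" "continuous_on UNIV X'"
  "!!s. 0 <= X s" "!!s. X s <= 1" "!!s. s <= 1 ==> X s = 0" "!!s. \<bar>X' s\<bar> <= B" "B > 0" "!!s. 0 <= X' s"
 shows "(e *i n) * (LBINT x. \<bar>V x\<bar> * (X' (k * hgt p n e s x) * k)) <= (LBINT x. indicator {x. hgt p n e s x > 0} x * norm (DV x))"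
proof -
 let ?H = "hgt p n e s"
 let ?x = "%x. X' (k * ?H x) * k"
 note fD = frameD[OF fr]
 note CV = C1c_C1[OF V]
 obtain L where L: "compact L" "L \<subseteq> U" "!!x. x \<notin> L ==> V x = 0" "!!x. x \<notin> L ==> DV x = 0" by (rule C1cE[OF V]) (rule that)
 note Cz = frame_cutoff_C1[OF fr X(1,2), of k]
 have Xm[measurable]: "X' \<in> Bm" using X(2) by (rule borel_measurable_continuous_onI)
 note [measurable] = C1_borel[OF Cz] C1_borel[OF hgt_C1[OF fr]] C1_borel[OF CV] C1_borel_grad[OF CV]
 have xb: "\<bar>?x x\<bar> <= B * k" for x using X(6)[of "k * ?H x"] k by (simp add: abs_mult)
 have x0: "0 <= ?x x" for x using X(8)[of "k * ?H x"] k by simp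
 have iV: "lint (%x. \<bar>V x\<bar> * ?x x)"
  using int_scaleR_bounded[of lborel "%x. \<bar>V x\<bar>" ?x "B * k"] C1c_integrable(1)[OF V] xb by simp
 have iL: "lint (indicator L :: _ => real)" by (rule integrable_indicator_compact[OF L(1)])
 have iD: "lint (%x. indicator {x. ?H x > 0} x * norm (DV x))"
  using int_bounded_scaleR[of lborel "%x. norm (DV x)" "indicator {x. ?H x > 0}" 1] C1c_integrable(2)[OF V] by (auto simp: indicator_def)
 let ?D = "LBINT x. indicator {x. ?H x > 0} x * norm (DV x)"
 have main: "(e *i n) * (LBINT x. \<bar>V x\<bar> * ?x x) - ?D <= et * ((e *i n) * (LBINT x. indicator L x * (B * k)))" if et: "et > 0" for et
 proof -
  \<comment> \<open>A C1 regularisation of the absolute value with slope at most one and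
    \<open>z 0 = 0\<close>; the latter keeps the support compact. The error \<open>et\<close> is
    removed at the end by \<open>le_all_eps\<close>.\<close>
  define z where "z = (%s. sqrt (s^2 + et^2) - et)"
  define z' where "z' = (%s. s / sqrt (s^2 + et^2))"
  have pos: "s^2 + et^2 > 0" for s using et by (simp add: add_nonneg_pos)
  have dz: "(z has_real_derivative z' s) (at s)" for s unfolding z_def z'_def by (rule smooth_abs_deriv[OF et])
  have cz: "continuous_on UNIV z'" unfolding z'_def using pos by (intro continuous_intros) (auto simp: less_imp_neq[symmetric])
  have z'b: "\<bar>z' s\<bar> <= 1" for s
  proof -
   have "\<bar>s\<bar> <= sqrt (s^2 + et^2)" by (rule real_le_rsqrt) simp
   thus ?thesis using pos[of s] by (simp add: z'_def)
  qed
  have zge: "\<bar>s\<bar> - et <= z s" for s unfolding z_def using real_le_rsqrt[of "\<bar>s\<bar>" "s^2 + et^2"] by simp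
  have z0: "z 0 = 0" using et by (simp add: z_def)
  have CW: "C1 (%x. z (V x)) (%x. z' (V x) *r DV x)" by (rule C1_compose_real[OF CV dz cz])
  have W: "C1c U (%x. z (V x)) (%x. z' (V x) *r DV x)" unfolding C1c_def using CW L z0 by (intro conjI exI[of _ L]) auto
  note t = C1c_mult[OF Cz W]
  have [measurable]: "(%x. z (V x)) \<in> Bm" "(%x. z' (V x) *r DV x) \<in> Bm" by (rule C1_borel[OF CW], rule C1_borel_grad[OF CW])
  have i1: "lint (%x. z (V x) * ?x x)" using int_scaleR_bounded[of lborel "%x. z (V x)" ?x "B * k"] C1c_integrable(1)[OF W] xb by simp
  let ?Z = "%x. X (k * ?H x) * (z' (V x) * (DV x *i e))"
  have bd: "\<bar>?Z x\<bar> <= indicator {x. ?H x > 0} x * norm (DV x)" for x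
  proof (cases "?H x > 0")
   case True
   have "\<bar>X (k * ?H x)\<bar> * (\<bar>z' (V x)\<bar> * \<bar>DV x *i e\<bar>) <= 1 * (1 * norm (DV x))"
    using X(3,4)[of "k * ?H x"] z'b Cauchy_Schwarz_ineq2[of "DV x" e] fD(2) by (intro mult_mono) auto
   thus ?thesis using True by (simp add: abs_mult)
  next
   case False
   hence "k * ?H x <= 1" using k mult_nonneg_nonpos[of k "?H x"] by simp
   thus ?thesis using X(5) False by simp
  qed
  have i2: "lint ?Z"
  proof (rule int_bound[OF iD])
   have "(%x. z' (V x) *r DV x *i e) \<in> Bm" by measurable
   hence [measurable]: "(%x. z' (V x) * (DV x *i e)) \<in> Bm" by simp
   show "?Z \<in> borel_measurable lborel" by measurable
  qed (use bd in simp)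
  have eq: "(z (V x) *r (?x x) *r (n - (e *i n) *r gs x) + X (k * ?H x) *r z' (V x) *r DV x) *i e
   = (e *i n) * (z (V x) * ?x x) + ?Z x" for x using frame_gs(3)[OF fr, of x] by (simp add: inner_add_left inner_diff_left inner_commute[of n e])
  have "0 = (LBINT x. z (V x) *r (?x x) *r (n - (e *i n) *r gs x) + X (k * ?H x) *r z' (V x) *r DV x) *i e" using C1c_integral_grad[OF t] by simp
  also have "... = (LBINT x. (z (V x) *r (?x x) *r (n - (e *i n) *r gs x) + X (k * ?H x) *r z' (V x) *r DV x) *i e)"
   using C1c_integrable(2)[OF t] by (intro integral_inner_left[symmetric]) simp
  also have "... = (LBINT x. (e *i n) * (z (V x) * ?x x) + ?Z x)" by (simp only: eq)
  also have "... = (e *i n) * (LBINT x. z (V x) * ?x x) + (LBINT x. ?Z x)" using i1 i2 by simp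
  finally have A: "(e *i n) * (LBINT x. z (V x) * ?x x) = - (LBINT x. ?Z x)" by simp
  have "- (LBINT x. ?Z x) <= ?D" using integral_norm_diff_le[OF i2 integrable_zero iD] bd by (simp add: abs_le_iff)
  hence Bd: "(e *i n) * (LBINT x. z (V x) * ?x x) <= ?D" using A by simp
  have "(LBINT x. \<bar>V x\<bar> * ?x x) <= (LBINT x. z (V x) * ?x x + et * (indicator L x * (B * k)))"
  proof (rule integral_mono)
   show "lint (%x. z (V x) * ?x x + et * (indicator L x * (B * k)))" using i1 iL by simp
   fix x
   show "\<bar>V x\<bar> * ?x x <= z (V x) * ?x x + et * (indicator L x * (B * k))"
   proof (cases "x \<in> L")
    case True
    have "\<bar>V x\<bar> * ?x x <= (z (V x) + et) * ?x x" using zge[of "V x"] x0[of x] by (intro mult_right_mono) auto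
    also have "... <= z (V x) * ?x x + et * (B * k)" using xb[of x] et by (simp add: distrib_right mult_left_mono)
    finally show ?thesis using True by simp
   qed (simp add: L(3) z0)
  qed (rule iV)
  also have "... = (LBINT x. z (V x) * ?x x) + et * (LBINT x. indicator L x * (B * k))" using i1 iL by simp
  finally have "(e *i n) * (LBINT x. \<bar>V x\<bar> * ?x x) <= (e *i n) * ((LBINT x. z (V x) * ?x x) + et * (LBINT x. indicator L x * (B * k)))"
   using fD(3) by (intro mult_left_mono) auto
  thus ?thesis using Bd by (simp add: algebra_simps)
 qed
 from le_all_eps[OF main] show ?thesis by simp
qed

lemma gframeD:
 assumes "gframe Om al r K p n e s gs" shows "frame p n e s gs" "norm (gs x) <= K * norm (x - p) powr al" "1 / K <= e *i n"
  "x \<in> ball p r ==> x \<in> Om \<longleftrightarrow> hgt p n e s x > 0"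
  "x \<in> ball p r ==> hgt p n e s x = 0 ==> x \<in> frontier Om"
  "x \<in> ball p r ==> hgt p n e s x = 0 ==> outer_normal Om x = - sgn (n - (e *i n) *r gs x)" using assms unfolding gframe_def by auto

lemma gframe_normal:
 assumes g: "gframe Om al r K p n e s gs" and "r > 0" "al > 0" shows "outer_normal Om p = - n" "p \<in> frontier Om"
proof -
 note fD = frameD[OF gframeD(1)[OF g]]
 have h: "hgt p n e s p = 0" by (simp add: hgt_def fD(6))
 have pb: "p \<in> ball p r" using assms(2) by simp
 have "gs p = 0" using gframeD(2)[OF g, of p] by simp
 thus "outer_normal Om p = - n" using gframeD(6)[OF g pb h] fD(1) by (simp add: sgn_div_norm)
 show "p \<in> frontier Om" by (rule gframeD(5)[OF g pb h])
qed

text \<open>The point \<open>x - ta e\<close> lies on the boundary, and the gradient of the height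
  there is the same vector as at \<open>x\<close> because \<open>gs\<close> is constant along
  \<open>e\<close>. The flux of \<open>F\<close> through that vector is thus a multiple of the
  prescribed normal flux, which is Hoelder continuous; moving from \<open>x\<close> down to the
  boundary costs only the continuity of \<open>F\<close>.\<close>

lemma boundary_flux:
 assumes g: "gframe Om al r K p n e s gs" and d: "pdata Om al lam Lam sg gsg F f M" and r: "r > 0" and al: "0 < al" "al < 1"
  and K: "K >= 1" and x: "x \<in> ball p r" "hgt p n e s x > 0" "norm (x - p) <= rh" and rh: "rh > 0"
  and ta: "ta = hgt p n e s x / (e *i n)" and xb: "x - ta *r e \<in> ball p r" and tarh: "ta <= rh"
  and cont: "norm (F x - F (x - ta *r e)) <= M * rh powr al"
 shows "\<bar>(F x - (F p *i n) *r n) *i (n - (e *i n) *r gs x)\<bar> <= 8 * K * M * rh powr al"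
proof -
 note fr = gframeD(1)[OF g]
 note fD = frameD[OF fr]
 let ?b = "x - ta *r e"
 define w where "w = n - (e *i n) *r gs x"
 define v where "v = (e *i n) *r gs x"
 have en: "e *i n <= 1" using Cauchy_Schwarz_ineq2[of e n] fD(1,2) by simp
 have M: "M > 0" by (rule pdataD(13)[OF d])
 have "norm v <= 1 * norm (gs x)" unfolding v_def norm_scaleR using en fD(3) by (intro mult_right_mono) auto
 hence v: "norm v <= norm (gs x)" by simp
 hence v4: "norm v <= 1 / 4" using fD(7)[of x] by linarith
 have "norm (gs x) <= K * norm (x - p) powr al" by (rule gframeD(2)[OF g])
 also have "... <= K * rh powr al" using x(3) K al by (intro mult_left_mono powr_mono2) auto
 finally have vr: "norm v <= K * rh powr al" using v by simp
 have wv: "w = n - v" by (simp add: w_def v_def)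
 have w2: "norm w <= 1 + norm v" unfolding wv using norm_triangle_ineq4[of n v] fD(1) by simp
 have nv: "\<bar>n *i v\<bar> <= norm v" using Cauchy_Schwarz_ineq2[of n v] fD(1) by simp
 have nw: "n *i w = 1 - n *i v" unfolding wv using unit_inner[OF fD(1)] by (simp add: inner_diff_right)
 have w0: "w ~= 0" using nw nv v4 by auto
 have hb: "hgt p n e s ?b = 0" using hgt_shift[OF fr, of x "- ta"] fD(3) by (simp add: ta)
 have bf: "?b \<in> frontier Om" by (rule gframeD(5)[OF g xb hb])
 have "outer_normal Om ?b = - sgn w" using gframeD(6)[OF g xb hb] frame_gs(2)[OF fr] by (simp add: w_def)
 hence wn: "w = - norm w *r outer_normal Om ?b" using w0 by (simp add: sgn_div_norm)
 note gn = gframe_normal[OF g r al(1)]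
 let ?gb = "F ?b *i outer_normal Om ?b"
 let ?gp = "F p *i outer_normal Om p"
 have "F ?b *i w = - norm w * ?gb" by (subst wn) simp
 moreover have "((F p *i n) *r n) *i w = - ?gp * (n *i w)" unfolding gn(1) by simp
 ultimately have e1: "(F ?b - (F p *i n) *r n) *i w = - (norm w * (?gb - ?gp)) - ?gp * (norm w - n *i w)" by (simp add: inner_diff_left algebra_simps)
 have ta0: "ta >= 0" using x(2) fD(3) by (simp add: ta)
 have "norm (?b - p) <= norm (x - p) + norm (ta *r e)" using norm_triangle_ineq4[of "x - p" "ta *r e"] by (simp add: algebra_simps)
 hence db: "dist ?b p <= 2 * rh" using x(3) tarh ta0 fD(2) by (simp add: dist_norm)
 have "\<bar>?gb - ?gp\<bar> <= M * dist ?b p powr al" by (rule pdataD(12)[OF d bf gn(2)])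
 also have "... <= M * (2 * rh) powr al" using db M al by (intro mult_left_mono powr_mono2) auto
 also have "... <= M * (2 * rh powr al)"
 proof -
  have "(2::real) powr al <= 2 powr 1" using al by (intro powr_mono) auto
  thus ?thesis using M rh by (simp add: powr_mult mult_right_mono)
 qed
 finally have h1: "\<bar>?gb - ?gp\<bar> <= M * (2 * rh powr al)" .
 have h2: "\<bar>?gp\<bar> <= M" by (rule pdataD(11)[OF d gn(2)])
 have h3: "\<bar>norm w - n *i w\<bar> <= 2 * (K * rh powr al)"
 proof -
  have "n *i w <= norm w" using Cauchy_Schwarz_ineq2[of n w] fD(1) by simp
  thus ?thesis using w2 nw nv vr by linarith
 qed
 have "\<bar>(F ?b - (F p *i n) *r n) *i w\<bar> <= norm w * \<bar>?gb - ?gp\<bar> + \<bar>?gp\<bar> * \<bar>norm w - n *i w\<bar>"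
  unfolding e1 using abs_triangle_ineq4[of "- (norm w * (?gb - ?gp))" "?gp * (norm w - n *i w)"] by (simp add: abs_mult)
 also have "... <= (5 / 4) * (M * (2 * rh powr al)) + M * (2 * (K * rh powr al))" using w2 v4 h1 h2 h3 M by (intro add_mono mult_mono) auto
 finally have A: "\<bar>(F ?b - (F p *i n) *r n) *i w\<bar> <= (5 / 4) * (M * (2 * rh powr al)) + M * (2 * (K * rh powr al))" .
 have "\<bar>(F x - F ?b) *i w\<bar> <= norm (F x - F ?b) * norm w" by (rule Cauchy_Schwarz_ineq2)
 also have "... <= (M * rh powr al) * (5 / 4)" using cont w2 v4 M by (intro mult_mono) auto
 finally have B: "\<bar>(F x - F ?b) *i w\<bar> <= (M * rh powr al) * (5 / 4)" .
 have "(F x - (F p *i n) *r n) *i w = (F x - F ?b) *i w + (F ?b - (F p *i n) *r n) *i w" by (simp add: inner_diff_left)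
 hence "\<bar>(F x - (F p *i n) *r n) *i w\<bar> <= (M * rh powr al) * (5 / 4) + ((5 / 4) * (M * (2 * rh powr al)) + M * (2 * (K * rh powr al)))"
  using A B by linarith
 also have "... = (15 / 4) * (1 * (M * rh powr al)) + 2 * (K * (M * rh powr al))" by (simp add: algebra_simps)
 also have "... <= (15 / 4) * (K * (M * rh powr al)) + 2 * (K * (M * rh powr al))" using K M by (intro add_mono mult_left_mono mult_right_mono) auto
 also have "... <= 8 * (K * (M * rh powr al))" using K M by simp
 finally show ?thesis by (simp add: w_def mult.assoc)
qed

text \<open>The divergence theorem for test functions that need not vanish at the boundary. A
  cut-off in the height makes the weak divergence applicable; the derivative of the cut-off produces
  a strip integral of the flux, controlled by \<open>boundary_flux\<close> and
  \<open>strip_bound\<close> uniformly in \<open>k\<close>. The constant field subtracted from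
  \<open>F\<close> is what makes this flux small.\<close>

lemma boundary_functional:
 assumes g: "gframe Om al r K p n e s gs" and d: "pdata Om al lam Lam sg gsg F f M" and r: "r > 0" and al: "0 < al" "al < 1"
  and K: "K >= 1" and Om: "open Om" "bounded Om" and lam: "0 < lam" and V: "C1c (ball p r) V DV" and rh: "rh > 0" "!!x. norm (x - p) > rh ==> V x = 0"
 shows "\<bar>LBINT x. sg x * ((F x - (F p *i n) *r n) *i DV x)\<bar>
  <= (LBINT x. indicator Om x * (\<bar>f x\<bar> + Lam * M) * \<bar>V x\<bar>)
   + (8 * K^2 / lam) * M * rh powr al * (LBINT x. indicator Om x * norm (DV x))"
proof -
 let ?H = "hgt p n e s"
 let ?b = "(F p *i n) *r n"
 let ?S = "%x. sg x * ((F x - ?b) *i DV x)"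
 note fr = gframeD(1)[OF g]
 note fD = frameD[OF fr]
 note dD = pdataD[OF d]
 have M: "M > 0" by (rule dD(13))
 note CV = C1c_C1[OF V]
 obtain L where L: "compact L" "L \<subseteq> ball p r" "!!x. x \<notin> L ==> V x = 0" "!!x. x \<notin> L ==> DV x = 0"
  by (rule C1cE[OF V]) (rule that)
 obtain B1 where B1: "B1 > 0" "!!x. \<bar>V x\<bar> <= B1" "!!x. norm (DV x) <= B1" by (rule C1c_bounded[OF V]) (rule that)
 obtain X X' B where X: "!!s::real. (X has_real_derivative X' s) (at s)" "continuous_on UNIV X'"
  "!!s. 0 <= X s" "!!s. X s <= 1" "!!s. s <= 1 ==> X s = 0" "!!s. s >= 2 ==> X s = 1"
  "!!s. s <= 1 \<or> s >= 2 ==> X' s = 0" "!!s. \<bar>X' s\<bar> <= B" "B > 0" "!!s. 0 <= X' s" by (rule cutoff_exists) (rule that)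
 have [measurable]: "X' \<in> Bm" using X(2) by (rule borel_measurable_continuous_onI)
 note iS = wgrad_integrable[OF dD(1)] and iF = wdiv_integrable[OF dD(8)]
 have [measurable]: "Om \<in> sets borel" using Om(1) by simp
 note [measurable] = Bm_int[OF iS(1)] Bm_int[OF iS(2)]
  Bm_int[OF iF(1)] Bm_int[OF iF(2)] dD(7)
  C1_borel[OF hgt_C1[OF fr]] C1_borel[OF CV] C1_borel_grad[OF CV]
 have cl: "compact (closure Om)" using Om(2) by simp
 have uc: "uniformly_continuous_on (closure Om) F" using compact_uniformly_continuous[OF dD(6) cl] .
 have "M * rh powr al > 0" using M rh(1) by simp
 then obtain dd where dd: "dd > 0" "!!x y. x \<in> closure Om ==> y \<in> closure Om ==> dist y x < dd ==> dist (F y) (F x) < M * rh powr al"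
  using uc unfolding uniformly_continuous_on_def by metis
 \<comment> \<open>Room between the support of \<open>V\<close> and the sphere of radius
   \<open>r\<close>, so that points of the support can be moved along \<open>e\<close> to the
   boundary without leaving the ball of the frame.\<close>
 obtain rh1 where rh1: "rh1 < r" "L \<subseteq> cball p rh1"
 proof -
  have "continuous_on L (%x. dist p x)" by (intro continuous_intros)
  hence "L ~= {} ==> \<exists>x\<in>L. \<forall>y\<in>L. dist p y <= dist p x" using continuous_attains_sup[OF L(1)] by blast
  thus ?thesis using L(2) r by (cases "L = {}") (use that[of 0] in simp, use that in fastforce)
 qed
 have en1: "e *i n > 0" by (rule fD(3))
 have enK: "1 / (e *i n) <= K" using gframeD(3)[OF g] en1 K by (simp add: field_simps)
 define Q where "Q = 8 * K * M * rh powr al"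
 have Q: "Q >= 0" using K M by (simp add: Q_def)
 let ?z = "%k x. X (real k * ?H x)"
 let ?x = "%k x. X' (real k * ?H x) * real k"
 let ?T = "LBINT x. indicator Om x * (\<bar>f x\<bar> + Lam * M) * \<bar>V x\<bar>"
 let ?D = "LBINT x. indicator Om x * norm (DV x)"
 have iA: "lint ?S"
 proof -
  have "lint (%x. (sg x *r F x - sg x *r ?b) *i DV x)" by (rule int_inner_bounded[OF _ _ B1(3)]) (use iF iS in auto)
  thus ?thesis by (simp only: scaleR_diff_right[symmetric] inner_scaleR_left)
 qed
 have bM: "norm ?b <= M" using dD(11)[OF gframe_normal(2)[OF g r al(1)]] fD(1) unfolding gframe_normal(1)[OF g r al(1)] by simp
 have LamM: "Lam >= 0" using dD(5)[of 0] norm_ge_zero order_trans by blast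
 have iT: "lint (%x. indicator Om x * (\<bar>f x\<bar> + Lam * M) * \<bar>V x\<bar>)"
 proof -
  have 1: "lint (%x. \<bar>f x\<bar> * \<bar>V x\<bar>)"
   using int_scaleR_bounded[of lborel "%x. \<bar>f x\<bar>" "%x. \<bar>V x\<bar>" B1] B1(2) iF(2) by simp
  have 2: "lint (%x. (Lam * M) * \<bar>V x\<bar>)" using C1c_integrable(1)[OF V] by simp
  have "lint (%x. indicator Om x *r (\<bar>f x\<bar> * \<bar>V x\<bar> + (Lam * M) * \<bar>V x\<bar>))"
   using 1 2 by (intro integrable_mult_indicator) auto
  thus ?thesis by (simp add: algebra_simps)
 qed
 have step: "\<bar>LBINT x. ?z k x * ?S x\<bar> <= ?T + (8 * K^2 / lam) * M * rh powr al * ?D"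
  if k: "k > 0" "2 * K / real k < dd" "2 * K / real k <= rh" "2 * K / real k < r - rh1" for k
 proof -
  let ?G = "%x. n - (e *i n) *r gs x"
  have kp: "real k > 0" using k(1) by simp
  note Cz = frame_cutoff_C1[OF fr X(1,2), of "real k"]
  note [measurable] = C1_borel[OF Cz]
  have Gm: "?G \<in> Bm" by (rule C1_borel_grad[OF hgt_C1[OF fr]])
  note [measurable] = Gm
  have sub: "ball p r \<inter> {x. ?H x >= 1 / real k} \<subseteq> Om"
  proof
   fix x assume x: "x \<in> ball p r \<inter> {x. ?H x >= 1 / real k}"
   have "0 < 1 / real k" using kp by simp
   also have "... <= ?H x" using x by simp
   finally show "x \<in> Om" using gframeD(4)[OF g, of x] x by blast
  qed
  have t: "C1c Om (%x. ?z k x * V x) (%x. V x *r ?x k x *r ?G x + ?z k x *r DV x)"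
  proof (rule C1c_cutoff[OF V Cz _ _ sub])
   show "closed {x. 1 / real k <= ?H x}" by (intro closed_Collect_le continuous_intros C1_continuous[OF hgt_C1[OF fr]])
   show "?z k x = 0" if "x \<notin> {x. 1 / real k <= ?H x}" for x using that kp X(5)[of "real k * ?H x"] by (simp add: field_simps)
  qed
  let ?Dt = "%x. V x *r ?x k x *r ?G x + ?z k x *r DV x"
  obtain B2 where B2: "B2 > 0" "!!x. \<bar>?z k x * V x\<bar> <= B2" "!!x. norm (?Dt x) <= B2" by (rule C1c_bounded[OF t]) (rule that)
  have i1: "lint (%x. (sg x *r F x) *i ?Dt x)" by (rule int_inner_bounded[OF iF(1) _ B2(3)]) measurable
  have i2: "lint (%x. sg x *r ?Dt x)" "lint (%x. (?z k x * V x) *r gsg x)"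
   by (rule C1c_int_scaleR(1)[OF t iS(1)], rule C1c_int_scaleR(2)[OF t iS(2)])
  have e1: "(LBINT x. (sg x *r F x) *i ?Dt x) = - (LBINT x. f x * (?z k x * V x))" by (rule wdivD[OF dD(8) t])
  have e2: "(LBINT x. (sg x *r ?Dt x) *i ?b) = - (LBINT x. ((?z k x * V x) *r gsg x) *i ?b)"
  proof -
   have "(LBINT x. sg x *r ?Dt x) *i ?b = - ((LBINT x. (?z k x * V x) *r gsg x) *i ?b)" by (simp only: wgradD[OF dD(1) t] inner_minus_left)
   thus ?thesis by (rule trans[OF integral_inner_left[OF i2(1)] trans[OF _ arg_cong[where f=uminus, OF integral_inner_left[OF i2(2), symmetric]]]])
  qed
  have i4: "lint (%x. (sg x *r ?Dt x) *i ?b)" "lint (%x. ((?z k x * V x) *r gsg x) *i ?b)"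
   by (rule Bochner_Integration.integrable_inner_left[OF i2(1)], rule Bochner_Integration.integrable_inner_left[OF i2(2)])
  have i5: "lint (%x. f x * (?z k x * V x))" using C1c_int_scaleR(2)[OF t iF(2)] by (simp add: mult.commute)
  \<comment> \<open>\<open>A\<close> is the wanted integrand times the cut-off, \<open>P\<close>
    collects the derivative of the cut-off and lives in the strip, and \<open>R\<close> consists of
    the divergence of the data and the gradient of the coefficient paired with the constant
    field.\<close>
  define A where "A = (%x. ?z k x * ?S x)"
  define P where "P = (%x. sg x * (V x * ?x k x) * ((F x - ?b) *i ?G x))"
  define R where "R = (%x. (f x - gsg x *i ?b) * (?z k x * V x))"
  have split: "(sg x *r F x) *i ?Dt x - (sg x *r ?Dt x) *i ?b = A x + P x" for x
   by (simp add: A_def P_def inner_add_right inner_diff_left inner_diff_right inner_add_left algebra_simps inner_commute)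
  have Ri: "f x * (?z k x * V x) - ((?z k x * V x) *r gsg x) *i ?b = R x" for x by (simp add: R_def algebra_simps)
  have iR: "lint R" using int_diff[OF i5 i4(2)] unfolding Ri .
  have iAk: "lint A" unfolding A_def using int_bounded_scaleR[OF iA, of "?z k" 1] X(3,4) by simp
  have iAP: "lint (%x. A x + P x)" using int_diff[OF i1 i4(1)] unfolding split .
  have iP: "lint P" using int_diff[OF iAP iAk] by simp
  have "(LBINT x. A x + P x) = - (LBINT x. R x)" using integral_minus2[OF i1 i4(1), unfolded split] integral_minus2[OF i5 i4(2), unfolded Ri] e1 e2
   by linarith
  hence AR: "(LBINT x. A x) = - (LBINT x. R x) - (LBINT x. P x)" using integral_plus[OF iAk iP] by simp
  have Rb: "\<bar>LBINT x. R x\<bar> <= ?T"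
  proof -
   have "\<bar>R x\<bar> <= indicator Om x * (\<bar>f x\<bar> + Lam * M) * \<bar>V x\<bar>" for x
   proof (cases "x \<in> Om")
    case True
    have "\<bar>gsg x *i ?b\<bar> <= norm (gsg x) * norm ?b" by (rule Cauchy_Schwarz_ineq2)
    also have "... <= Lam * M" using dD(5)[of x] bM LamM by (intro mult_mono) auto
    finally have "\<bar>f x - gsg x *i ?b\<bar> <= \<bar>f x\<bar> + Lam * M" using abs_triangle_ineq4[of "f x" "gsg x *i ?b"] by linarith
    moreover have "\<bar>?z k x * V x\<bar> <= 1 * \<bar>V x\<bar>" using X(3,4)[of "real k * ?H x"] unfolding abs_mult by (intro mult_right_mono) auto
    ultimately have "\<bar>f x - gsg x *i ?b\<bar> * \<bar>?z k x * V x\<bar> <= (\<bar>f x\<bar> + Lam * M) * (1 * \<bar>V x\<bar>)"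
     using LamM M by (intro mult_mono) auto
    thus ?thesis using True by (simp add: R_def abs_mult)
   next
    case False
    hence "?z k x * V x = 0" by (rule C1c_zero(1)[OF t])
    hence "R x = 0" unfolding R_def by (simp only: mult_zero_right)
    thus ?thesis using False by simp
   qed
   thus ?thesis using integral_norm_diff_le[OF iR integrable_zero iT] by simp
  qed
  have iVx: "lint (%x. \<bar>V x\<bar> * ?x k x)"
   using int_scaleR_bounded[of lborel "%x. \<bar>V x\<bar>" "?x k" "B * real k"] C1c_integrable(1)[OF V] X(8) kp by (simp add: abs_mult)
  have Pb: "\<bar>LBINT x. P x\<bar> <= (Q / lam) * (LBINT x. \<bar>V x\<bar> * ?x k x)"
  proof -
   have "\<bar>P x\<bar> <= (Q / lam) * (\<bar>V x\<bar> * ?x k x)" for x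
   proof (cases "V x = 0 \<or> ?x k x = 0")
    case True
    thus ?thesis by (auto simp: P_def)
   next
    case False
    hence xL: "x \<in> L" using L(3) by blast
    hence xb: "x \<in> ball p r" and xr: "dist p x <= rh1" using L(2) rh1(2) by auto
    have xrh: "norm (x - p) <= rh" using rh(2)[of x] False by fastforce
    have "X' (real k * ?H x) ~= 0" using False by auto
    hence "\<not> (real k * ?H x <= 1 \<or> real k * ?H x >= 2)" using X(7)[of "real k * ?H x"] by blast
    hence kH: "1 < real k * ?H x" "real k * ?H x < 2" by linarith+
    have H0: "?H x > 0" using kH(1) kp mult_nonneg_nonpos[of "real k" "?H x"] by (cases "?H x > 0") auto
    have xOm: "x \<in> Om" using gframeD(4)[OF g xb] H0 by simp
    \<comment> \<open>Descent along \<open>e\<close> to the boundary. A nonzero \<open>X'\<close>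
      confines the height to less than \<open>2 / k\<close>, so \<open>ta\<close> is at most
      \<open>2 * K / k\<close>, small enough for the uniform continuity of \<open>F\<close>.\<close>
    define ta where "ta = ?H x / (e *i n)"
    have ta0: "ta > 0" using H0 en1 by (simp add: ta_def)
    have "ta = ?H x * (1 / (e *i n))" by (simp add: ta_def)
    also have "... <= (2 / real k) * K" using kH(2) kp enK H0 en1 by (intro mult_mono) (auto simp: field_simps)
    finally have tak: "ta <= 2 * K / real k" by simp
    have ds: "dist (x - ta *r e) x = ta" using ta0 fD(2) by (simp add: dist_norm)
    have "dist p (x - ta *r e) <= dist p x + dist x (x - ta *r e)" by (rule dist_triangle)
    hence xb': "x - ta *r e \<in> ball p r" using xr ds tak k(4) by (simp add: dist_commute)
    have hb: "?H (x - ta *r e) = 0" using hgt_shift[OF fr, of x "- ta"] en1 by (simp add: ta_def)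
    have "x - ta *r e \<in> closure Om" using gframeD(5)[OF g xb' hb] by (simp add: frontier_def)
    hence cont: "norm (F x - F (x - ta *r e)) <= M * rh powr al"
     using dd(2)[of x "x - ta *r e"] xOm closure_subset ds tak k(2) by (force simp: dist_nm)
    have "\<bar>(F x - ?b) *i ?G x\<bar> <= Q" unfolding Q_def
     by (rule boundary_flux[OF g d r al K xb H0 xrh rh(1) ta_def xb' _ cont]) (use tak k(3) in simp)
    moreover have "\<bar>sg x\<bar> <= 1 / lam" using dD(3,4)[OF xOm] lam by simp
    moreover have "0 <= ?x k x" using X(10)[of "real k * ?H x"] kp by simp
    ultimately have "\<bar>sg x\<bar> * (\<bar>V x\<bar> * ?x k x) * \<bar>(F x - ?b) *i ?G x\<bar> <= (1 / lam) * (\<bar>V x\<bar> * ?x k x) * Q"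
     using lam X(10)[of "real k * ?H x"] by (intro mult_mono) auto
    thus ?thesis using X(10)[of "real k * ?H x"] by (simp add: P_def abs_mult mult_ac)
   qed
   thus ?thesis using integral_norm_diff_le[OF iP integrable_zero integrable_mult_right[OF iVx, of "Q / lam"]] by simp
  qed
  have "(e *i n) * (LBINT x. \<bar>V x\<bar> * ?x k x) <= (LBINT x. indicator {x. ?H x > 0} x * norm (DV x))"
   by (rule strip_bound[OF fr V kp X(1,2,3,4,5,8,9,10)])
  also have "(%x. indicator {x. ?H x > 0} x * norm (DV x)) = (%x. indicator Om x * norm (DV x))"
  proof
   fix x show "indicator {x. ?H x > 0} x * norm (DV x) = indicator Om x * norm (DV x)"
    using L(2) L(4)[of x] gframeD(4)[OF g, of x] by (cases "x \<in> L") (auto simp: indicator_def)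
  qed
  finally have sb: "(e *i n) * (LBINT x. \<bar>V x\<bar> * ?x k x) <= ?D" .
  have D0: "?D >= 0" by (intro integral_ge0) auto
  have "(LBINT x. \<bar>V x\<bar> * ?x k x) <= (1 / (e *i n)) * ?D" using sb en1 by (simp add: field_simps)
  also have "... <= K * ?D" using enK D0 by (intro mult_right_mono) auto
  finally have "(Q / lam) * (LBINT x. \<bar>V x\<bar> * ?x k x) <= (Q / lam) * (K * ?D)" using Q lam by (intro mult_left_mono) auto
  also have "... = (8 * K^2 / lam) * M * rh powr al * ?D" by (simp add: Q_def power2_eq_square)
  finally have "\<bar>LBINT x. P x\<bar> <= (8 * K^2 / lam) * M * rh powr al * ?D" using Pb by simp
  thus ?thesis using AR Rb unfolding A_def by simp
 qed
 have lim: "(%k. (LBINT x. ?z k x * ?S x)) \<longlonglongrightarrow> (LBINT x. ?S x)"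
 proof (rule integral_dominated_convergence[where w="%x. \<bar>?S x\<bar>"])
  show "AE x in lborel. (%k. ?z k x * ?S x) \<longlonglongrightarrow> ?S x"
  proof (rule AE_I2)
   fix x
   show "(%k. ?z k x * ?S x) \<longlonglongrightarrow> ?S x"
   proof (cases "x \<in> Om & x \<in> L")
    case True
    hence H0: "?H x > 0" using gframeD(4)[OF g, of x] L(2) by blast
    have "eventually (%k. ?z k x * ?S x = ?S x) sequentially" using eventually_real_mult_ge[OF H0, of 2] by eventually_elim (simp add: X(6))
    thus ?thesis by (rule tendsto_eventually)
   next
    case False
    hence z: "?S x = 0" using dD(2)[of x] L(4)[of x] by auto
    show ?thesis unfolding z mult_zero_right by (rule tendsto_const)
   qed
  qed
  show "AE x in lborel. norm (?z k x * ?S x) <= \<bar>?S x\<bar>" for k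
   using X(3,4) by (intro AE_I2) (auto simp: abs_mult intro!: mult_left_le_one_le)
  show "lint (%x. \<bar>?S x\<bar>)" using iA by simp
  show "(%x. ?z k x * ?S x) \<in> borel_measurable lborel" for k using C1_borel[OF frame_cutoff_C1[OF fr X(1,2), of "real k"]] Bm_int[OF iA] by simp
 qed (use Bm_int[OF iA] in simp)
 have "(%k. 2 * K / real k) \<longlonglongrightarrow> 0" using tendsto_mult[OF tendsto_const[of "2 * K"] lim_1_over_n] by simp
 hence "\<forall>\<^sub>F k in sequentially. 2 * K / real k < dd" "\<forall>\<^sub>F k in sequentially. 2 * K / real k < rh" "\<forall>\<^sub>F k in sequentially. 2 * K / real k < r - rh1"
  using dd(1) rh(1) rh1(1) by (auto intro: order_tendstoD(2))
 hence "\<forall>\<^sub>F k in sequentially. \<bar>LBINT x. ?z k x * ?S x\<bar> <= ?T + (8 * K^2 / lam) * M * rh powr al * ?D"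
  using eventually_gt_at_top[of 0] by eventually_elim (rule step, auto)
 from tendsto_upperbound[OF tendsto_rabs[OF lim] this] show ?thesis by simp
qed

section \<open>Averages at different scales\<close>

definition zq :: "real^3 => real => nat => real^3 => real" where
 "zq y t n x = (max 0 (t^2 - (x - y) *i (x - y))) ^ n"

text \<open>With \<open>Q = zq y t 4\<close>, \<open>kW y t i\<close> is \<open>\<partial>\<^sub>i Q\<close>, \<open>kDW\<close> its gradient, \<open>kP y t i j = \<partial>\<^sub>i \<partial>\<^sub>j Q\<close> and \<open>kDP\<close> its gradient.
  Up to the factor \<open>8 t\<^sup>1\<^sup>0\<close>, the Laplacian of \<open>Q\<close> is the \<open>t\<close>-derivative of the averaging kernel \<open>kap\<close>; this
  is what makes averages of gradients of solutions comparable at different scales.\<close>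

definition kW :: "real^3 => real => 3 => real^3 => real" where
 "kW y t i x = - 8 * (zq y t 3 x * (x - y) $ i)"

definition kDW :: "real^3 => real => 3 => real^3 => real^3" where
 "kDW y t i x = (- 8 * zq y t 3 x) *r axis i 1 + (48 * zq y t 2 x * (x - y) $ i) *r (x - y)"

definition kP :: "real^3 => real => 3 => 3 => real^3 => real" where
 "kP y t i j x = (if i = j then - 8 else 0) * zq y t 3 x + 48 * (zq y t 2 x * ((x - y) $ i * (x - y) $ j))"

definition kDP :: "real^3 => real => 3 => 3 => real^3 => real^3" where
 "kDP y t i j x = ((if i = j then 48 else 0) * zq y t 2 x - 192 * zq y t 1 x * ((x - y) $ i * (x - y) $ j)) *r (x - y)
  + (48 * zq y t 2 x) *r ((x - y) $ j *r axis i 1 + (x - y) $ i *r axis j 1)"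

definition kap :: "real^3 => real => real^3 => real" where
 "kap y t x = zq y t 3 x / t ^ 9"

lemma zq_nonneg: "0 <= zq y t n x" by (simp add: zq_def)

lemma zq_zero:
 assumes "t >= 0" "n > 0" "norm (x - y) >= t" shows "zq y t n x = 0"
proof -
 have "t^2 <= (norm (x - y))^2" using assms by (intro power_mono) auto
 thus ?thesis using assms(2) by (simp add: zq_def power2_norm_eq_inner)
qed

lemma zq_le:
 assumes "t >= 0" shows "zq y t n x <= t ^ (2 * n)"
proof -
 have "max 0 (t^2 - (x - y) *i (x - y)) <= t^2" by simp
 hence "zq y t n x <= (t^2) ^ n" unfolding zq_def by (intro power_mono) auto
 thus ?thesis by (simp add: power_mult)
qed

lemma C1_zq: "C1 (zq y t (Suc (Suc m))) (%x. (- 2 * real (Suc (Suc m)) * zq y t (Suc m) x) *r (x - y))"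
proof -
 have 1: "C1 (%x. t^2 - (x - y) *i (x - y)) (%x. (- 2) *r (x - y))" unfolding C1_def
 proof (intro conjI allI continuous_intros)
  fix x
  have "((%x. t^2 - (x - y) *i (x - y)) has_derivative (%h. 0 - (((x - y) *i (h - 0)) + ((h - 0) *i (x - y))))) (at x)" by (intro derivative_intros)
  thus "((%x. t^2 - (x - y) *i (x - y)) has_derivative (*i) ((- 2) *r (x - y))) (at x)" by (rule has_derivative_eq_rhs) (auto simp: inner_commute)
 qed
 have c: "continuous_on UNIV (%s::real. real (Suc (Suc m)) * max 0 s ^ Suc m)" by (intro continuous_intros)
 from C1_compose_real[OF 1 pos_part_power_deriv c]
 show ?thesis by (simp add: zq_def[abs_def] mult_ac del: power_Suc of_nat_Suc)
qed

lemma C1_zq_numeral: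
 "C1 (zq y t 3) (%x. (- 6 * zq y t 2 x) *r (x - y))" "C1 (zq y t 2) (%x. (- 4 * zq y t 1 x) *r (x - y))"
 using C1_zq[of y t 1] C1_zq[of y t 0] by (simp_all add: eval_nat_numeral)

lemma C1_cong:
 assumes "C1 f F" "!!x. f x = g x" "!!x. F x = G x" shows "C1 g G"
proof -
 have "f = g" "F = G" using assms(2,3) by (auto intro: ext)
 thus ?thesis using assms(1) by simp
qed

lemma C1_coord: "C1 (%x. (x - y) $ i) (%x. axis i 1)"
 by (rule C1_cong[OF C1_diff[OF C1_inner[of "axis i 1"] C1_const[of "y $ i"]]]) (auto simp: inner_axis')

lemma C1_kW: "C1 (kW y t i) (kDW y t i)" by (rule C1_cong[OF C1_cmult[OF C1_mult[OF C1_zq_numeral(1) C1_coord], of "-8"]])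
  (auto simp: kW_def kDW_def algebra_simps)

lemma C1_kP: "C1 (kP y t i j) (kDP y t i j)" by (rule C1_cong[OF C1_add[OF C1_cmult[OF C1_zq_numeral(1), of "if i = j then - 8 else 0"]
    C1_cmult[OF C1_mult[OF C1_zq_numeral(2) C1_mult[OF C1_coord[of y i] C1_coord[of y j]]], of 48]]])
  (auto simp: kP_def kDP_def scaleR_add_right scaleR_diff_left algebra_simps)

lemma C1c_kernel:
 assumes "t > 0" "cball y t \<subseteq> U"
 shows "C1c U (kW y t i) (kDW y t i)" "C1c U (kP y t i j) (kDP y t i j)" "C1c U (zq y t 3) (%x. (- 6 * zq y t 2 x) *r (x - y))"
proof -
 have z: "zq y t 3 x = 0" "zq y t 2 x = 0" if "x \<notin> cball y t" for x
  using zq_zero[of t 3 x y] zq_zero[of t 2 x y] that assms by (auto simp: dist_nm)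
 show "C1c U (kW y t i) (kDW y t i)" "C1c U (kP y t i j) (kDP y t i j)" "C1c U (zq y t 3) (%x. (- 6 * zq y t 2 x) *r (x - y))"
  unfolding C1c_def using C1_kW C1_kP C1_zq_numeral z assms(2) by (auto intro!: exI[of _ "cball y t"] simp: kW_def kP_def)
qed

lemma kDW_nth: "kDW y t i x $ j = kP y t i j x" by (simp add: kDW_def kP_def axis_def)

lemma kDP_sym: "kDP y t j j x $ i = kDP y t i j x $ j" by (simp add: kDP_def axis_def algebra_simps)

lemma kernel_bounds:
 assumes "t > 0" shows "\<bar>kW y t i x\<bar> <= (56 * t ^ 6) * t" "norm (kDW y t i x) <= 56 * t ^ 6"
  "norm (x - y) >= t ==> kW y t i x = 0" "norm (x - y) >= t ==> kDW y t i x = 0"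
proof -
 show z: "kW y t i x = 0" "kDW y t i x = 0" if "norm (x - y) >= t"
  using zq_zero[of t 3 x y] zq_zero[of t 2 x y] that assms by (auto simp: kW_def kDW_def)
 have c: "\<bar>(x - y) $ i\<bar> <= norm (x - y)" by (rule component_le_norm_cart)
 have z3: "zq y t 3 x <= t ^ 6" "zq y t 2 x <= t ^ 4" using zq_le[of t y 3 x] zq_le[of t y 2 x] assms by auto
 note zn = zq_nonneg[of y t 3 x] zq_nonneg[of y t 2 x]
 show "\<bar>kW y t i x\<bar> <= (56 * t ^ 6) * t"
 proof (cases "norm (x - y) >= t")
  case True thus ?thesis using z assms by simp
 next
  case False
  have "\<bar>kW y t i x\<bar> = 8 * (zq y t 3 x * \<bar>(x - y) $ i\<bar>)" using zn by (simp add: kW_def abs_mult)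
  also have "... <= 8 * (t ^ 6 * t)" using z3 zn c False assms by (intro mult_left_mono mult_mono) auto
  also have "... <= (56 * t ^ 6) * t" using assms by simp
  finally show ?thesis .
 qed
 show "norm (kDW y t i x) <= 56 * t ^ 6"
 proof (cases "norm (x - y) >= t")
  case True thus ?thesis using z assms by simp
 next
  case False
  have "norm (kDW y t i x) <= 8 * zq y t 3 x + (48 * zq y t 2 x * \<bar>(x - y) $ i\<bar>) * norm (x - y)"
   unfolding kDW_def by (rule norm_triangle_le) (use zn in \<open>simp add: abs_mult norm_axis_1\<close>)
  also have "... <= 8 * t ^ 6 + (48 * t ^ 4 * t) * t" using z3 zn c False assms by (intro add_mono mult_left_mono mult_mono) auto
  also have "... = 56 * t ^ 6" by (simp add: eval_nat_numeral)
  finally show ?thesis .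
 qed
qed

lemma laplacian_kernel:
 assumes "t > 0" shows "(\<Sum>j\<in>UNIV. kP y t j j x) = 48 * t^2 * zq y t 2 x - 72 * zq y t 3 x"
proof -
 define m where "m = max 0 (t^2 - (x - y) *i (x - y))"
 have z: "zq y t 3 x = m ^ 3" "zq y t 2 x = m^2" by (simp_all add: zq_def m_def)
 have k: "m^2 * ((x - y) *i (x - y)) = t^2 * m^2 - m ^ 3" by (auto simp: m_def max_def power2_eq_square power3_eq_cube algebra_simps)
 have "(\<Sum>j\<in>UNIV. kP y t j j x) = - 24 * m ^ 3 + 48 * (m^2 * ((x - y) *i (x - y)))" by (simp add: kP_def sum_3 inner_vec_def z algebra_simps)
 thus ?thesis unfolding k z by simp
qed

text \<open>Both sides become \<open>u\<close> against a third derivative of the same kernel, and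
  third derivatives are symmetric: this is the weak form of \<open>G\<close> being curl free. The
  fourth power in the kernel is what makes its second derivatives C1, hence admissible as test
  functions.\<close>

lemma curl_free_laplacian:
 assumes w: "wgrad U u G" and t: "t > 0" "cball y t \<subseteq> U"
 shows "(LBINT x. (\<Sum>j\<in>UNIV. kP y t j j x) * G x $ i) = (LBINT x. G x *i kDW y t i x)"
  "lint (%x. (\<Sum>j\<in>UNIV. kP y t j j x) * G x $ i)"
proof -
 note iw = wgrad_integrable[OF w]
 have i1: "lint (%x. kP y t a b x *r G x)" for a b by (rule C1c_int_scaleR(2)[OF C1c_kernel(2)[OF t] iw(2)])
 have i2: "lint (%x. u x *r kDP y t a b x)" for a b by (rule C1c_int_scaleR(1)[OF C1c_kernel(2)[OF t] iw(1)])
 have i3: "lint (%x. kP y t a b x * G x $ c)" for a b c using integral_nth(2)[OF i1] by simp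
 have e: "(LBINT x. kP y t a b x * G x $ c) = - (LBINT x. u x * kDP y t a b x $ c)" for a b c
  using arg_cong[OF wgradD[OF w C1c_kernel(2)[OF t, of a b]], of "%v. v $ c"]
   integral_nth(1)[OF i1, of a b c] integral_nth(1)[OF i2, of a b c] by simp
 have e2: "(LBINT x. kP y t j j x * G x $ i) = (LBINT x. kP y t i j x * G x $ j)" for j unfolding e kDP_sym[of y t j] ..
 have s: "(\<Sum>j\<in>UNIV. kP y t j j x) * G x $ i = (\<Sum>j\<in>UNIV. kP y t j j x * G x $ i)" for x by (rule sum_distrib_right)
 show "lint (%x. (\<Sum>j\<in>UNIV. kP y t j j x) * G x $ i)" unfolding s by (intro Bochner_Integration.integrable_sum i3)
 have d: "G x *i kDW y t i x = (\<Sum>j\<in>UNIV. kP y t i j x * G x $ j)" for x by (simp add: inner_vec_def kDW_nth mult.commute)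
 show "(LBINT x. (\<Sum>j\<in>UNIV. kP y t j j x) * G x $ i) = (LBINT x. G x *i kDW y t i x)"
  unfolding s d by (simp add: Bochner_Integration.integral_sum i3 e2)
qed

text \<open>The average of \<open>G\<close> at scale \<open>t\<close>, up to a constant factor.\<close>

definition mav :: "(real^3 => real^3) => real^3 => real => real^3" where
 "mav G y t = (LBINT x. kap y t x *r G x)"

lemma kap_integrable:
 assumes "lint (G :: real^3 => 'b::{banach,second_countable_topology})" shows "lint (%x. zq y t 3 x *r G x)" "lint (%x. (c * zq y t 2 x) *r G x)"
proof -
 have m: "zq y t n \<in> Bm" for n unfolding zq_def[abs_def] by (intro borel_measurable_continuous_onI continuous_intros)
 have zb: "\<bar>zq y t n x\<bar> <= \<bar>t\<bar> ^ (2 * n)" for n x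
  using zq_nonneg[of y t n x] zq_le[of "\<bar>t\<bar>" y n x] by (simp add: zq_def)
 have z: "\<bar>zq y t 3 x\<bar> <= \<bar>t\<bar> ^ (2 * 3)" "\<bar>c * zq y t 2 x\<bar> <= \<bar>c\<bar> * \<bar>t\<bar> ^ (2 * 2)" for x
  using zb[of 3 x] mult_left_mono[OF zb[of 2 x], of "\<bar>c\<bar>"] unfolding abs_mult by simp_all
 show "lint (%x. zq y t 3 x *r G x)" by (rule int_bounded_scaleR[OF assms _ z(1)]) (use m in simp)
 show "lint (%x. (c * zq y t 2 x) *r G x)" by (rule int_bounded_scaleR[OF assms _ z(2)]) (use m in simp)
qed

lemma has_real_derivative_integral:
 fixes f :: "real => 'a => real"
 assumes d: "d > 0" and int: "!!t. integrable M (f t)" "integrable M g" and m: "f' a \<in> borel_measurable M"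
  and f: "!!t x. \<bar>t - a\<bar> < d ==> ((%t. f t x) has_real_derivative f' t x) (at t)"
  and b: "!!t x. \<bar>t - a\<bar> < d ==> \<bar>f' t x\<bar> <= g x"
 shows "((%t. \<integral>x. f t x \<partial>M) has_real_derivative (\<integral>x. f' a x \<partial>M)) (at a)"
proof -
 have "((%h. \<integral>x. (f (a + h) x - f a x) / h \<partial>M) \<longlongrightarrow> (\<integral>x. f' a x \<partial>M)) (at 0 within ball 0 d)"
  unfolding tendsto_at_iff_sequentially comp_def
 proof (intro allI impI)
  fix X :: "nat => real" assume X: "\<forall>i. X i \<in> ball 0 d - {0}" "X \<longlonglongrightarrow> 0"
  hence X0: "X n ~= 0" "\<bar>X n\<bar> < d" for n by auto
  have F: "filterlim X (at 0) sequentially" unfolding filterlim_at by (rule conjI, rule always_eventually, simp add: X0, rule X(2))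
  have b': "norm ((f (a + X n) x - f a x) / X n) <= g x" for n x
  proof -
   have "norm (f (a + X n) x - f a x) <= g x * norm (a + X n - a)"
   proof (rule field_differentiable_bound[where S="ball a d" and f'="%t. f' t x" and f="%t. f t x"])
    fix t assume "t \<in> ball a d"
    hence t: "\<bar>t - a\<bar> < d" by (simp add: dist_real_def abs_minus_commute)
    show "((%t. f t x) has_real_derivative f' t x) (at t within ball a d)" by (rule has_field_derivative_at_within[OF f[OF t]])
    show "norm (f' t x) <= g x" using b[OF t, of x] by simp
   qed (use X0[of n] d in \<open>simp_all add: dist_real_def\<close>)
   thus ?thesis using X0[of n] by (simp add: divide_le_eq)
  qed
  show "(%n. \<integral>x. (f (a + X n) x - f a x) / X n \<partial>M) \<longlonglongrightarrow> (\<integral>x. f' a x \<partial>M)"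
  proof (rule integral_dominated_convergence[where w=g])
   show "AE x in M. (%n. (f (a + X n) x - f a x) / X n) \<longlonglongrightarrow> f' a x"
    by (rule AE_I2, rule filterlim_compose[OF _ F]) (use f[of a] d in \<open>simp add: DERIV_def\<close>)
   show "AE x in M. norm ((f (a + X n) x - f a x) / X n) <= g x" for n by (rule AE_I2) (rule b')
   show "(%x. (f (a + X n) x - f a x) / X n) \<in> borel_measurable M" for n using Bm_int[OF int(1)] by simp
  qed (rule m, rule int(2))
 qed
 moreover have "at 0 within ball 0 d = at (0 :: real)" by (rule at_within_open) (use d in auto)
 moreover have "(\<integral>x. (f (a + h) x - f a x) / h \<partial>M) = ((\<integral>x. f (a + h) x \<partial>M) - (\<integral>x. f a x \<partial>M)) / h" for h
  using int(1)[of a] int(1)[of "a + h"] by simp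
 ultimately show ?thesis unfolding DERIV_def by (simp only:)
qed

lemma zq_integral_deriv:
 assumes G: "lint (G :: real^3 => real)" and a: "a > 0"
 shows "((%t. (LBINT x. zq y t 3 x * G x)) has_real_derivative (LBINT x. (6 * a * zq y a 2 x) * G x)) (at a)"
proof (rule has_real_derivative_integral[where f'="%t x. (6 * t * zq y t 2 x) * G x" and g="%x. (6 * (2 * a) * (2 * a) ^ (2 * 2)) * \<bar>G x\<bar>", OF a])
 show "lint (%x. zq y t 3 x * G x)" for t using kap_integrable(1)[OF G] by simp
 show "(%x. 6 * a * zq y a 2 x * G x) \<in> borel_measurable lborel" using kap_integrable(2)[OF G, of "6 * a" y a] by (simp add: Bm_int)
 fix t x assume "\<bar>t - a\<bar> < a"
 hence t: "0 < t" "t <= 2 * a" by auto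
 have g: "((%t. t^2 - (x - y) *i (x - y)) has_real_derivative 2 * t) (at t)" by (auto intro!: derivative_eq_intros)
 have p: "((%s::real. (max 0 s) ^ 3) has_real_derivative 3 * (max 0 s)^2) (at s)" for s
  using pos_part_power_deriv[of 1 s] by (simp add: numeral_3_eq_3 numeral_2_eq_2)
 have "((%t. zq y t 3 x) has_real_derivative 6 * t * zq y t 2 x) (at t)" using DERIV_chain2[OF p g] by (simp add: zq_def mult_ac)
 thus "((%t. zq y t 3 x * G x) has_real_derivative 6 * t * zq y t 2 x * G x) (at t)" by (rule DERIV_cmult_right)
 have "6 * t * zq y t 2 x <= 6 * (2 * a) * (2 * a) ^ (2 * 2)"
  using zq_le[of t y 2 x] power_mono[OF t(2), of "2 * 2"] zq_nonneg[of y t 2 x] t by (intro mult_mono) auto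
 thus "\<bar>6 * t * zq y t 2 x * G x\<bar> <= 6 * (2 * a) * (2 * a) ^ (2 * 2) * \<bar>G x\<bar>"
  using t zq_nonneg[of y t 2 x] by (simp add: abs_mult mult_right_mono)
qed (use G in simp)

lemma mav_nth:
 assumes "lint G" shows "mav G y t $ i = (LBINT x. zq y t 3 x * G x $ i) / t ^ 9"
proof -
 have "lint (%x. kap y t x *r G x)"
  using integrable_scaleR_right[OF kap_integrable(1)[OF assms, of y t], of "1 / t ^ 9"] by (simp add: kap_def divide_inverse mult.commute)
 from integral_nth(1)[OF this, of i] show ?thesis by (simp add: mav_def kap_def)
qed

text \<open>The scale derivative of the kernel is a multiple of a Laplacian, and
  \<open>curl_free_laplacian\<close> turns it into the weak form tested with \<open>kW\<close>. The
  change of an average with the scale thus becomes a quantity that the equation controls.\<close>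

lemma mav_deriv:
 assumes w: "wgrad U u G" and t: "t > 0" "cball y t \<subseteq> U"
 shows "((%t. mav G y t $ i) has_real_derivative (LBINT x. G x *i kDW y t i x) / (8 * t ^ 10)) (at t)"
proof -
 note iG = wgrad_integrable(2)[OF w]
 note iGi = integral_nth(2)[OF iG, of i]
 have z2: "lint (%x. (6 * t * zq y t 2 x) * G x $ i)" using kap_integrable(2)[OF iGi, of "6 * t" y t] by simp
 have z3: "lint (%x. zq y t 3 x * G x $ i)" using kap_integrable(1)[OF iGi, of y t] by simp
 have lap: "(LBINT x. G x *i kDW y t i x) = (LBINT x. (8 * t) * ((6 * t * zq y t 2 x) * G x $ i) - 72 * (zq y t 3 x * G x $ i))"
  unfolding curl_free_laplacian(1)[OF w t, symmetric] laplacian_kernel[OF t(1)] by (simp add: power2_eq_square algebra_simps)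
 also have "... = 8 * t * (LBINT x. (6 * t * zq y t 2 x) * G x $ i) - 72 * (LBINT x. zq y t 3 x * G x $ i)"
  by (rule trans[OF integral_minus2[OF integrable_mult_right[OF z2] integrable_mult_right[OF z3]]])
   (simp only: integral_mult_right_zero)
 finally have lap: "(LBINT x. G x *i kDW y t i x) = 8 * t * (LBINT x. (6 * t * zq y t 2 x) * G x $ i) - 72 * (LBINT x. zq y t 3 x * G x $ i)" .
 have "((%t. (LBINT x. zq y t 3 x * G x $ i) / t ^ 9) has_real_derivative
  ((LBINT x. (6 * t * zq y t 2 x) * G x $ i) * t ^ 9 - (LBINT x. zq y t 3 x * G x $ i) * (9 * t ^ 8)) / (t ^ 9 * t ^ 9)) (at t)"
  by (rule DERIV_divide[OF zq_integral_deriv[OF iGi t(1)]]) (use t(1) in \<open>auto intro!: derivative_eq_intros\<close>)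
 also have "((LBINT x. (6 * t * zq y t 2 x) * G x $ i) * t ^ 9 - (LBINT x. zq y t 3 x * G x $ i) * (9 * t ^ 8)) / (t ^ 9 * t ^ 9)
  = (LBINT x. G x *i kDW y t i x) / (8 * t ^ 10)" unfolding lap using t(1) by (simp add: field_simps eval_nat_numeral)
 finally show ?thesis using mav_nth[OF iG] by simp
qed

text \<open>By the mean value theorem in the scale, each component changes by at most
  \<open>E / 8\<close>, since half of \<open>t\<close> is below the intermediate scale; three
  components stay below \<open>E\<close>.\<close>

lemma mav_step:
 assumes w: "wgrad U u G" and t: "t > 0" "cball y t \<subseteq> U" and E: "E >= 0"
  and b: "!!ta i. t / 2 <= ta ==> ta <= t ==> \<bar>LBINT x. G x *i kDW y ta i x\<bar> <= E * ta ^ 9" shows "norm (mav G y t - mav G y (t / 2)) <= E"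
proof -
 have "\<bar>(mav G y t - mav G y (t / 2)) $ i\<bar> <= E / 8" for i
 proof -
  have "\<exists>z. t / 2 < z & z < t & mav G y t $ i - mav G y (t / 2) $ i = (t - t / 2) * ((LBINT x. G x *i kDW y z i x) / (8 * z ^ 10))"
  proof (rule MVT2)
   fix z assume "t / 2 <= z" "z <= t"
   thus "((%t. mav G y t $ i) has_real_derivative (LBINT x. G x *i kDW y z i x) / (8 * z ^ 10)) (at z)" by (intro mav_deriv[OF w]) (use t in auto)
  qed (use t in simp)
  then obtain z where z: "t / 2 < z" "z < t" "mav G y t $ i - mav G y (t / 2) $ i = (t - t / 2) * ((LBINT x. G x *i kDW y z i x) / (8 * z ^ 10))"
   by blast
  have z0: "z > 0" using z t by simp
  have "\<bar>mav G y t $ i - mav G y (t / 2) $ i\<bar> = (t / 2) * (\<bar>LBINT x. G x *i kDW y z i x\<bar> / (8 * z ^ 10))"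
   unfolding z(3) using t z0 by (simp add: abs_mult)
  also have "... <= z * ((E * z ^ 9) / (8 * z ^ 10))" using z z0 t b[of z i] by (intro mult_mono divide_right_mono) auto
  also have "... = E / 8" using z0 by (simp add: field_simps eval_nat_numeral)
  finally show ?thesis by simp
 qed
 hence "norm (mav G y t - mav G y (t / 2)) <= (\<Sum>i\<in>(UNIV::3 set). E / 8)" by (intro order_trans[OF norm_le_l1_cart] sum_mono) auto
 also have "... <= E" using E by simp
 finally show ?thesis .
qed

section \<open>Weak solutions, frozen coefficients and local estimates\<close>

definition psol where
 "psol Om sg F w G \<longleftrightarrow> wgrad Om w G & (\<forall>x. x \<notin> Om --> G x = 0) &
  (\<forall>V DV. C1c UNIV V DV --> (LBINT x. sg x * (G x *i DV x)) = (LBINT x. sg x * (F x *i DV x))) &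
  lint (%x. (norm (G x))^2) &
  (LBINT x. sg x * (G x *i G x)) = (LBINT x. sg x * (F x *i G x))"

lemma psolD:
 assumes "psol Om sg F w G" shows "wgrad Om w G" "x \<notin> Om ==> G x = 0"
  "C1c UNIV V DV ==> (LBINT x. sg x * (G x *i DV x)) = (LBINT x. sg x * (F x *i DV x))"
  "lint (%x. (norm (G x))^2)"
  "(LBINT x. sg x * (G x *i G x)) = (LBINT x. sg x * (F x *i G x))"
proof -
 note a = assms[unfolded psol_def]
 show "wgrad Om w G" using a by (rule conjunct1)
 note b = conjunct2[OF a]
 show "x \<notin> Om ==> G x = 0" using conjunct1[OF b] by (elim allE impE)
 note c = conjunct2[OF b]
 show "C1c UNIV V DV ==> (LBINT x. sg x * (G x *i DV x)) = (LBINT x. sg x * (F x *i DV x))"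
  using spec[OF spec[OF conjunct1[OF c]], of V DV] by (rule mp)
 show "lint (%x. (norm (G x))^2)" using conjunct2[OF c] by (rule conjunct1)
 show "(LBINT x. sg x * (G x *i G x)) = (LBINT x. sg x * (F x *i G x))" using conjunct2[OF c] by (rule conjunct2)
qed

text \<open>The integral of \<open>|G|\<close> over a ball, not divided by its volume; the factors
  \<open>t ^ 3\<close> are kept explicit in the estimates.\<close>

definition ag :: "(real^3 => real^3) => real^3 => real => real" where
 "ag G y t = (LBINT x. indicator (cball y t) x * norm (G x))"

lemma ag_integrable:
 fixes G :: "real^3 => real^3"
 assumes "lint G" shows "lint (%x. indicator (cball y t) x * norm (G x))"
 using integrable_mult_indicator[OF _ integrable_norm[OF assms], of "cball y t"] by simp

lemma ag_nonneg: "0 <= ag G y t" unfolding ag_def by (intro integral_ge0) auto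

lemma ag_mono:
 assumes "lint G" "cball y t \<subseteq> cball z s" shows "ag G y t <= ag G z s" unfolding ag_def
 by (rule integral_mono[OF ag_integrable[OF assms(1)] ag_integrable[OF assms(1)]]) (use assms(2) in \<open>auto simp: indicator_def\<close>)

lemma ag_le_norm:
 assumes "lint G" shows "ag G y t <= (LBINT x. norm (G x))" unfolding ag_def
 by (rule integral_mono[OF ag_integrable[OF assms] integrable_norm[OF assms]]) (auto simp: indicator_def)

lemma cball_volume:
 assumes "t >= 0" shows "lint (indicator (cball (y::real^3) t) :: _ => real)" "(LBINT x. indicator (cball (y::real^3) t) x) <= 8 * t ^ 3"
proof -
 show i: "lint (indicator (cball y t) :: _ => real)" by (rule integrable_indicator_compact) simp
 let ?c = "cbox (y - (\<chi> i. t)) (y + (\<chi> i. t))"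
 have sub: "cball y t \<subseteq> ?c"
 proof
  fix x assume "x \<in> cball y t"
  hence "\<bar>(x - y) $ i\<bar> <= t" for i using component_le_norm_cart[of "x - y" i] by (simp add: dist_nm)
  thus "x \<in> ?c" by (auto simp: mem_box_cart abs_le_iff algebra_simps)
 qed
 have "(LBINT x. indicator (cball y t) x) <= ((LBINT x. indicator ?c x) :: real)"
  by (rule integral_mono[OF i integrable_indicator_compact]) (use sub in \<open>auto simp: indicator_def\<close>)
 also have "... = measure lborel ?c" by simp
 also have "... = (2 * t) ^ 3" using assms by (subst content_cbox_cart) (auto simp: interval_eq_empty_cart not_less)
 finally show "(LBINT x. indicator (cball y t) x) <= 8 * t ^ 3" by (simp add: power_mult_distrib)
qed

lemma open_minus_null_nonempty:
 fixes U :: "'a::euclidean_space set"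
 assumes "open U" "U ~= {}" "N \<in> null_sets lborel" shows "\<exists>x. x \<in> U - N"
proof (rule ccontr)
 assume "\<not> ?thesis"
 hence "U \<subseteq> N" by blast
 moreover have "negligible N" using assms(3) by (simp add: negligible_iff_null_sets null_sets_completionI)
 ultimately have "negligible U" using negligible_subset by blast
 thus False using open_not_negligible assms by blast
qed

lemma AE_lborel_witness:
 assumes "AE x in lborel. P (x::'a::euclidean_space)" "open U" "U ~= {}" shows "\<exists>x\<in>U. P x"
proof -
 obtain N where N: "N \<in> null_sets lborel" "{x. \<not> P x} \<subseteq> N" using assms(1) by (auto elim!: AE_E simp: space_lborel null_sets_def)
 obtain x where "x \<in> U - N" using open_minus_null_nonempty[OF assms(2,3) N(1)] by blast
 thus ?thesis using N(2) by blast
qed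

lemma interior_freeze:
 assumes d: "pdata Om al lam Lam sg gsg F f M" and t: "t > 0" "ball y t \<subseteq> Om"
 shows "\<exists>sg0. lam <= sg0 & (AE x in lborel. x \<in> ball y t --> \<bar>sg x - sg0\<bar> <= 2 * Lam * t)"
proof -
 note dD = pdataD[OF d]
 have Lam: "Lam >= 0" using dD(5)[of 0] norm_ge_zero order_trans by blast
 obtain N where N: "N \<in> null_sets lborel" "!!x z. x \<in> ball y t - N ==> z \<in> ball y t - N ==> \<bar>sg x - sg z\<bar> <= Lam * dist x z"
  using wgrad_oscillation[OF wgrad_mono[OF dD(1) t(2)] _ Lam] dD(5) by blast
 obtain x0 where x0: "x0 \<in> ball y t - N" using open_minus_null_nonempty[OF open_ball _ N(1), of y t] t(1) by auto
 have "AE x in lborel. x \<notin> N" using N(1) by (rule AE_not_in)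
 hence "AE x in lborel. x \<in> ball y t --> \<bar>sg x - sg x0\<bar> <= 2 * Lam * t"
 proof eventually_elim
  case (elim x)
  show ?case
  proof
   assume x: "x \<in> ball y t"
   have "\<bar>sg x - sg x0\<bar> <= Lam * dist x x0" using N(2)[of x x0] x x0 elim by blast
   also have "... <= Lam * (2 * t)"
   proof (rule mult_left_mono[OF _ Lam])
    show "dist x x0 <= 2 * t" using x x0 dist_triangle3[of x x0 y] by (simp add: dist_commute)
   qed
   finally show "\<bar>sg x - sg x0\<bar> <= 2 * Lam * t" by simp
  qed
 qed
 moreover have "lam <= sg x0" using dD(3) x0 t(2) by blast
 ultimately show ?thesis by blast
qed

lemma gframe_sub: "gframe Om al r K p n e s gs ==> ball p r \<inter> {x. hgt p n e s x > 0} \<subseteq> Om" using gframeD(4) by blast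

text \<open>The half ball inside \<open>Om\<close> need not be convex, so the oscillation is
  measured on the reflected extension over a full ball. The extension multiplies the gradient bound
  by 5, which gives \<open>10 * Lam * t\<close> in place of \<open>2 * Lam * t\<close>.\<close>

lemma boundary_freeze:
 assumes d: "pdata Om al lam Lam sg gsg F f M" and g: "gframe Om al r K p n e s gs" and al: "al > 0" and t: "t > 0" "t <= r / 2" and Om: "open Om"
 shows "\<exists>sg0. lam <= sg0 & (AE x in lborel. x \<in> Om \<inter> ball p t --> \<bar>sg x - sg0\<bar> <= 10 * Lam * t)"
proof -
 note dD = pdataD[OF d]
 note fr = gframeD(1)[OF g]
 have Lam: "Lam >= 0" using dD(5)[of 0] norm_ge_zero order_trans by blast
 have w: "wgrad (ball p (r / 2)) (ext p n e s sg) (extG p n e s gs gsg)" by (rule wgrad_ext[OF fr wgrad_mono[OF dD(1) gframe_sub[OF g]]])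
 have "AE x in lborel. norm (extG p n e s gs gsg x) <= 5 * Lam" by (rule extG_bound[OF fr]) (use dD(5) in simp)
 hence b: "AE x in lborel. x \<in> ball p (r / 2) --> norm (extG p n e s gs gsg x) <= 5 * Lam" by eventually_elim simp
 obtain N where N: "N \<in> null_sets lborel" "!!x z. x \<in> ball p (r / 2) - N ==> z \<in> ball p (r / 2) - N ==>
   \<bar>ext p n e s sg x - ext p n e s sg z\<bar> <= 5 * Lam * dist x z" using wgrad_oscillation[OF w b] Lam by auto
 have r: "r > 0" using t by simp
 have "p \<in> closure Om" using gframe_normal(2)[OF g r al] by (simp add: frontier_def)
 then obtain z where "z \<in> Om" "dist z p < t" using t(1) unfolding closure_approachable by blast
 hence "z \<in> Om \<inter> ball p t" by (simp add: dist_commute)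
 hence "Om \<inter> ball p t ~= {}" by blast
 then obtain x0 where x0: "x0 \<in> Om \<inter> ball p t - N" using open_minus_null_nonempty[OF _ _ N(1), of "Om \<inter> ball p t"] Om by blast
 have e: "ext p n e s sg x = sg x" if "x \<in> Om \<inter> ball p t" for x using gframeD(4)[OF g, of x] that t r by (simp add: ext_def)
 have "AE x in lborel. x \<notin> N" using N(1) by (rule AE_not_in)
 hence "AE x in lborel. x \<in> Om \<inter> ball p t --> \<bar>sg x - sg x0\<bar> <= 10 * Lam * t"
 proof eventually_elim
  case (elim x)
  show ?case
  proof
   assume x: "x \<in> Om \<inter> ball p t"
   have "x \<in> ball p (r / 2) - N" "x0 \<in> ball p (r / 2) - N" using x x0 elim t by auto
   from N(2)[OF this] have "\<bar>sg x - sg x0\<bar> <= 5 * Lam * dist x x0" using e[OF x] e[of x0] x0 by simp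
   also have "... <= 5 * Lam * (2 * t)"
   proof (rule mult_left_mono)
    show "dist x x0 <= 2 * t" using x x0 dist_triangle3[of x x0 p] by (simp add: dist_commute)
   qed (use Lam in simp)
   finally show "\<bar>sg x - sg x0\<bar> <= 10 * Lam * t" by simp
  qed
 qed
 moreover have "lam <= sg x0" using dD(3) x0 by blast
 ultimately show ?thesis by blast
qed

lemma integral_abs_bound:
 fixes f :: "'a => real"
 assumes "integrable M f" "integrable M g" "AE x in M. \<bar>f x\<bar> <= g x"
 shows "\<bar>\<integral>x. f x \<partial>M\<bar> <= (\<integral>x. g x \<partial>M)"
proof -
 have "\<bar>\<integral>x. f x \<partial>M\<bar> <= (\<integral>x. \<bar>f x\<bar> \<partial>M)" by (rule integral_abs_bound)
 also have "... <= (\<integral>x. g x \<partial>M)" by (rule integral_mono_AE) (use assms in auto)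
 finally show ?thesis .
qed

lemma powr_split: "0 < (t::real) ==> t powr (2 + al) = t^2 * t powr al" by (simp add: powr_add powr_numeral)

lemma le_powr_self:
 assumes "0 < (t::real)" "t <= 1" "al <= 1" shows "t <= t powr al"
proof -
 have "t powr 1 <= t powr al" using assms by (intro powr_mono') auto
 thus ?thesis using assms by simp
qed

text \<open>Replacing the coefficient by a constant at least \<open>lam\<close> costs its
  oscillation times the integral of \<open>|G|\<close>. Dividing by \<open>lam\<close> later leaves
  an estimate for \<open>G\<close> alone, the form needed by \<open>mav_step\<close>.\<close>

lemma freeze_bound:
 assumes d: "pdata Om al lam Lam sg gsg F f M" and lam: "0 < lam" and G: "lint G" "!!x. x \<notin> Om ==> G x = 0"
  and V: "C1c U V DV" and vb: "!!x. norm (DV x) <= X" "!!x. norm (x - p) >= t ==> DV x = 0"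
  and s0: "lam <= sg0" "AE x in lborel. x \<in> Om \<inter> ball p t --> \<bar>sg x - sg0\<bar> <= c" "0 <= c"
 shows "lam * \<bar>LBINT x. G x *i DV x\<bar> <= \<bar>LBINT x. sg x * (G x *i DV x)\<bar> + c * X * ag G p t"
proof -
 note dD = pdataD[OF d]
 have X0: "X >= 0" using vb(1)[of 0] norm_ge_zero order_trans by blast
 note iS = wgrad_integrable[OF dD(1)]
 note CV = C1c_C1[OF V]
 have [measurable]: "DV \<in> Bm" "G \<in> Bm" "sg \<in> Bm" using C1_borel_grad[OF CV] Bm_int[OF G(1)] Bm_int[OF iS(1)] by simp_all
 have sb: "\<bar>sg x\<bar> <= 1 / lam" for x using dD(2,3,4)[of x] lam by (cases "x \<in> Om") auto
 have iGv: "lint (%x. G x *i DV x)" by (rule int_inner_bounded[OF G(1) _ vb(1)]) measurable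
 have isG: "lint (%x. sg x * (G x *i DV x))" using int_bounded_scaleR[OF iGv _ sb] by simp
 have id: "lint (%x. (sg x - sg0) * (G x *i DV x))" unfolding left_diff_distrib by (rule int_diff[OF isG integrable_mult_right[OF iGv]])
 have b2: "\<bar>LBINT x. (sg x - sg0) * (G x *i DV x)\<bar> <= c * X * ag G p t"
 proof -
  have "\<bar>LBINT x. (sg x - sg0) * (G x *i DV x)\<bar> <= (LBINT x. (c * X) * (indicator (cball p t) x * norm (G x)))"
  proof (rule integral_abs_bound[OF id integrable_mult_right[OF ag_integrable[OF G(1)]]])
   show "AE x in lborel. \<bar>(sg x - sg0) * (G x *i DV x)\<bar> <= c * X * (indicator (cball p t) x * norm (G x))" using s0(2)
   proof eventually_elim
    case (elim x)
    show ?case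
    proof (cases "norm (x - p) >= t \<or> x \<notin> Om")
     case True thus ?thesis using vb(2)[of x] G(2)[of x] X0 s0(3) by auto
    next
     case False
     hence x: "x \<in> Om \<inter> ball p t" "x \<in> cball p t" by (simp_all add: dist_nm)
     have "\<bar>G x *i DV x\<bar> <= norm (G x) * X" using order_trans[OF Cauchy_Schwarz_ineq2 mult_left_mono[OF vb(1)[of x] norm_ge_zero]] .
     hence "\<bar>sg x - sg0\<bar> * \<bar>G x *i DV x\<bar> <= c * (norm (G x) * X)" using elim x(1) s0(3) by (intro mult_mono) auto
     thus ?thesis using x(2) by (simp add: abs_mult mult_ac)
    qed
   qed
  qed
  thus ?thesis by (simp add: ag_def)
 qed
 have "(LBINT x. (sg x - sg0) * (G x *i DV x)) = (LBINT x. sg x * (G x *i DV x) - sg0 * (G x *i DV x))" by (simp only: left_diff_distrib)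
 also have "... = (LBINT x. sg x * (G x *i DV x)) - (LBINT x. sg0 * (G x *i DV x))" by (rule integral_minus2[OF isG integrable_mult_right[OF iGv]])
 also have "(LBINT x. sg0 * (G x *i DV x)) = sg0 * (LBINT x. G x *i DV x)" by (rule integral_mult_right_zero)
 finally have "\<bar>sg0 * (LBINT x. G x *i DV x)\<bar> <= \<bar>LBINT x. sg x * (G x *i DV x)\<bar> + c * X * ag G p t" using b2 by linarith
 moreover have "\<bar>sg0 * (LBINT x. G x *i DV x)\<bar> = sg0 * \<bar>LBINT x. G x *i DV x\<bar>" using s0(1) lam by (simp add: abs_mult)
 moreover have "lam * \<bar>LBINT x. G x *i DV x\<bar> <= sg0 * \<bar>LBINT x. G x *i DV x\<bar>" using s0(1) by (intro mult_right_mono) auto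
 ultimately show ?thesis by linarith
qed

text \<open>A test function supported in the ball turns the equation into an integral of
  \<open>f * v\<close>; the size \<open>X * t\<close> of \<open>v\<close> and the bound on
  \<open>f\<close> give the order \<open>t ^ 3 * t powr al\<close>. The oscillation of the
  coefficient contributes a factor \<open>t\<close>, which is at most \<open>t powr al\<close>
  because \<open>t <= 1\<close>.\<close>

lemma interior_estimate:
 assumes d: "pdata Om al lam Lam sg gsg F f M" and so: "psol Om sg F w G" and lam: "0 < lam" and al: "0 < al" "al < 1"
  and t: "0 < t" "t <= 1" "cball y t \<subseteq> Om" and v: "C1c Om v Dv"
  and vb: "!!x. \<bar>v x\<bar> <= X * t" "!!x. norm (Dv x) <= X" "!!x. norm (x - y) >= t ==> v x = 0" "!!x. norm (x - y) >= t ==> Dv x = 0"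
 shows "\<bar>LBINT x. G x *i Dv x\<bar> <= X * t powr al * (1 / lam) * (16 * M * t ^ 3 + 2 * Lam * ag G y t)"
proof -
 note dD = pdataD[OF d] and sD = psolD[OF so]
 have X0: "X >= 0" using vb(2)[of 0] norm_ge_zero order_trans by blast
 have Lam: "Lam >= 0" using dD(5)[of 0] norm_ge_zero order_trans by blast
 note iG = wgrad_integrable(2)[OF sD(1)] and iF = wdiv_integrable[OF dD(8)]
 have "ball y t \<subseteq> Om" using t(3) by auto
 then obtain sg0 where "lam <= sg0" "AE x in lborel. x \<in> ball y t --> \<bar>sg x - sg0\<bar> <= 2 * Lam * t"
  using interior_freeze[OF d t(1)] by blast
 hence s0: "lam <= sg0" "AE x in lborel. x \<in> Om \<inter> ball y t --> \<bar>sg x - sg0\<bar> <= 2 * Lam * t" by (auto elim: eventually_mono)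
 have a1: "(LBINT x. sg x * (G x *i Dv x)) = - (LBINT x. f x * v x)" using sD(3)[OF C1c_mono[OF v]] wdivD[OF dD(8) v] by simp
 have if1: "lint (%x. indicator (cball y t) x * \<bar>f x\<bar>)"
  using integrable_mult_indicator[of "cball y t" lborel "%x. \<bar>f x\<bar>"] iF(2) by simp
 have ifv: "lint (%x. f x * v x)" using C1c_int_scaleR(2)[OF v iF(2)] by (simp add: mult.commute)
 have b1: "\<bar>LBINT x. f x * v x\<bar> <= (X * t) * (16 * M * t powr (2 + al))"
 proof -
  have "\<bar>LBINT x. f x * v x\<bar> <= (LBINT x. (X * t) * (indicator (cball y t) x * \<bar>f x\<bar>))"
  proof (rule integral_abs_bound[OF ifv integrable_mult_right[OF if1]], rule AE_I2)
   fix x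
   show "\<bar>f x * v x\<bar> <= X * t * (indicator (cball y t) x * \<bar>f x\<bar>)"
   proof (cases "norm (x - y) >= t")
    case True thus ?thesis using vb(3) X0 t by simp
   next
    case False
    hence "x \<in> cball y t" by (simp add: dist_nm)
    thus ?thesis using mult_left_mono[OF vb(1)[of x], of "\<bar>f x\<bar>"] by (simp add: abs_mult mult_ac)
   qed
  qed
  also have "... = (X * t) * (LBINT x. indicator (cball y t) x * \<bar>f x\<bar>)" by simp
  also have "... <= (X * t) * (16 * M * t powr (2 + al))" using dD(10)[OF t(1), of y] X0 t by (intro mult_left_mono) auto
  finally show ?thesis .
 qed
 have "lam * \<bar>LBINT x. G x *i Dv x\<bar> <= \<bar>LBINT x. sg x * (G x *i Dv x)\<bar> + 2 * Lam * t * X * ag G y t"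
  by (rule freeze_bound[OF d lam iG sD(2) v vb(2,4) s0]) (use Lam t in auto)
 also have "\<bar>LBINT x. sg x * (G x *i Dv x)\<bar> <= (X * t) * (16 * M * t powr (2 + al))" using a1 b1 by simp
 also have "(X * t) * (16 * M * t powr (2 + al)) = X * t powr al * (16 * M * t ^ 3)" using t by (simp add: powr_split eval_nat_numeral)
 also have "2 * Lam * t * X * ag G y t <= 2 * Lam * t powr al * X * ag G y t"
  using le_powr_self[OF t(1,2), of al] al Lam X0 ag_nonneg by (intro mult_right_mono mult_left_mono) auto
 finally have "lam * \<bar>LBINT x. G x *i Dv x\<bar> <= X * t powr al * (16 * M * t ^ 3 + 2 * Lam * ag G y t)" by (simp add: algebra_simps)
 thus ?thesis using lam by (simp add: field_simps)
qed

lemma arho_zero: "frame p n e s gs ==> arho p n e s gs x 0 = 0" using cmap_linear(2)[OF cmap_rho, of p n e s gs x 0 0] by simp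

lemma rfl0_sym: "norm n = 1 ==> rfl0 n h *i k = h *i rfl0 n k" using cmap_rfl[of n 0] unfolding cmap_def by blast

lemma arho_bound: "frame p n e s gs ==> norm (arho p n e s gs x k) <= 5 * norm k" using cmap_rho[of p n e s gs] unfolding cmap_def by blast

lemma four_powr_le:
 assumes "0 <= (t::real)" "0 < al" "al < 1" "0 <= s" "s <= 4 * t" shows "s powr al <= 4 * t powr al"
proof -
 have "s powr al <= (4 * t) powr al" using assms by (intro powr_mono2) auto
 also have "... = 4 powr al * t powr al" using assms by (simp add: powr_mult)
 also have "4 powr al <= (4::real) powr 1" using assms by (intro powr_mono) auto
 finally show ?thesis by (simp add: mult_right_mono)
qed

text \<open>Folding the reflected half back by \<open>rho\<close> pairs \<open>G\<close> with the
  gradient of the symmetrised test function. The two expressions would agree if the derivative of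
  \<open>rho\<close> were the symmetric map \<open>rfl0\<close>; their difference is the deviation
  of \<open>arho\<close> from it.\<close>

lemma ext_test_reflect:
 assumes g: "gframe Om al r K p n e s gs" and al: "0 < al" "al < 1" and K: "K >= 0" and ta: "0 < ta" "4 * ta <= r"
  and G: "lint G" "!!x. x \<in> ball p r ==> hgt p n e s x <= 0 ==> G x = 0"
  and v: "C1c U v Dv" and vb: "!!x. norm (Dv x) <= X" "!!x. norm (x - p) >= 2 * ta ==> Dv x = 0"
 shows "\<bar>(LBINT x. extG p n e s gs G x *i Dv x) - (LBINT x. G x *i (Dv x + arho p n e s gs x (Dv (rho p n e s x))))\<bar>
  <= 32 * K * ta powr al * X * (LBINT x. indicator (cball p (4 * ta)) x * norm (G x))"
proof -
 note fr = gframeD(1)[OF g]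
 note fD = frameD[OF fr]
 let ?T = "rho p n e s" and ?A = "arho p n e s gs" and ?h = "hgt p n e s"
 note cT = cmap_rho[OF fr]
 have mp: "mpres ?T" using cT by (simp add: cmap_def)
 have X0: "X >= 0" using vb(1)[of 0] norm_ge_zero order_trans by blast
 note Cv = C1c_C1[OF v]
 have [measurable]: "G \<in> Bm" "Dv \<in> Bm" "?h \<in> Bm" using Bm_int[OF G(1)] C1_borel_grad[OF Cv] C1_borel[OF hgt_C1[OF fr]] by simp_all
 note [measurable] = mpres_borel[OF mp]
 have [measurable]: "(%x. ?A x (Dv (?T x))) \<in> Bm" "(%x. ?A x (G (?T x))) \<in> Bm" by (rule cmap_borel[OF cT], measurable)+
 define H where "H x = indicator {x. ?h x <= 0} x * (?A x (G (?T x)) *i Dv x)" for x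
 have Hm[measurable]: "H \<in> Bm" unfolding H_def by measurable
 have iAG: "lint (%x. ?A x (G (?T x)) *i Dv x)" by (rule int_inner_bounded[OF cmap_integrable[OF cT G(1)] _ vb(1)]) simp
 have iH: "lint H" unfolding H_def using integrable_mult_indicator[OF _ iAG, of "{x. ?h x <= 0}"] by simp
 have i1: "lint (%x. G x *i Dv x)" by (rule int_inner_bounded[OF G(1) _ vb(1)]) simp
 have AX: "norm (?A x (Dv (?T x))) <= 5 * X" for x using arho_bound[OF fr, of x "Dv (?T x)"] vb(1)[of "?T x"] by simp
 have i2: "lint (%x. G x *i ?A x (Dv (?T x)))" by (rule int_inner_bounded[OF G(1) _ AX]) simp
 have iHT: "lint (%x. H (?T x))" using mpres_integrable[OF mp Hm] iH by simp
 have e: "extG p n e s gs G x *i Dv x = G x *i Dv x + H x" for x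
 proof (cases "norm (x - p) >= 2 * ta")
  case True thus ?thesis using vb(2)[of x] by (simp add: H_def)
 next
  case False
  hence "x \<in> ball p r" using ta by (simp add: dist_nm)
  thus ?thesis using G(2)[of x] by (auto simp: extG_def H_def)
 qed
 have "(LBINT x. extG p n e s gs G x *i Dv x) = (LBINT x. G x *i Dv x) + (LBINT x. H x)" unfolding e by (rule integral_plus[OF i1 iH])
 moreover have "(LBINT x. G x *i (Dv x + ?A x (Dv (?T x)))) = (LBINT x. G x *i Dv x) + (LBINT x. G x *i ?A x (Dv (?T x)))"
  unfolding inner_add_right by (rule integral_plus[OF i1 i2])
 moreover have "(LBINT x. H (?T x) - G x *i ?A x (Dv (?T x))) = (LBINT x. H x) - (LBINT x. G x *i ?A x (Dv (?T x)))"
  using integral_minus2[OF iHT i2] mpres_integral[OF mp Hm] by simp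
 moreover have "\<bar>LBINT x. H (?T x) - G x *i ?A x (Dv (?T x))\<bar> <=
   (LBINT x. (32 * K * ta powr al * X) * (indicator (cball p (4 * ta)) x * norm (G x)))"
 proof (rule integral_abs_bound[OF int_diff[OF iHT i2] integrable_mult_right[OF ag_integrable[OF G(1)]]], rule AE_I2)
  fix x
  let ?c = "32 * K * ta powr al * X"
  have c0: "?c >= 0" using K X0 by simp
  have TT: "?T (?T x) = x" by (rule rho_rho[OF fr])
  show "\<bar>H (?T x) - G x *i ?A x (Dv (?T x))\<bar> <= ?c * (indicator (cball p (4 * ta)) x * norm (G x))"
  proof (cases "norm (?T x - p) >= 2 * ta")
   case True
   hence "Dv (?T x) = 0" by (rule vb(2))
   thus ?thesis using c0 by (simp add: H_def arho_zero[OF fr])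
  next
   case False
   have nx: "norm (x - p) <= 4 * ta" "norm (x - p) < 4 * ta" using rho_norm[OF fr, of "?T x"] False unfolding TT by auto
   hence xb: "x \<in> ball p r" "x \<in> cball p (4 * ta)" using ta by (simp_all add: dist_nm)
   show ?thesis
   proof (cases "?h x > 0")
    case False
    hence "G x = 0" using G(2)[OF xb(1)] by simp
    thus ?thesis by (simp add: H_def TT arho_zero[OF fr])
   next
    case True
    have h: "?h (?T x) <= 0" using True hgt_rho[OF fr, of x] by simp
    have gs: "norm (gs z) <= K * (4 * ta powr al)" if "norm (z - p) <= 4 * ta" for z
     using order_trans[OF gframeD(2)[OF g, of z] mult_left_mono[OF four_powr_le[of ta al "norm (z - p)"] K]] ta al that by simp
    have gsb: "norm (gs x) + norm (gs (?T x)) <= 8 * K * ta powr al" using gs[of x] gs[of "?T x"] nx(1) False ta by simp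
    let ?d = "Dv (?T x)"
    have ad: "norm (?A z k - rfl0 n k) <= 16 * K * ta powr al * norm k" if "z = x \<or> z = ?T x" for z k
    proof -
     have "norm (?A z k - rfl0 n k) <= 2 * (norm (gs z) + norm (gs (?T z))) * norm k" by (rule arho_diff[OF fr])
     also have "... <= 2 * (8 * K * ta powr al) * norm k" using gsb that TT by (intro mult_right_mono mult_left_mono) (auto simp: add.commute)
     finally show ?thesis by simp
    qed
    \<comment> \<open>Inserting \<open>rfl0\<close>, which can be moved from one factor of the inner
      product to the other, leaves only the two deviations bounded by \<open>ad\<close>.\<close>
    have "H (?T x) - G x *i ?A x ?d = (?A (?T x) (G x) - rfl0 n (G x)) *i ?d - G x *i (?A x ?d - rfl0 n ?d)"
     using h rfl0_sym[OF fD(1), of "G x" ?d] by (simp add: H_def TT inner_diff_left inner_diff_right)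
    also have "\<bar>...\<bar> <= norm (?A (?T x) (G x) - rfl0 n (G x)) * norm ?d + norm (G x) * norm (?A x ?d - rfl0 n ?d)"
     by (rule order_trans[OF abs_triangle_ineq4 add_mono[OF Cauchy_Schwarz_ineq2 Cauchy_Schwarz_ineq2]])
    also have "... <= (16 * K * ta powr al * norm (G x)) * norm ?d + norm (G x) * (16 * K * ta powr al * norm ?d)"
     by (intro add_mono mult_left_mono mult_right_mono ad) auto
    also have "... = 32 * K * ta powr al * norm (G x) * norm ?d" by simp
    also have "... <= 32 * K * ta powr al * norm (G x) * X" using vb(1)[of "?T x"] K by (intro mult_left_mono) auto
    finally show ?thesis using xb(2) by (simp add: mult_ac)
   qed
  qed
 qed
 ultimately show ?thesis by simp
qed

lemma psol_test:
 assumes d: "pdata Om al lam Lam sg gsg F f M" and so: "psol Om sg F w G" and lam: "0 < lam" and V: "C1c U V DV"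
 shows "(LBINT x. sg x * ((indicator Om x *r (G x - b)) *i DV x)) = (LBINT x. sg x * ((F x - b) *i DV x))"
proof -
 note dD = pdataD[OF d] and sD = psolD[OF so]
 obtain B where B: "B > 0" "!!x. \<bar>V x\<bar> <= B" "!!x. norm (DV x) <= B" by (rule C1c_bounded[OF V]) (rule that)
 note iG = wgrad_integrable(2)[OF sD(1)] and iF = wdiv_integrable[OF dD(8)] and iS = wgrad_integrable[OF dD(1)]
 note CV = C1c_C1[OF V]
 have [measurable]: "DV \<in> Bm" "G \<in> Bm" "sg \<in> Bm" using C1_borel_grad[OF CV] Bm_int[OF iG] Bm_int[OF iS(1)] by simp_all
 have sb: "\<bar>sg x\<bar> <= 1 / lam" for x using dD(2,3,4)[of x] lam by (cases "x \<in> Om") auto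
 have iGD: "lint (%x. G x *i DV x)" by (rule int_inner_bounded[OF iG _ B(3)]) measurable
 have i1: "lint (%x. sg x * (G x *i DV x))" using int_bounded_scaleR[OF iGD _ sb] by simp
 have i2: "lint (%x. sg x * (F x *i DV x))" using int_inner_bounded[OF iF(1) _ B(3)] by simp
 have i3: "lint (%x. sg x * (b *i DV x))"
  using Bochner_Integration.integrable_inner_right[OF int_scaleR_bounded[OF iS(1) _ B(3)], of b] by simp
 have "(LBINT x. sg x * ((indicator Om x *r (G x - b)) *i DV x)) = (LBINT x. sg x * (G x *i DV x) - sg x * (b *i DV x))"
 proof (rule integral_cong2[OF refl])
  fix x show "sg x * ((indicator Om x *r (G x - b)) *i DV x) = sg x * (G x *i DV x) - sg x * (b *i DV x)"
   using dD(2)[of x] by (cases "x \<in> Om") (simp_all add: inner_diff_left right_diff_distrib)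
 qed
 also have "... = (LBINT x. sg x * (G x *i DV x)) - (LBINT x. sg x * (b *i DV x))" by (rule integral_minus2[OF i1 i3])
 also have "... = (LBINT x. sg x * (F x *i DV x)) - (LBINT x. sg x * (b *i DV x))" using sD(3)[OF C1c_mono[OF V]] by simp
 also have "... = (LBINT x. sg x * (F x *i DV x) - sg x * (b *i DV x))" by (rule integral_minus2[OF i2 i3, symmetric])
 also have "... = (LBINT x. sg x * ((F x - b) *i DV x))" by (simp only: inner_diff_left right_diff_distrib)
 finally show ?thesis .
qed

lemma freeze_test:
 assumes d: "pdata Om al lam Lam sg gsg F f M" and g: "gframe Om al r K p n e s gs" and al: "0 < al" and lam: "0 < lam"
  and t: "t > 0" "t <= r / 2" and Om: "open Om" and G: "lint G" "!!x. x \<notin> Om ==> G x = 0"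
  and V: "C1c U V DV" and vb: "!!x. norm (DV x) <= X" "!!x. norm (x - p) >= t ==> DV x = 0"
 shows "lam * \<bar>LBINT x. G x *i DV x\<bar> <= \<bar>LBINT x. sg x * (G x *i DV x)\<bar> + 10 * Lam * t * X * ag G p t"
proof -
 have Lam: "Lam >= 0" using pdataD(5)[OF d, of 0] norm_ge_zero order_trans by blast
 obtain sg0 where "lam <= sg0" "AE x in lborel. x \<in> Om \<inter> ball p t --> \<bar>sg x - sg0\<bar> <= 10 * Lam * t"
  using boundary_freeze[OF d g al t Om] by blast
 from freeze_bound[OF d lam G V vb this] show ?thesis using Lam t by simp
qed

text \<open>Folding onto the domain, freezing the coefficient, using the equation with the constant
  field subtracted on both sides, and bounding the resulting flux; each contributes one summand of
  \<open>C0\<close>. The factor 513 is 1 for \<open>G\<close> itself and 512 for the subtracted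
  field on a ball of radius \<open>4 * ta\<close>.\<close>

lemma boundary_estimate:
 fixes K M lam Lam :: real
 defines "C0 \<equiv> (1 / lam) * (2048 + 1024 * Lam + 98304 * K^2 / lam) + 513 * (32 * K + 240 * Lam / lam)"
 assumes d: "pdata Om al lam Lam sg gsg F f M" and so: "psol Om sg F w G" and lam: "0 < lam"
  and g: "gframe Om al r K p n e s gs" and al: "0 < al" "al < 1" and K: "K >= 1" and Om: "open Om" "bounded Om"
  and ta: "0 < ta" "ta <= 1" "8 * ta <= r" and y: "norm (y - p) <= ta" and v: "C1c (ball p (r / 2)) v Dv"
  and vb: "!!x. \<bar>v x\<bar> <= X * ta" "!!x. norm (Dv x) <= X" "!!x. norm (x - y) >= ta ==> v x = 0" "!!x. norm (x - y) >= ta ==> Dv x = 0"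
 shows "\<bar>LBINT x. extG p n e s gs (%x. indicator Om x *r (G x - (F p *i n) *r n)) x *i Dv x\<bar>
  <= X * ta powr al * C0 * (M * ta ^ 3 + ag G y (5 * ta))"
proof -
 note dD = pdataD[OF d] and sD = psolD[OF so]
 note fr = gframeD(1)[OF g]
 note fD = frameD[OF fr]
 let ?T = "rho p n e s" and ?A = "arho p n e s gs" and ?h = "hgt p n e s"
 let ?b = "(F p *i n) *r n"
 \<comment> \<open>The support of \<open>v\<close> lies within \<open>2 * ta\<close> of
   \<open>p\<close>, and \<open>rho\<close> at most doubles distances from \<open>p\<close>, so the
   symmetrised test function lives within \<open>4 * ta\<close>; this ball is contained in the ball
   of radius \<open>5 * ta\<close> about \<open>y\<close>.\<close>
 let ?t = "4 * ta" and ?a = "ag G y (5 * ta)"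
 let ?I = "indicator (cball p ?t) :: real^3 => real"
 define H where "H = (%x. indicator Om x *r (G x - ?b))"
 have r: "r > 0" using ta by simp
 have M: "M > 0" using d unfolding pdata_def by blast
 have X0: "X >= 0" using vb(2)[of 0] norm_ge_zero order_trans by blast
 have Lam: "Lam >= 0" using dD(5)[of 0] norm_ge_zero order_trans by blast
 note iG = wgrad_integrable(2)[OF sD(1)]
 have bM: "norm ?b <= M" using dD(11)[of p] gframe_normal[OF g r al(1)] fD(1) by simp
 have Hm: "lint H"
 proof -
  have "emeasure lborel Om < \<infinity>" by (rule emeasure_bounded_finite[OF Om(2)])
  hence "lint (%x. indicator Om x *r ?b)" using Om(1) by (intro integrable_scaleR_left integrable_real_indicator) auto
  moreover have "lint (%x. indicator Om x *r G x)" by (rule integrable_mult_indicator[OF _ iG]) (use Om(1) in simp)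
  ultimately show ?thesis unfolding H_def scaleR_diff_right by (rule int_diff[rotated])
 qed
 have H0: "H x = 0" if "x \<in> ball p r" "?h x <= 0" for x using gframeD(4)[OF g that(1)] that(2) by (simp add: H_def)
 have HO: "H x = 0" if "x \<notin> Om" for x using that by (simp add: H_def)
 define A where "A = M * ta ^ 3 + ?a"
 have A0: "A >= 0" using M ta ag_nonneg[of G y "5 * ta"] by (simp add: A_def)
 note vol = cball_volume[of "4 * ta" p]
 have agH: "ag H p ?t <= 513 * A"
 proof -
  have "ag H p ?t <= (LBINT x. ?I x * norm (G x) + M * ?I x)" unfolding ag_def
  proof (rule integral_mono[OF ag_integrable[OF Hm] int_add[OF ag_integrable[OF iG] integrable_mult_right]])
   fix x
   have "norm (H x) <= norm (G x) + M" using norm_triangle_ineq4[of "G x" ?b] bM M by (auto simp: H_def indicator_def)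
   thus "?I x * norm (H x) <= ?I x * norm (G x) + M * ?I x" by (auto simp: indicator_def)
  qed (use vol(1) ta in simp)
  also have "... = ag G p ?t + M * (LBINT x. ?I x)" unfolding ag_def by (subst integral_plus[OF ag_integrable[OF iG]]) (use vol(1) ta in auto)
  also have "ag G p ?t <= ?a"
  proof (rule ag_mono[OF iG], rule subsetI)
   fix x assume "x \<in> cball p ?t"
   thus "x \<in> cball y (5 * ta)" using dist_triangle[of y x p] y by (simp add: dist_norm)
  qed
  also have "M * (LBINT x. ?I x) <= M * (8 * ?t ^ 3)" using vol(2) ta M by (intro mult_left_mono) auto
  finally have "ag H p ?t <= ?a + 512 * (M * ta ^ 3)" by (simp add: power_mult_distrib)
  moreover have "0 <= M * ta ^ 3" using M ta by simp
  moreover have "a <= b + 512 * m ==> 0 <= m ==> 0 <= b ==> a <= 513 * (m + b)" for a b m :: real by simp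
  ultimately show ?thesis using ag_nonneg[of G y "5 * ta"] unfolding A_def by blast
 qed
 have far: "norm (x - y) >= ta" if "norm (x - p) >= 2 * ta" for x using norm_triangle_ineq[of "x - y" "y - p"] that y by simp
 have farT: "norm (?T x - y) >= ta" if "norm (x - p) >= 4 * ta" for x
  using far[of "?T x"] rho_norm[OF fr, of "?T x"] that rho_rho[OF fr, of x] by simp
 define V where "V x = v x + v (?T x)" for x
 define DV where "DV x = Dv x + ?A x (Dv (?T x))" for x
 note cT = cmap_rho[OF fr]
 have sub: "?T ` ball p (r / 2) \<subseteq> ball p r"
 proof
  fix z assume "z \<in> ?T ` ball p (r / 2)"
  then obtain x where "z = ?T x" "norm (x - p) < r / 2" by (auto simp: dist_nm)
  thus "z \<in> ball p r" using rho_norm[OF fr, of x] by (simp add: dist_nm)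
 qed
 have V: "C1c (ball p r) V DV" unfolding V_def[abs_def] DV_def[abs_def]
 proof (rule C1c_add)
  show "C1c (ball p r) v Dv" by (rule C1c_mono[OF v]) (use r in auto)
  show "C1c (ball p r) (%x. v (?T x)) (%x. ?A x (Dv (?T x)))" by (rule cmap_C1c[OF cT v cmap_continuous[OF cT] rho_rho[OF fr] sub])
 qed
 have Vb: "\<bar>V x\<bar> <= 2 * X * ta" for x using vb(1)[of x] vb(1)[of "?T x"] unfolding V_def by linarith
 have DVb: "norm (DV x) <= 6 * X" for x
 proof -
  have "norm (DV x) <= norm (Dv x) + norm (?A x (Dv (?T x)))" unfolding DV_def by (rule norm_triangle_ineq)
  thus ?thesis using vb(2)[of x] vb(2)[of "?T x"] arho_bound[OF fr, of x "Dv (?T x)"] by linarith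
 qed
 have V0: "V x = 0" "DV x = 0" if "norm (x - p) >= 4 * ta" for x
 proof -
  have "norm (x - y) >= ta" using far[of x] that ta by simp
  from vb(3,4)[OF this] vb(3,4)[OF farT[OF that]] show "V x = 0" "DV x = 0" by (simp_all add: V_def DV_def arho_zero[OF fr])
 qed
 have ind: "x \<in> cball p ?t" if "V x ~= 0 \<or> DV x ~= 0" for x using V0[of x] that by (fastforce simp: dist_nm)
 have P: "ta <= ta powr al" by (rule le_powr_self) (use ta al in auto)
 have step1: "\<bar>(LBINT x. extG p n e s gs H x *i Dv x) - (LBINT x. H x *i DV x)\<bar> <= 32 * K * ta powr al * X * ag H p ?t"
  unfolding DV_def ag_def by (rule ext_test_reflect[OF g al _ ta(1) _ Hm H0 v vb(2)]) (use K ta vb(4) far in auto)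
 have step2: "lam * \<bar>LBINT x. H x *i DV x\<bar> <= \<bar>LBINT x. sg x * (H x *i DV x)\<bar> + 10 * Lam * ?t * (6 * X) * ag H p ?t"
  by (rule freeze_test[OF d g al(1) lam _ _ Om(1) Hm HO V DVb]) (use ta V0 in auto)
 have step3: "(LBINT x. sg x * (H x *i DV x)) = (LBINT x. sg x * ((F x - ?b) *i DV x))" unfolding H_def by (rule psol_test[OF d so lam V])
 have step4: "\<bar>LBINT x. sg x * ((F x - ?b) *i DV x)\<bar>
  <= (LBINT x. indicator Om x * (\<bar>f x\<bar> + Lam * M) * \<bar>V x\<bar>)
   + (8 * K^2 / lam) * M * ?t powr al * (LBINT x. indicator Om x * norm (DV x))"
  by (rule boundary_functional[OF g d r al K Om lam V]) (use ta V0 in auto)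
 have if1: "lint (%x. ?I x * \<bar>f x\<bar>)"
  using integrable_mult_indicator[of "cball p ?t" lborel "%x. \<bar>f x\<bar>"] wdiv_integrable[OF dD(8)] by simp
 have p4: "?t powr al <= 4 * ta powr al" by (rule four_powr_le) (use ta al in auto)
 have step5: "(LBINT x. indicator Om x * (\<bar>f x\<bar> + Lam * M) * \<bar>V x\<bar>) <= X * ta powr al * (2048 + 1024 * Lam) * (M * ta ^ 3)"
 proof -
  let ?g = "%x. (2 * X * ta) * (?I x * \<bar>f x\<bar> + Lam * M * ?I x)"
  have ig: "lint (%x. ?I x * \<bar>f x\<bar> + Lam * M * ?I x)" by (rule int_add[OF if1 integrable_mult_right]) (use vol(1) ta in simp)
  have "(LBINT x. indicator Om x * (\<bar>f x\<bar> + Lam * M) * \<bar>V x\<bar>) <= (LBINT x. ?g x)"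
  proof (rule integral_mono'[OF integrable_mult_right[OF ig]])
   fix x
   have c: "\<bar>f x\<bar> + Lam * M >= 0" using Lam M by simp
   show "indicator Om x * (\<bar>f x\<bar> + Lam * M) * \<bar>V x\<bar> <= ?g x"
   proof (cases "V x = 0")
    case True thus ?thesis using X0 ta Lam M by simp
   next
    case False
    have "indicator Om x * (\<bar>f x\<bar> + Lam * M) * \<bar>V x\<bar> <= 1 * (\<bar>f x\<bar> + Lam * M) * (2 * X * ta)"
     by (rule mult_mono[OF mult_right_mono Vb]) (use c X0 ta in \<open>auto simp: indicator_def\<close>)
    thus ?thesis using ind[of x] False by (simp add: mult_ac)
   qed
   show "0 <= ?g x" using X0 ta Lam M by simp
  qed
  also have "... = (2 * X * ta) * ((LBINT x. ?I x * \<bar>f x\<bar>) + Lam * M * (LBINT x. ?I x))"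
   by (subst integral_mult_right_zero, subst integral_plus[OF if1]) (use vol(1) ta in auto)
  also have "... <= (2 * X * ta) * (16 * M * ?t powr (2 + al) + Lam * M * (8 * ?t ^ 3))"
   using dD(10)[of "4 * ta" p] vol(2) ta X0 Lam M by (intro mult_left_mono add_mono) auto
  also have "... <= (2 * X * ta) * (16 * M * (64 * ta^2 * ta powr al) + Lam * M * (8 * ?t ^ 3))"
  proof -
   have "?t powr (2 + al) <= 64 * ta^2 * ta powr al" using mult_left_mono[OF p4, of "16 * ta^2"] ta by (simp add: powr_split power_mult_distrib)
   thus ?thesis using X0 M ta by (intro mult_left_mono add_right_mono) auto
  qed
  also have "... = X * ta powr al * 2048 * (M * ta ^ 3) + ta * (1024 * X * Lam * (M * ta ^ 3))"
   by (simp add: power_mult_distrib power2_eq_square power3_eq_cube algebra_simps)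
  also have "ta * (1024 * X * Lam * (M * ta ^ 3)) <= ta powr al * (1024 * X * Lam * (M * ta ^ 3))"
   by (rule mult_right_mono[OF P]) (use X0 Lam M ta in simp)
  also have "X * ta powr al * 2048 * (M * ta ^ 3) + ta powr al * (1024 * X * Lam * (M * ta ^ 3)) = X * ta powr al * (2048 + 1024 * Lam) * (M * ta ^ 3)"
   by (simp add: algebra_simps)
  finally show ?thesis by simp
 qed
 have step6: "(8 * K^2 / lam) * M * ?t powr al * (LBINT x. indicator Om x * norm (DV x)) <= X * ta powr al * (98304 * K^2 / lam) * (M * ta ^ 3)"
 proof -
  have "(LBINT x. indicator Om x * norm (DV x)) <= (LBINT x. (6 * X) * ?I x)"
  proof (rule integral_mono')
   fix x show "indicator Om x * norm (DV x) <= (6 * X) * ?I x" using DVb[of x] ind[of x] X0 by (cases "DV x = 0") (auto simp: indicator_def)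
  qed (use vol(1) ta X0 in auto)
  also have "... = (6 * X) * (LBINT x. ?I x)" by simp
  also have "... <= (6 * X) * (8 * ?t ^ 3)" using vol(2) ta X0 by (intro mult_left_mono) auto
  finally have I: "(LBINT x. indicator Om x * norm (DV x)) <= 3072 * X * ta ^ 3" by (simp add: power_mult_distrib)
  have "(8 * K^2 / lam) * M * ?t powr al * (LBINT x. indicator Om x * norm (DV x)) <= (8 * K^2 / lam) * M * (4 * ta powr al) * (3072 * X * ta ^ 3)"
   by (intro mult_mono mult_left_mono p4 I integral_ge0) (use lam M X0 ta in auto)
  thus ?thesis by (simp add: mult_ac)
 qed
 have M3: "M * ta ^ 3 <= A" unfolding A_def using ag_nonneg by simp
 have "lam * \<bar>LBINT x. H x *i DV x\<bar> <= X * ta powr al * (2048 + 1024 * Lam + 98304 * K^2 / lam) * (M * ta ^ 3) + ta * (240 * Lam * X * ag H p ?t)"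
  using step2 step3 step4 step5 step6 by (simp add: algebra_simps)
 also have "X * ta powr al * (2048 + 1024 * Lam + 98304 * K^2 / lam) * (M * ta ^ 3) <= X * ta powr al * (2048 + 1024 * Lam + 98304 * K^2 / lam) * A"
  by (rule mult_left_mono[OF M3]) (use X0 Lam lam in simp)
 also have "ta * (240 * Lam * X * ag H p ?t) <= ta powr al * (240 * Lam * X * (513 * A))"
  by (intro mult_mono mult_left_mono P agH) (use X0 Lam ag_nonneg ta in auto)
 finally have L: "lam * \<bar>LBINT x. H x *i DV x\<bar> <= X * ta powr al * ((2048 + 1024 * Lam + 98304 * K^2 / lam) + 513 * 240 * Lam) * A"
  by (simp add: algebra_simps)
 have "lam * (\<bar>LBINT x. H x *i DV x\<bar> + 32 * K * ta powr al * X * (513 * A)) <= lam * (X * ta powr al * C0 * A)"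
 proof -
  have "lam * (X * ta powr al * C0 * A) = X * ta powr al * (lam * C0) * A" by simp
  also have "lam * C0 = (2048 + 1024 * Lam + 98304 * K^2 / lam) + 513 * 240 * Lam + lam * (513 * 32 * K)"
   using lam unfolding C0_def by (simp add: field_simps)
  also have "X * ta powr al * ... * A = X * ta powr al * ((2048 + 1024 * Lam + 98304 * K^2 / lam) + 513 * 240 * Lam) * A + lam * (32 * K * ta powr al * X * (513 * A))"
   by (simp only: distrib_left distrib_right mult_ac)
  finally show ?thesis using L by (simp only: distrib_left)
 qed
 hence "\<bar>LBINT x. H x *i DV x\<bar> + 32 * K * ta powr al * X * (513 * A) <= X * ta powr al * C0 * A"
  using lam by (simp only: mult_le_cancel_left_pos)
 moreover have "32 * K * ta powr al * X * ag H p ?t <= 32 * K * ta powr al * X * (513 * A)" by (rule mult_left_mono[OF agH]) (use K X0 in simp)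
 ultimately show ?thesis using step1 unfolding H_def[symmetric] A_def[symmetric] by linarith
qed

lemma extG_norm:
 assumes "frame p n e s gs" shows "norm (extG p n e s gs H x) <= norm (H x) + 5 * norm (H (rho p n e s x))"
 using arho_bound[OF assms, of x "H (rho p n e s x)"] by (auto simp: extG_def intro: add_increasing)

lemma six_times: "(a::real) <= h + 5 * h ==> h <= x ==> a <= 6 * x" by simp

section \<open>Mass of the averaging kernel and recovery of the gradient from averages\<close>

lemma kap_shift: "kap y t x = kap 0 t (x - y)" by (simp add: kap_def zq_def)

lemma kap_sym: "kap 0 t (x - z) = kap x t z" by (simp add: kap_def zq_def inner_diff_left inner_diff_right inner_commute add.commute)

lemma kap_C1c:
 assumes "t > 0" "cball y t \<subseteq> U" shows "C1c U (kap y t) (%x. (1 / t ^ 9) *r ((- 6 * zq y t 2 x) *r (x - y)))"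
 using C1c_cmult[OF C1c_kernel(3)[OF assms], of "1 / t ^ 9"] by (simp add: kap_def[abs_def])

lemma kap_bounds:
 assumes "t > 0" shows "0 <= kap y t x" "kap y t x <= 1 / t ^ 3" "norm (x - y) >= t ==> kap y t x = 0"
 using zq_nonneg[of y t 3 x] zq_le[of t y 3 x] zq_zero[of t 3 x y] assms by (auto simp: kap_def field_simps eval_nat_numeral)

text \<open>The total mass of the kernel, which is not normalised. The power \<open>t ^ 9\<close> in
  \<open>kap\<close> combines the height \<open>t ^ 6\<close> with the volume factor
  \<open>t ^ 3\<close>, so the mass does not change under the halving of scales.\<close>

definition kN :: "real => real" where
 "kN t = (LBINT x. kap 0 t x)"

lemma kap_integral: "(LBINT x. kap y t x) = kN t"
proof -
 have m: "kap 0 t \<in> Bm"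
  unfolding kap_def[abs_def] zq_def[abs_def] by (intro borel_measurable_divide borel_measurable_const borel_measurable_continuous_onI continuous_intros)
 show ?thesis unfolding kN_def kap_shift[of y] using mpres_integral[OF mpres_plus m, of "- y"] by simp
qed

lemma mav_const:
 assumes "t > 0" "cball y t \<subseteq> U" shows "mav (%x. indicator U x *r b) y t = kN t *r b"
proof -
 have "mav (%x. indicator U x *r b) y t = (LBINT x. kap y t x *r b)" unfolding mav_def
 proof (rule integral_cong2[OF refl])
  fix x show "kap y t x *r indicator U x *r b = kap y t x *r b"
   using kap_bounds(3)[OF assms(1), of x y] assms(2) by (cases "norm (x - y) >= t") (auto simp: indicator_def dist_nm)
 qed
 also have "... = (LBINT x. kap y t x) *r b" by (rule integral_scaleR_left) (use C1c_integrable(1)[OF kap_C1c[OF assms]] in simp)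
 finally show ?thesis by (simp add: kap_integral)
qed

text \<open>The averages of a constant gradient field do not change between the scales, since the
  integral of a test gradient vanishes; \<open>mav_step\<close> with error zero then compares the
  masses.\<close>

lemma kN_half:
 assumes t: "t > 0" shows "kN (t / 2) = kN t"
proof -
 let ?b = "axis 1 1 :: real^3" and ?U = "ball 0 (2 * t) :: (real^3) set"
 let ?G = "%x. indicator ?U x *r ?b"
 have w: "wgrad ?U (%x. indicator ?U x *r (?b *i x)) ?G" by (rule C1_wgrad[OF C1_inner]) auto
 have "norm (mav ?G 0 t - mav ?G 0 (t / 2)) <= 0"
 proof (rule mav_step[OF w t])
  show "cball 0 t \<subseteq> ?U" using t by auto
  fix ta i assume ta: "t / 2 <= ta" "ta <= t"
  hence c: "ta > 0" "cball 0 ta \<subseteq> ?U" using t by auto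
  have "(LBINT x. ?G x *i kDW 0 ta i x) = (LBINT x. ?b *i kDW 0 ta i x)"
  proof (rule integral_cong2[OF refl])
   fix x show "?G x *i kDW 0 ta i x = ?b *i kDW 0 ta i x" using C1c_zero(2)[OF C1c_kernel(1)[OF c], of x i] by (cases "x \<in> ?U") auto
  qed
  also have "... = ?b *i (LBINT x. kDW 0 ta i x)" by (rule integral_inner_right) (rule C1c_integrable(2)[OF C1c_kernel(1)[OF c]])
  also have "... = 0" unfolding C1c_integral_grad[OF C1c_kernel(1)[OF c]] by simp
  finally show "\<bar>LBINT x. ?G x *i kDW 0 ta i x\<bar> <= 0 * ta ^ 9" by simp
 qed simp
 moreover have "cball 0 t \<subseteq> ?U" "cball 0 (t / 2) \<subseteq> ?U" using t by auto
 ultimately have "kN t *r ?b - kN (t / 2) *r ?b = 0" using mav_const[OF t, of 0 ?U ?b] mav_const[of "t / 2" 0 ?U ?b] t by simp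
 thus ?thesis by (simp add: vec_eq_iff forall_3 axis_def)
qed

lemma kN_dyadic: "t > 0 ==> kN (t / 2 ^ j) = kN t"
proof (induction j)
 case (Suc j)
 thus ?case using kN_half[of "t / 2 ^ j"] by (simp add: mult.commute)
qed simp

lemma kN_pos:
 assumes "t > 0" shows "kN t > 0"
proof -
 have i: "lint (kap 0 t)" using C1c_integrable(1)[OF kap_C1c[OF assms, of 0 UNIV]] by simp
 have "kN t >= 0" unfolding kN_def by (intro integral_ge0 kap_bounds(1)[OF assms])
 moreover have "kN t ~= 0"
 proof
  assume "kN t = 0"
  hence "AE x in lborel. kap 0 t x = 0" unfolding kN_def using integral_nonneg_eq_0_iff_AE[OF i] kap_bounds(1)[OF assms] by simp
  then obtain N where N: "N \<in> null_sets lborel" "{x. kap 0 t x ~= 0} \<subseteq> N" by (auto elim!: AE_E simp: null_sets_def)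
  have "ball 0 t \<subseteq> N"
  proof
   fix x :: "real^3" assume "x \<in> ball 0 t"
   hence "x *i x < t^2" unfolding power2_norm_eq_inner[symmetric] by (intro power_strict_mono) auto
   hence "kap 0 t x ~= 0" using assms by (simp add: kap_def zq_def)
   thus "x \<in> N" using N(2) by blast
  qed
  thus False using open_minus_null_nonempty[OF open_ball _ N(1), of 0 t] assms by auto
 qed
 ultimately show ?thesis by simp
qed

text \<open>The kernels at the scales \<open>R / 2 ^ j\<close>, divided by their common mass, form a
  mollifier sequence, so a subsequence of scales recovers \<open>G\<close> almost
  everywhere.\<close>

lemma mav_limit:
 assumes R: "R > 0" and G: "lint G"
 shows "\<exists>q::nat=>nat. strict_mono q & (AE y in lborel. (%j. mav G y (R / 2 ^ q j)) \<longlonglongrightarrow> kN R *r G y)"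
proof -
 define et where "et j z = (1 / kN R) * kap 0 (R / 2 ^ j) z" for j :: nat and z
 define D where "D j x = (1 / kN R) *r ((1 / (R / 2 ^ j) ^ 9) *r ((- 6 * zq 0 (R / 2 ^ j) 2 x) *r (x - 0)))" for j :: nat and x
 note k0 = kN_pos[OF R]
 have tj: "R / 2 ^ j > 0" for j :: nat using R by simp
 have m: "mollifier (R / 2 ^ j) (et j) (D j)" for j unfolding mollifier_def
 proof (intro conjI allI impI)
  show "C1c UNIV (et j) (D j)" unfolding et_def[abs_def] D_def[abs_def] by (rule C1c_cmult[OF kap_C1c[OF tj]]) simp
  show "et j z = 0" if "R / 2 ^ j < norm z" for z using kap_bounds(3)[OF tj, of j z 0] that by (simp add: et_def)
  show "0 <= et j z" for z using kap_bounds(1)[OF tj, of 0 j z] k0 by (simp add: et_def)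
  show "(LBINT z. et j z) = 1" using kap_integral[of 0 "R / 2 ^ j"] kN_dyadic[OF R, of j] k0 by (simp add: et_def)
 qed
 have d: "(%j. R / 2 ^ j) \<longlonglongrightarrow> 0" using LIMSEQ_divide_realpow_zero[of 2 R] by simp
 obtain q :: "nat => nat" where q: "strict_mono q" "AE x in lborel. (%n. cv (et (q n)) G x) \<longlonglongrightarrow> G x"
  using cv_AE_subseq[OF m d G] by blast
 have c: "cv (et j) G x = (1 / kN R) *r mav G x (R / 2 ^ j)" for j x
  unfolding cv_def mav_def et_def kap_sym scaleR_scaleR[symmetric] by (rule integral_scaleR_right)
 have "AE x in lborel. (%j. mav G x (R / 2 ^ q j)) \<longlonglongrightarrow> kN R *r G x" using q(2)
 proof eventually_elim
  case (elim x)
  have "(%n. kN R *r cv (et (q n)) G x) \<longlonglongrightarrow> kN R *r G x" by (intro tendsto_intros elim)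
  thus ?case using k0 by (simp add: c)
 qed
 thus ?thesis using q(1) by blast
qed

lemma nearest_frontier_point:
 fixes Om :: "'a::euclidean_space set"
 assumes "open Om" "bounded Om" "y \<in> Om" shows "\<exists>p\<in>frontier Om. 0 < dist y p & ball y (dist y p) \<subseteq> Om"
proof -
 have ne: "frontier Om ~= {}" using frontier_eq_empty[of Om] assms(2,3) not_bounded_UNIV by auto
 obtain p where p: "p \<in> frontier Om" "infdist y (frontier Om) = dist y p" using infdist_attains_inf[OF frontier_closed ne] by blast
 have "y \<notin> frontier Om" using assms by (simp add: frontier_def interior_open)
 hence "dist y p > 0" using p(1) by auto
 moreover have "ball y (dist y p) \<subseteq> Om"
 proof (rule ccontr)
  assume c: "\<not> ?thesis"
  have "ball y (dist y p) \<inter> frontier Om ~= {}"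
   proof (rule connected_Int_frontier)
   show "ball y (dist y p) \<inter> Om ~= {}" using assms(3) centre_in_ball[of y "dist y p"] \<open>dist y p > 0\<close> by blast
  qed (use c in auto)
  then obtain z where "dist y z < dist y p" "z \<in> frontier Om" by auto
  thus False using infdist_le[of z "frontier Om" y] p(2) by simp
 qed
 ultimately show ?thesis using p(1) by blast
qed

text \<open>One instance of the problem. The numbers \<open>al\<close>, \<open>lam\<close>,
  \<open>Lam\<close>, \<open>r\<close>, \<open>K\<close> and the domain are to be fixed before the
  data; uniform bounds are therefore stated outside the locale, with a constant chosen first and the
  locale predicate as a hypothesis. The normalisation \<open>r <= 1\<close> allows powers of the
  scale to be compared.\<close>

locale coil_data =
 fixes Om :: "(real^3) set" and al lam Lam M r K :: real and sg f w :: "real^3 => real" and gsg F G :: "real^3 => real^3"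
 assumes data: "pdata Om al lam Lam sg gsg F f M" and sol: "psol Om sg F w G"
  and Om: "open Om" "bounded Om" and al: "0 < al" "al < 1" and lam: "0 < lam" and r: "0 < r" "r <= 1" and K: "1 <= K"
  and frames: "!!p. p \<in> frontier Om ==> \<exists>n e s gs. gframe Om al r K p n e s gs"
begin

definition "C0 = (1 / lam) * (2048 + 1024 * Lam + 98304 * K^2 / lam) + 513 * (32 * K + 240 * Lam / lam)"

lemmas dD = pdataD[OF data]
lemmas sD = psolD[OF sol]
lemmas iG = wgrad_integrable(2)[OF sD(1)]

lemma M0: "M > 0" using data unfolding pdata_def by blast

lemma Lam0: "Lam >= 0" using dD(5)[of 0] norm_ge_zero order_trans by blast

lemma C0_ge: "C0 >= 0" "16 / lam <= C0" "2 * Lam / lam <= C0" using lam Lam0 K by (simp_all add: C0_def field_simps)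

lemma interior_bound:
 assumes "0 < t" "t <= 1" "cball y t \<subseteq> Om"
 shows "\<bar>LBINT x. G x *i kDW y t i x\<bar> <= 56 * t ^ 6 * t powr al * C0 * (M * t ^ 3 + ag G y (5 * t))"
proof -
 have "\<bar>LBINT x. G x *i kDW y t i x\<bar> <= (56 * t ^ 6) * t powr al * (1 / lam) * (16 * M * t ^ 3 + 2 * Lam * ag G y t)"
  by (rule interior_estimate[OF data sol lam al assms C1c_kernel(1)[OF assms(1,3)] kernel_bounds[OF assms(1)]])
 also have "... = (56 * t ^ 6) * t powr al * ((16 / lam) * (M * t ^ 3) + (2 * Lam / lam) * ag G y t)" using lam by (simp add: field_simps)
 also have "... <= (56 * t ^ 6) * t powr al * (C0 * (M * t ^ 3) + C0 * ag G y (5 * t))"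
  using C0_ge M0 assms(1) ag_nonneg by (intro mult_left_mono add_mono mult_mono C0_ge ag_mono[OF iG]) auto
 also have "... = 56 * t ^ 6 * t powr al * C0 * (M * t ^ 3 + ag G y (5 * t))" by (simp only: distrib_left mult.assoc)
 finally show ?thesis .
qed

text \<open>Gives every point of the domain a gradient field on a ball of the same radius
  \<open>r / 16\<close>, agreeing near the point with \<open>G\<close> up to a constant
  \<open>b\<close>. Far from the boundary this is \<open>G\<close> itself; near it, the reflected
  extension of \<open>G - b\<close>. Later arguments need no distinction between interior and
  boundary.\<close>

lemma local_field:
 assumes y: "y \<in> Om"
 shows "\<exists>U u F' b d. wgrad U u F' & cball y (r / 16) \<subseteq> U & norm b <= M & 0 < d & (\<forall>x\<in>ball y d. F' x = G x - b) &
  (LBINT x. norm (F' x)) <= 6 * ((LBINT x. norm (G x)) + M * measure lborel Om) &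
  (\<forall>t i. 0 < t --> t <= r / 16 --> \<bar>LBINT x. F' x *i kDW y t i x\<bar> <= 56 * t ^ 6 * t powr al * C0 * (M * t ^ 3 + ag G y (5 * t)))"
proof -
 obtain p where p: "p \<in> frontier Om" "0 < dist y p" "ball y (dist y p) \<subseteq> Om" using nearest_frontier_point[OF Om y] by blast
 define d where "d = dist y p"
 have nG: "(LBINT x. norm (G x)) >= 0" by (intro integral_ge0) simp
 have m0: "measure lborel Om >= 0" by simp
 show ?thesis
 proof (cases "d > r / 16")
  case True
  show ?thesis
  proof (intro exI[of _ "ball y d"] exI[of _ w] exI[of _ G] exI[of _ "0 :: real^3"] exI[of _ d] conjI allI impI ballI)
   show "wgrad (ball y d) w G" by (rule wgrad_mono[OF sD(1)]) (use p d_def in simp)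
   show "cball y (r / 16) \<subseteq> ball y d" using True by auto
   show "norm (0::real^3) <= M" using M0 by simp
   show "0 < d" using p d_def by simp
   show "(LBINT x. norm (G x)) <= 6 * ((LBINT x. norm (G x)) + M * measure lborel Om)" using nG mult_nonneg_nonneg[OF less_imp_le[OF M0] m0] by simp
   fix t i assume t: "0 < t" "t <= r / 16"
   have "cball y t \<subseteq> Om"
   proof
    fix x assume "x \<in> cball y t"
    hence "x \<in> ball y (dist y p)" using t True d_def by simp
    thus "x \<in> Om" using p(3) by blast
   qed
   from interior_bound[OF _ _ this] show "\<bar>LBINT x. G x *i kDW y t i x\<bar> <= 56 * t ^ 6 * t powr al * C0 * (M * t ^ 3 + ag G y (5 * t))"
    using t r by simp
  qed simp
 next
  case False
  obtain n e s gs where g: "gframe Om al r K p n e s gs" using frames[OF p(1)] by blast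
  note fr = gframeD(1)[OF g]
  let ?b = "(F p *i n) *r n"
  let ?U = "ball p (r / 2)"
  let ?H = "%x. indicator Om x *r (G x - ?b)"
  let ?F = "extG p n e s gs ?H"
  let ?c = "%x. indicator Om x *r ((- ?b) *i x)"
  have bM: "norm ?b <= M" using dD(11)[OF p(1)] gframe_normal[OF g r(1) al(1)] frameD(1)[OF fr] by simp
  have w1: "wgrad Om ?c (%x. indicator Om x *r (- ?b))" by (rule C1_wgrad[OF C1_inner Om(2)]) (use Om(1) in simp)
  have "indicator Om x *r (G x - ?b) = G x + indicator Om x *r (- ?b)" for x using sD(2)[of x] by (cases "x \<in> Om") auto
  hence w2: "wgrad Om (%x. w x + ?c x) ?H" using wgrad_add[OF sD(1) w1] by simp
  have w3: "wgrad ?U (ext p n e s (%x. w x + ?c x)) ?F" by (rule wgrad_ext[OF fr wgrad_mono[OF w2 gframe_sub[OF g]]])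
  have ball_eq: "?F x = G x - ?b" if "x \<in> ball y d" for x
  proof -
   have xO: "x \<in> Om" using that p(3) d_def by blast
   have "dist p x < 2 * d" using that dist_triangle[of p x y] by (simp add: d_def dist_commute)
   hence "x \<in> ball p r" using False r by simp
   thus ?thesis using gframeD(4)[OF g, of x] xO by (simp add: extG_def)
  qed
  have iH: "lint ?H" by (rule wgrad_integrable(2)[OF w2])
  have mp: "mpres (rho p n e s)" using cmap_rho[OF fr] by (simp add: cmap_def)
  have iHT: "lint (%x. ?H (rho p n e s x))" using mpres_integrable[OF mp, of ?H] iH Bm_int[OF iH] by simp
  have nH: "(LBINT x. norm (?H x)) <= (LBINT x. norm (G x)) + M * measure lborel Om"
  proof -
   have io: "lint (indicator Om :: _ => real)" by (rule integrable_real_indicator) (use Om emeasure_bounded_finite[OF Om(2)] in auto)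
   have "(LBINT x. norm (?H x)) <= (LBINT x. norm (G x) + M * indicator Om x)"
   proof (rule integral_mono[OF integrable_norm[OF iH] int_add[OF integrable_norm[OF iG] integrable_mult_right[OF io]]])
    fix x show "norm (?H x) <= norm (G x) + M * indicator Om x" using norm_triangle_ineq4[of "G x" ?b] bM by (cases "x \<in> Om") auto
   qed
   also have "... = (LBINT x. norm (G x)) + M * measure lborel Om"
    by (subst integral_plus[OF integrable_norm[OF iG] integrable_mult_right[OF io]]) simp
   finally show ?thesis .
  qed
  have "(LBINT x. norm (?F x)) <= (LBINT x. norm (?H x) + 5 * norm (?H (rho p n e s x)))"
  proof (rule integral_mono[OF integrable_norm[OF wgrad_integrable(2)[OF w3]] int_add[OF integrable_norm[OF iH] integrable_mult_right[OF integrable_norm[OF iHT]]]])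
   fix x show "norm (?F x) <= norm (?H x) + 5 * norm (?H (rho p n e s x))" by (rule extG_norm[OF fr])
  qed
  also have "... = (LBINT x. norm (?H x)) + 5 * (LBINT x. norm (?H (rho p n e s x)))"
   by (subst integral_plus[OF integrable_norm[OF iH] integrable_mult_right[OF integrable_norm[OF iHT]]]) simp
  also have "(LBINT x. norm (?H (rho p n e s x))) = (LBINT x. norm (?H x))"
   using mpres_integral[OF mp, of "%x. norm (?H x)"] Bm_int[OF integrable_norm[OF iH]] by simp
  finally have nF: "(LBINT x. norm (?F x)) <= 6 * ((LBINT x. norm (G x)) + M * measure lborel Om)" using nH by (rule six_times)
  show ?thesis
  proof (intro exI[of _ ?U] exI[of _ "ext p n e s (%x. w x + ?c x)"] exI[of _ ?F] exI[of _ ?b] exI[of _ d] conjI allI impI ballI w3 bM ball_eq nF)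
   show sub: "cball y (r / 16) \<subseteq> ?U"
   proof
    fix x assume "x \<in> cball y (r / 16)"
    hence "dist p x <= d + r / 16" using dist_triangle[of p x y] by (simp add: d_def dist_commute)
    thus "x \<in> ?U" using False r by simp
   qed
   show "0 < d" using p d_def by simp
   fix t i assume t: "0 < t" "t <= r / 16"
   have t1: "t <= 1" using t r by simp
   show "\<bar>LBINT x. ?F x *i kDW y t i x\<bar> <= 56 * t ^ 6 * t powr al * C0 * (M * t ^ 3 + ag G y (5 * t))"
   \<comment> \<open>Below the distance \<open>d\<close> to the frontier the kernel sees only
     \<open>G - b\<close>, and \<open>b\<close> drops out because a test gradient has integral zero.
     At scales from \<open>d\<close> on, \<open>y\<close> is within \<open>t\<close> of
     \<open>p\<close> and the boundary estimate applies.\<close>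
   proof (cases "t < d")
    case True
    have sb: "cball y t \<subseteq> ball y d" using True by auto
    hence sO: "cball y t \<subseteq> Om" using p(3) d_def by blast
    note Ck = C1c_kernel(1)[OF t(1) sO]
    note Dk = C1_borel_grad[OF C1c_C1[OF Ck]]
    have "(LBINT x. ?F x *i kDW y t i x) = (LBINT x. G x *i kDW y t i x - ?b *i kDW y t i x)"
    proof (rule integral_cong2[OF refl])
     fix x
     show "?F x *i kDW y t i x = G x *i kDW y t i x - ?b *i kDW y t i x"
     proof (cases "x \<in> ball y d")
      case True thus ?thesis using ball_eq[OF True] by (simp only: inner_diff_left)
     next
      case False
      hence "kDW y t i x = 0" using kernel_bounds(4)[OF t(1), of x y i] \<open>t < d\<close> by (simp add: dist_nm)
      thus ?thesis by simp
     qed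
    qed
    also have "... = (LBINT x. G x *i kDW y t i x) - (LBINT x. ?b *i kDW y t i x)"
     by (rule integral_minus2[OF int_inner_bounded[OF iG _ kernel_bounds(2)[OF t(1)]]
       Bochner_Integration.integrable_inner_right[OF C1c_integrable(2)[OF Ck]]]) (use Dk in simp)
    also have "(LBINT x. ?b *i kDW y t i x) = 0" using integral_inner_right[OF C1c_integrable(2)[OF Ck], of ?b] C1c_integral_grad[OF Ck] by simp
    finally show ?thesis using interior_bound[OF t(1) t1 sO] by simp
   next
    case False
    have yp: "norm (y - p) <= t" using False by (simp add: d_def dist_norm)
    have "cball y t \<subseteq> ?U" using sub t by auto
    note Ck = C1c_kernel(1)[OF t(1) this]
    show ?thesis unfolding C0_def by (rule boundary_estimate[OF data sol lam g al K Om t(1) t1 _ yp Ck kernel_bounds[OF t(1)]]) (use t in simp)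
   qed
  qed
 qed
qed

end

lemma indicator_cball_measurable [simp, measurable]:
 "(indicator (cball y s) :: 'a::metric_space => real) \<in> Bm" by (rule borel_measurable_indicator) simp

section \<open>Sup bound\<close>

lemma ag_ennreal:
 assumes "lint G" shows "ennreal (ag G z rh) = (NINT x. ennreal (indicator (cball z rh) x * norm (G x)))"
 unfolding ag_def by (rule nn_integral_eq_integral[OF ag_integrable[OF assms], symmetric]) auto

lemma ball_kernel_measurable:
 assumes [measurable]: "(G::real^3 => real^3) \<in> Bm"
 shows "(%p. ennreal (indicator (cball (fst p) rh) (snd p) * norm (G (snd p)))) \<in> borel_measurable (lborel \<Otimes>\<^sub>M lborel)"
proof -
 have "closed {p::(real^3) \<times> (real^3). dist (fst p) (snd p) <= rh}" by (intro closed_Collect_le continuous_intros)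
 hence "{p::(real^3) \<times> (real^3). dist (fst p) (snd p) <= rh} \<in> sets (borel \<Otimes>\<^sub>M borel)"
  unfolding borel_prod by (rule borel_closed)
 hence [measurable]: "{p::(real^3) \<times> (real^3). dist (fst p) (snd p) <= rh} \<in> sets (lborel \<Otimes>\<^sub>M lborel)"
  by (simp add: sets_pair_measure_cong[OF sets_lborel sets_lborel])
 have e: "indicator (cball (fst p) rh) (snd p) = (indicator {p. dist (fst p) (snd p) <= rh} p :: real)" for p :: "(real^3) \<times> (real^3)"
  by (auto simp: indicator_def)
 show ?thesis unfolding e by measurable
qed

lemma ag_measurable:
 assumes "lint G" shows "(%z. ag G z rh) \<in> Bm"
proof -
 have G: "G \<in> Bm" using Bm_int[OF assms] by simp
 have "(%z. (NINT x. ennreal (indicator (cball z rh) x * norm (G x)))) \<in> borel_measurable lborel"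
  using lborel.borel_measurable_nn_integral[of "%z x. ennreal (indicator (cball z rh) x * norm (G x))" lborel]
   ball_kernel_measurable[OF G, of rh] by (simp add: case_prod_beta')
 hence "(%z. ennreal (ag G z rh)) \<in> Bm" by (simp add: ag_ennreal[OF assms])
 from borel_measurable_enn2real[OF this] show ?thesis by (simp add: ag_nonneg)
qed

lemma cball_nn_volume:
 assumes "t >= 0" shows "(NINT x. ennreal (indicator (cball (y::real^3) t) x)) <= ennreal (8 * t ^ 3)"
 using nn_integral_eq_integral[OF cball_volume(1)[OF assms, of y]] cball_volume(2)[OF assms, of y] by (simp add: ennreal_leI)

text \<open>After exchanging the order of integration, a point within \<open>s + rh\<close> of
  \<open>y\<close> is counted at most with the volume of a ball of radius \<open>rh\<close>.\<close>

lemma ag_fubini: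
 assumes G: "lint G" and rh: "rh >= 0" shows "(NINT z. ennreal (indicator (cball y s) z * ag G z rh)) <= ennreal (8 * rh ^ 3 * ag G y (s + rh))"
proof -
 let ?k = "%z x. ennreal (indicator (cball y s) z) * ennreal (indicator (cball z rh) x * norm (G x))"
 have Gm[measurable]: "G \<in> Bm" using Bm_int[OF G] by simp
 note bk = ball_kernel_measurable[OF Gm, of rh]
 have [measurable]: "(%x. ennreal (indicator (cball z rh) x * norm (G x))) \<in> Bm" for z by measurable
 have "(NINT z. ennreal (indicator (cball y s) z * ag G z rh))
  = (NINT z. (NINT x. ?k z x))"
 proof (rule nn_integral_cong)
  fix z
  have "ennreal (indicator (cball y s) z * ag G z rh) = ennreal (indicator (cball y s) z) * (NINT x. ennreal (indicator (cball z rh) x * norm (G x)))"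
   unfolding ag_ennreal[OF G, symmetric] by (rule ennreal_mult) (auto simp: ag_nonneg)
  also have "... = (NINT x. ?k z x)" by (rule nn_integral_cmult[symmetric]) simp
  finally show "ennreal (indicator (cball y s) z * ag G z rh) = ..." .
 qed
 also have "... = (NINT x. (NINT z. ?k z x))"
 proof (rule lborel_pair.Fubini'[symmetric])
  have [measurable]: "(%p. ennreal (indicator (cball y s) (fst p))) \<in> borel_measurable (lborel \<Otimes>\<^sub>M lborel)" by measurable
  have "(%p. ennreal (indicator (cball y s) (fst p)) * ennreal (indicator (cball (fst p) rh) (snd p) * norm (G (snd p)))) \<in> borel_measurable (lborel \<Otimes>\<^sub>M lborel)"
   using bk by measurable
  thus "(%(z, x). ?k z x) \<in> borel_measurable (lborel \<Otimes>\<^sub>M lborel)" by (simp add: case_prod_beta')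
 qed
 also have "... <= (NINT x. ennreal (8 * rh ^ 3) * ennreal (indicator (cball y (s + rh)) x * norm (G x)))"
 proof (rule nn_integral_mono)
  fix x
  let ?c = "ennreal (indicator (cball y (s + rh)) x * norm (G x))"
  have "(NINT z. ?k z x)
   <= (NINT z. ?c * ennreal (indicator (cball x rh) z))"
  proof (rule nn_integral_mono)
   fix z
   have "indicator (cball y s) z * (indicator (cball z rh) x * norm (G x)) <= indicator (cball y (s + rh)) x * norm (G x) * indicator (cball x rh) z"
    using dist_triangle[of y x z] by (auto simp: indicator_def dist_commute)
   thus "?k z x <= ?c * ennreal (indicator (cball x rh) z)" by (simp add: ennreal_mult[symmetric] ennreal_leI)
  qed
  also have "... = ?c * (NINT z. ennreal (indicator (cball x rh) z))" by (rule nn_integral_cmult) simp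
  also have "... <= ?c * ennreal (8 * rh ^ 3)" by (rule mult_left_mono[OF cball_nn_volume[OF rh]]) simp
  finally show "(NINT z. ?k z x) <= ennreal (8 * rh ^ 3) * ?c" by (simp add: mult.commute)
 qed
 also have "... = ennreal (8 * rh ^ 3) * ennreal (ag G y (s + rh))" unfolding ag_ennreal[OF G] by (rule nn_integral_cmult) simp
 also have "... = ennreal (8 * rh ^ 3 * ag G y (s + rh))" by (rule ennreal_mult[symmetric]) (use rh ag_nonneg in auto)
 finally show ?thesis .
qed

lemma dyadic_sum:
 fixes c R al :: real
 assumes "R > 0" "al > 0" "c >= 0" shows "(%j. c * (R / 2 ^ j) powr al) sums (c * R powr al / (1 - 2 powr - al))"
proof -
 let ?x = "2 powr - al :: real"
 have "?x < 2 powr 0" by (rule powr_less_mono) (use assms in auto)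
 hence x: "norm ?x < 1" by simp
 have "(%j. c * R powr al * ?x ^ j) sums (c * R powr al * (1 / (1 - ?x)))" by (rule sums_mult[OF geometric_sums[OF x]])
 moreover have "c * (R / 2 ^ j) powr al = c * R powr al * ?x ^ j" for j
 proof -
  have "(R / 2 ^ j) powr al = R powr al / (2 ^ j) powr al" using assms by (simp add: powr_divide)
  also have "(2 ^ j) powr al = (2 powr al) ^ j" by (simp add: powr_realpow[symmetric] powr_powr mult.commute)
  finally show ?thesis by (simp add: powr_minus power_inverse divide_inverse)
 qed
 ultimately show ?thesis by (simp only: times_divide_eq_right mult_1_right)
qed

text \<open>The right-hand side still contains integrals of \<open>|G|\<close>. Integrated over
  balls, the inequality bounds the largest normalised ball integral \<open>A\<close> by
  \<open>8 * P + A / 2\<close>, hence by \<open>16 * P\<close>; inserting this into the pointwise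
  inequality bounds \<open>G\<close>. The factor 16000 is twice 8000, that is twice
  \<open>64 * 5 ^ 3\<close>.\<close>

lemma absorb_iterate:
 assumes G: "lint G" and R: "R > 0" and al: "al > 0" and c: "c >= 0" and P: "P >= 0"
  and pw: "AE z in lborel. ennreal (norm (G z)) <= ennreal P + (\<Sum>j. ennreal (c * (R / 2 ^ j) powr al / (R / 2 ^ j) ^ 3 * ag G z (5 * (R / 2 ^ j))))"
  and small: "16000 * (c * R powr al / (1 - 2 powr - al)) <= 1" shows "AE z in lborel. norm (G z) <= 17 * P"
proof -
 define t where "t j = R / 2 ^ j" for j :: nat
 have t: "t j > 0" for j using R by (simp add: t_def)
 define e where "e j = c * t j powr al" for j
 have e: "e j >= 0" for j using c by (simp add: e_def)
 define S where "S = c * R powr al / (1 - 2 powr - al)"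
 have eS: "e sums S" using dyadic_sum[OF R al c] by (simp add: e_def[abs_def] t_def S_def)
 have S: "16000 * S <= 1" "S >= 0" using small sums_le[OF _ sums_zero eS] e by (auto simp: S_def)
 define N1 where "N1 = (LBINT x. norm (G x))"
 have [measurable]: "G \<in> Bm" "(%z. ag G z rh) \<in> Bm" for rh using Bm_int[OF G] ag_measurable[OF G] by simp_all
 have pw': "AE z in lborel. ennreal (norm (G z)) <= ennreal P + (\<Sum>j. ennreal (e j / t j ^ 3 * ag G z (5 * t j)))"
  using pw by (simp add: e_def t_def)
 have key: "ag G y s <= s ^ 3 * (8 * P + A / 2)" if s: "s > 0" "!!y u. s <= u ==> ag G y u <= u ^ 3 * A" for y s A
 proof -
  have "0 <= s ^ 3 * A" using s(2)[of s y] ag_nonneg[of G y s] by simp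
  hence A0: "A >= 0" using zero_less_power[OF s(1), of 3] by (simp only: zero_le_mult_iff) simp
  let ?f = "%j x. ennreal (e j / t j ^ 3) * ennreal (indicator (cball y s) x * ag G x (5 * t j))"
   and ?g = "%rh z. ennreal (indicator (cball y s) z * ag G z rh)" and ?h = "%j. ennreal (8000 * s ^ 3 * A * e j)"
  \<comment> \<open>For \<open>rh <= s\<close> Fubini enlarges the ball to at most radius
    \<open>2 * s\<close>. For larger \<open>rh\<close> the hypothesis on balls of radius at least
    \<open>s\<close> applies to each inner integral directly. Both regimes are needed, since the
    scales \<open>t j\<close> fall on either side of \<open>s\<close>.\<close>
  have b: "(NINT z. ?g rh z) <= ennreal (64 * rh ^ 3 * s ^ 3 * A)" if rh: "rh > 0" for rh
  proof (cases "rh <= s")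
   case True
   have "ag G y (s + rh) <= ag G y (2 * s)" by (rule ag_mono[OF G]) (use True in auto)
   also have "... <= (2 * s) ^ 3 * A" by (rule s(2)) (use s(1) in simp)
   finally have "8 * rh ^ 3 * ag G y (s + rh) <= 8 * rh ^ 3 * ((2 * s) ^ 3 * A)" using rh by (intro mult_left_mono) auto
   also have "... = 64 * rh ^ 3 * s ^ 3 * A" by (simp add: power_mult_distrib)
   finally show ?thesis using ag_fubini[OF G less_imp_le[OF rh], of y s] by (meson ennreal_leI order_trans)
  next
   case False
   have "(NINT z. ?g rh z) <= (NINT z. ennreal (rh ^ 3 * A) * ennreal (indicator (cball y s) z))"
   proof (rule nn_integral_mono)
    fix z
    have "indicator (cball y s) z * ag G z rh <= (rh ^ 3 * A) * indicator (cball y s) z" using s(2)[of rh z] False by (auto simp: indicator_def)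
    thus "?g rh z <= ennreal (rh ^ 3 * A) * ennreal (indicator (cball y s) z)" using A0 rh by (simp add: ennreal_mult[symmetric] ennreal_leI)
   qed
   also have "... = ennreal (rh ^ 3 * A) * (NINT z. ennreal (indicator (cball y s) z))" by (rule nn_integral_cmult) simp
   also have "... <= ennreal (rh ^ 3 * A) * ennreal (8 * s ^ 3)" by (rule mult_left_mono[OF cball_nn_volume]) (use s in auto)
   also have "... = ennreal (8 * (rh ^ 3 * s ^ 3 * A))" using A0 rh s by (simp add: ennreal_mult[symmetric] mult_ac)
   also have "... <= ennreal (64 * rh ^ 3 * s ^ 3 * A)" using A0 rh s by (intro ennreal_leI) (simp add: mult.assoc)
   finally show ?thesis .
  qed
  have "ennreal (ag G y s) = (NINT x. ennreal (indicator (cball y s) x * norm (G x)))" by (rule ag_ennreal[OF G])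
  also have "... <= (NINT x. ennreal P * ennreal (indicator (cball y s) x) + (\<Sum>j. ?f j x))"
  proof (rule nn_integral_mono_AE)
   show "AE x in lborel. ennreal (indicator (cball y s) x * norm (G x))
    <= ennreal P * ennreal (indicator (cball y s) x) + (\<Sum>j. ?f j x)" using pw'
   proof eventually_elim
    case (elim x)
    show ?case
    proof (cases "x \<in> cball y s")
     case True
     have "ennreal (e j / t j ^ 3 * ag G x (5 * t j)) = ennreal (e j / t j ^ 3) * ennreal (ag G x (5 * t j))" for j
      by (rule ennreal_mult) (use e t[of j] ag_nonneg in auto)
     thus ?thesis using elim True by simp
    qed simp
   qed
  qed
  also have "... = (NINT x. ennreal P * ennreal (indicator (cball y s) x)) + (NINT x. (\<Sum>j. ?f j x))" by (rule nn_integral_add) measurable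
  also have "(NINT x. (\<Sum>j. ?f j x))
   = (\<Sum>j. (NINT x. ?f j x))" by (rule nn_integral_suminf) measurable
  also have "... <= (\<Sum>j. ?h j)"
  proof (rule suminf_le)
   fix j
   have "(NINT x. ?f j x)
    = ennreal (e j / t j ^ 3) * (NINT x. ennreal (indicator (cball y s) x * ag G x (5 * t j)))" by (rule nn_integral_cmult) measurable
   also have "... <= ennreal (e j / t j ^ 3) * ennreal (64 * (5 * t j) ^ 3 * s ^ 3 * A)" by (rule mult_left_mono[OF b]) (use t[of j] in auto)
   also have "... = ennreal (e j / t j ^ 3 * (64 * (5 * t j) ^ 3 * s ^ 3 * A))" by (rule ennreal_mult[symmetric]) (use e[of j] t[of j] A0 s in auto)
   also have "e j / t j ^ 3 * (64 * (5 * t j) ^ 3 * s ^ 3 * A) = 8000 * s ^ 3 * A * e j" using t[of j] by (simp add: power_mult_distrib)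
   finally show "(NINT x. ?f j x) <= ?h j" .
  qed auto
  also have "(\<Sum>j. ?h j) = ennreal (8000 * s ^ 3 * A * S)" by (rule suminf_ennreal_eq[OF _ sums_mult[OF eS]]) (use e A0 s in auto)
  also have "(NINT x. ennreal P * ennreal (indicator (cball y s) x)) = ennreal P * (NINT x. ennreal (indicator (cball y s) x))"
   by (rule nn_integral_cmult) simp
  also have "... <= ennreal P * ennreal (8 * s ^ 3)" by (rule mult_left_mono[OF cball_nn_volume]) (use s in auto)
  also have "... = ennreal (P * (8 * s ^ 3))" by (rule ennreal_mult[symmetric]) (use P s in auto)
  finally have "ennreal (ag G y s) <= ennreal (P * (8 * s ^ 3)) + ennreal (8000 * s ^ 3 * A * S)" by (simp add: add_right_mono)
  hence "ag G y s <= P * (8 * s ^ 3) + 8000 * s ^ 3 * A * S" using P s A0 S by (simp add: ennreal_plus[symmetric] del: ennreal_plus)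
  also have "... <= P * (8 * s ^ 3) + s ^ 3 * A * (1 / 2)" using mult_left_mono[of "16000 * S" 1 "s ^ 3 * A"] S A0 s by simp
  finally show ?thesis by (simp add: algebra_simps)
 qed
 have bound: "ag G y s <= s ^ 3 * (16 * P)" if s: "s > 0" for y s
 proof -
  \<comment> \<open>Only radii at least \<open>s\<close> enter, so the supremum is finite: it is
    bounded by the L1 norm divided by \<open>s ^ 3\<close>. Finiteness is what permits
    \<open>A / 2\<close> to be absorbed, and the resulting bound no longer depends on
    \<open>s\<close>.\<close>
  define T where "T = {ag G y u / u ^ 3 |y u. s <= u}"
  have N0: "N1 >= 0" unfolding N1_def by (intro integral_ge0) simp
  have bdd: "bdd_above T"
  proof (rule bdd_aboveI)
   fix x assume "x \<in> T"
   then obtain y u where x: "x = ag G y u / u ^ 3" "s <= u" by (auto simp: T_def)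
   have "x <= N1 / s ^ 3"
    unfolding x(1) by (rule frac_le) (use ag_le_norm[OF G, of y u] x(2) s N0 in \<open>auto simp: N1_def intro: power_mono\<close>)
   thus "x <= N1 / s ^ 3" .
  qed
  define A where "A = Sup T"
  have up: "ag G y u <= u ^ 3 * A" if "s <= u" for y u
  proof -
   have "ag G y u / u ^ 3 <= A" unfolding A_def by (rule cSup_upper[OF _ bdd]) (use that in \<open>auto simp: T_def\<close>)
   thus ?thesis using s that by (simp add: field_simps)
  qed
  have "A <= 8 * P + A / 2" unfolding A_def
  proof (rule cSup_least)
   show "T ~= {}" by (auto simp: T_def)
   fix x assume "x \<in> T"
   then obtain y u where x: "x = ag G y u / u ^ 3" "s <= u" by (auto simp: T_def)
   have u: "u > 0" using x s by simp
   have "ag G y u <= u ^ 3 * (8 * P + A / 2)" by (rule key[OF u up]) (use x in simp)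
   thus "x <= 8 * P + Sup T / 2" unfolding x(1) A_def[symmetric] using u by (simp add: field_simps)
  qed
  hence "A <= 16 * P" by simp
  hence "s ^ 3 * A <= s ^ 3 * (16 * P)" using s by (intro mult_left_mono) auto
  thus ?thesis using up[of s y] by simp
 qed
 show ?thesis using pw'
 proof eventually_elim
  case (elim z)
  have "(\<Sum>j. ennreal (e j / t j ^ 3 * ag G z (5 * t j))) <= (\<Sum>j. ennreal (2000 * P * e j))"
  proof (rule suminf_le)
   fix j
   have "e j / t j ^ 3 * ag G z (5 * t j) <= e j / t j ^ 3 * ((5 * t j) ^ 3 * (16 * P))"
    by (rule mult_left_mono[OF bound]) (use t[of j] e[of j] in auto)
   also have "... = 2000 * P * e j" using t[of j] by (simp add: power_mult_distrib)
   finally show "ennreal (e j / t j ^ 3 * ag G z (5 * t j)) <= ennreal (2000 * P * e j)" by (rule ennreal_leI)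
  qed auto
  also have "... = ennreal (2000 * P * S)" by (rule suminf_ennreal_eq[OF _ sums_mult[OF eS]]) (use e P in auto)
  finally have "ennreal (norm (G z)) <= ennreal P + ennreal (2000 * P * S)" using elim by (meson add_left_mono order_trans)
  hence "norm (G z) <= P + 2000 * P * S" using P S by (simp add: ennreal_plus[symmetric] del: ennreal_plus)
  also have "... <= P + P * 1" using mult_left_mono[OF S(1) P] P S by simp
  finally show "norm (G z) <= 17 * P" using P by simp
 qed
qed

context coil_data
begin

text \<open>Between \<open>t / 2\<close> and \<open>t\<close> the intermediate scale is comparable
  to \<open>t\<close>, which costs a factor 8 in volumes; 448 is 8 times the kernel constant
  56.\<close>

lemma step_bound:
 assumes w: "wgrad U u F'" "cball y (r / 16) \<subseteq> U" and t: "0 < t" "t <= r / 16"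
  and b: "!!t i. 0 < t ==> t <= r / 16 ==> \<bar>LBINT x. F' x *i kDW y t i x\<bar> <= 56 * t ^ 6 * t powr al * C0 * (M * t ^ 3 + ag G y (5 * t))"
 shows "norm (mav F' y t - mav F' y (t / 2)) <= 448 * C0 * t powr al * (M + ag G y (5 * t) / t ^ 3)"
proof (rule mav_step[OF w(1) t(1)])
 show "cball y t \<subseteq> U" using w(2) t by auto
 let ?a = "ag G y (5 * t)"
 have a0: "?a >= 0" by (rule ag_nonneg)
 show "0 <= 448 * C0 * t powr al * (M + ?a / t ^ 3)" using C0_ge(1) M0 a0 t by simp
 fix ta i assume ta: "t / 2 <= ta" "ta <= t"
 have ta0: "ta > 0" using ta t by simp
 have "\<bar>LBINT x. F' x *i kDW y ta i x\<bar> <= 56 * ta ^ 6 * ta powr al * C0 * (M * ta ^ 3 + ag G y (5 * ta))" by (rule b) (use ta ta0 t in auto)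
 also have "... <= 56 * ta ^ 6 * t powr al * C0 * (8 * ta ^ 3 * (M + ?a / t ^ 3))"
 proof (intro mult_mono mult_nonneg_nonneg)
  show "ta powr al <= t powr al" using ta ta0 al by (intro powr_mono2) auto
  have "ag G y (5 * ta) <= ?a" by (rule ag_mono[OF iG]) (use ta in auto)
  also have "?a <= 8 * ta ^ 3 * (?a / t ^ 3)"
  proof -
   have "t ^ 3 <= (2 * ta) ^ 3" using ta t by (intro power_mono) auto
   hence "?a * t ^ 3 <= ?a * (8 * ta ^ 3)" using a0 by (intro mult_left_mono) (auto simp: power_mult_distrib)
   thus ?thesis using t by (simp add: field_simps)
  qed
  finally have "ag G y (5 * ta) <= 8 * ta ^ 3 * (?a / t ^ 3)" .
  moreover have "M * ta ^ 3 <= 8 * ta ^ 3 * M" using M0 ta0 by simp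
  ultimately show "M * ta ^ 3 + ag G y (5 * ta) <= 8 * ta ^ 3 * (M + ?a / t ^ 3)" by (simp only: distrib_left)
 qed (use C0_ge(1) M0 ta0 ag_nonneg in auto)
 also have "... = 448 * C0 * t powr al * (M + ?a / t ^ 3) * ta ^ 9" by (simp add: eval_nat_numeral)
 finally show "\<bar>LBINT x. F' x *i kDW y ta i x\<bar> <= 448 * C0 * t powr al * (M + ?a / t ^ 3) * ta ^ 9" .
qed

lemma mav_norm:
 assumes "lint H" "t > 0" shows "norm (mav H y t) <= (LBINT x. norm (H x)) / t ^ 3"
proof -
 have "norm (mav H y t) <= (LBINT x. norm (kap y t x *r H x))" unfolding mav_def by (rule integral_norm_bound)
 also have "... <= (LBINT x. (1 / t ^ 3) * norm (H x))"
 proof (rule integral_mono')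
  fix x show "norm (kap y t x *r H x) <= (1 / t ^ 3) * norm (H x)"
   using kap_bounds(1,2)[OF assms(2), of y x] mult_right_mono[of "kap y t x" "1 / t ^ 3" "norm (H x)"] by simp
 qed (use assms in auto)
 finally show ?thesis by simp
qed

text \<open>Telescoping over the scales \<open>R / 2 ^ j\<close>. The first average is bounded by
  the L1 norm, the part of the steps proportional to \<open>M\<close> sums to a geometric series,
  and the remaining parts form the series on the right, kept in \<open>ennreal\<close> because its
  convergence is not known at this stage.\<close>

lemma pointwise_bound:
 fixes m :: nat
 defines "R \<equiv> (r / 16) / 2 ^ m" and "k \<equiv> kN (r / 16)"
 defines "P \<equiv> M + 6 * ((LBINT x. norm (G x)) + M * measure lborel Om) / (R ^ 3 * k)"
 shows "AE y in lborel. ennreal (norm (G y)) <= ennreal (P + M * (448 * C0 / k * R powr al / (1 - 2 powr - al)))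
  + (\<Sum>j. ennreal (448 * C0 / k * (R / 2 ^ j) powr al / (R / 2 ^ j) ^ 3 * ag G y (5 * (R / 2 ^ j))))"
proof -
 have R: "R > 0" using r by (simp add: R_def)
 have k: "k > 0" unfolding k_def by (rule kN_pos) (use r in simp)
 have kR: "kN (R / 2 ^ j) = k" for j using kN_dyadic[OF R, of j] kN_dyadic[of "r / 16" m] r by (simp add: R_def k_def)
 define t where "t j = R / 2 ^ j" for j :: nat
 have t: "0 < t j" "t j <= r / 16" for j
 proof -
  show "0 < t j" using R by (simp add: t_def)
  have "t j <= R" using R by (simp add: t_def divide_le_eq)
  also have "R <= r / 16" using r by (simp add: R_def divide_le_eq)
  finally show "t j <= r / 16" .
 qed
 define c where "c = 448 * C0 / k"
 have c: "c >= 0" using C0_ge k by (simp add: c_def)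
 define S where "S = c * R powr al / (1 - 2 powr - al)"
 have cS: "(%j. c * t j powr al) sums S" unfolding t_def S_def by (rule dyadic_sum[OF R al(1) c])
 have S0: "S >= 0" by (rule sums_le[OF _ sums_zero cS]) (use c in simp)
 let ?N = "LBINT x. norm (G x)"
 have P0: "P >= 0" using M0 R k by (simp add: P_def)
 let ?e = "%y j. c * t j powr al / t j ^ 3 * ag G y (5 * t j)"
 have e0: "?e y j >= 0" for y j using c ag_nonneg t(1)[of j] by simp
 obtain q :: "nat => nat" where q: "strict_mono q" "AE y in lborel. (%j. mav G y (R / 2 ^ q j)) \<longlonglongrightarrow> kN R *r G y"
  using mav_limit[OF R iG] by blast
 have kR0: "kN R = k" using kR[of 0] by simp
 have "AE y in lborel. ennreal (norm (G y)) <= ennreal (P + M * S) + (\<Sum>j. ennreal (?e y j))" using q(2)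
 proof eventually_elim
  case (elim y)
  show ?case
  proof (cases "y \<in> Om")
   case False thus ?thesis using sD(2)[of y] by simp
  next
   case True
   obtain U u F' b d where L: "wgrad U u F'" "cball y (r / 16) \<subseteq> U" "norm b <= M" "0 < d" "!!x. x \<in> ball y d ==> F' x = G x - b"
    "(LBINT x. norm (F' x)) <= 6 * (?N + M * measure lborel Om)"
    "!!t i. 0 < t ==> t <= r / 16 ==> \<bar>LBINT x. F' x *i kDW y t i x\<bar> <= 56 * t ^ 6 * t powr al * C0 * (M * t ^ 3 + ag G y (5 * t))"
    using local_field[OF True] by blast
   note iF' = wgrad_integrable(2)[OF L(1)]
   have st: "norm (mav F' y (t j) - mav F' y (t (Suc j))) <= k * (M * (c * t j powr al) + ?e y j)" for j
   proof -
    have "t j / 2 = t (Suc j)" by (simp add: t_def)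
    hence "norm (mav F' y (t j) - mav F' y (t (Suc j))) <= 448 * C0 * t j powr al * (M + ag G y (5 * t j) / t j ^ 3)"
     using step_bound[OF L(1,2) t[of j] L(7)] by simp
    also have "448 * C0 = k * c" using k by (simp add: c_def)
    finally show ?thesis by (simp add: algebra_simps)
   qed
   have tele: "norm (mav F' y (t 0) - mav F' y (t n)) <= (\<Sum>j<n. k * (M * (c * t j powr al) + ?e y j))" for n
   proof (induction n)
    case (Suc n)
    have "norm (mav F' y (t 0) - mav F' y (t (Suc n))) <= norm (mav F' y (t 0) - mav F' y (t n)) + norm (mav F' y (t n) - mav F' y (t (Suc n)))"
     using norm_triangle_ineq[of "mav F' y (t 0) - mav F' y (t n)" "mav F' y (t n) - mav F' y (t (Suc n))"] by simp
    thus ?case using Suc st[of n] by simp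
   qed simp
   have m0: "norm (mav F' y (t 0)) <= k * (6 * (?N + M * measure lborel Om) / (R ^ 3 * k))"
   proof -
    have "norm (mav F' y (t 0)) <= (LBINT x. norm (F' x)) / t 0 ^ 3" by (rule mav_norm[OF iF' t(1)])
    also have "... <= 6 * (?N + M * measure lborel Om) / R ^ 3" using L(6) R by (simp add: t_def divide_right_mono)
    finally show ?thesis using k by simp
   qed
   have loc: "mav F' y (t n) = mav G y (t n) - k *r b" if "t n < d" for n
   proof -
    have "mav F' y (t n) = (LBINT x. kap y (t n) x *r G x - kap y (t n) x *r b)" unfolding mav_def
    proof (rule integral_cong2[OF refl])
     fix x show "kap y (t n) x *r F' x = kap y (t n) x *r G x - kap y (t n) x *r b"
     proof (cases "norm (x - y) >= t n")
      case True thus ?thesis using kap_bounds(3)[OF t(1) True] by simp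
     next
      case False
      hence "x \<in> ball y d" using that by (simp add: dist_nm)
      thus ?thesis using L(5) by (simp add: scaleR_diff_right)
     qed
    qed
    also have "... = mav G y (t n) - (LBINT x. kap y (t n) x *r b)" unfolding mav_def
    proof (rule integral_minus2)
     note Ck = kap_C1c[OF t(1)[of n] subset_UNIV, of y]
     show "lint (%x. kap y (t n) x *r G x)" by (rule C1c_int_scaleR(2)[OF Ck iG])
     show "lint (%x. kap y (t n) x *r b)" by (rule integrable_scaleR_left) (use C1c_integrable(1)[OF Ck] in simp)
    qed
    also have "(LBINT x. kap y (t n) x *r b) = (LBINT x. kap y (t n) x) *r b"
     by (rule integral_scaleR_left) (use C1c_integrable(1)[OF kap_C1c[OF t(1)[of n] subset_UNIV, of y]] in simp)
    also have "(LBINT x. kap y (t n) x) = k" unfolding kap_integral t_def by (rule kR)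
    finally show ?thesis .
   qed
   \<comment> \<open>Only scales below \<open>d\<close> are compared with \<open>G\<close>, where
     the averages of the local field and of \<open>G\<close> differ by the constant
     \<open>k *r b\<close>. Larger scales are covered by the telescoping sum of the local
     field.\<close>
   have fin: "ennreal (norm ((1 / k) *r mav G y (t n))) <= ennreal (P + M * S) + (\<Sum>j. ennreal (?e y j))" if "t n < d" for n
   proof -
    have "norm (mav G y (t n)) = norm (mav F' y (t 0) - (mav F' y (t 0) - mav F' y (t n)) + k *r b)" unfolding loc[OF that] by simp
    also have "... <= norm (mav F' y (t 0)) + norm (mav F' y (t 0) - mav F' y (t n)) + norm (k *r b)"
     using norm_triangle_ineq[of "mav F' y (t 0) - (mav F' y (t 0) - mav F' y (t n))" "k *r b"] norm_triangle_ineq4[of "mav F' y (t 0)" "mav F' y (t 0) - mav F' y (t n)"] by linarith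
    also have "... <= k * (6 * (?N + M * measure lborel Om) / (R ^ 3 * k)) + (\<Sum>j<n. k * (M * (c * t j powr al) + ?e y j)) + k * M"
     using m0 tele[of n] L(3) k by (intro add_mono) auto
    also have "... = k * (P + M * (\<Sum>j<n. c * t j powr al) + (\<Sum>j<n. ?e y j))"
     by (simp only: P_def distrib_left sum_distrib_left[symmetric] sum.distrib add_ac)
    also have "... <= k * (P + M * S + (\<Sum>j<n. ?e y j))"
    proof -
     have "(\<Sum>j<n. c * t j powr al) <= S" using sum_le_suminf[OF sums_summable[OF cS], of "{..<n}"] sums_unique[OF cS] c by simp
     thus ?thesis using k M0 by (intro mult_left_mono add_right_mono add_left_mono) auto
    qed
    finally have "norm ((1 / k) *r mav G y (t n)) <= P + M * S + (\<Sum>j<n. ?e y j)" using k by (simp add: field_simps)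
    hence "ennreal (norm ((1 / k) *r mav G y (t n))) <= ennreal (P + M * S + (\<Sum>j<n. ?e y j))" by (rule ennreal_leI)
    also have "... = ennreal (P + M * S) + (\<Sum>j<n. ennreal (?e y j))"
    proof -
     have "(\<Sum>j<n. ennreal (?e y j)) = ennreal (\<Sum>j<n. ?e y j)" by (rule sum_ennreal) (use e0 in auto)
     moreover have "ennreal (P + M * S + (\<Sum>j<n. ?e y j)) = ennreal (P + M * S) + ennreal (\<Sum>j<n. ?e y j)"
      by (rule ennreal_plus) (use P0 M0 S0 e0 in \<open>auto intro!: sum_nonneg\<close>)
     ultimately show ?thesis by simp
    qed
    also have "... <= ennreal (P + M * S) + (\<Sum>j. ennreal (?e y j))" by (intro add_left_mono sum_le_suminf) auto
    finally show ?thesis .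
   qed
   have lim: "(%j. (1 / k) *r mav G y (t (q j))) \<longlonglongrightarrow> (1 / k) *r (k *r G y)"
    using elim unfolding t_def kR0 by (intro tendsto_intros)
   have t0: "(%j. t (q j)) \<longlonglongrightarrow> 0"
    using LIMSEQ_subseq_LIMSEQ[OF LIMSEQ_divide_realpow_zero[of 2 R] q(1)] by (simp add: t_def comp_def)
   have "(%j. ennreal (norm ((1 / k) *r mav G y (t (q j))))) \<longlonglongrightarrow> ennreal (norm (G y))"
    using tendsto_ennrealI[OF tendsto_norm[OF lim]] k by simp
   moreover have "eventually (%j. t (q j) < d) sequentially" using t0 L(4) by (rule order_tendstoD(2))
   hence "eventually (%j. ennreal (norm ((1 / k) *r mav G y (t (q j)))) <= ennreal (P + M * S) + (\<Sum>j. ennreal (?e y j))) sequentially"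
    by (rule eventually_mono) (rule fin)
   ultimately show ?thesis by (rule tendsto_upperbound) simp
  qed
 qed
 thus ?thesis unfolding t_def S_def c_def .
qed

lemma sup_bound:
 fixes m :: nat
 defines "R \<equiv> (r / 16) / 2 ^ m" and "k \<equiv> kN (r / 16)"
 assumes small: "16000 * (448 * C0 / k * R powr al / (1 - 2 powr - al)) <= 1"
 shows "AE y in lborel. norm (G y) <= 17 * (2 + 6 * (1 + measure lborel Om) / (R ^ 3 * k)) * (M + (LBINT x. norm (G x)))"
proof -
 let ?N = "LBINT x. norm (G x)" and ?m = "measure lborel Om"
 let ?S = "448 * C0 / k * R powr al / (1 - 2 powr - al)"
 let ?P = "M + 6 * (?N + M * ?m) / (R ^ 3 * k) + M * ?S"
 have R: "R > 0" using r by (simp add: R_def)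
 have k: "k > 0" unfolding k_def by (rule kN_pos) (use r in simp)
 have N0: "?N >= 0" by (intro integral_ge0) simp
 have c: "448 * C0 / k >= 0" using C0_ge k by simp
 have S0: "?S >= 0"
 proof (rule sums_le[OF _ sums_zero dyadic_sum[OF R al(1) c]])
  show "0 <= 448 * C0 / k * (R / 2 ^ j) powr al" for j by (rule mult_nonneg_nonneg[OF c]) simp
 qed
 have P0: "?P >= 0" by (rule add_nonneg_nonneg[OF add_nonneg_nonneg mult_nonneg_nonneg[OF less_imp_le[OF M0] S0]])
   (use M0 R k N0 in \<open>auto intro!: divide_nonneg_nonneg\<close>)
 have bd: "AE y in lborel. norm (G y) <= 17 * ?P" using absorb_iterate[OF iG R al(1) c P0 pointwise_bound[of m, folded R_def k_def] small] .
 have le: "?P <= (2 + 6 * (1 + ?m) / (R ^ 3 * k)) * (M + ?N)"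
 proof -
  have ar: "m + x + s <= 2 * (m + n) + y" if "s <= m * 1" "x <= y" "0 <= n" "0 <= m" for m n s x y :: real using that by simp
  have "M * ?S <= M * 1" using small S0 M0 by (intro mult_left_mono) auto
  moreover have "6 * (?N + M * ?m) / (R ^ 3 * k) <= 6 * ((1 + ?m) * (M + ?N)) / (R ^ 3 * k)"
   using M0 N0 R k by (intro divide_right_mono) (auto simp: algebra_simps)
  ultimately have "?P <= 2 * (M + ?N) + 6 * ((1 + ?m) * (M + ?N)) / (R ^ 3 * k)" using N0 less_imp_le[OF M0] by (rule ar)
  thus ?thesis by (simp add: algebra_simps add_divide_distrib)
 qed
 show ?thesis using bd
 proof eventually_elim
  case (elim y)
  from order_trans[OF elim mult_left_mono[OF le, of 17]] show ?case by (simp only: mult.assoc)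
 qed
qed

end

text \<open>The initial scale is halved until the smallness condition of the absorption holds. The
  condition involves only \<open>lam\<close>, \<open>Lam\<close>, \<open>K\<close>, \<open>r\<close>
  and \<open>al\<close>, so the number \<open>m\<close> of halvings is chosen before the
  data.\<close>

lemma gradient_sup_bound:
 fixes Om :: "(real^3) set"
 assumes "0 < lam" "0 <= Lam" "1 <= K" "0 < r" "0 < al"
 shows "\<exists>C\<ge>0. \<forall>M sg f w gsg F G. coil_data Om al lam Lam M r K sg f w gsg F G -->
  (AE x in lborel. norm (G x) <= C * (M + (LBINT x. norm (G x))))"
proof -
 let ?k = "kN (r / 16)" and ?C0 = "coil_data.C0 lam Lam K"
 let ?s = "%R. 16000 * (448 * ?C0 / ?k * R powr al / (1 - 2 powr - al))"
 have "(%m. (r / 16) / 2 ^ m) \<longlonglongrightarrow> 0" using LIMSEQ_divide_realpow_zero[of 2 "r / 16"] by simp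
 hence "(%m. ((r / 16) / 2 ^ m) powr al) \<longlonglongrightarrow> 0 powr al" by (rule tendsto_powr'[OF _ tendsto_const]) (use assms in auto)
 hence "(%m. ((r / 16) / 2 ^ m) powr al) \<longlonglongrightarrow> 0" by simp
 from tendsto_mult_right_zero[OF this, of "16000 * (448 * ?C0 / ?k) / (1 - 2 powr - al)"]
 have "(%m. ?s ((r / 16) / 2 ^ m)) \<longlonglongrightarrow> 0" by (simp add: mult_ac)
 hence "eventually (%m. ?s ((r / 16) / 2 ^ m) < 1) sequentially" by (rule order_tendstoD(2)) simp
 then obtain m where m: "?s ((r / 16) / 2 ^ m) < 1" by (auto simp: eventually_sequentially)
 have k: "?k > 0" by (rule kN_pos) (use assms in simp)
 show ?thesis
 proof (intro exI[of _ "17 * (2 + 6 * (1 + measure lborel Om) / (((r / 16) / 2 ^ m) ^ 3 * ?k))"] conjI allI impI)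
  show "0 <= 17 * (2 + 6 * (1 + measure lborel Om) / (((r / 16) / 2 ^ m) ^ 3 * ?k))" using k assms by simp
  fix M sg f w gsg F G assume "coil_data Om al lam Lam M r K sg f w gsg F G"
  then interpret coil_data Om al lam Lam M r K sg f w gsg F G .
  show "AE x in lborel. norm (G x) <= 17 * (2 + 6 * (1 + measure lborel Om) / (((r / 16) / 2 ^ m) ^ 3 * ?k)) * (M + (LBINT x. norm (G x)))"
   by (rule sup_bound) (use m in simp)
 qed
qed

section \<open>Energy bound\<close>

lemma cv_norm_bound:
 fixes u :: "real^3 => 'c::{banach,second_countable_topology}"
 assumes m: "mollifier d et D" and u: "lint u" "AE x in lborel. norm (u x) <= B" shows "norm (cv et u x) <= B"
proof -
 note M = mollifierD[OF m]
 have i3: "lint (%t. et (x - t))" using M(5,6) by (subst mpres_integrable[OF mpres_reflect]) auto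
 have "norm (cv et u x) <= (LBINT t. norm (et (x - t) *r u t))" unfolding cv_def by (rule integral_norm_bound)
 also have "... <= (LBINT t. et (x - t) * B)"
 proof (rule integral_mono_AE[OF integrable_norm[OF cv_integrable_integrand[OF M(1) u(1)]]])
  show "lint (%t. et (x - t) * B)" using i3 by simp
  show "AE t in lborel. norm (et (x - t) *r u t) <= et (x - t) * B"
   using u(2) by eventually_elim (use M(3) in \<open>auto intro: mult_left_mono\<close>)
 qed
 also have "... = (LBINT t. et (x - t)) * B" by simp
 also have "(LBINT t. et (x - t)) = 1" using mpres_integral[OF mpres_reflect M(6), of x] M(4) by simp
 finally show ?thesis by simp
qed

text \<open>Mollification preserves sup bounds on function and gradient, because the kernels are
  probability densities, and converges in L1. The index offset \<open>m\<close> ensures that already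
  the first kernel keeps the support inside \<open>U\<close>.\<close>

lemma smooth_approx:
 fixes u :: "real^3 => real"
 assumes w: "wgrad U u H" and U: "open U" and K: "compact K" "K \<subseteq> U" "!!x. x \<notin> K ==> u x = 0" "!!x. x \<notin> K ==> H x = 0"
  and b: "AE x in lborel. \<bar>u x\<bar> <= B" "AE x in lborel. norm (H x) <= B'"
 shows "\<exists>V DV. (\<forall>j::nat. C1c U (V j) (DV j)) & (\<forall>j x. \<bar>V j x\<bar> <= B) & (\<forall>j x. norm (DV j x) <= B') &
  (%j. (LBINT x. norm (DV j x - H x))) \<longlonglongrightarrow> 0"
proof -
 note i = wgrad_integrable[OF w]
 obtain ep where e: "ep > 0" "(\<Union>x\<in>K. ball x ep) \<subseteq> U" using compact_subset_open_imp_ball_epsilon_subset[OF K(1) U K(2)] by blast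
 obtain m :: nat where m: "1 / real (Suc m) < ep / 2" using nat_approx_posE[of "ep / 2"] e(1) by auto
 obtain et D where ml: "!!n. mollifier (1 / real (Suc n)) (et n) (D n)" by (rule mollifier_sequence) (rule that)
 have mj: "mollifier (1 / real (Suc (j + m))) (et (j + m)) (D (j + m))" for j by (rule ml)
 have C: "C1c U (cv (et (j + m)) u) (cv (et (j + m)) H)" for j
 proof -
  define d where "d = 1 / real (Suc (j + m))"
  have d: "d > 0" "d < ep / 2"
  proof -
   have "d <= 1 / real (Suc m)" unfolding d_def by (intro divide_left_mono) auto
   thus "d < ep / 2" using m by simp
  qed (simp add: d_def)
  note M = mollifierD[OF mj[of j], folded d_def]
  let ?et = "et (j + m)" and ?D = "D (j + m)"
  have c1: "C1 (cv ?et u) (%x. (LBINT z. u z *r ?D (x - z)))" by (rule C1_cv[OF M(1) i(1)])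
  have eq: "(LBINT z. u z *r ?D (x - z)) = cv ?et H x" for x
  proof (cases "\<exists>y\<in>K. norm (x - y) <= d")
   case True
   then obtain y where y: "y \<in> K" "norm (x - y) <= d" by blast
   have "cball x d \<subseteq> ball y ep"
   proof
    fix z assume "z \<in> cball x d"
    thus "z \<in> ball y ep" using y(2) d dist_triangle[of y z x] by (simp add: dist_nm)
   qed
   hence "cball x d \<subseteq> U" using e(2) y(1) by blast
   from wgrad_cv[OF w M(1,2) this] show ?thesis .
  next
   case False
   hence far: "norm (x - z) > d" if "z \<in> K" for z using that by force
   have D0: "?D z = 0" if "norm z > d" for z by (rule C1_zero_grad[OF C1c_C1[OF M(1)], of "cball 0 d"]) (use M(2) that in auto)
   have z: "u z *r ?D (x - z) = 0" for z using K(3)[of z] D0[OF far[of z]] by (cases "z \<in> K") auto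
   have c: "cv ?et H x = 0" by (rule cv_support[OF K(4) M(2) far])
   show ?thesis by (simp only: z c Bochner_Integration.integral_zero)
  qed
  have "C1 (cv ?et u) (cv ?et H)" using c1 by (simp only: eq)
  moreover have "\<exists>L. compact L & L \<subseteq> U & (\<forall>x. x \<notin> L --> cv ?et u x = 0)"
  proof (intro exI conjI allI impI)
   let ?L = "{x + y | x y. x \<in> K & y \<in> cball 0 d}"
   show "compact ?L" by (rule compact_sums[OF K(1) compact_cball])
   show "?L \<subseteq> U"
   proof
    fix z assume "z \<in> ?L"
    then obtain x y where z: "z = x + y" "x \<in> K" "norm y <= d" by auto
    hence "z \<in> ball x ep" using d by (simp add: dist_norm)
    thus "z \<in> U" using z(2) e(2) by blast
   qed
   fix x assume x: "x \<notin> ?L"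
   have far: "norm (x - z) > d" if "z \<in> K" for z
   proof (rule ccontr)
    assume "\<not> ?thesis"
    hence "x = z + (x - z) & z \<in> K & x - z \<in> cball 0 d" using that by simp
    thus False using x by blast
   qed
   show "cv ?et u x = 0" by (rule cv_support[OF K(3) M(2) far])
  qed
  ultimately show ?thesis unfolding C1c_def by blast
 qed
 have "(%j. 1 / real (Suc (j + m))) \<longlonglongrightarrow> 0" using LIMSEQ_ignore_initial_segment[OF LIMSEQ_Suc[OF lim_1_over_n], of m] by simp
 from cv_L1_tendsto_real[OF mj this i(2)]
 have L: "(%j. (LBINT x. norm (cv (et (j + m)) H x - H x))) \<longlonglongrightarrow> 0" .
 have "\<bar>cv (et (j + m)) u x\<bar> <= B" for j x using cv_norm_bound[OF mj i(1), of B j x] b(1) by simp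
 moreover have "norm (cv (et (j + m)) H x) <= B'" for j x by (rule cv_norm_bound[OF mj i(2) b(2)])
 ultimately show ?thesis using C L by (intro exI[of _ "%j. cv (et (j + m)) u"] exI[of _ "%j. cv (et (j + m)) H"]) blast
qed

lemma cutoff_ball:
 fixes a :: "real^3"
 assumes s: "s > 0"
 shows "\<exists>ph D X. C1c (ball a (2 * s)) ph D & (\<forall>x. 0 <= ph x & ph x <= 1) & (\<forall>x\<in>ball a s. ph x = 1 & D x = 0) & (\<forall>x. norm (D x) <= X)"
proof -
 obtain X X' :: "real => real" and B where X: "!!s. (X has_real_derivative X' s) (at s)" "continuous_on UNIV X'"
  "!!s. 0 <= X s" "!!s. X s <= 1" "!!s. s <= 1 ==> X s = 0" "!!s. s >= 2 ==> X s = 1"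
  "!!s. s <= 1 \<or> s >= 2 ==> X' s = 0" by (rule cutoff_exists) (rule that)
 define q where "q x = (1 / s^2) * ((x - a) *i (x - a))" for x :: "real^3"
 have "C1 (%x. (x - a) *i (x - a)) (%x. 2 *r (x - a))"
  unfolding C1_def by (auto intro!: derivative_eq_intros continuous_intros simp: inner_commute algebra_simps)
 from C1_cmult[OF this, of "1 / s^2"] have q: "C1 q (%x. (2 / s^2) *r (x - a))" by (simp add: q_def[abs_def])
 let ?D = "%x. - (X' (q x) *r ((2 / s^2) *r (x - a)))"
 have C: "C1 (%x. 1 - X (q x)) ?D" using C1_diff[OF C1_const[of 1] C1_compose_real[OF q X(1,2)]] by simp
 have qn: "q x = (norm (x - a) / s)^2" for x by (simp add: q_def power_divide power2_norm_eq_inner)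
 have C2: "C1c (ball a (2 * s)) (%x. 1 - X (q x)) ?D" unfolding C1c_def
 proof (intro conjI C exI[of _ "cball a (3 / 2 * s)"] allI impI)
  fix x assume "x \<notin> cball a (3 / 2 * s)"
  hence "norm (x - a) / s >= 3 / 2" using s by (simp add: dist_nm field_simps)
  hence "(norm (x - a) / s)^2 >= (3 / 2)^2" by (intro power_mono) auto
  moreover have "(3 / 2)^2 >= (2::real)" by (simp add: power2_eq_square)
  ultimately have "q x >= 2" unfolding qn by linarith
  thus "1 - X (q x) = 0" using X(6) by simp
 qed (use s in auto)
 obtain Y where "!!x. norm (?D x) <= Y" by (rule C1c_bounded[OF C2]) (rule that)
 moreover have "1 - X (q x) = 1 & ?D x = 0" if "x \<in> ball a s" for x
 proof -
  have "norm (x - a) / s <= 1" using that s by (simp add: dist_nm)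
  hence "(norm (x - a) / s)^2 <= 1" by (rule power_le_one[rotated]) (use s in simp)
  thus ?thesis using X(5,7)[of "q x"] by (simp add: qn)
 qed
 ultimately show ?thesis using C2 X(3,4) by (intro exI[of _ "%x. 1 - X (q x)"] exI[of _ ?D] exI[of _ Y]) auto
qed

context coil_data
begin

lemma sigma_bound: "\<bar>sg x\<bar> <= 1 / lam" using dD(2,3,4)[of x] lam by (cases "x \<in> Om") auto

lemma sigma_borel: "sg \<in> Bm" using Bm_int[OF wgrad_integrable(1)[OF dD(1)]] by simp

lemma finite_measure_domain: "lint (indicator Om :: _ => real)" by (rule integrable_real_indicator) (use Om emeasure_bounded_finite[OF Om(2)] in auto)

lemma F_bounded: "\<exists>A>0. \<forall>x\<in>Om. norm (F x) <= A"
proof -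
 have "compact (F ` closure Om)" by (rule compact_continuous_image[OF dD(6)]) (use Om(2) in simp)
 then obtain A where "A > 0" "\<forall>x\<in>F ` closure Om. norm x <= A" using compact_imp_bounded bounded_pos by blast
 thus ?thesis using closure_subset by blast
qed

text \<open>Bounds the functional by \<open>M\<close> times sup norms of \<open>V\<close> and its
  gradient. The ball of radius \<open>T\<close> contains the domain, so the growth condition on
  \<open>f\<close> at that scale is an L1 bound. Near the boundary the constant field is subtracted
  and added back, which turns the 8 of the flux estimate into 9.\<close>

lemma functional_bound:
 assumes T: "0 < T" "Om \<subseteq> cball 0 T" and V: "(\<exists>p\<in>frontier Om. C1c (ball p r) V DV) \<or> C1c Om V DV"
  and b: "!!x. \<bar>V x\<bar> <= B" "!!x. norm (DV x) <= B'"
 shows "\<bar>LBINT x. sg x * (F x *i DV x)\<bar> <= M * ((16 * T powr (2 + al) + Lam * measure lborel Om) * B + (9 * K^2 / lam) * measure lborel Om * B')"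
proof -
 let ?m = "measure lborel Om"
 have B0: "B >= 0" "B' >= 0" using b(1)[of 0] b(2)[of 0] by (meson abs_ge_zero norm_ge_zero order_trans)+
 have K2: "1 <= K^2" using K by simp
 note iF = wdiv_integrable[OF dD(8)]
 have fint: "(LBINT x. \<bar>f x\<bar>) <= 16 * M * T powr (2 + al)"
 proof -
  have "(LBINT x. \<bar>f x\<bar>) = (LBINT x. indicator (cball 0 T) x * \<bar>f x\<bar>)"
  proof (rule integral_cong2[OF refl])
   fix x show "\<bar>f x\<bar> = indicator (cball 0 T) x * \<bar>f x\<bar>" using dD(9)[of x] T(2) by (cases "x \<in> Om") auto
  qed
  thus ?thesis using dD(10)[OF T(1), of 0] by simp
 qed
 from V show ?thesis
 proof
  assume V: "C1c Om V DV"
  have "(LBINT x. sg x * (F x *i DV x)) = - (LBINT x. f x * V x)" using wdivD[OF dD(8) V] by simp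
  hence "\<bar>LBINT x. sg x * (F x *i DV x)\<bar> = \<bar>LBINT x. f x * V x\<bar>" by simp
  also have "... <= (LBINT x. B * \<bar>f x\<bar>)"
  proof (rule integral_abs_bound)
   show "lint (%x. f x * V x)" using C1c_int_scaleR(2)[OF V iF(2)] by (simp add: mult.commute)
   show "lint (%x. B * \<bar>f x\<bar>)" using iF(2) by simp
   show "AE x in lborel. \<bar>f x * V x\<bar> <= B * \<bar>f x\<bar>" using b(1) by (intro AE_I2) (simp add: abs_mult mult.commute mult_right_mono)
  qed
  also have "... = B * (LBINT x. \<bar>f x\<bar>)" by simp
  also have "... <= B * (16 * M * T powr (2 + al))" using fint B0 by (intro mult_left_mono) auto
  also have "... = M * ((16 * T powr (2 + al)) * B)" by (simp only: mult_ac)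
  also have "... <= M * ((16 * T powr (2 + al) + Lam * ?m) * B + (9 * K^2 / lam) * ?m * B')"
  proof (rule mult_left_mono)
   have "0 <= Lam * ?m * B" "0 <= (9 * K^2 / lam) * ?m * B'" using Lam0 B0 lam by auto
   thus "(16 * T powr (2 + al)) * B <= (16 * T powr (2 + al) + Lam * ?m) * B + (9 * K^2 / lam) * ?m * B'" unfolding distrib_right by linarith
  qed (use M0 in simp)
  finally show ?thesis .
 next
  assume "\<exists>p\<in>frontier Om. C1c (ball p r) V DV"
  then obtain p where p: "p \<in> frontier Om" and V: "C1c (ball p r) V DV" by blast
  obtain n e s gs where g: "gframe Om al r K p n e s gs" using frames[OF p] by blast
  let ?b = "(F p *i n) *r n"
  have bM: "norm ?b <= M" using dD(11)[OF p] gframe_normal[OF g r(1) al(1)] frameD(1)[OF gframeD(1)[OF g]] by simp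
  have rb: "x \<notin> ball p r" if "norm (x - p) > r" for x using that by (simp add: dist_nm)
  have s1: "\<bar>LBINT x. sg x * ((F x - ?b) *i DV x)\<bar>
  <= (LBINT x. indicator Om x * (\<bar>f x\<bar> + Lam * M) * \<bar>V x\<bar>)
   + (8 * K^2 / lam) * M * r powr al * (LBINT x. indicator Om x * norm (DV x))"
   by (rule boundary_functional[OF g data r(1) al K Om lam V r(1)]) (rule C1c_zero(1)[OF V rb])
  have s2: "(LBINT x. indicator Om x * (\<bar>f x\<bar> + Lam * M) * \<bar>V x\<bar>) <= B * (16 * M * T powr (2 + al) + Lam * M * ?m)"
  proof -
   have ii: "lint (%x. \<bar>f x\<bar> + Lam * M * indicator Om x)" using iF(2) finite_measure_domain by (intro int_add integrable_mult_right) auto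
   have "(LBINT x. indicator Om x * (\<bar>f x\<bar> + Lam * M) * \<bar>V x\<bar>) <= (LBINT x. B * (\<bar>f x\<bar> + Lam * M * indicator Om x))"
   proof (rule integral_mono'[OF integrable_mult_right[OF ii]])
    fix x
    have c: "0 <= \<bar>f x\<bar> + Lam * M" using Lam0 M0 by simp
    show "indicator Om x * (\<bar>f x\<bar> + Lam * M) * \<bar>V x\<bar> <= B * (\<bar>f x\<bar> + Lam * M * indicator Om x)"
     using mult_left_mono[OF b(1)[of x] c] B0 by (cases "x \<in> Om") (auto simp: mult.commute)
    show "0 <= B * (\<bar>f x\<bar> + Lam * M * indicator Om x)" using B0 Lam0 M0 by simp
   qed
   also have "... = B * ((LBINT x. \<bar>f x\<bar>) + Lam * M * ?m)"
    using iF(2) finite_measure_domain by (subst integral_mult_right_zero, subst integral_plus) auto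
   also have "... <= B * (16 * M * T powr (2 + al) + Lam * M * ?m)" using fint B0 by (intro mult_left_mono) auto
   finally show ?thesis .
  qed
  have DV: "(LBINT x. indicator Om x * norm (DV x)) <= B' * ?m"
  proof -
   have "(LBINT x. indicator Om x * norm (DV x)) <= (LBINT x. B' * indicator Om x)"
    by (rule integral_mono'[OF integrable_mult_right[OF finite_measure_domain]]) (use b(2) B0 in \<open>auto simp: indicator_def\<close>)
   thus ?thesis by simp
  qed
  have s3: "(8 * K^2 / lam) * M * r powr al * (LBINT x. indicator Om x * norm (DV x)) <= (8 * K^2 / lam) * M * 1 * (B' * ?m)"
  proof (intro mult_mono mult_left_mono DV)
   show "r powr al <= 1" using r al by (intro powr_le1) auto
  qed (use lam M0 B0 in \<open>auto intro!: integral_ge0\<close>)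
  have Dm: "DV \<in> Bm" by (rule C1_borel_grad[OF C1c_C1[OF V]])
  have i3: "lint (%x. sg x * (?b *i DV x))"
   using Bochner_Integration.integrable_inner_right[OF int_scaleR_bounded[OF wgrad_integrable(1)[OF dD(1)] _ b(2)], of ?b] Dm by simp
  have s4: "\<bar>LBINT x. sg x * (?b *i DV x)\<bar> <= (1 / lam) * (M * B') * ?m"
  proof -
   have "\<bar>LBINT x. sg x * (?b *i DV x)\<bar> <= (LBINT x. ((1 / lam) * (M * B')) * indicator Om x)"
   proof (rule integral_abs_bound[OF i3 integrable_mult_right[OF finite_measure_domain]], rule AE_I2)
    fix x
    have "\<bar>?b *i DV x\<bar> <= M * B'" by (rule order_trans[OF Cauchy_Schwarz_ineq2 mult_mono[OF bM b(2)]]) (use M0 in auto)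
    hence "\<bar>sg x\<bar> * \<bar>?b *i DV x\<bar> <= (1 / lam) * (M * B')" using sigma_bound[of x] lam by (intro mult_mono) auto
    thus "\<bar>sg x * (?b *i DV x)\<bar> <= ((1 / lam) * (M * B')) * indicator Om x" using dD(2)[of x] by (cases "x \<in> Om") (auto simp: abs_mult)
   qed
   thus ?thesis by simp
  qed
  have i2: "lint (%x. sg x * (F x *i DV x))" using int_inner_bounded[OF iF(1) _ b(2)] Dm by simp
  have "(LBINT x. sg x * ((F x - ?b) *i DV x)) = (LBINT x. sg x * (F x *i DV x) - sg x * (?b *i DV x))"
   by (simp only: inner_diff_left right_diff_distrib)
  also have "... = (LBINT x. sg x * (F x *i DV x)) - (LBINT x. sg x * (?b *i DV x))" by (rule integral_minus2[OF i2 i3])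
  finally have "\<bar>LBINT x. sg x * (F x *i DV x)\<bar> <= B * (16 * M * T powr (2 + al) + Lam * M * ?m) + (8 * K^2 / lam) * M * 1 * (B' * ?m) + (1 / lam) * (M * B') * ?m"
   using s1 s2 s3 s4 by linarith
  also have "(1 / lam) * (M * B') * ?m <= (K^2 / lam) * (M * B') * ?m" by (intro mult_right_mono divide_right_mono K2) (use lam M0 B0 in auto)
  also have "B * (16 * M * T powr (2 + al) + Lam * M * ?m) + (8 * K^2 / lam) * M * 1 * (B' * ?m) + (K^2 / lam) * (M * B') * ?m
   = M * ((16 * T powr (2 + al) + Lam * ?m) * B + (9 * K^2 / lam) * ?m * B')" using lam by (simp add: field_simps)
  finally show ?thesis by simp
 qed
qed

lemma functional_limit:
 assumes T: "0 < T" "Om \<subseteq> cball 0 T" and U: "open U" "(\<exists>p\<in>frontier Om. U \<subseteq> ball p r) \<or> U \<subseteq> Om"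
  and w: "wgrad U u H" and K: "compact Q" "Q \<subseteq> U" "!!x. x \<notin> Q ==> u x = 0" "!!x. x \<notin> Q ==> H x = 0"
  and b: "AE x in lborel. \<bar>u x\<bar> <= B" "AE x in lborel. norm (H x) <= B'"
 shows "\<bar>LBINT x. sg x * (F x *i H x)\<bar> <= M * ((16 * T powr (2 + al) + Lam * measure lborel Om) * B + (9 * K^2 / lam) * measure lborel Om * B')"
  (is "_ <= ?R")
proof -
 let ?I = "%J. (LBINT x. sg x * (F x *i J x))"
 obtain V DV where V: "!!j::nat. C1c U (V j) (DV j)" "!!j x. \<bar>V j x\<bar> <= B" "!!j x. norm (DV j x) <= B'"
  "(%j. (LBINT x. norm (DV j x - H x))) \<longlonglongrightarrow> 0" using smooth_approx[OF w U(1) K b] by blast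
 obtain A where A: "A > 0" "\<forall>x\<in>Om. norm (F x) <= A" using F_bounded by blast
 note iH = wgrad_integrable(2)[OF w]
 have [measurable]: "F \<in> Bm" "sg \<in> Bm" by (rule dD(7), rule sigma_borel)
 have sF: "norm (sg x *r F x) <= A / lam" for x
 proof (cases "x \<in> Om")
  case True
  have "\<bar>sg x\<bar> * norm (F x) <= (1 / lam) * A" by (rule mult_mono[OF sigma_bound]) (use A True lam in auto)
  thus ?thesis by simp
 qed (use dD(2) A lam in simp)
 have lim: "(%j. ?I (DV j)) \<longlonglongrightarrow> ?I H"
 proof (rule LIM_zero_cancel, rule Lim_null_comparison)
  show "(%j. (A / lam) * (LBINT x. norm (DV j x - H x))) \<longlonglongrightarrow> 0" by (rule tendsto_mult_right_zero[OF V(4)])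
  show "eventually (%j. norm (?I (DV j) - ?I H) <= (A / lam) * (LBINT x. norm (DV j x - H x))) sequentially"
  proof (rule always_eventually, rule allI)
   fix j
   have iD: "lint (DV j)" by (rule C1c_integrable(2)[OF V(1)])
   have i: "lint (%x. sg x * (F x *i J x))" if "lint J" for J
   proof -
    have "lint (%x. J x *i (sg x *r F x))" by (rule int_inner_bounded[OF that _ sF]) measurable
    thus ?thesis by (simp add: inner_commute)
   qed
   have idf: "lint (%x. DV j x - H x)" by (rule int_diff[OF iD iH])
   have "?I (DV j) - ?I H = (LBINT x. sg x * (F x *i (DV j x - H x)))"
    unfolding inner_diff_right right_diff_distrib by (rule integral_minus2[OF i[OF iD] i[OF iH], symmetric])
   also have "\<bar>...\<bar> <= (LBINT x. (A / lam) * norm (DV j x - H x))"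
   proof (rule integral_abs_bound[OF i[OF idf] integrable_mult_right[OF integrable_norm[OF idf]]], rule AE_I2)
    fix x
    show "\<bar>sg x * (F x *i (DV j x - H x))\<bar> <= (A / lam) * norm (DV j x - H x)"
     using order_trans[OF Cauchy_Schwarz_ineq2[of "sg x *r F x" "DV j x - H x"] mult_right_mono[OF sF[of x] norm_ge_zero]] by simp
   qed
   finally show "norm (?I (DV j) - ?I H) <= (A / lam) * (LBINT x. norm (DV j x - H x))" by simp
  qed
 qed
 have "\<bar>?I (DV j)\<bar> <= ?R" for j
 proof (rule functional_bound[OF T _ V(2,3)])
  show "(\<exists>p\<in>frontier Om. C1c (ball p r) (V j) (DV j)) \<or> C1c Om (V j) (DV j)" using U(2) C1c_mono[OF V(1)] by blast
 qed
 thus ?thesis by (intro LIMSEQ_le_const2[OF tendsto_rabs[OF lim]]) auto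
qed

text \<open>A function known only inside the domain is localised by \<open>ph\<close> and, at the
  boundary, reflected to a compactly supported function on a full ball, where mollification is
  possible. The factor 5 is the growth of gradients under this extension.\<close>

lemma patch_bound:
 assumes T: "0 < T" "Om \<subseteq> cball 0 T" and s: "s > 0" and patch: "(a \<in> frontier Om & 8 * s <= r) \<or> ball a (2 * s) \<subseteq> Om"
  and ph: "C1c (ball a (2 * s)) ph D" "!!x. 0 <= ph x" "!!x. ph x <= 1" "!!x. norm (D x) <= X"
  and u: "wgrad Om u H" "!!x. x \<notin> Om ==> u x = 0" "!!x. x \<notin> Om ==> H x = 0"
  and b: "AE x in lborel. \<bar>u x\<bar> <= B" "AE x in lborel. norm (H x) <= B"
 shows "\<bar>LBINT x. sg x * (F x *i (u x *r D x + ph x *r H x))\<bar>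
  <= M * ((16 * T powr (2 + al) + Lam * measure lborel Om) + (9 * K^2 / lam) * measure lborel Om * (5 * (1 + X))) * B"
proof -
 let ?c = "16 * T powr (2 + al) + Lam * measure lborel Om" and ?k = "(9 * K^2 / lam) * measure lborel Om"
 let ?v = "%x. ph x * u x" and ?J = "%x. u x *r D x + ph x *r H x"
 obtain Q where Q: "compact Q" "Q \<subseteq> ball a (2 * s)" "!!x. x \<notin> Q ==> ph x = 0" "!!x. x \<notin> Q ==> D x = 0"
  by (rule C1cE[OF ph(1)]) (rule that)
 have X0: "X >= 0" using ph(4)[of 0] norm_ge_zero order_trans by blast
 have f1: "\<bar>ph x\<bar> <= 1" for x using ph(2,3)[of x] by simp
 have f2: "\<bar>ph x\<bar> <= 1 + X" "norm (D x) <= 1 + X" for x using f1[of x] ph(4)[of x] X0 by simp_all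
 have wv: "wgrad Om ?v ?J" by (rule wgrad_mult[OF u(1) C1c_C1[OF ph(1)] f2])
 have B0: "B >= 0" using AE_lborel_witness[OF b(1) open_UNIV] by force
 have bv: "AE x in lborel. \<bar>?v x\<bar> <= B" using b(1)
 proof eventually_elim
  case (elim x)
  have "\<bar>ph x\<bar> * \<bar>u x\<bar> <= 1 * B" by (rule mult_mono[OF f1 elim]) auto
  thus ?case by (simp add: abs_mult)
 qed
 have bJ: "AE x in lborel. norm (?J x) <= (1 + X) * B" using b
 proof eventually_elim
  case (elim x)
  have "norm (?J x) <= norm (u x *r D x) + norm (ph x *r H x)" by (rule norm_triangle_ineq)
  also have "... <= B * X + 1 * B" unfolding norm_scaleR real_norm_def by (intro add_mono mult_mono elim f1 ph(4)) (use B0 in auto)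
  finally show ?case by (simp add: algebra_simps)
 qed
 have fin: "\<bar>z\<bar> <= M * (?c + ?k * (5 * (1 + X))) * B" if "\<bar>z\<bar> <= M * (?c * B + ?k * B')" "B' <= 5 * ((1 + X) * B)" for z B'
 proof -
  have "?k * B' <= ?k * (5 * ((1 + X) * B))" by (rule mult_left_mono[OF that(2)]) (use lam in simp)
  hence "M * (?c * B + ?k * B') <= M * (?c * B + ?k * (5 * ((1 + X) * B)))" by (rule mult_left_mono[OF add_left_mono less_imp_le[OF M0]])
  also have "... = M * (?c + ?k * (5 * (1 + X))) * B" by (simp only: distrib_right mult.assoc)
  finally show ?thesis using that(1) by linarith
 qed
 from patch show ?thesis
 proof
  assume sub: "ball a (2 * s) \<subseteq> Om"
  show ?thesis
  proof (rule fin)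
   show "\<bar>LBINT x. sg x * (F x *i ?J x)\<bar> <= M * (?c * B + ?k * ((1 + X) * B))"
    by (rule functional_limit[OF T Om(1) _ wv Q(1) _ _ _ bv bJ]) (use Q sub in auto)
   have "0 <= (1 + X) * B" using X0 B0 by simp
   thus "(1 + X) * B <= 5 * ((1 + X) * B)" by linarith
  qed
 next
  assume bd: "a \<in> frontier Om & 8 * s <= r"
  obtain n e S gs where g: "gframe Om al r K a n e S gs" using frames bd by blast
  note fr = gframeD(1)[OF g]
  let ?T = "rho a n e S"
  note cT = cmap_rho[OF fr]
  have mp: "mpres ?T" using cT by (simp add: cmap_def)
  have rT: "?T z \<in> ball a (r / 2)" if "z \<in> Q" for z
  proof -
   have "norm (z - a) < 2 * s" using Q(2) that by (auto simp: dist_nm)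
   thus ?thesis using rho_norm[OF fr, of z] bd by (simp add: dist_nm)
  qed
  have we: "wgrad (ball a (r / 2)) (ext a n e S ?v) (extG a n e S gs ?J)" by (rule wgrad_ext[OF fr wgrad_mono[OF wv gframe_sub[OF g]]])
  let ?Q = "Q \<union> ?T ` Q"
  have zero: "ext a n e S ?v x = 0" "extG a n e S gs ?J x = 0" if "x \<notin> ?Q" for x
  proof -
   have "?T x \<notin> Q"
   proof
    assume "?T x \<in> Q"
    hence "?T (?T x) \<in> ?T ` Q" by blast
    thus False using that rho_rho[OF fr, of x] by simp
   qed
   thus "ext a n e S ?v x = 0" "extG a n e S gs ?J x = 0" using Q(3,4)[of x] Q(3,4)[of "?T x"] that by (auto simp: ext_def extG_def arho_zero[OF fr])
  qed
  have be: "AE x in lborel. \<bar>ext a n e S ?v x\<bar> <= B" using bv mpres_AE[OF mp bv] by eventually_elim (simp add: ext_def)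
  have bG: "AE x in lborel. norm (extG a n e S gs ?J x) <= 5 * ((1 + X) * B)" by (rule extG_bound[OF fr bJ])
  \<comment> \<open>The reflected part is invisible to the functional: the coefficient is zero
    outside the domain, and inside the extension agrees with the original.\<close>
  have eq: "sg x * (F x *i extG a n e S gs ?J x) = sg x * (F x *i ?J x)" for x
  proof (cases "x \<in> Om")
   case True
   show ?thesis
   proof (cases "x \<in> ball a r")
    case b: True
    thus ?thesis using gframeD(4)[OF g b] True by (simp add: extG_def)
   next
    case False
    have "x \<notin> ?Q"
    proof
     assume "x \<in> ?Q"
     hence "x \<in> ball a r"
     proof
      assume "x \<in> Q"
      hence "x \<in> ball a (2 * s)" using Q(2) by blast
      thus ?thesis using bd s by simp
     next
      assume "x \<in> ?T ` Q"
      hence "x \<in> ball a (r / 2)" using rT by blast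
      thus ?thesis using r by simp
     qed
     thus False using False by blast
    qed
    thus ?thesis using zero(2)[of x] Q(3,4)[of x] by simp
   qed
  next
   case False thus ?thesis using dD(2) by simp
  qed
  have "\<bar>LBINT x. sg x * (F x *i extG a n e S gs ?J x)\<bar> <= M * (?c * B + ?k * (5 * ((1 + X) * B)))"
  proof (rule functional_limit[OF T open_ball _ we _ _ zero be bG])
   show "(\<exists>p\<in>frontier Om. ball a (r / 2) \<subseteq> ball p r) \<or> ball a (r / 2) \<subseteq> Om"
    using bd r by (intro disjI1 bexI[of _ a]) auto
   show "compact ?Q" by (intro compact_Un Q(1) compact_continuous_image cmap_continuous[OF cT])
   have "Q \<subseteq> ball a (r / 2)"
   proof
    fix x assume "x \<in> Q"
    hence "x \<in> ball a (2 * s)" using Q(2) by blast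
    thus "x \<in> ball a (r / 2)" using bd s by simp
   qed
   thus "?Q \<subseteq> ball a (r / 2)" using rT by blast
  qed
  thus ?thesis unfolding eq by (rule fin) simp
 qed
qed

end

definition vanishing_off :: "(real^3) set => (real^3) set => (real^3 => real) => (real^3 => real^3) => real => bool" where
 "vanishing_off Om S u H B \<longleftrightarrow> wgrad Om u H & (\<forall>x. x \<notin> Om \<or> x \<notin> S --> u x = 0 & H x = 0) &
  (AE x in lborel. \<bar>u x\<bar> <= B) & (AE x in lborel. norm (H x) <= B)"

lemma vanishing_offD:
 assumes "vanishing_off Om S u H B" shows "wgrad Om u H" "x \<notin> Om \<or> x \<notin> S ==> u x = 0" "x \<notin> Om \<or> x \<notin> S ==> H x = 0"
  "AE x in lborel. \<bar>u x\<bar> <= B" "AE x in lborel. norm (H x) <= B" "B >= 0"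
proof -
 note a = assms[unfolded vanishing_off_def]
 show "wgrad Om u H" using a by (rule conjunct1)
 note b = conjunct2[OF a]
 show "x \<notin> Om \<or> x \<notin> S ==> u x = 0" "x \<notin> Om \<or> x \<notin> S ==> H x = 0" using conjunct1[OF b] by blast+
 show u: "AE x in lborel. \<bar>u x\<bar> <= B" using conjunct2[OF b] by (rule conjunct1)
 show "AE x in lborel. norm (H x) <= B" using conjunct2[OF b] by (rule conjunct2)
 obtain x where "\<bar>u x\<bar> <= B" using AE_lborel_witness[OF u open_UNIV] by auto
 thus "B >= 0" by linarith
qed

text \<open>Each patch carries its double as the support of a cut-off. At the boundary, reflection
  doubles distances again, up to \<open>4 * s\<close>, which has to fit into the extension ball of
  radius \<open>r / 2\<close>.\<close>

definition patch :: "(real^3) set => real => (real^3) \<times> real => bool" where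
 "patch Om r P \<longleftrightarrow> snd P > 0 & ((fst P \<in> frontier Om & 8 * snd P <= r) \<or> ball (fst P) (2 * snd P) \<subseteq> Om)"

text \<open>Induction over the list of patches. The cut-off of the first patch splits
  \<open>u\<close>; one piece is handled by \<open>patch_bound\<close>, the other vanishes on that
  patch and falls under the induction hypothesis with the bound \<open>B\<close> enlarged by
  \<open>1 + X\<close>. The constant depends on the cover only, not on the data.\<close>

lemma functional_cover:
 fixes Om :: "(real^3) set"
 assumes T: "0 < T" "Om \<subseteq> cball 0 T" and lam: "0 < lam" and Lam: "0 <= Lam" and ps: "\<forall>P\<in>set ps. patch Om r P"
 shows "\<exists>C\<ge>0. \<forall>M sg f w gsg F G u H B. coil_data Om al lam Lam M r K sg f w gsg F G -->
  vanishing_off Om (\<Union>P\<in>set ps. ball (fst P) (snd P)) u H B --> \<bar>LBINT x. sg x * (F x *i H x)\<bar> <= C * M * B" using ps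
proof (induction ps)
 case Nil
 show ?case
 proof (intro exI[of _ 0] conjI allI impI)
  fix M sg f w gsg F G u H B
  assume v: "vanishing_off Om (\<Union>P\<in>set []. ball (fst P) (snd P)) u H (B::real)"
  have "H x = 0" for x by (rule vanishing_offD(3)[OF v]) simp
  thus "\<bar>LBINT x. sg x * (F x *i H x)\<bar> <= 0 * M * B" by simp
 qed simp
next
 case (Cons P ps)
 obtain a s where P: "P = (a, s)" by (cases P)
 have p: "s > 0" "(a \<in> frontier Om & 8 * s <= r) \<or> ball a (2 * s) \<subseteq> Om" using Cons.prems by (simp_all add: patch_def P)
 have ps': "\<forall>P\<in>set ps. patch Om r P" using Cons.prems by simp
 obtain C where C0: "C >= 0" and C1: "\<forall>M sg f w gsg F G u H B. coil_data Om al lam Lam M r K sg f w gsg F G -->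
  vanishing_off Om (\<Union>P\<in>set ps. ball (fst P) (snd P)) u H B --> \<bar>LBINT x. sg x * (F x *i H x)\<bar> <= C * M * B"
  using Cons.IH[OF ps'] by (elim exE conjE) (rule that)
 note C = C0 C1[rule_format]
 obtain ph D X where ph: "C1c (ball a (2 * s)) ph D" "!!x. 0 <= ph x" "!!x. ph x <= 1" "!!x. x \<in> ball a s ==> ph x = 1"
  "!!x. x \<in> ball a s ==> D x = 0" "!!x. norm (D x) <= X" using cutoff_ball[OF p(1), of a] by blast
 have X0: "X >= 0" using ph(6)[of 0] norm_ge_zero order_trans by blast
 define E where "E = (16 * T powr (2 + al) + Lam * measure lborel Om) + (9 * K^2 / lam) * measure lborel Om * (5 * (1 + X))"
 have E0: "E >= 0" using T lam Lam X0 by (simp add: E_def)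
 show ?case
 proof (intro exI[of _ "E + C * (1 + X)"] conjI allI impI)
  show "0 <= E + C * (1 + X)" using E0 C(1) X0 by simp
  fix M sg f w gsg F G u H B
  assume cd: "coil_data Om al lam Lam M r K sg f w gsg F G" and v: "vanishing_off Om (\<Union>P\<in>set (P # ps). ball (fst P) (snd P)) u H B"
  interpret coil_data Om al lam Lam M r K sg f w gsg F G by (rule cd)
  note vD = vanishing_offD[OF v]
  let ?J = "%x. u x *r D x + ph x *r H x"
  let ?u = "%x. (1 - ph x) * u x" and ?H = "%x. u x *r (- D x) + (1 - ph x) *r H x"
  have f: "\<bar>ph x\<bar> <= 1 + X" "\<bar>1 - ph x\<bar> <= 1 + X" "\<bar>1 - ph x\<bar> <= 1" "norm (D x) <= 1 + X" "norm (- D x) <= 1 + X" "norm (- D x) <= X" for x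
   using ph(2,3,6)[of x] X0 by simp_all
  have c1: "C1 (%x. 1 - ph x) (%x. - D x)" using C1_diff[OF C1_const[of 1] C1c_C1[OF ph(1)]] by simp
  have w1: "wgrad Om (%x. ph x * u x) ?J" by (rule wgrad_mult[OF vD(1) C1c_C1[OF ph(1)] f(1,4)])
  have w2: "wgrad Om ?u ?H" by (rule wgrad_mult[OF vD(1) c1 f(2,5)])
  have s1: "\<bar>LBINT x. sg x * (F x *i ?J x)\<bar> <= M * E * B"
   unfolding E_def by (rule patch_bound[OF T p ph(1-3,6) vD(1) _ _ vD(4,5)]) (use vD(2,3) in auto)
  have s2: "\<bar>LBINT x. sg x * (F x *i ?H x)\<bar> <= C * M * ((1 + X) * B)"
  proof (rule C(2)[OF cd])
   have "?u x = 0 & ?H x = 0" if "x \<notin> Om \<or> x \<notin> (\<Union>P\<in>set ps. ball (fst P) (snd P))" for x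
   proof (cases "x \<in> ball a s")
    case True thus ?thesis using ph(4,5)[of x] by simp
   next
    case False
    hence "x \<notin> Om \<or> x \<notin> (\<Union>P\<in>set (P # ps). ball (fst P) (snd P))" using that P by auto
    thus ?thesis using vD(2,3)[of x] by simp
   qed
   moreover have "AE x in lborel. \<bar>?u x\<bar> <= (1 + X) * B" using vD(4)
   proof eventually_elim
    case (elim x)
    show ?case unfolding abs_mult by (rule mult_mono[OF f(2) elim]) (use X0 in auto)
   qed
   moreover have "AE x in lborel. norm (?H x) <= (1 + X) * B" using vD(4,5)
   proof eventually_elim
    case (elim x)
    have "norm (?H x) <= norm (u x *r (- D x)) + norm ((1 - ph x) *r H x)" by (rule norm_triangle_ineq)
    also have "... <= B * X + 1 * B" unfolding norm_scaleR real_norm_def by (intro add_mono mult_mono elim f) (use vD(6) in auto)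
    finally show ?case by (simp add: algebra_simps)
   qed
   ultimately show "vanishing_off Om (\<Union>P\<in>set ps. ball (fst P) (snd P)) ?u ?H ((1 + X) * B)" unfolding vanishing_off_def using w2 by blast
  qed
  obtain A where A: "A > 0" "\<forall>x\<in>Om. norm (F x) <= A" using F_bounded by blast
  have [measurable]: "F \<in> Bm" "sg \<in> Bm" by (rule dD(7), rule sigma_borel)
  have sF: "norm (sg x *r F x) <= A / lam" for x
  proof (cases "x \<in> Om")
   case True
   have "\<bar>sg x\<bar> * norm (F x) <= (1 / lam) * A" by (rule mult_mono[OF sigma_bound]) (use A True lam in auto)
   thus ?thesis by simp
  qed (use dD(2) A lam in simp)
  have i: "lint (%x. sg x * (F x *i J x))" if "lint J" for J
  proof -
   have "lint (%x. J x *i (sg x *r F x))" by (rule int_inner_bounded[OF that _ sF]) measurable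
   thus ?thesis by (simp add: inner_commute)
  qed
  have HJ: "H x = ?J x + ?H x" for x by (simp add: algebra_simps)
  have "(LBINT x. sg x * (F x *i H x)) = (LBINT x. sg x * (F x *i ?J x) + sg x * (F x *i ?H x))"
   by (subst HJ) (simp only: inner_add_right distrib_left)
  also have "... = (LBINT x. sg x * (F x *i ?J x)) + (LBINT x. sg x * (F x *i ?H x))"
   by (rule integral_plus[OF i[OF wgrad_integrable(2)[OF w1]] i[OF wgrad_integrable(2)[OF w2]]])
  finally have "\<bar>LBINT x. sg x * (F x *i H x)\<bar> <= M * E * B + C * M * ((1 + X) * B)" using s1 s2 by linarith
  thus "\<bar>LBINT x. sg x * (F x *i H x)\<bar> <= (E + C * (1 + X)) * M * B" by (simp add: algebra_simps)
 qed
qed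

text \<open>Sets are linked when they meet. If some nonempty set could not be reached from
  \<open>A i0\<close>, the unions of the reachable and of the other sets would disconnect
  \<open>Om\<close>. The constant is fixed before \<open>w\<close>, \<open>N\<close> and
  \<open>B\<close>, and is the sum of finitely many chain constants; only the oscillation on each
  set matters, not its shape.\<close>

lemma oscillation_chain:
 fixes A :: "'i => 'a::euclidean_space set" and L :: "'i => real"
 assumes op: "!!i. i \<in> I ==> open (A i)" and fin: "finite I" and cov: "Om = (\<Union>i\<in>I. A i)" and con: "connected Om" and ne: "Om ~= {}" and L: "!!i. i \<in> I ==> L i >= 0"
 shows "\<exists>C\<ge>0. \<forall>w N (B::real). N \<in> null_sets lborel --> 0 <= B --> (\<forall>i\<in>I. \<forall>x\<in>A i - N. \<forall>y\<in>A i - N. \<bar>w x - w y\<bar> <= L i * B) -->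
  (\<exists>c::real. \<forall>x\<in>Om - N. \<bar>w x - c\<bar> <= C * B)"
proof -
 obtain i0 where i0: "i0 \<in> I" "A i0 ~= {}" using ne cov by blast
 define E where "E = {(i, j). i \<in> I & j \<in> I & A i \<inter> A j ~= {}}"
 define osc where "osc w N B \<longleftrightarrow> N \<in> null_sets lborel & 0 <= B & (\<forall>i\<in>I. \<forall>x\<in>A i - N. \<forall>y\<in>A i - N. \<bar>w x - w y\<bar> <= L i * B)" for w N and B :: real
 have chain: "j \<in> I & (\<exists>m\<ge>0. \<forall>w N B. osc w N B --> (\<forall>x\<in>A i0 - N. \<forall>y\<in>A j - N. \<bar>w x - w y\<bar> <= m * B))"
  if "(i0, j) \<in> E\<^sup>*" for j using that
 proof (induction rule: rtrancl_induct)
  case base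
  show ?case using i0 L by (auto simp: osc_def intro!: exI[of _ "L i0"])
 next
  case (step j k)
  have jk: "j \<in> I" "k \<in> I" "A j \<inter> A k ~= {}" using step.hyps(2) by (auto simp: E_def)
  obtain m where m: "m >= 0" "!!w N B x y. osc w N B ==> x \<in> A i0 - N ==> y \<in> A j - N ==> \<bar>w x - w y\<bar> <= m * B" using step.IH by blast
  have "\<bar>w x - w y\<bar> <= (m + L k) * B" if o: "osc w N B" and x: "x \<in> A i0 - N" and y: "y \<in> A k - N" for w N B x y
  proof -
   \<comment> \<open>Two consecutive sets meet in a nonempty open set, which is not null, so a
     linking point can be chosen outside \<open>N\<close>.\<close>
   have "open (A j \<inter> A k)" using op jk by blast
   moreover have "N \<in> null_sets lborel" using o by (simp add: osc_def)
   ultimately obtain z where z: "z \<in> A j \<inter> A k - N" using open_minus_null_nonempty jk(3) by blast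
   have "\<bar>w x - w z\<bar> <= m * B" by (rule m(2)[OF o x]) (use z in blast)
   moreover have "\<bar>w z - w y\<bar> <= L k * B" using o z y jk(2) unfolding osc_def by blast
   ultimately show ?thesis by (simp add: algebra_simps)
  qed
  moreover have "m + L k >= 0" using m(1) L[OF jk(2)] by simp
  ultimately show ?case using jk(2) by blast
 qed
 have reach: "(i0, j) \<in> E\<^sup>*" if j: "j \<in> I" "A j ~= {}" for j
 proof (rule ccontr)
  assume nr: "(i0, j) \<notin> E\<^sup>*"
  let ?R = "{k \<in> I. (i0, k) \<in> E\<^sup>*}"
  let ?S = "\<Union>k\<in>?R. A k" and ?T = "\<Union>k\<in>I - ?R. A k"
  have o: "open ?S" "open ?T" using op by blast+
  have sub: "Om \<subseteq> ?S \<union> ?T" using cov by blast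
  have dis: "?S \<inter> ?T = {}"
  proof (rule ccontr)
   assume "?S \<inter> ?T ~= {}"
   then obtain x k l where x: "k \<in> ?R" "l \<in> I - ?R" "x \<in> A k" "x \<in> A l" by blast
   hence "(k, l) \<in> E" unfolding E_def by blast
   hence "(i0, l) \<in> E\<^sup>*" using x(1) by (auto intro: rtrancl_into_rtrancl)
   thus False using x(2) by blast
  qed
  have S: "?S \<inter> Om ~= {}" using i0 cov by blast
  have T: "?T \<inter> Om ~= {}" using j nr cov by blast
  have "?S \<inter> ?T \<inter> Om = {}" using dis by blast
  from connectedD[OF con o this sub] S T show False by (elim disjE) (erule (1) notE)+
 qed
 define Q where "Q j m \<longleftrightarrow> 0 <= m & (A j ~= {} --> (\<forall>w N B. osc w N B --> (\<forall>x\<in>A i0 - N. \<forall>y\<in>A j - N. \<bar>w x - w y\<bar> <= m * B)))" for j and m :: real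
 have "\<exists>m. Q j m" if "j \<in> I" for j
 proof (cases "A j = {}")
  case True thus ?thesis unfolding Q_def by (intro exI[of _ 0]) simp
 next
  case False
  from chain[OF reach[OF that this]] show ?thesis unfolding Q_def by blast
 qed
 then obtain m where Qm: "!!j. j \<in> I ==> Q j (m j)" using bchoice[of I Q] by blast
 have m1: "m j >= 0" if "j \<in> I" for j using Qm[OF that] by (simp add: Q_def)
 have m2: "\<bar>w x - w y\<bar> <= m j * B" if "j \<in> I" "A j ~= {}" "osc w N B" "x \<in> A i0 - N" "y \<in> A j - N" for j w N B x y
  using Qm[OF that(1)] that(2-5) unfolding Q_def by blast
 show ?thesis
 proof (rule exI[of _ "\<Sum>j\<in>I. m j"], intro conjI allI impI)
  show "0 <= (\<Sum>j\<in>I. m j)" using m1 by (rule sum_nonneg)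
  fix w N and B :: real
  assume h: "N \<in> null_sets lborel" "0 <= B" "\<forall>i\<in>I. \<forall>x\<in>A i - N. \<forall>y\<in>A i - N. \<bar>w x - w y\<bar> <= L i * B"
  hence o: "osc w N B" by (simp add: osc_def)
  obtain x0 where x0: "x0 \<in> A i0 - N" using open_minus_null_nonempty[OF op[OF i0(1)] i0(2) h(1)] by blast
  have "\<bar>w x - w x0\<bar> <= (\<Sum>j\<in>I. m j) * B" if x: "x \<in> Om - N" for x
  proof -
   obtain j where j: "j \<in> I" "x \<in> A j" using x cov by blast
   have "\<bar>w x0 - w x\<bar> <= m j * B" by (rule m2[OF j(1) _ o x0]) (use j x in auto)
   also have "... <= (\<Sum>j\<in>I. m j) * B" by (rule mult_right_mono[OF member_le_sum[OF j(1) _ fin] h(2)]) (use m1 in auto)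
   finally show ?thesis by (simp add: abs_minus_commute)
  qed
  thus "\<exists>c. \<forall>x\<in>Om - N. \<bar>w x - c\<bar> <= (\<Sum>j\<in>I. m j) * B" by blast
 qed
qed

lemma (in coil_data) patch_oscillation:
 assumes p: "patch Om r (a, s)" and b: "AE x in lborel. norm (G x) <= B" and B: "B >= 0"
 shows "\<exists>N\<in>null_sets lborel. \<forall>x\<in>(Om \<inter> ball a s) - N. \<forall>y\<in>(Om \<inter> ball a s) - N. \<bar>w x - w y\<bar> <= 10 * s * B"
proof -
 have s: "s > 0" "(a \<in> frontier Om & 8 * s <= r) \<or> ball a (2 * s) \<subseteq> Om" using p by (simp_all add: patch_def)
 have dd: "dist x y <= 2 * s" if "x \<in> ball a s" "y \<in> ball a s" for x y using that dist_triangle3[of x y a] by simp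
 from s(2) show ?thesis
 proof
  assume "ball a (2 * s) \<subseteq> Om"
  hence "wgrad (ball a s) w G" by (intro wgrad_mono[OF sD(1)]) (use s(1) in auto)
  moreover have "AE x in lborel. x \<in> ball a s --> norm (G x) <= B" using b by eventually_elim simp
  ultimately obtain N where N: "N \<in> null_sets lborel" "!!x y. x \<in> ball a s - N ==> y \<in> ball a s - N ==> \<bar>w x - w y\<bar> <= B * dist x y"
   using wgrad_oscillation[of a s w G B] B by blast
  have "\<bar>w x - w y\<bar> <= 10 * s * B" if "x \<in> (Om \<inter> ball a s) - N" "y \<in> (Om \<inter> ball a s) - N" for x y
  proof -
   have "\<bar>w x - w y\<bar> <= B * dist x y" by (rule N(2)) (use that in auto)
   also have "... <= B * (10 * s)" using dd[of x y] that s(1) by (intro mult_left_mono B) auto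
   finally show ?thesis by (simp add: mult_ac)
  qed
  thus ?thesis using N(1) by blast
 next
  assume bd: "a \<in> frontier Om & 8 * s <= r"
  obtain n e S gs where g: "gframe Om al r K a n e S gs" using frames bd by blast
  note fr = gframeD(1)[OF g]
  have w: "wgrad (ball a s) (ext a n e S w) (extG a n e S gs G)"
   by (rule wgrad_mono[OF wgrad_ext[OF fr wgrad_mono[OF sD(1) gframe_sub[OF g]]]]) (use bd r in auto)
  have "AE x in lborel. norm (extG a n e S gs G x) <= 5 * B" by (rule extG_bound[OF fr b])
  hence b': "AE x in lborel. x \<in> ball a s --> norm (extG a n e S gs G x) <= 5 * B" by eventually_elim simp
  obtain N where N: "N \<in> null_sets lborel" "!!x y. x \<in> ball a s - N ==> y \<in> ball a s - N ==> \<bar>ext a n e S w x - ext a n e S w y\<bar> <= 5 * B * dist x y"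
   using wgrad_oscillation[OF w b'] B by auto
  have e: "ext a n e S w x = w x" if "x \<in> Om \<inter> ball a s" for x using gframeD(4)[OF g, of x] that bd s(1) by (simp add: ext_def)
  have "\<bar>w x - w y\<bar> <= 10 * s * B" if "x \<in> (Om \<inter> ball a s) - N" "y \<in> (Om \<inter> ball a s) - N" for x y
  proof -
   have "\<bar>ext a n e S w x - ext a n e S w y\<bar> <= 5 * B * dist x y" by (rule N(2)) (use that in auto)
   also have "... <= 5 * B * (2 * s)" using dd[of x y] that by (intro mult_left_mono) (use B in auto)
   finally show ?thesis using e[of x] e[of y] that by (simp add: mult_ac)
  qed
  thus ?thesis using N(1) by blast
 qed
qed

lemma oscillation_bound:
 fixes Om :: "(real^3) set"
 assumes op: "open Om" and con: "connected Om" and ne: "Om ~= {}" and ps0: "\<forall>P\<in>set ps. patch Om r P"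
  and cov: "Om \<subseteq> (\<Union>P\<in>set ps. ball (fst P) (snd P))"
 shows "\<exists>C\<ge>0. \<forall>M sg f w gsg F G B. coil_data Om al lam Lam M r K sg f w gsg F G --> 0 <= B --> (AE x in lborel. norm (G x) <= B) -->
  (\<exists>c. AE x in lborel. x \<in> Om --> \<bar>w x - c\<bar> <= C * B)"
proof -
 note ps = bspec[OF ps0]
 let ?A = "%P. Om \<inter> ball (fst P) (snd P)"
 have "\<exists>C\<ge>0. \<forall>w N (B::real). N \<in> null_sets lborel --> 0 <= B --> (\<forall>P\<in>set ps. \<forall>x\<in>?A P - N. \<forall>y\<in>?A P - N. \<bar>w x - w y\<bar> <= 10 * snd P * B) -->
  (\<exists>c::real. \<forall>x\<in>Om - N. \<bar>w x - c\<bar> <= C * B)"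
  by (rule oscillation_chain[OF _ finite_set _ con ne]) (use op cov ps in \<open>auto simp: patch_def intro: less_imp_le\<close>)
 then obtain C where C0: "C >= 0" and C1: "\<forall>w N (B::real). N \<in> null_sets lborel --> 0 <= B --> (\<forall>P\<in>set ps. \<forall>x\<in>?A P - N. \<forall>y\<in>?A P - N. \<bar>w x - w y\<bar> <= 10 * snd P * B) -->
  (\<exists>c::real. \<forall>x\<in>Om - N. \<bar>w x - c\<bar> <= C * B)" by (elim exE conjE) (rule that)
 show ?thesis
 proof (rule exI[of _ C], intro conjI allI impI C0)
  fix M sg f w gsg F G and B :: real
  assume cd: "coil_data Om al lam Lam M r K sg f w gsg F G" and B: "0 <= B" and b: "AE x in lborel. norm (G x) <= B"
  define Q where "Q P N \<longleftrightarrow> N \<in> null_sets lborel & (\<forall>x\<in>?A P - N. \<forall>y\<in>?A P - N. \<bar>w x - w y\<bar> <= 10 * snd P * B)" for P N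
  have "\<exists>N. Q P N" if "P \<in> set ps" for P
  proof -
   obtain a s where P: "P = (a, s)" by (cases P)
   from coil_data.patch_oscillation[OF cd ps[OF that, unfolded P] b B] show ?thesis unfolding Q_def P by auto
  qed
  then obtain N where QN: "!!P. P \<in> set ps ==> Q P (N P)" using bchoice[of "set ps" Q] by blast
  have N: "!!P. P \<in> set ps ==> N P \<in> null_sets lborel" "!!P x y. P \<in> set ps ==> x \<in> ?A P - N P ==> y \<in> ?A P - N P ==> \<bar>w x - w y\<bar> <= 10 * snd P * B"
   using QN unfolding Q_def by blast+
  let ?N = "\<Union>P\<in>set ps. N P"
  have N0: "?N \<in> null_sets lborel" by (rule null_sets_UN') (use N(1) countable_finite in auto)
  have oN: "\<forall>P\<in>set ps. \<forall>x\<in>?A P - ?N. \<forall>y\<in>?A P - ?N. \<bar>w x - w y\<bar> <= 10 * snd P * B"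
  proof (intro ballI)
   fix P x y
   assume "P \<in> set ps" "x \<in> ?A P - ?N" "y \<in> ?A P - ?N"
   thus "\<bar>w x - w y\<bar> <= 10 * snd P * B" by (intro N(2)) auto
  qed
  have "\<exists>c. \<forall>x\<in>Om - ?N. \<bar>w x - c\<bar> <= C * B"
   by (rule C1[THEN spec, THEN spec, THEN spec, THEN mp, THEN mp, THEN mp, OF N0 B oN])
  then obtain c where c: "\<forall>x\<in>Om - ?N. \<bar>w x - c\<bar> <= C * B" by (rule exE)
  have "AE x in lborel. x \<notin> ?N" using N0 by (rule AE_not_in)
  hence "AE x in lborel. x \<in> Om --> \<bar>w x - c\<bar> <= C * B" by eventually_elim (use c in auto)
  thus "\<exists>c. AE x in lborel. x \<in> Om --> \<bar>w x - c\<bar> <= C * B" by blast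
 qed
qed

lemma patch_cover:
 fixes Om :: "(real^3) set"
 assumes "open Om" "bounded Om" "r > 0"
 shows "\<exists>ps. (\<forall>P\<in>set ps. patch Om r P) & Om \<subseteq> (\<Union>P\<in>set ps. ball (fst P) (snd P))"
proof -
 have cpt: "compact (closure Om)" using assms(2) by simp
 have cl: "closure Om \<subseteq> (\<Union>P\<in>Collect (patch Om r). ball (fst P) (snd P))"
 proof
  fix x assume x: "x \<in> closure Om"
  show "x \<in> (\<Union>P\<in>Collect (patch Om r). ball (fst P) (snd P))"
  proof (cases "x \<in> Om")
   case True
   then obtain e where "e > 0" "ball x e \<subseteq> Om" using assms(1) openE by blast
   hence "patch Om r (x, e / 2)" "x \<in> ball x (e / 2)" by (simp_all add: patch_def)
   thus ?thesis by force
  next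
   case False
   hence "x \<in> frontier Om" using x assms(1) by (simp add: frontier_def interior_open)
   hence "patch Om r (x, r / 8)" "x \<in> ball x (r / 8)" using assms(3) by (simp_all add: patch_def)
   thus ?thesis by force
  qed
 qed
 obtain S where S: "S \<subseteq> Collect (patch Om r)" "finite S" "closure Om \<subseteq> (\<Union>P\<in>S. ball (fst P) (snd P))"
  by (rule compactE_image[OF cpt _ cl]) auto
 obtain ps where "set ps = S" using finite_list[OF S(2)] by blast
 with S show ?thesis using closure_subset[of Om] by blast
qed

lemma (in coil_data) centred_solution:
 assumes b: "AE x in lborel. norm (G x) <= B" and c: "AE x in lborel. x \<in> Om --> \<bar>w x - c\<bar> <= D" and S: "Om \<subseteq> S" and "0 <= B" "0 <= D"
 shows "vanishing_off Om S (%x. indicator Om x * (w x - c)) G (B + D)"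
proof -
 let ?u = "%x. indicator Om x * (w x - c)"
 have w1: "wgrad Om (%x. indicator Om x *r (- c)) (%x. indicator Om x *r 0)" by (rule C1_wgrad[OF C1_const Om(2)]) (use Om(1) in simp)
 have w2: "wgrad Om (%x. w x + indicator Om x *r (- c)) G" using wgrad_add[OF sD(1) w1] by simp
 have "lint (%x. indicator Om x *r (w x + indicator Om x *r (- c)))"
  by (rule integrable_mult_indicator[OF _ wgrad_integrable(1)[OF w2]]) (use Om(1) in simp)
 moreover have "(%x. indicator Om x *r (w x + indicator Om x *r (- c))) = ?u" by (simp add: indicator_def fun_eq_iff)
 ultimately have iu: "lint ?u" by (rule subst[rotated])
 have "wgrad Om ?u G" by (rule wgrad_cong[OF w2 _ _ iu iG]) auto
 moreover have "?u x = 0 & G x = 0" if "x \<notin> Om \<or> x \<notin> S" for x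
 proof -
  have "x \<notin> Om" using that S by blast
  thus ?thesis using sD(2)[of x] by simp
 qed
 moreover have "AE x in lborel. \<bar>?u x\<bar> <= B + D" using c by eventually_elim (use assms(4,5) in \<open>auto simp: indicator_def\<close>)
 moreover have "AE x in lborel. norm (G x) <= B + D" using b by eventually_elim (use assms(5) in simp)
 ultimately show ?thesis unfolding vanishing_off_def by (intro conjI allI impI) simp_all
qed

lemma (in coil_data) energy_bound:
 assumes Q: "Q >= 0" and b: "\<bar>LBINT x. sg x * (F x *i G x)\<bar> <= Q * M * (M + (LBINT x. norm (G x)))"
 shows "(LBINT x. norm (G x)) <= (1 + measure lborel Om * (Q + 1) / lam) * M"
proof -
 let ?N = "LBINT x. norm (G x)" and ?m = "measure lborel Om" and ?E = "LBINT x. (norm (G x))^2"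
 have N0: "?N >= 0" by (intro integral_ge0) simp
 have [measurable]: "sg \<in> Bm" by (rule sigma_borel)
 note i2 = sD(4)
 have iS: "lint (%x. sg x * (G x *i G x))" using int_bounded_scaleR[OF i2 _ sigma_bound] by (simp add: power2_norm_eq_inner)
 have "lam * ?E = (LBINT x. lam * (norm (G x))^2)" by simp
 also have "... <= (LBINT x. sg x * (G x *i G x))"
 proof (rule integral_mono[OF integrable_mult_right[OF i2] iS])
  fix x show "lam * (norm (G x))^2 <= sg x * (G x *i G x)"
   using dD(3)[of x] sD(2)[of x] by (cases "x \<in> Om") (auto simp: power2_norm_eq_inner intro: mult_right_mono)
 qed
 also have "... = (LBINT x. sg x * (F x *i G x))" by (rule sD(5))
 also have "... <= Q * M * (M + ?N)" using b by linarith
 finally have E: "lam * ?E <= Q * M * (M + ?N)" .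
 \<comment> \<open>The weight is chosen so that the square integral contributes at most
   \<open>(M + ?N) / 2\<close>; \<open>Q + 1\<close> in place of \<open>Q\<close> keeps it positive
   when \<open>Q = 0\<close>.\<close>
 define ep where "ep = lam / ((Q + 1) * M)"
 have e: "ep > 0" using lam Q M0 by (simp add: ep_def)
 have "?N <= (LBINT x. (ep / 2) * (norm (G x))^2 + (1 / (2 * ep)) * indicator Om x)"
 proof (rule integral_mono[OF integrable_norm[OF iG] int_add[OF integrable_mult_right[OF i2] integrable_mult_right[OF finite_measure_domain]]])
  fix x
  show "norm (G x) <= (ep / 2) * (norm (G x))^2 + (1 / (2 * ep)) * indicator Om x"
  proof (cases "x \<in> Om")
   case True
   let ?g = "norm (G x)"
   have "0 <= (ep * ?g - 1)^2 / (2 * ep)" using e by simp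
   also have "... = (ep / 2) * ?g^2 + 1 / (2 * ep) - ?g" using e by (simp add: power2_eq_square field_simps)
   finally show ?thesis using True by simp
  next
   case False thus ?thesis using sD(2)[of x] by simp
  qed
 qed
 also have "... = (ep / 2) * ?E + (1 / (2 * ep)) * ?m"
  by (subst integral_plus[OF integrable_mult_right[OF i2] integrable_mult_right[OF finite_measure_domain]]) simp
 also have "(ep / 2) * ?E <= (1 / 2) * (M + ?N)"
 proof -
  have "ep * ?E = (lam * ?E) / ((Q + 1) * M)" by (simp add: ep_def)
  also have "... <= (Q * M * (M + ?N)) / ((Q + 1) * M)" using E Q M0 by (intro divide_right_mono) auto
  also have "... = (Q / (Q + 1)) * (M + ?N)" using M0 by simp
  also have "... <= 1 * (M + ?N)" using Q M0 N0 by (intro mult_right_mono) (auto simp: divide_le_eq)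
  finally show ?thesis by simp
 qed
 also have "(1 / (2 * ep)) * ?m = (1 / 2) * (?m * (Q + 1) / lam * M)" using lam Q M0 by (simp add: ep_def field_simps)
 finally have fin: "?N <= (1 / 2) * (M + ?N) + (1 / 2) * (?m * (Q + 1) / lam * M)" by simp
 have ar: "n <= m + z" if "n <= (1 / 2) * (m + n) + (1 / 2) * z" for m n z :: real using that by (simp add: field_simps)
 have "?N <= M + ?m * (Q + 1) / lam * M" by (rule ar[OF fin])
 thus ?thesis by (simp add: algebra_simps)
qed

text \<open>The sup bound contains the L1 norm, while the energy estimate needs the sup bound to
  control the oscillation of \<open>w\<close>. The circle closes because the energy is quadratic in
  \<open>G\<close>, whereas its bound is linear in the L1 norm and carries a factor
  \<open>M\<close>.\<close>

lemma gradient_bound: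
 fixes Om :: "(real^3) set"
 assumes op: "open Om" and bd: "bounded Om" and con: "connected Om" and ne: "Om ~= {}"
  and lam: "0 < lam" and Lam: "0 <= Lam" and K: "1 <= K" and r: "0 < r" and al: "0 < al"
 shows "\<exists>C>0. \<forall>M sg f w gsg F G. coil_data Om al lam Lam M r K sg f w gsg F G --> (AE x in lborel. norm (G x) <= C * M)"
proof -
 obtain T where T: "0 < T" "Om \<subseteq> cball 0 T" using bd unfolding bounded_pos by (auto simp: subset_iff)
 obtain ps where ps: "\<forall>P\<in>set ps. patch Om r P" "Om \<subseteq> (\<Union>P\<in>set ps. ball (fst P) (snd P))" using patch_cover[OF op bd r] by blast
 obtain C1 where C1: "C1 >= 0" and C1': "\<forall>M sg f w gsg F G. coil_data Om al lam Lam M r K sg f w gsg F G -->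
  (AE x in lborel. norm (G x) <= C1 * (M + (LBINT x. norm (G x))))" using gradient_sup_bound[OF lam Lam K r al, of Om] by (elim exE conjE) (rule that)
 obtain C2 where C2: "C2 >= 0" and C2': "\<forall>M sg f w gsg F G u H B. coil_data Om al lam Lam M r K sg f w gsg F G -->
  vanishing_off Om (\<Union>P\<in>set ps. ball (fst P) (snd P)) u H B --> \<bar>LBINT x. sg x * (F x *i H x)\<bar> <= C2 * M * B"
  using functional_cover[OF T lam Lam ps(1), where al=al and K=K] by (elim exE conjE) (rule that)
 obtain C3 where C3: "C3 >= 0" and C3': "\<forall>M sg f w gsg F G B. coil_data Om al lam Lam M r K sg f w gsg F G --> 0 <= B --> (AE x in lborel. norm (G x) <= B) -->
  (\<exists>c. AE x in lborel. x \<in> Om --> \<bar>w x - c\<bar> <= C3 * B)"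
  using oscillation_bound[OF op con ne ps, where al=al and lam=lam and Lam=Lam and K=K] by (elim exE conjE) (rule that)
 define Q where "Q = C2 * ((1 + C3) * C1)"
 have Q: "Q >= 0" using C1 C2 C3 by (simp add: Q_def)
 define C where "C = C1 * (2 + measure lborel Om * (Q + 1) / lam) + 1"
 have C0: "C > 0" using C1 Q lam by (auto simp: C_def intro!: add_nonneg_pos)
 show ?thesis
 proof (rule exI[of _ C], intro conjI C0 allI impI)
  fix M sg f w gsg F G
  assume cd: "coil_data Om al lam Lam M r K sg f w gsg F G"
  interpret coil_data Om al lam Lam M r K sg f w gsg F G by (rule cd)
  let ?N = "LBINT x. norm (G x)"
  let ?B = "C1 * (M + ?N)"
  have N0: "?N >= 0" by (intro integral_ge0) simp
  have B0: "?B >= 0" using C1 M0 N0 by simp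
  have b: "AE x in lborel. norm (G x) <= ?B" by (rule C1'[rule_format, OF cd])
  have "\<exists>c. AE x in lborel. x \<in> Om --> \<bar>w x - c\<bar> <= C3 * ?B"
   by (rule C3'[THEN spec, THEN spec, THEN spec, THEN spec, THEN spec, THEN spec, THEN spec, THEN spec, THEN mp, THEN mp, THEN mp, OF cd B0 b])
  then obtain c where c: "AE x in lborel. x \<in> Om --> \<bar>w x - c\<bar> <= C3 * ?B" by (rule exE)
  have D0: "0 <= C3 * ?B" using C3 B0 by simp
  have "\<bar>LBINT x. sg x * (F x *i G x)\<bar> <= C2 * M * (?B + C3 * ?B)" by (rule C2'[rule_format, OF cd centred_solution[OF b c ps(2) B0 D0]])
  also have "... = Q * M * (M + ?N)" by (simp add: Q_def algebra_simps)
  finally have "?N <= (1 + measure lborel Om * (Q + 1) / lam) * M" by (rule energy_bound[OF Q])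
  hence "?B <= C1 * (M + (1 + measure lborel Om * (Q + 1) / lam) * M)" by (intro mult_left_mono add_left_mono C1)
  also have "... <= C * M" using M0 by (simp add: C_def algebra_simps)
  finally have le: "?B <= C * M" .
  show "AE x in lborel. norm (G x) <= C * M" using b by eventually_elim (rule order_trans[OF _ le])
 qed
qed

section \<open>Continuity of the coil field\<close>

text \<open>Finite covers of arbitrarily small mesh with bounded sum of squared diameters; this is
  finiteness of the two-dimensional Hausdorff measure in a form that unions and Lipschitz images
  handle easily. Lists are used so that coinciding images are counted separately.\<close>

definition finely_covered :: "(real^3) set => real => bool" where
 "finely_covered A S \<longleftrightarrow> (\<forall>de>0. \<exists>Us. A \<subseteq> \<Union>(set Us) & (\<forall>V\<in>set Us. bounded V & diameter V <= de) & (\<Sum>V\<leftarrow>Us. (diameter V)^2) <= S)"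

lemma finely_covered_Un:
 assumes "finely_covered A S" "finely_covered B T" shows "finely_covered (A \<union> B) (S + T)" unfolding finely_covered_def
proof (intro allI impI)
 fix de :: real assume "de > 0"
 then obtain Us Vs where "A \<subseteq> \<Union>(set Us)" "\<forall>V\<in>set Us. bounded V & diameter V <= de" "(\<Sum>V\<leftarrow>Us. (diameter V)^2) <= S"
  "B \<subseteq> \<Union>(set Vs)" "\<forall>V\<in>set Vs. bounded V & diameter V <= de" "(\<Sum>V\<leftarrow>Vs. (diameter V)^2) <= T"
  using assms unfolding finely_covered_def by meson
 thus "\<exists>Us. A \<union> B \<subseteq> \<Union>(set Us) & (\<forall>V\<in>set Us. bounded V & diameter V <= de) & (\<Sum>V\<leftarrow>Us. (diameter V)^2) <= S + T"
  by (intro exI[of _ "Us @ Vs"]) auto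
qed

lemma finely_covered_mono: "finely_covered B S ==> A \<subseteq> B ==> finely_covered A S" unfolding finely_covered_def by (meson order_trans)

lemma finely_covered_UN:
 assumes "finite I" "!!i. i \<in> I ==> \<exists>S. finely_covered (A i) S" shows "\<exists>S. finely_covered (\<Union>i\<in>I. A i) S" using assms
proof (induction I rule: finite_induct)
 case empty
 have "finely_covered {} 0" unfolding finely_covered_def by (auto intro!: exI[of _ "[]"])
 thus ?case by auto
next
 case (insert i I)
 then obtain S T where "finely_covered (A i) S" "finely_covered (\<Union>i\<in>I. A i) T" by blast
 from finely_covered_Un[OF this] show ?case by auto
qed

lemma hausdorff2_finite:
 assumes "finely_covered A S" shows "hausdorff2 A < \<infinity>"
proof -
 have "hausdorff2 A <= ennreal (pi / 4 * S)" unfolding hausdorff2_def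
 proof (rule SUP_least)
  fix de :: real assume "de \<in> {0<..}"
  then obtain Us where U: "A \<subseteq> \<Union>(set Us)" "!!V. V \<in> set Us ==> bounded V & diameter V <= de" "(\<Sum>V\<leftarrow>Us. (diameter V)^2) <= S"
   using assms unfolding finely_covered_def by auto
  define W where "W i = (if i < length Us then Us ! i else {})" for i
  have "A \<subseteq> (\<Union>i. W i)"
  proof
   fix x assume "x \<in> A"
   then obtain V where "V \<in> set Us" "x \<in> V" using U(1) by blast
   then obtain i where "i < length Us" "x \<in> Us ! i" by (auto simp: in_set_conv_nth)
   thus "x \<in> (\<Union>i. W i)" by (auto simp: W_def)
  qed
  moreover have "bounded (W i) & diameter (W i) <= de" for i using U(2)[of "Us ! i"] \<open>de \<in> {0<..}\<close> by (auto simp: W_def)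
  ultimately have W: "W \<in> {U. A \<subseteq> (\<Union>i. U i) & (\<forall>i. bounded (U i) & diameter (U i) <= de)}" by blast
  have "(\<Sum>i. ennreal (pi / 4 * (diameter (W i))^2)) = (\<Sum>i<length Us. ennreal (pi / 4 * (diameter (W i))^2))"
   by (rule suminf_finite) (auto simp: W_def)
  also have "... = ennreal (\<Sum>i<length Us. pi / 4 * (diameter (W i))^2)" by (rule sum_ennreal) simp
  also have "(\<Sum>i<length Us. pi / 4 * (diameter (W i))^2) = (\<Sum>i<length Us. pi / 4 * (diameter (Us ! i))^2)"
   by (rule sum.cong) (simp_all add: W_def)
  also have "... = pi / 4 * (\<Sum>i<length Us. (diameter (Us ! i))^2)" by (rule sum_distrib_left[symmetric])
  also have "(\<Sum>i<length Us. (diameter (Us ! i))^2) = (\<Sum>V\<leftarrow>Us. (diameter V)^2)" by (simp add: sum_list_sum_nth atLeast0LessThan)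
  also have "ennreal (pi / 4 * (\<Sum>V\<leftarrow>Us. (diameter V)^2)) <= ennreal (pi / 4 * S)" using U(3) by (intro ennreal_leI mult_left_mono) auto
  finally show "(INF U\<in>{U. A \<subseteq> (\<Union>i. U i) & (\<forall>i. bounded (U i) & diameter (U i) <= de)}. \<Sum>i. ennreal (pi / 4 * (diameter (U i))^2)) <= ennreal (pi / 4 * S)"
   by (rule INF_lower2[OF W])
 qed
 thus ?thesis by (rule le_less_trans) simp
qed

text \<open>In the plane, a grid of \<open>m^2\<close> cells covers the ball; each image has
  diameter of order \<open>1 / m\<close>, so the sum of squares does not depend on
  \<open>m\<close>.\<close>

lemma finely_covered_lipschitz_image:
 fixes Ph :: "real^2 => real^3"
 assumes W: "W \<subseteq> ball u0 ep" and ep: "ep > 0" and b: "b >= 0" and lip: "!!u v. u \<in> W ==> v \<in> W ==> dist (Ph u) (Ph v) <= b * dist u v"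
 shows "finely_covered (Ph ` W) (16 * b^2 * ep^2)" unfolding finely_covered_def
proof (intro allI impI)
 fix de :: real assume de: "de > 0"
 obtain m0 :: nat where m0: "4 * b * ep / de < real m0" using reals_Archimedean2 by blast
 define m where "m = Suc m0"
 have m: "real m > 0" "4 * b * ep / real m <= de"
 proof -
  show m1: "real m > 0" by (simp add: m_def)
  have "4 * b * ep <= de * real m0" using m0 de by (simp add: divide_less_eq mult.commute)
  also have "... <= de * real m" using de by (simp add: m_def)
  finally show "4 * b * ep / real m <= de" using m1 by (simp add: divide_le_eq)
 qed
 \<comment> \<open>The side of a cell: a square of side \<open>2 * ep\<close> around the ball is cut
   into \<open>m\<close> parts in each direction. Diameters are measured by the sum of the two
   coordinate differences, hence at most \<open>2 * h\<close>.\<close>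
 define h where "h = 2 * ep / real m"
 have h: "h > 0" using ep m by (simp add: h_def)
 define cell where "cell P = {u \<in> W. \<forall>k. h * real (if k = 1 then fst P else snd P) <= u $ k - u0 $ k + ep &
   u $ k - u0 $ k + ep <= h * (real (if k = 1 then fst P else snd P) + 1)}" for P :: "nat \<times> nat"
 have dc: "dist u v <= 2 * h" if uv: "u \<in> cell P" "v \<in> cell P" for u v P
 proof -
  have "\<bar>(u - v) $ k\<bar> <= h" for k
  proof -
   let ?i = "real (if k = 1 then fst P else snd P)"
   have "h * ?i <= u $ k - u0 $ k + ep" "u $ k - u0 $ k + ep <= h * ?i + h" "h * ?i <= v $ k - u0 $ k + ep" "v $ k - u0 $ k + ep <= h * ?i + h"
    using uv unfolding cell_def by (auto simp: distrib_left)
   thus ?thesis by (simp add: abs_le_iff)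
  qed
  hence "(\<Sum>k\<in>UNIV. \<bar>(u - v) $ k\<bar>) <= 2 * h" using sum_bounded_above[of "UNIV :: 2 set" "%k. \<bar>(u - v) $ k\<bar>" h] by simp
  thus ?thesis using norm_le_l1_cart[of "u - v"] by (simp add: dist_norm)
 qed
 have diam: "bounded (Ph ` cell P) & diameter (Ph ` cell P) <= 4 * b * ep / real m" for P
 proof -
  have d: "dist x y <= 4 * b * ep / real m" if xy: "x \<in> Ph ` cell P" "y \<in> Ph ` cell P" for x y
  proof -
   obtain u v where uv: "x = Ph u" "y = Ph v" "u \<in> cell P" "v \<in> cell P" using xy by blast
   hence "dist x y <= b * dist u v" using lip[of u v] by (simp add: cell_def)
   also have "... <= b * (2 * h)" using dc[OF uv(3,4)] b by (intro mult_left_mono)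
   finally show ?thesis by (simp add: h_def mult_ac)
  qed
  have "bounded (Ph ` cell P)"
  proof (cases "cell P = {}")
   case False
   then obtain u where "u \<in> cell P" by blast
   thus ?thesis unfolding bounded_def using d by blast
  qed simp
  moreover have "diameter (Ph ` cell P) <= 4 * b * ep / real m" by (rule diameter_le) (use d b ep m in \<open>auto simp: dist_norm\<close>)
  ultimately show ?thesis by blast
 qed
 let ?Ps = "List.product [0..<m] [0..<m]"
 let ?Us = "map (%P. Ph ` cell P) ?Ps"
 have "Ph ` W \<subseteq> \<Union>(set ?Us)"
 proof
  fix x assume "x \<in> Ph ` W"
  then obtain u where u: "x = Ph u" "u \<in> W" by blast
  define i where "i k = nat \<lfloor>(u $ k - u0 $ k + ep) / h\<rfloor>" for k
  have uk: "\<bar>(u - u0) $ k\<bar> < ep" for k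
  proof -
   have "norm (u - u0) < ep" using W u(2) by (auto simp: dist_nm)
   thus ?thesis using component_le_norm_cart[of "u - u0" k] by simp
  qed
  have i: "i k < m" "h * real (i k) <= u $ k - u0 $ k + ep" "u $ k - u0 $ k + ep <= h * (real (i k) + 1)" for k
  proof -
   let ?z = "(u $ k - u0 $ k + ep) / h"
   have "real m * h = 2 * ep" using m(1) by (simp add: h_def)
   hence z: "0 <= ?z" "?z < real m" using uk[of k] h by (auto simp: divide_less_eq abs_less_iff)
   have r: "real (i k) <= ?z" "?z < real (i k) + 1" using z(1) unfolding i_def by linarith+
   have "real (i k) < real m" using r(1) z(2) by linarith
   thus "i k < m" by simp
   show "h * real (i k) <= u $ k - u0 $ k + ep" using r(1) h by (simp add: le_divide_eq mult.commute)
   show "u $ k - u0 $ k + ep <= h * (real (i k) + 1)" using r(2) h by (simp add: divide_less_eq mult.commute)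
  qed
  have "u \<in> cell (i 1, i 2)" unfolding cell_def using u(2) i by (auto simp: forall_2)
  moreover have "(i 1, i 2) \<in> set ?Ps" using i(1) by simp
  ultimately show "x \<in> \<Union>(set ?Us)" unfolding u(1) set_map by blast
 qed
 moreover have "\<forall>V\<in>set ?Us. bounded V & diameter V <= de" using diam m(2) by (auto intro: order_trans)
 moreover have "(\<Sum>V\<leftarrow>?Us. (diameter V)^2) <= 16 * b^2 * ep^2"
 proof -
  have "(\<Sum>V\<leftarrow>?Us. (diameter V)^2) <= (\<Sum>V\<leftarrow>?Us. (4 * b * ep / real m)^2)"
   by (rule sum_list_mono) (use diam diameter_ge_0 in \<open>auto intro!: power_mono\<close>)
  also have "... = real (m * m) * (4 * b * ep / real m)^2" by (simp add: sum_list_triv)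
  also have "... = 16 * b^2 * ep^2" using m(1) by (simp add: power2_eq_square)
  finally show ?thesis .
 qed
 ultimately show "\<exists>Us. Ph ` W \<subseteq> \<Union>(set Us) & (\<forall>V\<in>set Us. bounded V & diameter V <= de) & (\<Sum>V\<leftarrow>Us. (diameter V)^2) <= 16 * b^2 * ep^2"
  by blast
qed

text \<open>The lower Lipschitz bound of a chart sends a small ball of the surface into a bounded
  ball of parameters, and the upper bound covers its image; compactness of \<open>D\<close> reduces
  to finitely many such pieces.\<close>

lemma surface_finely_covered:
 assumes "compact_oriented_surface D \<gamma> n" shows "\<exists>S. finely_covered D S"
proof -
 have loc: "\<exists>d>0. \<exists>S. finely_covered (D \<inter> ball p d) S" if p: "p \<in> D" for p
 proof -
  obtain U Ph where c: "surface_chart D \<gamma> n U Ph" "p \<in> Ph ` U" using assms p unfolding compact_oriented_surface_def by blast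
  obtain a b where ab: "a > 0" "!!u v. u \<in> U ==> v \<in> U ==> a * dist u v <= dist (Ph u) (Ph v)"
   "!!u v. u \<in> U ==> v \<in> U ==> dist (Ph u) (Ph v) <= b * dist u v" using c(1) unfolding surface_chart_def by blast
  have "openin (top_of_set D) (Ph ` U)" using c(1) unfolding surface_chart_def by blast
  then obtain e where e: "e > 0" "ball p e \<inter> D \<subseteq> Ph ` U" using c(2) unfolding openin_contains_ball by blast
  obtain u0 where u0: "u0 \<in> U" "p = Ph u0" using c(2) by blast
  let ?W = "U \<inter> ball u0 (e / a)"
  have "finely_covered (Ph ` ?W) (16 * \<bar>b\<bar>^2 * (e / a)^2)"
  proof (rule finely_covered_lipschitz_image)
   fix u v assume "u \<in> ?W" "v \<in> ?W"
   hence "dist (Ph u) (Ph v) <= b * dist u v" using ab(3) by blast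
   also have "... <= \<bar>b\<bar> * dist u v" by (intro mult_right_mono) auto
   finally show "dist (Ph u) (Ph v) <= \<bar>b\<bar> * dist u v" .
  qed (use e ab in auto)
  moreover have "D \<inter> ball p e \<subseteq> Ph ` ?W"
  proof
   fix x assume x: "x \<in> D \<inter> ball p e"
   then obtain u where u: "u \<in> U" "x = Ph u" using e(2) by blast
   have "a * dist u0 u < e" using ab(2)[OF u0(1) u(1)] x u0 u by simp
   hence "u \<in> ball u0 (e / a)" using ab(1) by (simp add: less_divide_eq mult.commute)
   thus "x \<in> Ph ` ?W" using u by blast
  qed
  ultimately show ?thesis using e(1) finely_covered_mono by blast
 qed
 then obtain d where d: "!!p. p \<in> D ==> d p > 0 & (\<exists>S. finely_covered (D \<inter> ball p (d p)) S)" by metis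
 have D: "compact D" using assms unfolding compact_oriented_surface_def by blast
 have "D \<subseteq> (\<Union>p\<in>D. ball p (d p))" using d by force
 then obtain I where I: "I \<subseteq> D" "finite I" "D \<subseteq> (\<Union>p\<in>I. ball p (d p))"
  using compactE_image[OF D, of D "%p. ball p (d p)"] by auto
 have "\<exists>S. finely_covered (\<Union>p\<in>I. D \<inter> ball p (d p)) S" by (rule finely_covered_UN[OF I(2)]) (use I(1) d in blast)
 moreover have "D \<subseteq> (\<Union>p\<in>I. D \<inter> ball p (d p))" using I(3) by blast
 ultimately show ?thesis using finely_covered_mono by blast
qed

lemma sets_surface_measure: "sets surface_measure = sets borel" "space surface_measure = UNIV"
 using sigma_algebra.sigma_sets_eq[OF sets.sigma_algebra_axioms[of "borel :: (real^3) measure"]] by (simp_all add: surface_measure_def)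

text \<open>The construction by \<open>measure_of\<close> gives \<open>D\<close> either the value of
  \<open>hausdorff2\<close> or zero, and both are finite. This supplies the integrable majorant for
  the coil field.\<close>

lemma surface_measure_finite:
 assumes "compact_oriented_surface D \<gamma> n" shows "emeasure surface_measure D < \<infinity>"
proof -
 have "hausdorff2 D < \<infinity>" using surface_finely_covered[OF assms] hausdorff2_finite by blast
 thus ?thesis unfolding surface_measure_def emeasure_measure_of_conv by simp
qed

lemma norm_cross3_le: "norm (cross3 x y) <= norm x * norm y"
proof -
 have "(norm (cross3 x y))^2 <= (norm x * norm y)^2" using norm_cross_dot[of x y] zero_le_power2[of "x *i y"] by linarith
 thus ?thesis by (rule power2_le_imp_le) simp
qed

text \<open>The surface has positive distance \<open>d\<close> from the closed domain and the cross
  product is at most the distance times one, so the integrand is bounded by \<open>1 / d^2\<close>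
  on a set of finite measure and dominated convergence applies.\<close>

lemma coil_field_continuous:
 assumes s: "compact_oriented_surface D \<gamma> n" and Om: "bounded Om" and dis: "D \<inter> closure Om = {}"
 shows "continuous_on (closure Om) (coil_field \<mu> D n)"
proof -
 have D: "compact D" "n \<in> borel_measurable (restrict_space borel D)" "!!y. y \<in> D ==> norm (n y) = 1"
  using s unfolding compact_oriented_surface_def by auto
 have Db: "D \<in> sets borel" using D(1) by (rule borel_compact)
 obtain d where d: "d > 0" "!!y x. y \<in> D ==> x \<in> closure Om ==> d <= dist y x"
  using separate_compact_closed[OF D(1) closed_closure dis] by blast
 define N where "N y = indicator D y *r n y" for y
 have N: "N \<in> Bm" unfolding N_def[abs_def] using D(2) Db by (subst (asm) borel_measurable_restrict_space_iff) auto
 let ?f = "%x y. (1 / norm (y - x) ^ 3) *r cross3 (y - x) (N y)"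
 have fm: "?f x \<in> borel_measurable surface_measure" for x
 proof -
  have "(%p. cross3 (fst p) (snd p)) \<in> borel_measurable (borel :: ((real^3) \<times> (real^3)) measure)"
   by (intro borel_measurable_continuous_onI continuous_on_cross continuous_intros)
  hence c: "(%p. cross3 (fst p) (snd p)) \<in> borel_measurable ((borel :: (real^3) measure) \<Otimes>\<^sub>M (borel :: (real^3) measure))" by (simp add: borel_prod)
  have "(%y. (y - x, N y)) \<in> borel \<rightarrow>\<^sub>M borel \<Otimes>\<^sub>M borel" using N by measurable
  from measurable_compose[OF this c] have "(%y. cross3 (y - x) (N y)) \<in> Bm" by simp
  hence "?f x \<in> Bm" by measurable
  thus ?thesis using measurable_cong_sets[OF sets_surface_measure(1) refl] by blast
 qed
 have coil: "coil_field \<mu> D n x = - (\<mu> / (4 * pi)) *r (\<integral>y. ?f x y \<partial>surface_measure)" for x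
  unfolding coil_field_def set_lebesgue_integral_def N_def by (simp add: cross_mult_right indicator_def if_distrib cong: if_cong)
 have int: "continuous_on (closure Om) (%x. \<integral>y. ?f x y \<partial>surface_measure)" unfolding continuous_on_sequentially comp_def
 proof (intro allI ballI impI)
  fix xs :: "nat => real^3" and x assume x: "x \<in> closure Om" and xs: "(\<forall>k. xs k \<in> closure Om) & xs \<longlonglongrightarrow> x"
  show "(%k. \<integral>y. ?f (xs k) y \<partial>surface_measure) \<longlonglongrightarrow> (\<integral>y. ?f x y \<partial>surface_measure)"
  proof (rule integral_dominated_convergence[where w="%y. (1 / d^2) * indicator D y"])
   have "D \<in> sets surface_measure" using Db sets_surface_measure by simp
   thus "integrable surface_measure (%y. (1 / d^2) * indicator D y :: real)"
    by (intro integrable_mult_right integrable_real_indicator surface_measure_finite[OF s])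
   show "AE y in surface_measure. (%k. ?f (xs k) y) \<longlonglongrightarrow> ?f x y"
   proof (rule AE_I2)
    fix y
    show "(%k. ?f (xs k) y) \<longlonglongrightarrow> ?f x y"
    proof (cases "y \<in> D")
     case True
     hence "norm (y - x) ~= 0" using d(1) d(2)[OF True x] by (auto simp: dist_norm)
     moreover have "(%k. cross3 (y - xs k) (N y)) \<longlonglongrightarrow> cross3 (y - x) (N y)"
     proof -
      have "continuous_on UNIV (%z. cross3 (y - z) (N y))" by (intro continuous_on_cross continuous_intros)
      from continuous_on_tendsto_compose[OF this, of xs x] xs show ?thesis by simp
     qed
     ultimately show ?thesis using xs by (intro tendsto_intros) auto
    qed (simp add: N_def)
   qed
   fix k
   show "AE y in surface_measure. norm (?f (xs k) y) <= (1 / d^2) * indicator D y"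
   proof (rule AE_I2)
    fix y
    show "norm (?f (xs k) y) <= (1 / d^2) * indicator D y"
    proof (cases "y \<in> D")
     case True
     let ?r = "norm (y - xs k)"
     have r: "d <= ?r" using d(2)[OF True, of "xs k"] xs by (simp add: dist_norm)
     have "norm (cross3 (y - xs k) (N y)) <= ?r" using norm_cross3_le[of "y - xs k" "N y"] D(3)[OF True] True by (simp add: N_def)
     hence "norm (?f (xs k) y) <= (1 / ?r ^ 3) * ?r" by (simp add: divide_right_mono)
     also have "... = 1 / ?r^2" using r d(1) by (simp add: power2_eq_square power3_eq_cube)
     also have "... <= 1 / d^2"
      by (rule divide_left_mono[OF power_mono[OF r]]) (use d(1) less_le_trans[OF d(1) r] in \<open>auto intro!: mult_pos_pos\<close>)
     finally show ?thesis using True by simp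
    qed (simp add: N_def)
   qed
  qed (rule fm)+
 qed
 show ?thesis unfolding coil by (intro continuous_intros int)
qed

section \<open>Borel representatives\<close>

text \<open>\<open>borel_version Om h h'\<close>: the Borel function \<open>h'\<close> represents \<open>h\<close> on \<open>Om\<close> and is extended by zero.\<close>

definition borel_version :: "(real^3) set => (real^3 => 'b::real_normed_vector) => (real^3 => 'b) => bool" where
 "borel_version Om h h' \<longleftrightarrow> h' \<in> Bm & (AE x in lborel. x \<in> Om --> h x = h' x) & (\<forall>x. x \<notin> Om --> h' x = 0)"

lemma borel_versionD:
 assumes "borel_version Om h h'" shows "h' \<in> Bm" "AE x in lborel. x \<in> Om --> h x = h' x" "x \<notin> Om ==> h' x = 0"
 using assms unfolding borel_version_def by blast+

lemma borel_versionI: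
 assumes "h' \<in> Bm" "AE x in lborel. x \<in> Om --> h x = h' x" "!!x. x \<notin> Om ==> h' x = 0" shows "borel_version Om h h'"
 using assms unfolding borel_version_def by blast

lemma borel_version_map:
 assumes "borel_version Om u u'" "(%x. k x (u' x)) \<in> Bm" "!!x. k x 0 = 0" shows "borel_version Om (%x. k x (u x)) (%x. k x (u' x))"
proof (rule borel_versionI)
 show "AE x in lborel. x \<in> Om --> k x (u x) = k x (u' x)" using borel_versionD(2)[OF assms(1)] by eventually_elim simp
qed (use assms borel_versionD(3)[OF assms(1)] in simp_all)

text \<open>Preimages under \<open>f\<close> and \<open>g\<close> differ only inside a null set, and
  every subset of a null set is measurable in the completion.\<close>

lemma measurable_completion_AE:
 fixes f g :: "'a::euclidean_space => 'b::topological_space"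
 assumes g: "g \<in> Bm" and e: "AE x in lborel. f x = g x" shows "f \<in> borel_measurable lebesgue"
proof -
 obtain N where N: "N \<in> null_sets lborel" "{x. f x ~= g x} \<subseteq> N" using e by (auto elim!: AE_E simp: space_lborel null_sets_def)
 have N': "N \<in> null_sets lebesgue" using N(1) by (rule null_sets_completionI)
 show ?thesis
 proof (rule borel_measurableI)
  fix S :: "'b set" assume S: "open S"
  have 1: "f -` S \<inter> N \<in> sets lebesgue" by (rule completion.complete[OF _ N']) simp
  have "g -` S \<in> sets borel" using measurable_sets[OF g borel_open[OF S]] by simp
  hence 2: "g -` S \<in> sets lebesgue" by simp
  have "f -` S \<inter> space lebesgue = (g -` S - N) \<union> (f -` S \<inter> N)" using N(2) by auto
  thus "f -` S \<inter> space lebesgue \<in> sets lebesgue" using sets.Un[OF sets.Diff[OF 2 null_setsD2[OF N']] 1] by (rule ssubst)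
 qed
qed

lemma borel_version_lebesgue:
 fixes h :: "real^3 => 'b::{banach,second_countable_topology}"
 assumes v: "borel_version Om h h'" and Om: "open Om"
 shows "(LINT x|lebesgue_on Om. h x) = (LBINT x. h' x)" "integrable (lebesgue_on Om) h \<longleftrightarrow> lint h'"
  "h \<in> borel_measurable (lebesgue_on Om)"
proof -
 note D = borel_versionD[OF v]
 have O: "Om \<inter> space lebesgue \<in> sets lebesgue" using Om by simp
 have ae: "AE x in lborel. indicator Om x *r h x = h' x" using D(2) by eventually_elim (use D(3) in \<open>auto simp: indicator_def\<close>)
 have m: "(%x. indicator Om x *r h x) \<in> borel_measurable lebesgue" by (rule measurable_completion_AE[OF D(1) ae])
 have m': "h' \<in> borel_measurable lebesgue" using D(1) by (simp add: measurable_completion)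
 have ae': "AE x in lebesgue. indicator Om x *r h x = h' x" by (rule AE_completion[OF ae])
 have mb: "h' \<in> lborel \<rightarrow>\<^sub>M borel" using D(1) by simp
 show "(LINT x|lebesgue_on Om. h x) = (LBINT x. h' x)"
  unfolding integral_restrict_space[OF O] integral_completion[OF mb, symmetric] by (rule integral_cong_AE[OF m m' ae'])
 show "integrable (lebesgue_on Om) h \<longleftrightarrow> lint h'"
  unfolding integrable_restrict_space[OF O] integrable_completion[OF mb, symmetric] by (rule integrable_cong_AE[OF m m' ae'])
 show "h \<in> borel_measurable (lebesgue_on Om)" using m O by (subst borel_measurable_restrict_space_iff) auto
qed

lemma borel_version_ex_real:
 fixes g :: "real^3 => real"
 assumes "(%x. indicator Om x *r g x) \<in> borel_measurable lebesgue" and Om: "open Om" shows "\<exists>g'. borel_version Om g g'"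
proof -
 obtain k where k: "k \<in> borel_measurable lborel" "AE x in lborel. indicator Om x *r g x = k x"
  using completion_ex_borel_measurable_real[OF assms(1)] by blast
 have "borel_version Om g (%x. indicator Om x *r k x)"
 proof (rule borel_versionI)
  have [measurable]: "k \<in> Bm" "Om \<in> sets borel" using k(1) Om by simp_all
  show "(%x. indicator Om x *r k x) \<in> Bm" by measurable
  show "AE x in lborel. x \<in> Om --> g x = indicator Om x *r k x" using k(2) by eventually_elim auto
 qed simp
 thus ?thesis by blast
qed

lemma borel_version_ex_vec:
 fixes g :: "real^3 => real^3"
 assumes m: "(%x. indicator Om x *r g x) \<in> borel_measurable lebesgue" and Om: "open Om" shows "\<exists>g'. borel_version Om g g'"
proof -
 have "\<exists>k. borel_version Om (%x. g x $ i) k" for i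
 proof (rule borel_version_ex_real[OF _ Om])
  have "(%x. (indicator Om x *r g x) *i axis i 1) \<in> borel_measurable lebesgue" using m by measurable
  thus "(%x. indicator Om x *r (g x $ i)) \<in> borel_measurable lebesgue" by (simp add: inner_axis)
 qed
 then obtain k where k: "!!i. borel_version Om (%x. g x $ i) (k i)" by metis
 let ?g = "%x. \<Sum>i\<in>UNIV. k i x *r (axis i 1 :: real^3)"
 have c: "?g x $ j = k j x" for x j by (simp add: axis_def if_distrib cong: if_cong)
 have "borel_version Om g ?g"
 proof (rule borel_versionI)
  have [measurable]: "k i \<in> Bm" for i by (rule borel_versionD(1)[OF k])
  show "?g \<in> Bm" by measurable
  have "AE x in lborel. \<forall>i\<in>UNIV. x \<in> Om --> g x $ i = k i x" by (rule AE_finite_allI) (use borel_versionD(2)[OF k] in auto)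
  thus "AE x in lborel. x \<in> Om --> g x = ?g x" by eventually_elim (simp only: vec_eq_iff c, blast)
  show "?g x = 0" if "x \<notin> Om" for x using borel_versionD(3)[OF k that] by simp
 qed
 thus ?thesis by blast
qed

text \<open>Local integrability gives measurability on each compact subset; an exhaustion of the
  open set by compact sets passes it to the limit.\<close>

lemma locally_integrable_measurable:
 fixes u :: "real^3 => 'b::{banach,second_countable_topology}"
 assumes l: "locally_integrable Om u" and Om: "open Om" shows "(%x. indicator Om x *r u x) \<in> borel_measurable lebesgue"
proof -
 define ex where "ex C \<longleftrightarrow> (\<forall>n::nat. compact (C n) & C n \<subseteq> Om) & (\<forall>x\<in>Om. \<exists>N. \<forall>n\<ge>N. x \<in> C n)" for C
 have "\<exists>C. ex C"
 proof (rule open_Union_compact_subsets[OF Om])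
  fix C :: "nat => (real^3) set"
  assume a: "!!n. compact (C n)" "!!n. C n \<subseteq> Om" and b: "!!K. compact K ==> K \<subseteq> Om ==> \<exists>N. \<forall>n\<ge>N. K \<subseteq> C n"
  have "\<exists>N. \<forall>n\<ge>N. x \<in> C n" if "x \<in> Om" for x using b[of "{x}"] that by simp
  hence "ex C" using a by (simp add: ex_def)
  thus "\<exists>C. ex C" by blast
 qed
 then obtain C where "ex C" by blast
 hence C: "!!n. compact (C n)" "!!n. C n \<subseteq> Om" "!!x. x \<in> Om ==> \<exists>N. \<forall>n\<ge>N. x \<in> C n" unfolding ex_def by blast+
 show ?thesis
 proof (rule borel_measurable_LIMSEQ_metric[where f="%n x. indicator (C n) x *r u x"])
  show "(%x. indicator (C n) x *r u x) \<in> borel_measurable lebesgue" for n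
  proof (rule Bm_int)
   have "set_integrable lebesgue (C n) u" using l C(1,2)[of n] by (simp add: locally_integrable_def)
   thus "integrable lebesgue (%x. indicator (C n) x *r u x)" by (simp only: set_integrable_def)
  qed
  show "(%n. indicator (C n) x *r u x) \<longlonglongrightarrow> indicator Om x *r u x" for x
  proof (cases "x \<in> Om")
   case True
   then obtain N where "\<forall>n\<ge>N. x \<in> C n" using C(3) by blast
   hence "eventually (%n. indicator (C n) x *r u x = indicator Om x *r u x) sequentially"
    using True by (auto simp: eventually_sequentially indicator_def intro!: exI[of _ N])
   thus ?thesis by (rule tendsto_eventually)
  next
   case False
   have "indicator (C n) x = (0::real)" for n using False C(2)[of n] by (auto simp: indicator_def)
   thus ?thesis using False by simp
  qed
 qed
qed

lemma wgrad_of_weak_grad: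
 assumes w: "has_weak_grad Om u G" and Om: "open Om" and v: "borel_version Om u u'" "borel_version Om G G'" and i: "lint u'" "lint G'"
 shows "wgrad Om u' G'"
proof (rule wgrad_of_test[OF Om i])
 fix psi assume t: "test_function Om psi"
 note C = C1c_C1[OF test_function_C1c[OF t]]
 note [measurable] = C1_borel[OF C] C1_borel_grad[OF C] borel_versionD(1)[OF v(1)] borel_versionD(1)[OF v(2)]
 have v1: "borel_version Om (%x. u x *r grad psi x) (%x. u' x *r grad psi x)" and v2: "borel_version Om (%x. psi x *r G x) (%x. psi x *r G' x)"
  by (rule borel_version_map[OF v(1)] borel_version_map[OF v(2)]; simp)+
 have "(LINT x|lebesgue_on Om. u x *r grad psi x) = - (LINT x|lebesgue_on Om. psi x *r G x)" using w t unfolding has_weak_grad_def by blast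
 thus "(LBINT x. u' x *r grad psi x) = - (LBINT x. psi x *r G' x)" unfolding borel_version_lebesgue(1)[OF v1 Om] borel_version_lebesgue(1)[OF v2 Om] .
qed

lemma wdiv_of_weak_div:
 assumes w: "has_weak_div Om F f" and Om: "open Om" and v: "borel_version Om F F'" "borel_version Om f f'" and i: "lint F'" "lint f'"
 shows "wdiv Om F' f'"
proof (rule wdiv_of_test[OF Om i])
 fix psi assume t: "test_function Om psi"
 note C = C1c_C1[OF test_function_C1c[OF t]]
 note [measurable] = C1_borel[OF C] C1_borel_grad[OF C] borel_versionD(1)[OF v(1)] borel_versionD(1)[OF v(2)]
 have v1: "borel_version Om (%x. F x *i grad psi x) (%x. F' x *i grad psi x)" and v2: "borel_version Om (%x. f x * psi x) (%x. f' x * psi x)"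
  by (rule borel_version_map[OF v(1)] borel_version_map[OF v(2)]; simp)+
 have "(LINT x|lebesgue_on Om. F x *i grad psi x) = - (LINT x|lebesgue_on Om. f x * psi x)" using w t unfolding has_weak_div_def by blast
 thus "(LBINT x. F' x *i grad psi x) = - (LBINT x. f' x * psi x)" unfolding borel_version_lebesgue(1)[OF v1 Om] borel_version_lebesgue(1)[OF v2 Om] .
qed

lemma borel_version_restrict:
 fixes h :: "real^3 => 'b::{banach,second_countable_topology}"
 assumes "h \<in> Bm" "open Om" shows "borel_version Om h (%x. indicator Om x *r h x)"
proof -
 have [measurable]: "Om \<in> sets borel" "h \<in> Bm" using assms by simp_all
 have "(%x. indicator Om x *r h x) \<in> Bm" by measurable
 thus ?thesis by (simp add: borel_version_def)
qed

text \<open>Makes C1 functions that need not vanish at the boundary admissible in the adjoint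
  problem, so that the natural boundary condition becomes available for them.\<close>

lemma C1c_H1:
 assumes V: "C1c UNIV V DV" and Om: "open Om" shows "H1_with_grad Om V DV"
proof -
 note C = C1c_C1[OF V]
 note m[measurable] = C1_borel[OF C] C1_borel_grad[OF C]
 obtain B where B: "B > 0" "!!x. \<bar>V x\<bar> <= B" "!!x. norm (DV x) <= B" by (rule C1c_bounded[OF V]) (rule that)
 note i = C1c_integrable[OF V]
 have loc: "locally_integrable Om h" if "lint h" for h :: "real^3 => 'b::{banach,second_countable_topology}"
  unfolding locally_integrable_def set_integrable_def
 proof (intro allI impI)
  fix Q assume Q: "compact Q & Q \<subseteq> Om"
  have "lint (%x. indicator Q x *r h x)" by (rule integrable_mult_indicator[OF _ that]) (use Q in \<open>simp add: borel_compact\<close>)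
  thus "integrable lebesgue (%x. indicator Q x *r h x)" using integrable_completion[OF Bm_int] by blast
 qed
 have wk: "(LINT x|lebesgue_on Om. V x *r grad psi x) = - (LINT x|lebesgue_on Om. psi x *r DV x)" if t: "test_function Om psi" for psi
 proof -
  note T = test_function_C1c[OF t]
  note [measurable] = C1_borel[OF C1c_C1[OF T]] C1_borel_grad[OF C1c_C1[OF T]]
  have e1: "indicator Om x *r (V x *r grad psi x) = V x *r grad psi x" and e2: "indicator Om x *r (psi x *r DV x) = psi x *r DV x" for x
   using C1c_zero[OF T, of x] by (cases "x \<in> Om"; simp)+
  have "(LINT x|lebesgue_on Om. V x *r grad psi x) = (LBINT x. V x *r grad psi x)"
   using borel_version_lebesgue(1)[OF borel_version_restrict[OF _ Om] Om, of "%x. V x *r grad psi x"] unfolding e1 by simp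
  moreover have "(LINT x|lebesgue_on Om. psi x *r DV x) = (LBINT x. psi x *r DV x)"
   using borel_version_lebesgue(1)[OF borel_version_restrict[OF _ Om] Om, of "%x. psi x *r DV x"] unfolding e2 by simp
  moreover have "(LBINT x. V x *r grad psi x) + (LBINT x. psi x *r DV x) = 0"
   using C1_ibp[OF C T] integral_plus[OF C1c_int_scaleR(1)[OF T i(1)] C1c_int_scaleR(2)[OF T i(2)]] by simp
  ultimately show ?thesis by (simp add: eq_neg_iff_add_eq_0)
 qed
 have sq: "square_integrable_on Om h" if h: "h \<in> Bm" "lint h" "!!x. norm (h x) <= B" for h :: "real^3 => 'b::{banach,second_countable_topology}"
 proof -
  note [measurable] = h(1)
  have "lint (%x. norm (h x) *r norm (h x))" by (rule int_scaleR_bounded[OF integrable_norm[OF h(2)] _]) (use h(3) in auto)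
  hence i: "lint (%x. (norm (h x))^2)" by (simp add: power2_eq_square)
  have "lint (%x. indicator Om x *r (norm (h x))^2)" by (rule integrable_mult_indicator[OF _ i]) (use Om in simp)
  hence "integrable (lebesgue_on Om) (%x. (norm (h x))^2)"
   using borel_version_lebesgue(2)[OF borel_version_restrict[OF _ Om] Om, of "%x. (norm (h x))^2"] by simp
  moreover have "h \<in> borel_measurable (lebesgue_on Om)" by (rule borel_version_lebesgue(3)[OF borel_version_restrict[OF h(1) Om] Om])
  ultimately show ?thesis by (simp add: square_integrable_on_def)
 qed
 show ?thesis unfolding H1_with_grad_def has_weak_grad_def using loc[OF i(1)] loc[OF i(2)] wk sq[OF m(1) i(1)] sq[OF m(2) i(2) B(3)] B(2) by simp
qed

lemma weak_grad_version:
 assumes "has_weak_grad Om u G" "open Om"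
 obtains u' G' where "borel_version Om u u'" "borel_version Om G G'"
proof -
 have "\<exists>u'. borel_version Om u u'" "\<exists>G'. borel_version Om G G'"
  by (rule borel_version_ex_real borel_version_ex_vec, rule locally_integrable_measurable; use assms in \<open>simp add: has_weak_grad_def\<close>)+
 thus ?thesis using that by blast
qed

section \<open>From the norms in the statement to bounds on representatives\<close>

lemma AE_lebesgue_on:
 assumes "open (Om :: (real^3) set)" shows "(AE x in lebesgue_on Om. P x) \<longleftrightarrow> (AE x in lborel. x \<in> Om --> P x)"
 using AE_restrict_space_iff[of Om lebesgue P] AE_completion_iff[of "%x. x \<in> Om --> P x" lborel] assms by simp

lemma Linf_gradient:
 fixes G :: "real^3 => real^3"
 assumes "(\<Sum>i\<in>UNIV. Linf_norm Om (%x. G x $ i)) <= ennreal Lam" "0 <= Lam" "open Om" shows "AE x in lborel. x \<in> Om --> norm (G x) <= Lam"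
proof -
 have "AE x in lebesgue_on Om. \<forall>i\<in>UNIV. ennreal \<bar>G x $ i\<bar> <= Linf_norm Om (%x. G x $ i)"
  unfolding Linf_norm_def by (rule AE_finite_allI) (use esssup_AE in auto)
 hence "AE x in lebesgue_on Om. norm (G x) <= Lam"
 proof eventually_elim
  case (elim x)
  have "ennreal (\<Sum>i\<in>UNIV. \<bar>G x $ i\<bar>) = (\<Sum>i\<in>UNIV. ennreal \<bar>G x $ i\<bar>)" by (rule sum_ennreal[symmetric]) simp
  also have "... <= (\<Sum>i\<in>UNIV. Linf_norm Om (%x. G x $ i))" by (rule sum_mono) (use elim in blast)
  also have "... <= ennreal Lam" by (rule assms(1))
  finally have "(\<Sum>i\<in>UNIV. \<bar>G x $ i\<bar>) <= Lam" using assms(2) by (simp add: ennreal_le_iff)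
  thus "norm (G x) <= Lam" using norm_le_l1_cart[of "G x"] by linarith
 qed
 thus ?thesis unfolding AE_lebesgue_on[OF assms(3)] .
qed

lemma holder_norm_bounds:
 assumes "holder_norm S al g <= ennreal M" "0 <= M" "x \<in> S"
 shows "\<bar>g x\<bar> <= M" "y \<in> S ==> \<bar>g x - g y\<bar> <= M * dist x y powr al"
proof -
 let ?A = "SUP x\<in>S. ennreal \<bar>g x\<bar>" and ?B = "SUP (x, y)\<in>{(x, y). x \<in> S & y \<in> S & x ~= y}. ennreal (\<bar>g x - g y\<bar> / dist x y powr al)"
 have AB: "?A + ?B <= ennreal M" using assms(1) unfolding holder_norm_def .
 have "ennreal \<bar>g x\<bar> <= ?A" by (rule SUP_upper[OF assms(3)])
 also have "?A <= ?A + ?B" by simp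
 also note AB
 finally show "\<bar>g x\<bar> <= M" using assms(2) by (simp add: ennreal_le_iff)
 assume y: "y \<in> S"
 show "\<bar>g x - g y\<bar> <= M * dist x y powr al"
 proof (cases "x = y")
  case False
  have "(case (x, y) of (x, y) => ennreal (\<bar>g x - g y\<bar> / dist x y powr al)) <= ?B" by (rule SUP_upper) (use False assms(3) y in simp)
  hence "ennreal (\<bar>g x - g y\<bar> / dist x y powr al) <= ?B" by simp
  also have "?B <= ?A + ?B" by simp
  also note AB
  finally have "\<bar>g x - g y\<bar> / dist x y powr al <= M" using assms(2) by (simp add: ennreal_le_iff)
  thus ?thesis using False by (simp add: divide_le_eq)
 qed (use assms(2) in simp)
qed

text \<open>Hoelder's inequality in pointwise form: \<open>|f|\<close> is at most a level
  \<open>X\<close> plus \<open>X powr (1 - q)\<close> times \<open>|f| powr q\<close>. With the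
  right level both terms integrate to order \<open>M * t powr (2 + al)\<close> over the ball; this
  is the purpose of the exponent \<open>q\<close>.\<close>

lemma Lq_morrey:
 fixes f :: "real^3 => real"
 assumes q: "q = 3 / (1 - al)" and al: "0 < al" "al < 1" and M: "M > 0" and f: "lint f" "lint (%x. \<bar>f x\<bar> powr q)"
  and I: "(LBINT x. \<bar>f x\<bar> powr q) <= M powr q" and t: "t > 0"
 shows "(LBINT x. indicator (cball y t) x * \<bar>f x\<bar>) <= 16 * M * t powr (2 + al)"
proof -
 have q1: "q > 1" using q al by (simp add: less_divide_eq)
 \<comment> \<open>The level balances the two terms: \<open>X * t ^ 3\<close> and
   \<open>X powr (1 - q) * M powr q\<close> both scale like
   \<open>M * t powr (2 + al)\<close>.\<close>
 define X where "X = M * t powr (- (1 - al))"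
 have X: "X > 0" using M t by (simp add: X_def)
 have pt: "\<bar>f x\<bar> <= X + X powr (1 - q) * \<bar>f x\<bar> powr q" for x
 proof (cases "\<bar>f x\<bar> <= X")
  case True thus ?thesis by (simp add: add_increasing2)
 next
  case False
  have "\<bar>f x\<bar> = \<bar>f x\<bar> powr (1 - q) * \<bar>f x\<bar> powr q" using False X by (simp add: powr_add[symmetric])
  also have "... <= X powr (1 - q) * \<bar>f x\<bar> powr q" using False X q1 by (intro mult_right_mono powr_mono2') auto
  finally show ?thesis using X by simp
 qed
 note vol = cball_volume[OF less_imp_le[OF t], of y]
 have "(LBINT x. indicator (cball y t) x * \<bar>f x\<bar>) <= (LBINT x. X * indicator (cball y t) x + X powr (1 - q) * \<bar>f x\<bar> powr q)"
 proof (rule integral_mono')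
  show "lint (%x. X * indicator (cball y t) x + X powr (1 - q) * \<bar>f x\<bar> powr q)" by (intro int_add integrable_mult_right vol f)
  fix x show "indicator (cball y t) x * \<bar>f x\<bar> <= X * indicator (cball y t) x + X powr (1 - q) * \<bar>f x\<bar> powr q"
   using pt[of x] by (auto simp: indicator_def)
  show "0 <= X * indicator (cball y t) x + X powr (1 - q) * \<bar>f x\<bar> powr q" using X by simp
 qed
 also have "... = X * (LBINT x. indicator (cball y t) x) + X powr (1 - q) * (LBINT x. \<bar>f x\<bar> powr q)"
  by (subst integral_plus) (use vol f in \<open>auto intro!: integrable_mult_right\<close>)
 also have "... <= X * (8 * t ^ 3) + X powr (1 - q) * (M powr q)" using vol(2) I X by (intro add_mono mult_left_mono) auto
 also have "X powr (1 - q) * (M powr q) = M * t powr (2 + al)"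
 proof -
  have "X powr (1 - q) = M powr (1 - q) * t powr (- (1 - al) * (1 - q))" using M t by (simp add: X_def powr_mult powr_powr)
  moreover have "M powr (1 - q) * M powr q = M" using M by (simp add: powr_add[symmetric])
  moreover have "- (1 - al) * (1 - q) = 2 + al" using al by (simp add: q field_simps)
  ultimately show ?thesis by (simp add: mult_ac)
 qed
 also have "X * (8 * t ^ 3) = 8 * (M * t powr (2 + al))"
 proof -
  have t3: "t ^ 3 = t powr 3" using t by (simp add: powr_numeral)
  have "t powr (- (1 - al)) * t ^ 3 = t powr (- (1 - al) + 3)" by (simp only: t3 powr_add)
  also have "- (1 - al) + 3 = 2 + al" by simp
  finally show ?thesis unfolding X_def by (simp only: mult_ac)
 qed
 finally have le: "(LBINT x. indicator (cball y t) x * \<bar>f x\<bar>) <= 9 * (M * t powr (2 + al))" by simp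
 have "9 * (M * t powr (2 + al)) <= 16 * (M * t powr (2 + al))" using M by (intro mult_right_mono) auto
 thus ?thesis using le by (simp only: mult.assoc)
qed

lemma Lp_norm_integral:
 assumes "Lp_norm Om q f <= ennreal M" "M > 0" "q > 0"
 shows "f \<in> borel_measurable (lebesgue_on Om)" "integrable (lebesgue_on Om) (%x. \<bar>f x\<bar> powr q)" "(LINT x|lebesgue_on Om. \<bar>f x\<bar> powr q) <= M powr q"
proof -
 let ?I = "\<integral>\<^sup>+x. ennreal (\<bar>f x\<bar> powr q) \<partial>lebesgue_on Om"
 have c: "f \<in> borel_measurable (lebesgue_on Om)" "?I < \<infinity>"
  using assms(1) unfolding Lp_norm_def by (auto split: if_splits simp: top_unique)
 thus "f \<in> borel_measurable (lebesgue_on Om)" by simp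
 note [measurable] = c(1)
 show i: "integrable (lebesgue_on Om) (%x. \<bar>f x\<bar> powr q)" by (rule integrableI_nonneg) (use c(2) in auto)
 have e: "(LINT x|lebesgue_on Om. \<bar>f x\<bar> powr q) = enn2real ?I" by (rule integral_eq_nn_integral) auto
 have "ennreal (enn2real ?I powr (1 / q)) <= ennreal M" using assms(1) c unfolding Lp_norm_def by simp
 hence "enn2real ?I powr (1 / q) <= M" using assms(2) by (simp add: ennreal_le_iff)
 hence "(enn2real ?I powr (1 / q)) powr q <= M powr q" using assms(3) by (intro powr_mono2) auto
 thus "(LINT x|lebesgue_on Om. \<bar>f x\<bar> powr q) <= M powr q" unfolding e using assms(3) by (simp add: powr_powr)
qed

lemma square_integrable_version:
 fixes h :: "real^3 => 'b::{banach,second_countable_topology}"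
 assumes s: "square_integrable_on Om h" and v: "borel_version Om h h'" and Om: "open Om" "bounded Om" shows "lint (%x. (norm (h' x))^2)" "lint h'"
proof -
 note D = borel_versionD[OF v]
 have v2: "borel_version Om (%x. (norm (h x))^2) (%x. (norm (h' x))^2)" by (rule borel_version_map[OF v]) (use D(1) in simp_all)
 show i: "lint (%x. (norm (h' x))^2)" using s borel_version_lebesgue(2)[OF v2 Om(1)] unfolding square_integrable_on_def by blast
 have io: "lint (indicator Om :: _ => real)" by (rule integrable_real_indicator) (use Om emeasure_bounded_finite[OF Om(2)] in auto)
 show "lint h'"
 proof (rule int_bound[OF int_add[OF io i]], use D(1) in simp, rule AE_I2)
  fix x
  show "norm (h' x) <= norm (indicator Om x + (norm (h' x))^2)"
  proof (cases "x \<in> Om")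
   case True
   have "0 <= (norm (h' x) - 1 / 2)^2" by simp
   hence "norm (h' x) <= 1 + (norm (h' x))^2" by (simp add: power2_eq_square algebra_simps)
   thus ?thesis using True by simp
  qed (use D(3) in simp)
 qed
qed

text \<open>Chooses Borel representatives for which the almost everywhere bounds hold at every
  point, and converts the Lebesgue integrals of the weak formulations. The gradient is changed only
  on a null set of the domain, so bounds for \<open>G\<close> carry over to
  \<open>Gw\<close>.\<close>

lemma coil_data_exists:
 assumes Om: "open Om" "bounded Om" and al: "0 < al" "al < 1" and q: "q = 3 / (1 - al)" and lam: "0 < lam" "lam < 1" and Lam: "1 < Lam"
  and C: "continuous_on (closure Om) C" and sg: "sg \<in> Sigma_class Om lam Lam" and sol: "adjoint_solution Om sg C w Gw"
  and div: "has_weak_div Om (%x. sg x *r C x) f" and M: "M > 0"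
  and bd: "Lp_norm Om q f + holder_norm (frontier Om) al (%x. C x *i outer_normal Om x) <= ennreal M"
  and r: "0 < r" "r <= 1" and K: "1 <= K" and frames: "!!p. p \<in> frontier Om ==> \<exists>n e s gs. gframe Om al r K p n e s gs"
 shows "\<exists>sg' f' w' g' F G. coil_data Om al lam Lam M r K sg' f' w' g' F G & (AE x in lborel. x \<in> Om --> Gw x = G x)"
proof -
 have [measurable]: "Om \<in> sets borel" using Om(1) by simp
 have io: "lint (indicator Om :: _ => real)" by (rule integrable_real_indicator) (use Om emeasure_bounded_finite[OF Om(2)] in auto)
 have bdd_int: "lint h" if h: "h \<in> Bm" "!!x. x \<notin> Om ==> h x = 0" "!!x. norm (h x) <= B" for h :: "real^3 => 'c::{banach,second_countable_topology}" and B
 proof (rule int_bound[OF integrable_mult_right[OF io, of B]], use h(1) in simp, rule AE_I2)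
  fix x show "norm (h x) <= norm (B * indicator Om x)" using h(2)[of x] h(3)[of x] by (cases "x \<in> Om") auto
 qed
 obtain gg where gg: "has_weak_grad Om sg gg" "Linf_norm Om sg + (\<Sum>i\<in>UNIV. Linf_norm Om (%x. gg x $ i)) <= ennreal Lam"
  and sAE: "AE x in lebesgue_on Om. lam <= sg x & sg x <= inverse lam" using sg unfolding Sigma_class_def by blast
 have sAE': "AE x in lborel. x \<in> Om --> lam <= sg x & sg x <= 1 / lam"
  using sAE unfolding AE_lebesgue_on[OF Om(1)] by (simp add: inverse_eq_divide)
 have "(\<Sum>i\<in>UNIV. Linf_norm Om (%x. gg x $ i)) <= ennreal Lam" using gg(2) by (rule order_trans[rotated]) simp
 hence gAE: "AE x in lborel. x \<in> Om --> norm (gg x) <= Lam" by (rule Linf_gradient) (use Lam Om in auto)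
 obtain s0 g0 where s0: "borel_version Om sg s0" and g0: "borel_version Om gg g0" by (rule weak_grad_version[OF gg(1) Om(1)])
 \<comment> \<open>Clamping to the admissible interval, and setting the gradient to zero where it
   exceeds \<open>Lam\<close>, changes the representatives only on null sets of the domain but makes
   the bounds valid everywhere there.\<close>
 define s1 where "s1 x = indicator Om x * max lam (min (1 / lam) (s0 x))" for x
 define g1 where "g1 x = (if norm (g0 x) <= Lam then g0 x else 0)" for x
 have ll: "lam <= 1 / lam" using lam mult_mono[of lam 1 lam 1] by (simp add: le_divide_eq)
 have s1: "borel_version Om sg s1"
 proof (rule borel_versionI)
  have [measurable]: "s0 \<in> Bm" by (rule borel_versionD(1)[OF s0])
  show "s1 \<in> Bm" unfolding s1_def[abs_def] by measurable
  show "AE x in lborel. x \<in> Om --> sg x = s1 x" using sAE' borel_versionD(2)[OF s0] by eventually_elim (auto simp: s1_def)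
 qed (simp add: s1_def)
 have g1: "borel_version Om gg g1"
 proof (rule borel_versionI)
  have [measurable]: "g0 \<in> Bm" by (rule borel_versionD(1)[OF g0])
  show "g1 \<in> Bm" unfolding g1_def[abs_def] by measurable
  show "AE x in lborel. x \<in> Om --> gg x = g1 x" using gAE borel_versionD(2)[OF g0] by eventually_elim (auto simp: g1_def)
 qed (use borel_versionD(3)[OF g0] in \<open>simp add: g1_def\<close>)
 have s1b: "lam <= s1 x" "s1 x <= 1 / lam" if "x \<in> Om" for x using that ll by (simp_all add: s1_def)
 have s1n: "norm (s1 x) <= 1 / lam" for x using s1b[of x] lam by (cases "x \<in> Om") (auto simp: s1_def)
 have g1n: "norm (g1 x) <= Lam" for x using Lam by (simp add: g1_def)
 note s1D = borel_versionD[OF s1] and g1D = borel_versionD[OF g1]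
 have is1: "lint s1" by (rule bdd_int[OF s1D(1,3) s1n])
 have ig1: "lint g1" by (rule bdd_int[OF g1D(1,3) g1n])
 have w1: "wgrad Om s1 g1" by (rule wgrad_of_weak_grad[OF gg(1) Om(1) s1 g1 is1 ig1])
 \<comment> \<open>The cut is made at the closure: boundary values are kept for the normal flux,
   while the field becomes Borel on the whole space.\<close>
 define F where "F x = indicator (closure Om) x *r C x" for x
 have FC: "F x = C x" if "x \<in> closure Om" for x using that by (simp add: F_def)
 have FC': "F x = C x" if "x \<in> Om" for x using that closure_subset FC by blast
 have Fm[measurable]: "F \<in> Bm" unfolding F_def[abs_def] by (rule borel_measurable_continuous_on_indicator[OF _ C]) simp
 have Fc: "continuous_on (closure Om) F" using C by (rule continuous_on_eq) (simp add: FC)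
 obtain A where A: "A > 0" "!!x. x \<in> Om ==> norm (F x) <= A"
 proof -
  have "compact (F ` closure Om)" by (rule compact_continuous_image[OF Fc]) (use Om(2) in simp)
  then obtain A where A: "A > 0" "\<forall>x\<in>F ` closure Om. norm x <= A" using compact_imp_bounded bounded_pos by blast
  have "norm (F x) <= A" if "x \<in> Om" for x using A(2) that closure_subset by blast
  thus ?thesis by (rule that[OF A(1)])
 qed
 have [measurable]: "s1 \<in> Bm" by (rule s1D(1))
 have sF: "norm (s1 x *r F x) <= (1 / lam) * A" for x
 proof (cases "x \<in> Om")
  case True
  show ?thesis unfolding norm_scaleR using s1n[of x] by (intro mult_mono A(2)[OF True]) (use lam in auto)
 qed (use s1D(3) A lam in simp)
 have isF: "lint (%x. s1 x *r F x)" by (rule bdd_int[OF _ _ sF]) (use s1D(3) in auto)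
 have vF: "borel_version Om (%x. sg x *r C x) (%x. s1 x *r F x)"
 proof (rule borel_versionI)
  show "AE x in lborel. x \<in> Om --> sg x *r C x = s1 x *r F x" using s1D(2) by eventually_elim (auto simp: FC')
 qed (use s1D(3) in auto)
 have q1: "q > 1" using q al by (simp add: less_divide_eq)
 have Lp: "Lp_norm Om q f <= ennreal M" using bd by (rule order_trans[rotated]) simp
 have Ho: "holder_norm (frontier Om) al (%x. C x *i outer_normal Om x) <= ennreal M" using bd by (rule order_trans[rotated]) simp
 have "\<exists>f1. borel_version Om f f1"
  by (rule borel_version_ex_real[OF locally_integrable_measurable Om(1)]) (use div Om(1) in \<open>simp_all add: has_weak_div_def\<close>)
 then obtain f1 where f1: "borel_version Om f f1" by (rule exE)
 note f1D = borel_versionD[OF f1]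
 have vfq: "borel_version Om (%x. \<bar>f x\<bar> powr q) (%x. \<bar>f1 x\<bar> powr q)" by (rule borel_version_map[OF f1]) (use f1D(1) in simp_all)
 have q0: "q > 0" using q1 by simp
 have ifq: "lint (%x. \<bar>f1 x\<bar> powr q)" using Lp_norm_integral(2)[OF Lp M q0] borel_version_lebesgue(2)[OF vfq Om(1)] by simp
 have Ifq: "(LBINT x. \<bar>f1 x\<bar> powr q) <= M powr q" using Lp_norm_integral(3)[OF Lp M q0] borel_version_lebesgue(1)[OF vfq Om(1)] by simp
 have if1: "lint f1"
 proof (rule int_bound[OF int_add[OF io ifq]], use f1D(1) in simp, rule AE_I2)
  fix x
  have "\<bar>f1 x\<bar> <= 1 + \<bar>f1 x\<bar> powr q"
  proof (cases "\<bar>f1 x\<bar> <= 1")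
   case True thus ?thesis by (simp add: add_increasing2)
  next
   case False
   have "\<bar>f1 x\<bar> powr 1 <= \<bar>f1 x\<bar> powr q" using False q1 by (intro powr_mono) auto
   thus ?thesis using False by simp
  qed
  thus "norm (f1 x) <= norm (indicator Om x + \<bar>f1 x\<bar> powr q)" using f1D(3)[of x] by (cases "x \<in> Om") auto
 qed
 have w2: "wdiv Om (%x. s1 x *r F x) f1" by (rule wdiv_of_weak_div[OF div Om(1) vF f1 isF if1])
 have fr: "frontier Om \<subseteq> closure Om" by (simp add: frontier_def)
 have h: "\<bar>F x *i outer_normal Om x\<bar> <= M" "y \<in> frontier Om ==> \<bar>F x *i outer_normal Om x - F y *i outer_normal Om y\<bar> <= M * dist x y powr al"
  if "x \<in> frontier Om" for x y using holder_norm_bounds[OF Ho less_imp_le[OF M] that] fr that FC by (auto simp: subset_iff)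
 have pd: "pdata Om al lam Lam s1 g1 F f1 M" unfolding pdata_def
  using w1 s1D(3) s1b g1n Fc Fm w2 f1D(3) Lq_morrey[OF q al M if1 ifq Ifq] h M by (intro conjI allI ballI impI) simp_all
 have H1: "H1_with_grad Om w Gw" using sol unfolding adjoint_solution_def by (rule conjunct1)
 have eq: "(LINT x|lebesgue_on Om. sg x * (Gw x *i J x)) = (LINT x|lebesgue_on Om. sg x * (C x *i J x))" if "H1_with_grad Om ph J" for ph J
  using spec[OF spec[OF conjunct2[OF sol[unfolded adjoint_solution_def]]], of ph J] that by (rule mp)
 have wk: "has_weak_grad Om w Gw" and sqw: "square_integrable_on Om w" and sqG: "square_integrable_on Om Gw"
  using H1 by (simp_all add: H1_with_grad_def)
 obtain w1 G where w1v: "borel_version Om w w1" and G: "borel_version Om Gw G" by (rule weak_grad_version[OF wk Om(1)])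
 note GD = borel_versionD[OF G]
 have [measurable]: "G \<in> Bm" by (rule GD(1))
 have wG: "wgrad Om w1 G"
  by (rule wgrad_of_weak_grad[OF wk Om(1) w1v G square_integrable_version(2)[OF sqw w1v Om] square_integrable_version(2)[OF sqG G Om]])
 \<comment> \<open>Formulated for any admissible pair with a Borel version of its gradient, since it
   is used twice: for C1 test functions and for the solution itself, which yields the energy
   identity.\<close>
 have eq': "(LBINT x. s1 x * (G x *i J' x)) = (LBINT x. s1 x * (F x *i J' x))"
  if [measurable]: "J' \<in> Bm" and "AE x in lborel. x \<in> Om --> J x = J' x" "H1_with_grad Om ph J" for ph J J'
 proof -
  have v1: "borel_version Om (%x. sg x * (Gw x *i J x)) (%x. s1 x * (G x *i J' x))"
  proof (rule borel_versionI)
   show "AE x in lborel. x \<in> Om --> sg x * (Gw x *i J x) = s1 x * (G x *i J' x)" using s1D(2) GD(2) that(2) by eventually_elim auto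
  qed (use s1D(3) in auto)
  have v2: "borel_version Om (%x. sg x * (C x *i J x)) (%x. s1 x * (F x *i J' x))"
  proof (rule borel_versionI)
   show "AE x in lborel. x \<in> Om --> sg x * (C x *i J x) = s1 x * (F x *i J' x)" using s1D(2) that(2) by eventually_elim (auto simp: FC')
  qed (use s1D(3) in auto)
  show ?thesis using eq[OF that(3)] unfolding borel_version_lebesgue(1)[OF v1 Om(1)] borel_version_lebesgue(1)[OF v2 Om(1)] .
 qed
 have ps: "psol Om s1 F w1 G" unfolding psol_def
 proof (intro conjI allI impI)
  show "wgrad Om w1 G" by (rule wG)
  show "G x = 0" if "x \<notin> Om" for x by (rule GD(3)[OF that])
  show "(LBINT x. s1 x * (G x *i DV x)) = (LBINT x. s1 x * (F x *i DV x))" if V: "C1c UNIV V DV" for V DV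
   by (rule eq'[OF C1_borel_grad[OF C1c_C1[OF V]] _ C1c_H1[OF V Om(1)]]) simp
  show "lint (%x. (norm (G x))^2)" by (rule square_integrable_version(1)[OF sqG G Om])
  show "(LBINT x. s1 x * (G x *i G x)) = (LBINT x. s1 x * (F x *i G x))" by (rule eq'[OF GD(1,2) H1])
 qed
 have "coil_data Om al lam Lam M r K s1 f1 w1 g1 F G" by (rule coil_data.intro[OF pd ps Om al lam(1) r K frames])
 thus ?thesis using GD(2) by blast
qed

theorem theorem4p9:
  fixes \<Omega> :: "(real^3) set" and \<alpha> q lam Lam :: real
  assumes "open \<Omega>" and "connected \<Omega>" and "\<Omega> \<noteq> {}" and "bounded \<Omega>"
    and "simply_connected \<Omega>" and "connected (frontier \<Omega>)"
    and "0 < \<alpha>" and "\<alpha> < 1" and "C1_holder_boundary \<Omega> \<alpha>"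
    and "q = 3 / (1 - \<alpha>)"
    and "0 < lam" and "lam < 1" and "1 < Lam"
  shows "\<exists>C1::real. C1 > 0 \<and>
    (\<forall>\<mu> \<gamma> D n \<sigma> c \<Omega>' w Gw f.
       0 < \<mu> \<longrightarrow>
       simple_path \<gamma> \<and> pathfinish \<gamma> = pathstart \<gamma> \<and> path_image \<gamma> \<inter> closure \<Omega> = {} \<longrightarrow>
       compact_oriented_surface D \<gamma> n \<and> D \<inter> closure \<Omega> = {} \<longrightarrow>
       \<sigma> \<in> Sigma_class \<Omega> lam Lam \<longrightarrow>
       0 < c \<longrightarrow>
       open \<Omega>' \<and> connected \<Omega>' \<and> \<Omega>' \<noteq> {} \<and> \<Omega>' \<subseteq> \<Omega> \<longrightarrow>
       (\<forall>x\<in>\<Omega>'. c \<le> norm (coil_field \<mu> D n x)) \<longrightarrow>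
       adjoint_solution \<Omega> \<sigma> (coil_field \<mu> D n) w Gw \<longrightarrow>
       has_weak_div \<Omega> (\<lambda>x. \<sigma> x *\<^sub>R coil_field \<mu> D n x) f \<longrightarrow>
       Lp_norm \<Omega> q f
         + holder_norm (frontier \<Omega>) \<alpha> (\<lambda>x. coil_field \<mu> D n x \<bullet> outer_normal \<Omega> x)
         \<le> ennreal (c / (2 * C1)) \<longrightarrow>
       (AE x in lebesgue_on \<Omega>'.
          lam * c / 2 \<le> norm (\<sigma> x *\<^sub>R (coil_field \<mu> D n x - Gw x))))"
proof -
 obtain r0 K where r0: "r0 > 0" "K >= 1" "!!p. p \<in> frontier \<Omega> ==> \<exists>n e s gs. gframe \<Omega> \<alpha> r0 K p n e s gs"
  using uniform_frames[OF assms(1,4,7,9)] by blast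
 define r where "r = min r0 1"
 have r: "0 < r" "r <= 1" "r <= r0" using r0(1) by (simp_all add: r_def)
 have frames: "\<exists>n e s gs. gframe \<Omega> \<alpha> r K p n e s gs" if "p \<in> frontier \<Omega>" for p
  using r0(3)[OF that] gframe_mono[OF _ r(3) order_refl] r0(2) by fastforce
 have Lam0: "0 <= Lam" using assms(13) by simp
 \<comment> \<open>The constant is fixed here, before the coil, the coefficient and
   \<open>c\<close>. It depends on the domain and \<open>\<alpha>\<close>, also through
   \<open>r\<close> and \<open>K\<close>, and on \<open>lam\<close> and \<open>Lam\<close>.\<close>
 obtain C where C: "C > 0" and bound: "\<forall>M \<sigma> f w g\<sigma> F G. coil_data \<Omega> \<alpha> lam Lam M r K \<sigma> f w g\<sigma> F G --> (AE x in lborel. norm (G x) <= C * M)"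
  using gradient_bound[OF assms(1,4,2,3,11) Lam0 r0(2) r(1) assms(7)] by (elim exE conjE) (rule that)
 show ?thesis
 proof (rule exI[of _ C], intro conjI C allI impI)
  fix \<mu> \<gamma> D n \<sigma> c \<Omega>' w Gw f
  assume surf: "compact_oriented_surface D \<gamma> n & D \<inter> closure \<Omega> = {}" and \<sigma>: "\<sigma> \<in> Sigma_class \<Omega> lam Lam" and c: "0 < c"
   and \<Omega>': "open \<Omega>' & connected \<Omega>' & \<Omega>' ~= {} & \<Omega>' \<subseteq> \<Omega>" and low: "\<forall>x\<in>\<Omega>'. c <= norm (coil_field \<mu> D n x)"
   and sol: "adjoint_solution \<Omega> \<sigma> (coil_field \<mu> D n) w Gw" and div: "has_weak_div \<Omega> (%x. \<sigma> x *r coil_field \<mu> D n x) f"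
   and bd: "Lp_norm \<Omega> q f + holder_norm (frontier \<Omega>) \<alpha> (%x. coil_field \<mu> D n x *i outer_normal \<Omega> x) <= ennreal (c / (2 * C))"
  have cont: "continuous_on (closure \<Omega>) (coil_field \<mu> D n)" by (rule coil_field_continuous[OF conjunct1[OF surf] assms(4) conjunct2[OF surf]])
  have M: "c / (2 * C) > 0" using c C by simp
  have "\<exists>\<sigma>' f' w' g' F G. coil_data \<Omega> \<alpha> lam Lam (c / (2 * C)) r K \<sigma>' f' w' g' F G & (AE x in lborel. x \<in> \<Omega> --> Gw x = G x)"
   by (rule coil_data_exists[OF assms(1,4,7,8,10-13) cont \<sigma> sol div M bd r(1,2) r0(2)]) (rule frames)
  then obtain \<sigma>' f' w' g' F G where cd: "coil_data \<Omega> \<alpha> lam Lam (c / (2 * C)) r K \<sigma>' f' w' g' F G" and GG: "AE x in lborel. x \<in> \<Omega> --> Gw x = G x"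
   by (elim exE conjE) (rule that)
  have gb: "AE x in lborel. norm (G x) <= C * (c / (2 * C))" by (rule bound[rule_format, OF cd])
  have sAE: "AE x in lborel. x \<in> \<Omega> --> lam <= \<sigma> x & \<sigma> x <= inverse lam"
   using \<sigma> unfolding Sigma_class_def AE_lebesgue_on[OF assms(1)] by blast
  have "AE x in lborel. x \<in> \<Omega>' --> lam * c / 2 <= norm (\<sigma> x *r (coil_field \<mu> D n x - Gw x))" using gb GG sAE
  proof eventually_elim
   case (elim x)
   show ?case
   proof
    assume x: "x \<in> \<Omega>'"
    hence xO: "x \<in> \<Omega>" using \<Omega>' by blast
    have "norm (Gw x) <= c / 2" using elim xO C by simp
    moreover have "c <= norm (coil_field \<mu> D n x)" using low x by blast
    ultimately have d: "c / 2 <= norm (coil_field \<mu> D n x - Gw x)" using norm_triangle_ineq2[of "coil_field \<mu> D n x" "Gw x"] by linarith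
    have s: "lam <= \<bar>\<sigma> x\<bar>" using elim xO by auto
    have "lam * (c / 2) <= \<bar>\<sigma> x\<bar> * norm (coil_field \<mu> D n x - Gw x)" by (rule mult_mono[OF s d]) (use c assms(11) in auto)
    thus "lam * c / 2 <= norm (\<sigma> x *r (coil_field \<mu> D n x - Gw x))" by simp
   qed
  qed
  thus "AE x in lebesgue_on \<Omega>'. lam * c / 2 <= norm (\<sigma> x *r (coil_field \<mu> D n x - Gw x))" using AE_lebesgue_on \<Omega>' by blast
 qed
qed

end
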